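(* Let $k\ge2$ be fixed. Assume $n>p+1$ and that there exists $\delta\in(0,1)$ such that $\delta<p_i/p_j<\delta^{-1}$ for $1\le i,j\le k$. For the likelihood ratio statistic $\Lambda_n$ of test (VII) described in the context, with $f$ and $\rho$ given there, under $H_0$, as $n\to\infty$: (i) $\displaystyle\sup_{\alpha\in(0,1)}\bigl|\Pr\{-2\log\Lambda_n>\chi^2_f(\alpha)\}-\alpha\bigr|\to0$ if and only if $p/n^{1/2}\to0$; (ii) when $p=o(n)$, $\displaystyle\sup_{\alpha\in(0,1)}\bigl|\Pr\{-2\rho\log\Lambda_n>\chi^2_f(\alpha)\}-\alpha\bigr|\to0$ if and only if $p/n^{2/3}\to0$.
   Context: $x_1,\dots,x_n\in\mathbb R^p$ are i.i.d. $\mathcal N_p(\mu,\Sigma)$. Partition $x_i=(\xi_{i1}^T,\dots,\xi_{ik}^T)^T$ and $\Sigma=(\Sigma_{jl})_{1\le j,l\le k}$, where $\xi_{ij}$ is $p_j\times1$, $\Sigma_{jl}$ is $p_j\times p_l$, and $\sum_{j=1}^kp_j=p$; the $p_j$ may depend on $n$. Put $\bar x=n^{-1}\sum_ix_i$, $\bar\xi_j=n^{-1}\sum_i\xi_{ij}$, $A=\sum_{i=1}^n(x_i-\bar x)(x_i-\bar x)^T$, $A_{jj}=\sum_{i=1}^n(\xi_{ij}-\bar\xi_j)(\xi_{ij}-\bar\xi_j)^T$; $|\cdot|$ is the determinant. Test (VII): $H_0:\Sigma_{jl}=0$ for all $1\le j<l\le k$; $\Lambda_n=|A|^{n/2}\prod_{j=1}^k|A_{jj}|^{-n/2}$;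 $f=(p^2-\sum_{i=1}^kp_i^2)/2$; $\rho=1-\frac{3}{2n}-\{3n(p^2-\sum_{i=1}^kp_i^2)\}^{-1}(p^3-\sum_{i=1}^kp_i^3)$. $\chi^2_f(\alpha)$ is the upper $\alpha$-quantile of the chi-squared distribution with $f$ degrees of freedom. *)

theory Defs
  imports
    "HOL-Probability.Probability"
    "HOL-Library.Landau_Symbols"
    "Jordan_Normal_Form.Determinant"
    "Jordan_Normal_Form.Gauss_Jordan_Elimination"
begin

text \<open>
  The dimension \<open>p\<close> varies with the sample size. Matrices and vectors are therefore those of
  Jordan_Normal_Form, and a random vector in \<open>p\<close>-space is a map into the product space
  \<open>PiM {..<p} (\<lambda>_. borel)\<close>. All indices start from 0. Several names exist both in HOL-Analysis
  and in Jordan_Normal_Form, hence the qualified \<open>Determinant.det\<close>, \<open>Matrix.mat\<close>, \<open>Matrix.vec\<close>.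
\<close>

definition pos_def_mat :: "nat \<Rightarrow> real mat \<Rightarrow> bool" where
  "pos_def_mat p S \<longleftrightarrow> S \<in> carrier_mat p p \<and> transpose_mat S = S \<and>
     (\<forall>v\<in>carrier_vec p. v \<noteq> 0\<^sub>v p \<longrightarrow> scalar_prod v (S *\<^sub>v v) > 0)"

text \<open>
  Here \<open>mat_inverse\<close> is option-valued; it is \<open>Some\<close> of the inverse for every nonsingular matrix,
  in particular for a positive definite \<open>S\<close>.
\<close>

definition mvn_density :: "nat \<Rightarrow> real Matrix.vec \<Rightarrow> real mat \<Rightarrow> (nat \<Rightarrow> real) \<Rightarrow> real" where
  "mvn_density p \<mu> S x =
     (let v = Matrix.vec p x - \<mu>
      in exp (- (scalar_prod v (the (mat_inverse S) *\<^sub>v v)) / 2) / sqrt ((2 * pi) ^ p * Determinant.det S))"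

definition mvn_distributed ::
    "'a measure \<Rightarrow> nat \<Rightarrow> real Matrix.vec \<Rightarrow> real mat \<Rightarrow> ('a \<Rightarrow> nat \<Rightarrow> real) \<Rightarrow> bool" where
  "mvn_distributed M p \<mu> S X \<longleftrightarrow>
     \<mu> \<in> carrier_vec p \<and> pos_def_mat p S \<and>
     distributed M (PiM {..<p} (\<lambda>_. lborel)) X (\<lambda>x. ennreal (mvn_density p \<mu> S x))"

definition iid_mvn_sample ::
    "'a measure \<Rightarrow> nat \<Rightarrow> nat \<Rightarrow> real Matrix.vec \<Rightarrow> real mat \<Rightarrow> (nat \<Rightarrow> 'a \<Rightarrow> nat \<Rightarrow> real) \<Rightarrow> bool" where
  "iid_mvn_sample M n p \<mu> S X \<longleftrightarrow>
     prob_space M \<and>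
     (\<forall>i<n. mvn_distributed M p \<mu> S (X i)) \<and>
     prob_space.indep_vars M (\<lambda>_. PiM {..<p} (\<lambda>_. borel)) X {..<n}"

text \<open>The partition is given by the block sizes \<open>d 0, ..., d (k - 1)\<close>.\<close>

definition block_start :: "(nat \<Rightarrow> nat) \<Rightarrow> nat \<Rightarrow> nat" where
  "block_start d j = (\<Sum>i<j. d i)"

definition subvector :: "(nat \<Rightarrow> nat) \<Rightarrow> nat \<Rightarrow> (nat \<Rightarrow> real) \<Rightarrow> nat \<Rightarrow> real" where
  "subvector d j x a = x (block_start d j + a)"

definition mat_block :: "(nat \<Rightarrow> nat) \<Rightarrow> real mat \<Rightarrow> nat \<Rightarrow> nat \<Rightarrow> real mat" where
  "mat_block d S j l =
     Matrix.mat (d j) (d l) (\<lambda>(a, b). S $$ (block_start d j + a, block_start d l + b))"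

definition block_independence_hyp :: "nat \<Rightarrow> (nat \<Rightarrow> nat) \<Rightarrow> real mat \<Rightarrow> bool" where
  "block_independence_hyp k d S \<longleftrightarrow>
     (\<forall>l<k. \<forall>j<l. mat_block d S j l = 0\<^sub>m (d j) (d l))"

definition sample_mean :: "nat \<Rightarrow> (nat \<Rightarrow> nat \<Rightarrow> real) \<Rightarrow> nat \<Rightarrow> real" where
  "sample_mean n x a = (\<Sum>i<n. x i a) / real n"

definition scatter_mat :: "nat \<Rightarrow> nat \<Rightarrow> (nat \<Rightarrow> nat \<Rightarrow> real) \<Rightarrow> real mat" where
  "scatter_mat n q x =
     Matrix.mat q q (\<lambda>(a, b). \<Sum>i<n. (x i a - sample_mean n x a) * (x i b - sample_mean n x b))"

definition lrt_stat :: "nat \<Rightarrow> nat \<Rightarrow> nat \<Rightarrow> (nat \<Rightarrow> nat) \<Rightarrow> (nat \<Rightarrow> nat \<Rightarrow> real) \<Rightarrow> real" where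
  "lrt_stat n p k d x =
     Determinant.det (scatter_mat n p x) powr (real n / 2) *
     (\<Prod>j<k. Determinant.det (scatter_mat n (d j) (\<lambda>i. subvector d j (x i))) powr (- (real n / 2)))"

definition lrt_df :: "nat \<Rightarrow> nat \<Rightarrow> (nat \<Rightarrow> nat) \<Rightarrow> real" where
  "lrt_df p k d = (real p ^ 2 - (\<Sum>i<k. real (d i) ^ 2)) / 2"

definition bartlett_rho :: "nat \<Rightarrow> nat \<Rightarrow> nat \<Rightarrow> (nat \<Rightarrow> nat) \<Rightarrow> real" where
  "bartlett_rho n p k d =
     1 - 3 / (2 * real n)
       - (real p ^ 3 - (\<Sum>i<k. real (d i) ^ 3)) /
         (3 * real n * (real p ^ 2 - (\<Sum>i<k. real (d i) ^ 2)))"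

definition chi_squared_density :: "real \<Rightarrow> real \<Rightarrow> real" where
  "chi_squared_density f x =
     (if x > 0 then x powr (f / 2 - 1) * exp (- x / 2) / (2 powr (f / 2) * Gamma (f / 2)) else 0)"

definition chi_squared :: "real \<Rightarrow> real measure" where
  "chi_squared f = density lborel (\<lambda>x. ennreal (chi_squared_density f x))"

text \<open>For \<open>f > 0\<close> and \<open>0 < \<alpha> < 1\<close> the point described here exists and is unique.\<close>

definition chi_squared_upper_quantile :: "real \<Rightarrow> real \<Rightarrow> real" where
  "chi_squared_upper_quantile f \<alpha> = (THE q. measure (chi_squared f) {q<..} = \<alpha>)"

text \<open>
  The supremum over all levels of the difference between the true and the nominal level of the
  test that rejects when the statistic \<open>T\<close> exceeds the chi-squared quantile.
\<close>

definition chi_squared_level_error :: "'a measure \<Rightarrow> ('a \<Rightarrow> real) \<Rightarrow> real \<Rightarrow> real" where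
  "chi_squared_level_error M T f =
     (SUP \<alpha>\<in>{0<..<1}.
        \<bar>measure M {\<omega> \<in> space M. T \<omega> > chi_squared_upper_quantile f \<alpha>} - \<alpha>\<bar>)"

end

theory Submission
  imports Defs
begin

text \<open>
  Whitening by a block lower triangular matrix and Gram--Schmidt on the columns show that, under the
  null hypothesis, \<open>- 2 ln \<Lambda> / n\<close> is a sum of \<open>f\<close> independent terms \<open>- ln \<beta>\<close>, with
  \<open>\<beta> \<sim> Beta((n - 1 - t) / 2, 1 / 2)\<close>, where \<open>t\<close> runs over a multiset of indices below \<open>p\<close>.
  Stochastically, each term lies between the Gamma laws of shape \<open>1 / 2\<close> and rates \<open>(n - t - 1) / 2\<close> and
  \<open>(n - t - 2) / 2\<close>. The test is thus compared with weighted sums of independent chi-squared variables,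
  and these with \<open>\<chi>\<^sup>2\<^sub>f\<close>. For bounded \<open>p\<close> all weights tend to \<open>1\<close>. For large \<open>f\<close> the central limit theorem,
  uniform in the weights, reduces everything to the standardized shift of the mean. Without correction this
  shift is of the order \<open>\<Sum> t / (n \<surd>f)\<close>, that is \<open>p\<^sup>2 / n\<close>. Multiplication by \<open>\<rho>\<close>, for which \<open>\<rho> n\<close> is the
  average of the \<open>n - t - 3/2\<close>, cancels the first order, and the shift \<open>\<Sum> (t - mean t)\<^sup>2 / (n\<^sup>2 \<surd>f)\<close> that
  remains is of the order \<open>p\<^sup>3 / n\<^sup>2\<close>.
\<close>

section \<open>Gamma laws, logarithms of Beta variables and stochastic order\<close>

text \<open>The Gamma laws that enclose a term \<open>- ln \<beta>\<close> have rates on either side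
  of \<open>(n - t - 3/2) / 2\<close>. Passing from the sample law to one of them moves the
  standardized mean by the order p / n, which is negligible for p = o(n) and so cannot hide the term
  p^3 / n^2 that decides (ii). The dimension may be bounded along one subsequence and unbounded
  along another. All estimates are therefore made for a single n, and the central limit theorem
  supplies a length L that depends on the tolerance alone, for all rates that agree up to a factor
  2. For f at least L the normal approximation is used; otherwise a bound of order p^2 / n takes
  over, which comes from the estimate \<open>sqrt b / x\<close> of the Gamma density of shape b.
  That bound also gives the sufficiency in (i). Necessity needs one level only: at q = f the
  chi-squared tail is near 1/2, and the shift of the mean pushes the tail of the sample law above
  it. Comparable block sizes make f of order p^2 and the spread of the indices t of order p, so that
  the shifts have the stated order from below as well.\<close>

lemma exp_distr_lborel:
  "distr (density lborel (\<lambda>y. ennreal (exp y))) borel exp = density lborel (indicator {0::real<..})"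
proof (rule measure_eqI)
  fix A :: "real set" assume "A \<in> sets (distr (density lborel (\<lambda>y. ennreal (exp y))) borel exp)"
  then have A[measurable]: "A \<in> sets borel" by simp
  have inc: "incseq (\<lambda>k x. (f x :: ennreal) * indicator {- real k .. real k} x)" for f
    by (auto simp: incseq_def le_fun_def split: split_indicator)
  have inc2: "incseq (\<lambda>k x. (f x :: ennreal) * indicator {exp (- real k) .. exp (real k)} x)" for f
  proof -
    have "exp (- real n) \<le> x" if "m \<le> n" "exp (- real m) \<le> x" for m n :: nat and x
      using that by (auto intro: order_trans[of _ "exp (- real m)"])
    moreover have "x \<le> exp (real n)" if "m \<le> n" "x \<le> exp (real m)" for m n :: nat and x
      using that by (auto intro: order_trans[of _ "exp (real m)"])
    moreover have mono: "indicator A x \<le> (indicator B x :: ennreal)" if "A \<subseteq> B" for A B and x :: real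
      using that by (auto simp: indicator_def)
    ultimately have sub: "{exp (- real m) .. exp (real m)} \<subseteq> {exp (- real n) .. exp (real n)}" if "m \<le> n" for m n :: nat
      using that by (meson atLeastAtMost_iff subsetI)
    have "indicator {exp (- real m) .. exp (real m)} x \<le> (indicator {exp (- real n) .. exp (real n)} x :: ennreal)" if "m \<le> n" for m n x
      by (rule mono[OF sub[OF that]])
    then show ?thesis
      unfolding incseq_def le_fun_def by (intro allI impI mult_left_mono) simp_all
  qed
  have sup1: "(SUP k. (f :: ennreal) * indicator {- real k .. real k} x) = f" for f x
  proof -
    obtain k :: nat where "\<bar>x\<bar> \<le> real k" using real_arch_simple by blast
    then have "f * indicator {- real k .. real k} x = f" by (auto simp: indicator_def)
    then show ?thesis
      by (intro antisym SUP_least SUP_upper2[of k]) (auto split: split_indicator)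
  qed
  have sup2: "(SUP k. (f :: ennreal) * indicator {exp (- real k) .. exp (real k)} x) = f * indicator {0<..} x" for f x
  proof (cases "x > 0")
    case True
    obtain k :: nat where "\<bar>ln x\<bar> \<le> real k" using real_arch_simple by blast
    then have "- real k \<le> ln x" "ln x \<le> real k" by auto
    then have "exp (- real k) \<le> x \<and> x \<le> exp (real k)" using True
      by (metis exp_ln exp_le_cancel_iff)
    then have "f * indicator {exp (- real k) .. exp (real k)} x = f" by (auto simp: indicator_def)
    then show ?thesis using True
      by (intro antisym SUP_least SUP_upper2[of k]) (auto split: split_indicator)
  next
    case False
    then have "x \<notin> {exp (- real k) .. exp (real k)}" for k :: nat
      using exp_gt_zero[of "- real k"] by (auto simp: not_le intro: le_less_trans simp del: exp_gt_zero)
    then have "indicator {exp (- real k) .. exp (real k)} x = (0::ennreal)" for k :: nat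
      unfolding indicator_def by (simp only: if_False of_bool_eq simp_thms)
    then show ?thesis using False by simp
  qed
  \<comment> \<open>Substitution is carried out on compact intervals, which correspond to each other
    under \<open>exp\<close>; monotone convergence in \<open>k\<close> then exhausts both
    sides.\<close>
  have sub: "(\<integral>\<^sup>+x. indicator A x * indicator {exp (- real k) .. exp (real k)} x \<partial>lborel) =
    (\<integral>\<^sup>+y. ennreal (exp y) * indicator A (exp y) * indicator {- real k .. real k} y \<partial>lborel)" for k :: nat
  proof -
    have "(\<integral>\<^sup>+x. (indicator A x :: real) * indicator {exp (- real k) .. exp (real k)} x \<partial>lborel) =
      (\<integral>\<^sup>+y. (indicator A (exp y) :: real) * exp y * indicator {- real k .. real k} y \<partial>lborel)"
      by (rule nn_integral_substitution) (auto intro!: derivative_eq_intros continuous_intros simp: set_borel_measurable_def)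
    then show ?thesis by (simp add: ennreal_mult' mult_ac ennreal_indicator)
  qed
  have "emeasure (distr (density lborel (\<lambda>y. ennreal (exp y))) borel exp) A =
    (\<integral>\<^sup>+y. ennreal (exp y) * indicator A (exp y) \<partial>lborel)"
    by (simp add: emeasure_distr emeasure_density indicator_vimage[symmetric] vimage_def indicator_def)
  also have "\<dots> = (\<integral>\<^sup>+y. (SUP k::nat. ennreal (exp y) * indicator A (exp y) * indicator {- real k .. real k} y) \<partial>lborel)"
    by (simp only: sup1)
  also have "\<dots> = (SUP k::nat. \<integral>\<^sup>+y. ennreal (exp y) * indicator A (exp y) * indicator {- real k .. real k} y \<partial>lborel)"
    by (intro nn_integral_monotone_convergence_SUP inc) auto
  also have "\<dots> = (SUP k::nat. \<integral>\<^sup>+x. indicator A x * indicator {exp (- real k) .. exp (real k)} x \<partial>lborel)"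
    by (simp only: sub)
  also have "\<dots> = (\<integral>\<^sup>+x. (SUP k::nat. indicator A x * indicator {exp (- real k) .. exp (real k)} x) \<partial>lborel)"
    by (intro nn_integral_monotone_convergence_SUP[symmetric] inc2) auto
  also have "\<dots> = emeasure (density lborel (indicator {0::real<..})) A"
    by (simp only: sup2) (simp add: emeasure_density mult.commute)
  finally show "emeasure (distr (density lborel (\<lambda>y. ennreal (exp y))) borel exp) A =
    emeasure (density lborel (indicator {0::real<..})) A" .
qed simp

lemma nn_integral_exp_substitution:
  fixes F :: "real \<Rightarrow> ennreal"
  assumes [measurable]: "F \<in> borel_measurable borel"
  shows "(\<integral>\<^sup>+x. F x * indicator {0<..} x \<partial>lborel) = (\<integral>\<^sup>+y. F (exp y) * ennreal (exp y) \<partial>lborel)"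
proof -
  have "(\<integral>\<^sup>+x. F x * indicator {0<..} x \<partial>lborel) = (\<integral>\<^sup>+x. F x \<partial>density lborel (indicator {0::real<..}))"
    by (subst nn_integral_density) (auto simp: mult.commute)
  also have "\<dots> = (\<integral>\<^sup>+x. F x \<partial>distr (density lborel (\<lambda>y. ennreal (exp y))) borel exp)"
    by (simp only: exp_distr_lborel)
  also have "\<dots> = (\<integral>\<^sup>+y. F (exp y) * ennreal (exp y) \<partial>lborel)"
    by (subst nn_integral_distr) (auto simp: nn_integral_density mult.commute)
  finally show ?thesis .
qed

text \<open>\<open>b\<close> is the shape and \<open>c\<close> the rate, so the mean is
  \<open>b / c\<close> and the variance \<open>b / c\<^sup>2\<close>; chi-squared with f degrees of
  freedom has shape \<open>f / 2\<close> and rate \<open>1 / 2\<close>.\<close>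

definition gamma_density :: "real \<Rightarrow> real \<Rightarrow> real \<Rightarrow> real" where
  "gamma_density b c x = (if x > 0 then c powr b * x powr (b - 1) * exp (- (c * x)) / Gamma b else 0)"

definition gamma_law :: "real \<Rightarrow> real \<Rightarrow> real measure" where
  "gamma_law b c = density lborel (\<lambda>x. ennreal (gamma_density b c x))"

lemma gamma_density_measurable[measurable]: "gamma_density b c \<in> borel_measurable borel"
  unfolding gamma_density_def[abs_def] by measurable

lemma gamma_density_nonneg[simp]: "b > 0 \<Longrightarrow> 0 \<le> gamma_density b c x"
  by (simp add: gamma_density_def Gamma_real_pos less_imp_le)

lemma sets_gamma_law[simp, measurable_cong]: "sets (gamma_law b c) = sets borel"
  and space_gamma_law[simp]: "space (gamma_law b c) = UNIV"
  by (auto simp: gamma_law_def)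

lemma nn_integral_gamma_law:
  assumes [measurable]: "h \<in> borel_measurable borel"
  shows "(\<integral>\<^sup>+x. h x \<partial>gamma_law b c) = (\<integral>\<^sup>+x. ennreal (gamma_density b c x) * h x \<partial>lborel)"
  unfolding gamma_law_def by (subst nn_integral_density) auto

text \<open>Division by the rate carries rate 1 to rate \<open>c\<close>, so that densities need to
  be studied at rate 1 only.\<close>

lemma gamma_law_scale:
  assumes b: "b > 0" and c: "c > 0" and [measurable]: "h \<in> borel_measurable borel"
  shows "(\<integral>\<^sup>+x. h x \<partial>gamma_law b c) = (\<integral>\<^sup>+x. h (x / c) \<partial>gamma_law b 1)"
proof -
  have "ennreal (gamma_density b c ((1 / c) * x)) * ennreal (1 / c) = ennreal (gamma_density b 1 x)" for x
  proof (cases "x > 0")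
    case True
    have "gamma_density b c ((1 / c) * x) * (1 / c) = gamma_density b 1 x"
      using True c by (simp add: gamma_density_def powr_divide powr_diff field_simps)
    then show ?thesis using b c by (subst ennreal_mult[symmetric]) auto
  next
    case False
    then show ?thesis using c by (simp add: gamma_density_def zero_less_mult_iff zero_less_divide_iff)
  qed
  note * = this
  have "(\<integral>\<^sup>+x. h x \<partial>gamma_law b c) = ennreal \<bar>1 / c\<bar> * (\<integral>\<^sup>+x. ennreal (gamma_density b c (0 + (1 / c) * x)) * h (0 + (1 / c) * x) \<partial>lborel)"
    unfolding nn_integral_gamma_law[OF assms(3)] using c by (intro nn_integral_real_affine) auto
  also have "\<dots> = (\<integral>\<^sup>+x. ennreal (gamma_density b c ((1 / c) * x)) * ennreal (1 / c) * h (x / c) \<partial>lborel)"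
    using c by (subst nn_integral_cmult[symmetric]) (auto intro!: nn_integral_cong simp: mult_ac)
  also have "\<dots> = (\<integral>\<^sup>+x. h (x / c) \<partial>gamma_law b 1)"
    by (subst nn_integral_gamma_law) (simp_all only: *, measurable)
  finally show ?thesis .
qed

lemma prob_space_gamma_law:
  assumes b: "b > 0" and c: "c > 0"
  shows "prob_space (gamma_law b c)"
proof
  have "(\<integral>\<^sup>+x. 1 \<partial>gamma_law b c) = (\<integral>\<^sup>+x. 1 \<partial>gamma_law b 1)"
    by (rule gamma_law_scale[OF b c]) simp
  also have "\<dots> = (\<integral>\<^sup>+x. ennreal (1 / Gamma b) * (ennreal (x powr (b - 1) / exp x) * indicator {0..} x) \<partial>lborel)"
    using b by (subst nn_integral_gamma_law) (auto intro!: nn_integral_cong_AE AE_I[of _ _ "{0}"] simp: gamma_density_def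
        exp_minus field_simps indicator_def Gamma_real_pos ennreal_mult[symmetric] split: if_splits)
  also have "\<dots> = ennreal (1 / Gamma b) * ennreal (Gamma b)"
    by (subst nn_integral_cmult) (auto simp: nn_integral_has_integral_lebesgue'[OF _ Gamma_integral_real[OF b]])
  also have "\<dots> = 1" using Gamma_real_pos[OF b] by (simp add: ennreal_mult[symmetric])
  finally show "emeasure (gamma_law b c) (space (gamma_law b c)) = 1" by simp
qed

text \<open>The Beta(a, b) density after the substitution \<open>x = exp (- y)\<close>; the Jacobian
  \<open>exp (- y)\<close> raises the exponent \<open>a - 1\<close> of \<open>x\<close> to
  \<open>a\<close>.\<close>

definition log_beta_density :: "real \<Rightarrow> real \<Rightarrow> real \<Rightarrow> real" where
  "log_beta_density a b y =
    (if y > 0 then Gamma (a + b) / (Gamma a * Gamma b) * exp (- (a * y)) * (1 - exp (- y)) powr (b - 1) else 0)"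

text \<open>The law of \<open>- ln \<beta>\<close> for a random variable \<open>\<beta>\<close> with the \<open>Beta(a, b)\<close> distribution.\<close>

definition log_beta_law :: "real \<Rightarrow> real \<Rightarrow> real measure" where
  "log_beta_law a b = density lborel (\<lambda>y. ennreal (log_beta_density a b y))"

lemma log_beta_density_measurable[measurable]: "log_beta_density a b \<in> borel_measurable borel"
  unfolding log_beta_density_def[abs_def] by measurable

lemma log_beta_density_nonneg[simp]: "a > 0 \<Longrightarrow> b > 0 \<Longrightarrow> 0 \<le> log_beta_density a b x"
  by (simp add: log_beta_density_def Gamma_real_pos less_imp_le)

lemma sets_log_beta_law[simp, measurable_cong]: "sets (log_beta_law b c) = sets borel"
  and space_log_beta_law[simp]: "space (log_beta_law b c) = UNIV"
  by (auto simp: log_beta_law_def)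

lemma nn_integral_log_beta_law:
  assumes [measurable]: "h \<in> borel_measurable borel"
  shows "(\<integral>\<^sup>+x. h x \<partial>log_beta_law a b) = (\<integral>\<^sup>+x. ennreal (log_beta_density a b x) * h x \<partial>lborel)"
  unfolding log_beta_law_def by (subst nn_integral_density) auto

text \<open>The factor \<open>s * exp (- y)\<close> is the Jacobian of the map from
  \<open>(s, y)\<close> to \<open>(x, d) = (s * exp (- y), s - s * exp (- y))\<close>. Outside
  \<open>s > 0\<close>, \<open>y > 0\<close> both sides vanish because one of the densities
  does.\<close>

lemma beta_gamma_densities:
  assumes a: "a > 0" and b: "b > 0"
  shows "gamma_density a 1 (exp (- y) * s) * s * gamma_density b 1 (s - exp (- y) * s) * exp (- y) =
    gamma_density (a + b) 1 s * log_beta_density a b y"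
proof (cases "s > 0 \<and> y > 0")
  case True
  then have s: "s > 0" and y: "y > 0" by auto
  have e1: "1 - exp (- y) > 0" using y by simp
  have sm: "s - exp (- y) * s = s * (1 - exp (- y))" by (simp add: algebra_simps)
  have p: "s - exp (- y) * s > 0" using s e1 unfolding sm by simp
  have "gamma_density a 1 (exp (- y) * s) * s * gamma_density b 1 (s - exp (- y) * s) * exp (- y)
     = (exp (- y) * s) powr (a - 1) * s * (s * (1 - exp (- y))) powr (b - 1) * exp (- y)
        * (exp (- (exp (- y) * s)) * exp (- (s * (1 - exp (- y))))) / (Gamma a * Gamma b)"
  proof -
    have A: "gamma_density a 1 (exp (- y) * s) = (exp (- y) * s) powr (a - 1) * exp (- (exp (- y) * s)) / Gamma a"
      using s by (simp add: gamma_density_def)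
    have B: "gamma_density b 1 (s - exp (- y) * s) = (s * (1 - exp (- y))) powr (b - 1) * exp (- (s * (1 - exp (- y)))) / Gamma b"
      using p unfolding gamma_density_def sm by simp
    show ?thesis unfolding A B by (simp add: mult_ac)
  qed
  also have "exp (- (exp (- y) * s)) * exp (- (s * (1 - exp (- y)))) = exp (- s)"
    by (simp add: exp_add[symmetric] algebra_simps)
  also have "(exp (- y) * s) powr (a - 1) * s * (s * (1 - exp (- y))) powr (b - 1) * exp (- y)
      = (exp (- y) powr (a - 1) * exp (- y)) * (s powr (a - 1) * s * s powr (b - 1)) * (1 - exp (- y)) powr (b - 1)"
    using s e1 by (simp add: powr_mult)
  also have "exp (- y) powr (a - 1) * exp (- y) = exp (- (a * y))"
    by (simp add: powr_def exp_add[symmetric] algebra_simps)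
  also have "s powr (a - 1) * s * s powr (b - 1) = s powr (a + b - 1)"
  proof -
    have "s powr (a - 1) * s powr 1 * s powr (b - 1) = s powr (a - 1 + 1 + (b - 1))"
      by (simp only: powr_add)
    then show ?thesis using s by (simp add: algebra_simps)
  qed
  also have "exp (- (a * y)) * s powr (a + b - 1) * (1 - exp (- y)) powr (b - 1) * exp (- s) / (Gamma a * Gamma b) =
    gamma_density (a + b) 1 s * log_beta_density a b y"
    using s y Gamma_real_pos[OF add_pos_pos[OF a b]]
    by (simp add: gamma_density_def log_beta_density_def)
  finally show ?thesis .
next
  case False
  show ?thesis
  proof (cases "s > 0")
    case True
    with False have "y \<le> 0" by auto
    then have "exp (- y) \<ge> 1" by simp
    then have "exp (- y) * s \<ge> s" using True by simp
    then show ?thesis using \<open>y \<le> 0\<close> by (simp add: gamma_density_def log_beta_density_def)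
  next
    case False
    then have "\<not> exp (- y) * s > 0" by (simp add: zero_less_mult_iff)
    then show ?thesis using False by (simp add: gamma_density_def)
  qed
qed

text \<open>Beta-gamma algebra: for independent \<open>X \<sim> \<Gamma>(a)\<close> and \<open>D \<sim> \<Gamma>(b)\<close> the sum \<open>X + D \<sim> \<Gamma>(a + b)\<close> is
  independent of \<open>X / (X + D) \<sim> Beta(a, b)\<close>. Substitute \<open>D = X (exp y - 1)\<close>, then \<open>X = s exp (- y)\<close>.\<close>

lemma beta_gamma_algebra:
  fixes H :: "real \<Rightarrow> real \<Rightarrow> ennreal"
  assumes a: "a > 0" and b: "b > 0"
    and [measurable]: "case_prod H \<in> borel_measurable (borel \<Otimes>\<^sub>M borel)"
  shows "(\<integral>\<^sup>+x. \<integral>\<^sup>+d. H (x + d) (ln (x + d) - ln x) \<partial>gamma_law b 1 \<partial>gamma_law a 1) =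
    (\<integral>\<^sup>+s. \<integral>\<^sup>+y. H s y \<partial>log_beta_law a b \<partial>gamma_law (a + b) 1)"
proof -
  have ga[simp]: "0 \<le> gamma_density a 1 x" "0 \<le> gamma_density b 1 x" "0 \<le> gamma_density (a + b) 1 x"
     "0 \<le> log_beta_density a b x" for x using a b by auto
  have inner: "(\<integral>\<^sup>+d. ennreal (gamma_density b 1 d) * H (x + d) (ln (x + d) - ln x) \<partial>lborel) =
     (\<integral>\<^sup>+y. ennreal (x * exp y * gamma_density b 1 (x * exp y - x)) * H (x * exp y) y \<partial>lborel)"
    if x: "x > 0" for x
  proof -
    \<comment> \<open>\<open>t = x + d\<close> is a shift, \<open>t = x * r\<close> a scaling, and
      \<open>r = exp y\<close> makes \<open>y\<close> equal to
      \<open>ln (x + d) - ln x\<close>.\<close>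
    define \<phi> where "\<phi> t = ennreal (gamma_density b 1 (t - x)) * H t (ln t - ln x)" for t
    have [measurable]: "\<phi> \<in> borel_measurable borel" unfolding \<phi>_def[abs_def] by measurable
    have "(\<integral>\<^sup>+d. ennreal (gamma_density b 1 d) * H (x + d) (ln (x + d) - ln x) \<partial>lborel) = (\<integral>\<^sup>+d. \<phi> (x + 1 * d) \<partial>lborel)"
      by (simp add: \<phi>_def)
    also have "\<dots> = (\<integral>\<^sup>+t. \<phi> t \<partial>lborel)"
      using nn_integral_real_affine[of \<phi> 1 x] by simp
    also have "\<dots> = ennreal \<bar>x\<bar> * (\<integral>\<^sup>+r. \<phi> (0 + x * r) \<partial>lborel)"
      using x by (intro nn_integral_real_affine) auto
    \<comment> \<open>Values \<open>r \<le> 0\<close> mean \<open>d \<le> - x < 0\<close>, where the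
      density of \<open>d\<close> is zero; this frees the integral for the exponential
      substitution.\<close>
    also have "(\<integral>\<^sup>+r. \<phi> (0 + x * r) \<partial>lborel) = (\<integral>\<^sup>+r. \<phi> (x * r) * indicator {0<..} r \<partial>lborel)"
    proof (intro nn_integral_cong)
      fix r
      have "\<phi> (x * r) = 0" if "r \<le> 0"
        using that x mult_nonneg_nonpos[of x r] by (simp add: \<phi>_def gamma_density_def)
      then show "\<phi> (0 + x * r) = \<phi> (x * r) * indicator {0<..} r"
        by (auto split: split_indicator)
    qed
    also have "\<dots> = (\<integral>\<^sup>+y. \<phi> (x * exp y) * ennreal (exp y) \<partial>lborel)"
      by (rule nn_integral_exp_substitution) measurable
    also have "ennreal \<bar>x\<bar> * \<dots> = (\<integral>\<^sup>+y. ennreal \<bar>x\<bar> * (\<phi> (x * exp y) * ennreal (exp y)) \<partial>lborel)"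
      by (rule nn_integral_cmult[symmetric]) measurable
    also have "\<dots> = (\<integral>\<^sup>+y. ennreal (x * exp y * gamma_density b 1 (x * exp y - x)) * H (x * exp y) y \<partial>lborel)"
      using x by (intro nn_integral_cong) (auto simp: \<phi>_def ln_mult ennreal_mult mult_ac)
    finally show ?thesis .
  qed
  have "(\<integral>\<^sup>+x. \<integral>\<^sup>+d. H (x + d) (ln (x + d) - ln x) \<partial>gamma_law b 1 \<partial>gamma_law a 1) =
    (\<integral>\<^sup>+x. ennreal (gamma_density a 1 x) * (\<integral>\<^sup>+d. ennreal (gamma_density b 1 d) * H (x + d) (ln (x + d) - ln x) \<partial>lborel) \<partial>lborel)"
    by (subst nn_integral_gamma_law, measurable) (subst nn_integral_gamma_law, measurable)
  also have "\<dots> = (\<integral>\<^sup>+x. ennreal (gamma_density a 1 x) *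
      (\<integral>\<^sup>+y. ennreal (x * exp y * gamma_density b 1 (x * exp y - x)) * H (x * exp y) y \<partial>lborel) \<partial>lborel)"
  proof (intro nn_integral_cong)
    fix x
    show "ennreal (gamma_density a 1 x) * (\<integral>\<^sup>+d. ennreal (gamma_density b 1 d) * H (x + d) (ln (x + d) - ln x) \<partial>lborel) =
      ennreal (gamma_density a 1 x) *
      (\<integral>\<^sup>+y. ennreal (x * exp y * gamma_density b 1 (x * exp y - x)) * H (x * exp y) y \<partial>lborel)"
      by (cases "x > 0") (simp_all add: inner gamma_density_def[of a])
  qed
  also have "\<dots> = (\<integral>\<^sup>+x. \<integral>\<^sup>+y. ennreal (gamma_density a 1 x) *
      (ennreal (x * exp y * gamma_density b 1 (x * exp y - x)) * H (x * exp y) y) \<partial>lborel \<partial>lborel)"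
    by (intro nn_integral_cong nn_integral_cmult[symmetric]) measurable
  \<comment> \<open>With \<open>y\<close> fixed and \<open>x\<close> as the inner variable,
    \<open>x = exp (- y) * s\<close> is a linear substitution.\<close>
  also have "\<dots> = (\<integral>\<^sup>+y. \<integral>\<^sup>+x. ennreal (gamma_density a 1 x) *
      (ennreal (x * exp y * gamma_density b 1 (x * exp y - x)) * H (x * exp y) y) \<partial>lborel \<partial>lborel)"
    by (rule lborel_pair.Fubini'[symmetric]) measurable
  also have "\<dots> = (\<integral>\<^sup>+y. \<integral>\<^sup>+s. ennreal (gamma_density (a + b) 1 s) * (ennreal (log_beta_density a b y) * H s y) \<partial>lborel \<partial>lborel)"
  proof (rule nn_integral_cong)
    fix y :: real
    have "(\<integral>\<^sup>+x. ennreal (gamma_density a 1 x) * (ennreal (x * exp y * gamma_density b 1 (x * exp y - x)) * H (x * exp y) y) \<partial>lborel)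
      = ennreal \<bar>exp (- y)\<bar> * (\<integral>\<^sup>+s. ennreal (gamma_density a 1 (0 + exp (- y) * s)) *
         (ennreal ((0 + exp (- y) * s) * exp y * gamma_density b 1 ((0 + exp (- y) * s) * exp y - (0 + exp (- y) * s))) *
         H ((0 + exp (- y) * s) * exp y) y) \<partial>lborel)"
    proof (rule nn_integral_real_affine)
      show "(\<lambda>x. ennreal (gamma_density a 1 x) * (ennreal (x * exp y * gamma_density b 1 (x * exp y - x)) * H (x * exp y) y))
        \<in> borel_measurable borel" by measurable
    qed simp
    also have "\<dots> = (\<integral>\<^sup>+s. ennreal (exp (- y)) * (ennreal (gamma_density a 1 (exp (- y) * s)) *
         (ennreal (s * gamma_density b 1 (s - exp (- y) * s)) * H s y)) \<partial>lborel)"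
    proof (subst nn_integral_cmult[symmetric])
      have *: "(0 + exp (- y) * s) * exp y = s" for s by (simp add: exp_minus)
      show "(\<integral>\<^sup>+ s. ennreal \<bar>exp (- y)\<bar> * (ennreal (gamma_density a 1 (0 + exp (- y) * s)) *
         (ennreal ((0 + exp (- y) * s) * exp y * gamma_density b 1 ((0 + exp (- y) * s) * exp y - (0 + exp (- y) * s))) *
         H ((0 + exp (- y) * s) * exp y) y)) \<partial>lborel) = (\<integral>\<^sup>+s. ennreal (exp (- y)) * (ennreal (gamma_density a 1 (exp (- y) * s)) *
         (ennreal (s * gamma_density b 1 (s - exp (- y) * s)) * H s y)) \<partial>lborel)" unfolding * by simp
    qed measurable
    also have "\<dots> = (\<integral>\<^sup>+s. ennreal (gamma_density (a + b) 1 s) * (ennreal (log_beta_density a b y) * H s y) \<partial>lborel)"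
    proof (intro nn_integral_cong)
      fix s
      have "ennreal (exp (- y)) * (ennreal (gamma_density a 1 (exp (- y) * s)) * (ennreal (s * gamma_density b 1 (s - exp (- y) * s)) * H s y))
        = ennreal (exp (- y)) * ennreal (gamma_density a 1 (exp (- y) * s)) * ennreal (s * gamma_density b 1 (s - exp (- y) * s)) * H s y"
        by (simp add: mult_ac)
      also have "ennreal (exp (- y)) * ennreal (gamma_density a 1 (exp (- y) * s)) * ennreal (s * gamma_density b 1 (s - exp (- y) * s))
          = ennreal (gamma_density (a + b) 1 s) * ennreal (log_beta_density a b y)"
      proof (cases "s > 0")
        case True
        have "ennreal (exp (- y)) * ennreal (gamma_density a 1 (exp (- y) * s)) * ennreal (s * gamma_density b 1 (s - exp (- y) * s))
          = ennreal (exp (- y) * gamma_density a 1 (exp (- y) * s) * (s * gamma_density b 1 (s - exp (- y) * s)))"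
          using True by (simp add: ennreal_mult)
        also have "exp (- y) * gamma_density a 1 (exp (- y) * s) * (s * gamma_density b 1 (s - exp (- y) * s))
          = gamma_density (a + b) 1 s * log_beta_density a b y"
          using beta_gamma_densities[OF a b, of y s] by (simp add: mult_ac)
        finally show ?thesis by (simp add: ennreal_mult)
      next
        case False
        then show ?thesis by (simp add: gamma_density_def zero_less_mult_iff)
      qed
      finally show "ennreal (exp (- y)) * (ennreal (gamma_density a 1 (exp (- y) * s)) * (ennreal (s * gamma_density b 1 (s - exp (- y) * s)) * H s y))
        = ennreal (gamma_density (a + b) 1 s) * (ennreal (log_beta_density a b y) * H s y)" by (simp add: mult_ac)
    qed
    finally show "(\<integral>\<^sup>+x. ennreal (gamma_density a 1 x) * (ennreal (x * exp y * gamma_density b 1 (x * exp y - x)) * H (x * exp y) y) \<partial>lborel)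
      = (\<integral>\<^sup>+s. ennreal (gamma_density (a + b) 1 s) * (ennreal (log_beta_density a b y) * H s y) \<partial>lborel)" .
  qed
  also have "\<dots> = (\<integral>\<^sup>+s. \<integral>\<^sup>+y. ennreal (gamma_density (a + b) 1 s) * (ennreal (log_beta_density a b y) * H s y) \<partial>lborel \<partial>lborel)"
    by (rule lborel_pair.Fubini') measurable
  also have "\<dots> = (\<integral>\<^sup>+s. ennreal (gamma_density (a + b) 1 s) * (\<integral>\<^sup>+y. ennreal (log_beta_density a b y) * H s y \<partial>lborel) \<partial>lborel)"
    by (intro nn_integral_cong nn_integral_cmult) measurable
  also have "\<dots> = (\<integral>\<^sup>+s. ennreal (gamma_density (a + b) 1 s) * (\<integral>\<^sup>+y. H s y \<partial>log_beta_law a b) \<partial>lborel)"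
    by (intro nn_integral_cong) (subst nn_integral_log_beta_law, measurable)
  also have "\<dots> = (\<integral>\<^sup>+s. \<integral>\<^sup>+y. H s y \<partial>log_beta_law a b \<partial>gamma_law (a + b) 1)"
  proof (subst nn_integral_gamma_law)
    interpret sigma_finite_measure "log_beta_law a b"
      unfolding log_beta_law_def by (rule sigma_finite_measure.sigma_finite_iff_density_finite[THEN iffD2]) (auto intro: lborel.sigma_finite_measure_axioms)
    show "(\<lambda>s. \<integral>\<^sup>+y. H s y \<partial>log_beta_law a b) \<in> borel_measurable borel" by measurable
  qed simp
  finally show ?thesis .
qed

text \<open>The beta-gamma algebra with \<open>H = 1\<close> yields the total mass, so the Beta
  integral itself is never evaluated.\<close>

lemma prob_space_log_beta_law:
  assumes a: "a > 0" and b: "b > 0"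
  shows "prob_space (log_beta_law a b)"
proof
  interpret A: prob_space "gamma_law a 1" by (rule prob_space_gamma_law) (use a in auto)
  interpret B: prob_space "gamma_law b 1" by (rule prob_space_gamma_law) (use b in auto)
  interpret AB: prob_space "gamma_law (a + b) 1" by (rule prob_space_gamma_law) (use a b in auto)
  show "emeasure (log_beta_law a b) (space (log_beta_law a b)) = 1"
    using beta_gamma_algebra[OF a b, of "\<lambda>_ _. 1"] A.emeasure_space_1 B.emeasure_space_1 AB.emeasure_space_1
    by simp
qed

text \<open>The law of \<open>X + D\<close> is the \<open>s\<close>-marginal in the beta-gamma
  algebra; the general rate follows by scaling.\<close>

lemma gamma_law_convolution:
  assumes a: "a > 0" and b: "b > 0" and c: "c > 0"
  shows "(gamma_law a c \<star> gamma_law b c) = gamma_law (a + b) c"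
proof (rule measure_eqI)
  fix A assume "A \<in> sets (gamma_law a c \<star> gamma_law b c)"
  then have [measurable]: "A \<in> sets borel" by simp
  interpret A: prob_space "gamma_law a c" by (rule prob_space_gamma_law) (use a c in auto)
  interpret B: prob_space "gamma_law b c" by (rule prob_space_gamma_law) (use b c in auto)
  interpret B1: prob_space "gamma_law b 1" by (rule prob_space_gamma_law) (use b c in auto)
  interpret L: prob_space "log_beta_law a b" by (rule prob_space_log_beta_law) (use a b in auto)
  have "emeasure (gamma_law a c \<star> gamma_law b c) A = (\<integral>\<^sup>+x. \<integral>\<^sup>+y. indicator A (x + y) \<partial>gamma_law b c \<partial>gamma_law a c)"
    by (rule convolution_emeasure') (auto intro: A.finite_measure_axioms B.finite_measure_axioms)
  also have "\<dots> = (\<integral>\<^sup>+x. \<integral>\<^sup>+y. indicator A (x + y / c) \<partial>gamma_law b 1 \<partial>gamma_law a c)"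
    by (intro nn_integral_cong gamma_law_scale) (use b c in auto)
  also have "\<dots> = (\<integral>\<^sup>+x. \<integral>\<^sup>+y. indicator A (x / c + y / c) \<partial>gamma_law b 1 \<partial>gamma_law a 1)"
    by (intro gamma_law_scale) (use a c in auto)
  also have "\<dots> = (\<integral>\<^sup>+x. \<integral>\<^sup>+y. indicator A ((x + y) / c) \<partial>gamma_law b 1 \<partial>gamma_law a 1)"
    by (simp add: add_divide_distrib)
  also have "\<dots> = (\<integral>\<^sup>+s. \<integral>\<^sup>+y. indicator A (s / c) \<partial>log_beta_law a b \<partial>gamma_law (a + b) 1)"
    using beta_gamma_algebra[OF a b, of "\<lambda>s _. indicator A (s / c)"] by simp
  also have "\<dots> = (\<integral>\<^sup>+s. indicator A (s / c) \<partial>gamma_law (a + b) 1)"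
    using L.emeasure_space_1 by simp
  also have "\<dots> = (\<integral>\<^sup>+s. indicator A s \<partial>gamma_law (a + b) c)"
    by (rule gamma_law_scale[symmetric]) (use a b c in auto)
  finally show "emeasure (gamma_law a c \<star> gamma_law b c) A = emeasure (gamma_law (a + b) c) A" by simp
qed simp

text \<open>Multiplying the density of shape \<open>b\<close> by \<open>x ^ k\<close> gives the
  density of shape \<open>b + k\<close>, up to the quotient of the two Gamma values.\<close>

lemma gamma_law_moment:
  assumes b: "b > 0"
  shows "has_bochner_integral (gamma_law b 1) (\<lambda>x. x ^ k) (Gamma (b + real k) / Gamma b)"
proof (rule has_bochner_integral_nn_integral)
  interpret G: prob_space "gamma_law (b + real k) 1" by (rule prob_space_gamma_law) (use b in auto)
  have pos: "Gamma b > 0" "Gamma (b + real k) > 0" using b by (auto intro!: Gamma_real_pos)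
  show "AE x in gamma_law b 1. 0 \<le> x ^ k"
    unfolding gamma_law_def by (subst AE_density) (auto simp: gamma_density_def intro!: AE_I2)
  show "0 \<le> Gamma (b + real k) / Gamma b" using pos by simp
  have "(\<integral>\<^sup>+x. ennreal (x ^ k) \<partial>gamma_law b 1) =
     (\<integral>\<^sup>+x. ennreal (Gamma (b + real k) / Gamma b) * ennreal (gamma_density (b + real k) 1 x) \<partial>lborel)"
  proof (subst nn_integral_gamma_law)
    show "(\<integral>\<^sup>+x. ennreal (gamma_density b 1 x) * ennreal (x ^ k) \<partial>lborel) =
     (\<integral>\<^sup>+x. ennreal (Gamma (b + real k) / Gamma b) * ennreal (gamma_density (b + real k) 1 x) \<partial>lborel)"
    proof (rule nn_integral_cong)
      fix x :: real
      show "ennreal (gamma_density b 1 x) * ennreal (x ^ k) =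
        ennreal (Gamma (b + real k) / Gamma b) * ennreal (gamma_density (b + real k) 1 x)"
      proof (cases "x > 0")
        case True
        have "x powr (b + real k - 1) = x powr (b - 1) * x ^ k"
          using True by (simp add: powr_realpow[symmetric] powr_add[symmetric] algebra_simps)
        then have "gamma_density b 1 x * x ^ k = Gamma (b + real k) / Gamma b * gamma_density (b + real k) 1 x"
          using True pos by (simp add: gamma_density_def)
        then show ?thesis using b pos True by (simp add: ennreal_mult[symmetric])
      qed (simp add: gamma_density_def)
    qed
  qed simp
  also have "\<dots> = ennreal (Gamma (b + real k) / Gamma b) * (\<integral>\<^sup>+x. 1 \<partial>gamma_law (b + real k) 1)"
    using nn_integral_gamma_law[of "\<lambda>_. 1" "b + real k" 1] by (subst nn_integral_cmult) simp_all
  also have "\<dots> = ennreal (Gamma (b + real k) / Gamma b)"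
    using G.emeasure_space_1 by simp
  finally show "(\<integral>\<^sup>+x. ennreal (x ^ k) \<partial>gamma_law b 1) = ennreal (Gamma (b + real k) / Gamma b)" .
qed simp

lemma gamma_law_mean_variance:
  assumes b: "b > 0"
  shows "integrable (gamma_law b 1) (\<lambda>x. x)" "(LINT x|gamma_law b 1. x) = b"
    "integrable (gamma_law b 1) (\<lambda>x. (x - b)\<^sup>2)" "(LINT x|gamma_law b 1. (x - b)\<^sup>2) = b"
proof -
  interpret G: prob_space "gamma_law b 1" by (rule prob_space_gamma_law) (use b in auto)
  have pos: "Gamma b > 0" using b by (auto intro!: Gamma_real_pos)
  have ni: "y \<notin> \<int>\<^sub>\<le>\<^sub>0" if "y > 0" for y :: real using that by (auto elim!: nonpos_Ints_cases)
  have g1: "Gamma (b + 1) = b * Gamma b" using b by (intro Gamma_plus1 ni)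
  have "Gamma (b + 2) = Gamma ((b + 1) + 1)" by (simp add: add.assoc)
  also have "\<dots> = (b + 1) * (b * Gamma b)" using b by (subst Gamma_plus1) (auto simp: g1 intro!: ni)
  finally have g2: "Gamma (b + 2) = (b + 1) * (b * Gamma b)" .
  have m1: "has_bochner_integral (gamma_law b 1) (\<lambda>x. x) b"
    using gamma_law_moment[OF b, of 1] pos g1 by simp
  have m2: "has_bochner_integral (gamma_law b 1) (\<lambda>x. x\<^sup>2) ((b + 1) * b)"
    using gamma_law_moment[OF b, of 2] pos g2 by simp
  show "integrable (gamma_law b 1) (\<lambda>x. x)" "(LINT x|gamma_law b 1. x) = b"
    using m1 by (auto simp: has_bochner_integral_iff)
  have i[simp]: "integrable (gamma_law b 1) (\<lambda>x. x)" "integrable (gamma_law b 1) (\<lambda>x. x\<^sup>2)"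
    using m1 m2 by (auto simp: has_bochner_integral_iff)
  have eq: "(x - b)\<^sup>2 = x\<^sup>2 - 2 * b * x + b\<^sup>2" for x by (simp add: power2_eq_square algebra_simps)
  show "integrable (gamma_law b 1) (\<lambda>x. (x - b)\<^sup>2)" unfolding eq by auto
  show "(LINT x|gamma_law b 1. (x - b)\<^sup>2) = b"
    unfolding eq using m1 m2 G.prob_space by (simp add: has_bochner_integral_iff power2_eq_square algebra_simps)
qed

lemma gamma_law_abs_deviation:
  assumes b: "b > 0"
  shows "(\<integral>\<^sup>+x. ennreal \<bar>x - b\<bar> \<partial>gamma_law b 1) \<le> ennreal (sqrt b)"
proof -
  interpret G: prob_space "gamma_law b 1" by (rule prob_space_gamma_law) (use b in auto)
  note mv = gamma_law_mean_variance[OF b]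
  \<comment> \<open>Arithmetic against geometric mean, weighted by \<open>sqrt b\<close>, so that
    integrating with variance \<open>b\<close> gives exactly \<open>sqrt b\<close>.\<close>
  have amgm: "\<bar>z\<bar> \<le> (z\<^sup>2 / sqrt b + sqrt b) / 2" for z
  proof -
    have "0 \<le> (\<bar>z\<bar> - sqrt b)\<^sup>2" by simp
    then have "2 * \<bar>z\<bar> * sqrt b \<le> z\<^sup>2 + b" using b by (simp add: power2_eq_square algebra_simps)
    then have "2 * \<bar>z\<bar> \<le> (z\<^sup>2 + b) / sqrt b" using b by (simp add: field_simps)
    also have "\<dots> = z\<^sup>2 / sqrt b + sqrt b" using b by (simp add: add_divide_distrib real_div_sqrt)
    finally show ?thesis by simp
  qed
  have int: "integrable (gamma_law b 1) (\<lambda>x. ((x - b)\<^sup>2 / sqrt b + sqrt b) / 2)" using mv by auto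
  have "(\<integral>\<^sup>+x. ennreal \<bar>x - b\<bar> \<partial>gamma_law b 1) \<le> (\<integral>\<^sup>+x. ennreal (((x - b)\<^sup>2 / sqrt b + sqrt b) / 2) \<partial>gamma_law b 1)"
    by (intro nn_integral_mono ennreal_leI amgm)
  also have "\<dots> = ennreal (LINT x|gamma_law b 1. ((x - b)\<^sup>2 / sqrt b + sqrt b) / 2)"
    using b by (intro nn_integral_eq_integral[OF int]) auto
  also have "(LINT x|gamma_law b 1. ((x - b)\<^sup>2 / sqrt b + sqrt b) / 2) = sqrt b"
    using mv G.prob_space b by (simp add: real_div_sqrt)
  finally show ?thesis .
qed

text \<open>With \<open>F t = t * gamma_density b 1 t\<close> one has \<open>F' t = (b - t) * gamma_density b 1 t\<close>, so the maximum
  \<open>F b\<close> is at most the mean absolute deviation.\<close>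

lemma gamma_density_bound:
  assumes b: "b > 0" and x: "x > 0"
  shows "gamma_density b 1 x \<le> sqrt b / x"
proof -
  have pos: "Gamma b > 0" using b by (auto intro!: Gamma_real_pos)
  define F where "F t = t powr b * exp (- t) / Gamma b" for t
  have Fg: "F t = t * gamma_density b 1 t" if "t > 0" for t
    using that by (simp add: F_def gamma_density_def powr_mult_base)
  \<comment> \<open>The exponent \<open>b * ln t - t\<close> is maximal at \<open>t = b\<close>;
    this is \<open>ln z \<le> z - 1\<close> at \<open>z = x / b\<close>.\<close>
  have "F x \<le> F b"
  proof -
    have "ln (x / b) \<le> x / b - 1" using x b by (intro ln_le_minus_one) auto
    then have "b * ln x - x \<le> b * ln b - b" using x b by (simp add: ln_div field_simps)
    then have "exp (b * ln x - x) \<le> exp (b * ln b - b)" by simp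
    then have "x powr b * exp (- x) \<le> b powr b * exp (- b)"
      using x b by (simp add: powr_def exp_diff exp_minus divide_inverse)
    then show ?thesis using pos by (simp add: F_def divide_right_mono)
  qed
  also have "F b \<le> sqrt b"
  proof -
    \<comment> \<open>On \<open>{e..b}\<close> the derivative is nonnegative and its integral is at
      most the mean absolute deviation. The lower end stays positive because \<open>powr\<close> is
      differentiated there, and is sent to 0 afterwards.\<close>
    have step: "F b \<le> sqrt b + F e" if e: "0 < e" "e < b" for e
    proof -
      have "ennreal (F b - F e) = (\<integral>\<^sup>+t. ennreal ((b - t) * gamma_density b 1 t) * indicator {e..b} t \<partial>lborel)"
      proof (rule nn_integral_FTC_Icc[symmetric])
        fix t assume t: "t \<in> {e..b}"
        then have t0: "t > 0" using e by auto
        show "(F has_real_derivative (b - t) * gamma_density b 1 t) (at t)"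
          unfolding F_def gamma_density_def using t0 pos
          by (auto intro!: derivative_eq_intros simp: field_simps powr_diff)
        show "0 \<le> (b - t) * gamma_density b 1 t" using t b by simp
      qed (use e in auto)
      also have "\<dots> \<le>
        (\<integral>\<^sup>+t. ennreal (gamma_density b 1 t) * ennreal \<bar>t - b\<bar> \<partial>lborel)"
      proof (rule nn_integral_mono)
        fix t :: real
        show "ennreal ((b - t) * gamma_density b 1 t) * indicator {e..b} t \<le> ennreal (gamma_density b 1 t) * ennreal \<bar>t - b\<bar>"
          using b by (auto simp: ennreal_mult[symmetric] mult.commute split: split_indicator intro!: ennreal_leI mult_right_mono)
      qed
      also have "\<dots> = (\<integral>\<^sup>+x. ennreal \<bar>x - b\<bar> \<partial>gamma_law b 1)" by (subst nn_integral_gamma_law) auto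
      also have "\<dots> \<le> ennreal (sqrt b)" by (rule gamma_law_abs_deviation[OF b])
      finally have "F b - F e \<le> sqrt b" using b by (simp add: ennreal_le_iff)
      then show ?thesis by simp
    qed
    have "((\<lambda>e. sqrt b + F e) \<longlongrightarrow> sqrt b + 0) (at_right 0)"
    proof (intro tendsto_intros)
      have "((\<lambda>e. e powr b * exp (- e) / Gamma b) \<longlongrightarrow> 0 powr b * exp (- 0) / Gamma b) (at_right 0)"
        using b by (intro tendsto_intros tendsto_powr')
          (auto simp: eventually_at_right_less eventually_at_filter less_imp_neq[OF pos, symmetric])
      then show "(F \<longlongrightarrow> 0) (at_right 0)" using b by (simp add: F_def[abs_def])
    qed
    then show ?thesis
      by (intro tendsto_lowerbound[of "\<lambda>e. sqrt b + F e" "sqrt b" "at_right 0"])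
        (use step b in \<open>auto simp: eventually_at_right_field intro!: exI[of _ b]\<close>)
  qed
  finally show ?thesis using x Fg[OF x] by (simp add: field_simps)
qed

text \<open>The density bound \<open>sqrt b / t\<close> integrates to a logarithm, so the mass
  depends on the ratio \<open>w\<close> of the endpoints and not on their position. A rescaled
  quantile is thereby controlled uniformly in the level.\<close>

lemma gamma_law_interval_bound:
  assumes b: "b > 0" and x: "x > 0" and w: "w \<ge> 1"
  shows "measure (gamma_law b 1) {x<..x * w} \<le> sqrt b * ln w"
proof -
  interpret G: prob_space "gamma_law b 1" by (rule prob_space_gamma_law) (use b in auto)
  have "emeasure (gamma_law b 1) {x<..x * w} = (\<integral>\<^sup>+t. ennreal (gamma_density b 1 t) * indicator {x<..x * w} t \<partial>lborel)"
    unfolding gamma_law_def by (subst emeasure_density) auto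
  also have "\<dots> \<le> (\<integral>\<^sup>+t. ennreal (sqrt b / t) * indicator {x..x * w} t \<partial>lborel)"
    using x gamma_density_bound[OF b] by (intro nn_integral_mono) (auto split: split_indicator intro!: ennreal_leI)
  also have "\<dots> = ennreal (sqrt b * ln (x * w) - sqrt b * ln x)"
  proof (rule nn_integral_FTC_Icc)
    fix t assume "t \<in> {x..x * w}"
    then have t: "t > 0" using x by auto
    then show "((\<lambda>t. sqrt b * ln t) has_real_derivative sqrt b / t) (at t)"
      by (auto intro!: derivative_eq_intros)
    show "0 \<le> sqrt b / t" using t b by simp
  qed (use x w in auto)
  also have "sqrt b * ln (x * w) - sqrt b * ln x = sqrt b * ln w"
    using x w by (simp add: ln_mult algebra_simps)
  finally show ?thesis using b w by (simp add: G.emeasure_eq_measure)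
qed

lemma emeasure_gamma_law_tail:
  assumes b: "b > 0" and c: "c > 0"
  shows "emeasure (gamma_law b c) {q<..} = emeasure (gamma_law b 1) {c * q<..}"
proof -
  have "emeasure (gamma_law b c) {q<..} = (\<integral>\<^sup>+x. indicator {q<..} x \<partial>gamma_law b c)" by simp
  also have "\<dots> = (\<integral>\<^sup>+x. indicator {q<..} (x / c) \<partial>gamma_law b 1)"
    by (rule gamma_law_scale) (use b c in auto)
  also have "\<dots> = (\<integral>\<^sup>+x. indicator {c * q<..} x \<partial>gamma_law b 1)"
    using c by (intro nn_integral_cong) (auto simp: indicator_def field_simps)
  finally show ?thesis by simp
qed

lemma emeasure_gamma_law_nonpos:
  assumes b: "b > 0" and q: "q \<le> 0"
  shows "emeasure (gamma_law b 1) {q<..} = 1"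
proof -
  interpret G: prob_space "gamma_law b 1" by (rule prob_space_gamma_law) (use b in auto)
  have "AE x in gamma_law b 1. x \<in> {q<..}"
    unfolding gamma_law_def using q by (subst AE_density) (auto simp: gamma_density_def intro!: AE_I2)
  then show ?thesis by (subst G.emeasure_eq_1_AE) auto
qed

lemma real_distribution_gamma_law: "b > 0 \<Longrightarrow> c > 0 \<Longrightarrow> real_distribution (gamma_law b c)"
  using prob_space_gamma_law[of b c] by (simp add: real_distribution_def real_distribution_axioms_def)

lemma real_distribution_log_beta_law: "a > 0 \<Longrightarrow> b > 0 \<Longrightarrow> real_distribution (log_beta_law a b)"
  using prob_space_log_beta_law[of a b] by (simp add: real_distribution_def real_distribution_axioms_def)

section \<open>Stochastic order and monotone likelihood ratios\<close>

definition stoch_le :: "real measure \<Rightarrow> real measure \<Rightarrow> bool" where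
  "stoch_le M N \<longleftrightarrow> (\<forall>q. emeasure M {q<..} \<le> emeasure N {q<..})"

lemma stoch_le_refl[simp]: "stoch_le M M"
  by (simp add: stoch_le_def)

lemma stoch_le_trans: "stoch_le M N \<Longrightarrow> stoch_le N L \<Longrightarrow> stoch_le M L"
  unfolding stoch_le_def by (meson order_trans)

lemma stoch_le_gamma_rate:
  assumes b: "b > 0" and c: "0 < c" "c \<le> c'"
  shows "stoch_le (gamma_law b c') (gamma_law b c)"
  unfolding stoch_le_def
proof
  fix q :: real
  interpret G: prob_space "gamma_law b 1" by (rule prob_space_gamma_law) (use b in auto)
  show "emeasure (gamma_law b c') {q<..} \<le> emeasure (gamma_law b c) {q<..}"
  proof (cases "q \<ge> 0")
    case True
    then have "c * q \<le> c' * q" using c by (intro mult_right_mono) auto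
    then show ?thesis using b c emeasure_gamma_law_tail[of b c q] emeasure_gamma_law_tail[of b c' q] by (simp add: emeasure_mono)
  next
    case False
    then have "c * q \<le> 0" using c by (simp add: mult_le_0_iff)
    then have "emeasure (gamma_law b 1) {c * q<..} = 1" by (rule emeasure_gamma_law_nonpos[OF b])
    then show ?thesis using b c emeasure_gamma_law_tail[of b c q] emeasure_gamma_law_tail[of b c' q] by (simp add: G.emeasure_le_1)
  qed
qed

text \<open>A monotone likelihood ratio implies stochastic order.\<close>

lemma stoch_le_densityI:
  fixes f g r :: "real \<Rightarrow> real"
  assumes M: "prob_space (density lborel (\<lambda>x. ennreal (f x)))" and N: "prob_space (density lborel (\<lambda>x. ennreal (g x)))"
    and [measurable]: "f \<in> borel_measurable borel" "g \<in> borel_measurable borel"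
    and f0: "\<And>x. 0 \<le> f x"
    and g0: "\<And>x. x \<le> 0 \<Longrightarrow> g x = 0"
    and r: "\<And>x. 0 < x \<Longrightarrow> g x = r x * f x" and r_mono: "\<And>x y. 0 < x \<Longrightarrow> x \<le> y \<Longrightarrow> r x \<le> r y"
  shows "stoch_le (density lborel (\<lambda>x. ennreal (f x))) (density lborel (\<lambda>x. ennreal (g x)))"
  unfolding stoch_le_def
proof
  fix t :: real
  let ?M = "density lborel (\<lambda>x. ennreal (f x))" and ?N = "density lborel (\<lambda>x. ennreal (g x))"
  interpret M: prob_space ?M by fact
  interpret N: prob_space ?N by fact
  have compl: "emeasure ?M {t<..} \<le> emeasure ?N {t<..}" if "emeasure ?N {..t} \<le> emeasure ?M {..t}"
  proof -
    have e: "{t<..} = UNIV - {..t}" by auto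
    have "M.prob {t<..} = 1 - M.prob {..t}" "N.prob {t<..} = 1 - N.prob {..t}"
      using M.prob_compl[of "{..t}"] N.prob_compl[of "{..t}"] unfolding e by simp_all
    then show ?thesis using that by (simp add: M.emeasure_eq_measure N.emeasure_eq_measure)
  qed
  \<comment> \<open>If the ratio has reached 1 at \<open>t\<close>, the densities are ordered on the
    whole upper tail. Otherwise they are ordered the other way on the lower tail, and complements
    give the claim.\<close>
  show "emeasure ?M {t<..} \<le> emeasure ?N {t<..}"
  proof (cases "t > 0 \<and> r t \<ge> 1")
    case True
    have "f x \<le> g x" if "x > t" for x
    proof -
      have "1 \<le> r x" using True that r_mono[of t x] by linarith
      then have "1 * f x \<le> r x * f x" using f0 by (rule mult_right_mono)
      then show ?thesis using r[of x] True that by simp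
    qed
    then show ?thesis
      by (simp add: emeasure_density) (intro nn_integral_mono, auto split: split_indicator intro!: ennreal_leI)
  next
    case False
    have "g x \<le> f x" if "x \<le> t" for x
    proof (cases "x > 0")
      case True
      then have "r x \<le> 1" using False that r_mono[of x t] by linarith
      then have "r x * f x \<le> 1 * f x" using f0 by (rule mult_right_mono)
      then show ?thesis using r[OF True] by simp
    next
      case False
      then show ?thesis using g0[of x] f0[of x] by simp
    qed
    then show ?thesis
      by (intro compl) (simp add: emeasure_density, intro nn_integral_mono, auto split: split_indicator intro!: ennreal_leI)
  qed
qed

text \<open>Convexity of \<open>exp\<close> on the chord from \<open>0\<close> to
  \<open>y * z\<close>. With \<open>z = -1\<close> and \<open>z = 1\<close> it makes
  \<open>x / (1 - exp (- x))\<close> and \<open>(exp x - 1) / x\<close> increasing, the two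
  likelihood ratios needed below.\<close>

lemma exp_chord:
  fixes x y z :: real
  assumes "0 < x" "x \<le> y"
  shows "exp (x * z) \<le> x / y * exp (y * z) + (1 - x / y)"
proof -
  have "exp ((1 - x / y) *\<^sub>R 0 + (x / y) *\<^sub>R (y * z)) \<le> (1 - x / y) * exp 0 + (x / y) * exp (y * z)"
    using assms by (intro convex_onD[OF exp_convex]) auto
  then show ?thesis using assms by simp
qed

text \<open>Both densities carry the factor \<open>exp (- (a * y))\<close>, so their ratio is a
  constant times the square root of \<open>y / (1 - exp (- y))\<close>, which increases.\<close>

lemma stoch_le_gamma_log_beta:
  assumes a: "a > 0"
  shows "stoch_le (gamma_law (1/2) a) (log_beta_law a (1/2))"
  unfolding gamma_law_def log_beta_law_def
proof (rule stoch_le_densityI)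
  define K where "K = Gamma (a + 1/2) / (Gamma a * Gamma (1/2)) / (a powr (1/2) / Gamma (1/2))"
  have K: "K \<ge> 0" using a by (auto simp: K_def intro!: divide_nonneg_nonneg mult_nonneg_nonneg less_imp_le[OF Gamma_real_pos])
  let ?r = "\<lambda>y. K * (y / (1 - exp (- y))) powr (1/2)"
  show "log_beta_density a (1/2) x = ?r x * gamma_density (1/2) a x" if x: "0 < x" for x
  proof -
    have e: "1 - exp (- x) > 0" using x by simp
    have "Gamma (1/2::real) > 0" "Gamma a > 0" by (auto intro!: Gamma_real_pos a)
    have "(x / (1 - exp (- x))) powr (1/2) * x powr (1/2 - 1) = (1 - exp (- x)) powr (1/2 - 1)"
      using x e by (simp add: powr_divide powr_minus divide_simps powr_add[symmetric])
    then show ?thesis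
      using x a \<open>Gamma (1/2::real) > 0\<close> by (simp add: K_def log_beta_density_def gamma_density_def field_simps)
  qed
  show "?r x \<le> ?r y" if xy: "0 < x" "x \<le> y" for x y
  proof -
    have y: "y > 0" using xy by simp
    have "exp (- x) \<le> x / y * exp (- y) + (1 - x / y)" using exp_chord[OF xy, of "-1"] by simp
    then have "x / y * (1 - exp (- y)) \<le> 1 - exp (- x)" by (simp add: algebra_simps)
    then have "x * (1 - exp (- y)) \<le> y * (1 - exp (- x))" using y by (simp add: field_simps)
    then have "x / (1 - exp (- x)) \<le> y / (1 - exp (- y))"
      using xy y by (simp add: divide_simps mult.commute)
    then show ?thesis using K xy by (intro mult_left_mono powr_mono2) auto
  qed
  show "log_beta_density a (1/2) x = 0" if "x \<le> 0" for x using that by (simp add: log_beta_density_def)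
  show "prob_space (density lborel (\<lambda>x. ennreal (gamma_density (1/2) a x)))"
    using prob_space_gamma_law[of "1/2" a] a by (simp add: gamma_law_def)
  show "prob_space (density lborel (\<lambda>x. ennreal (log_beta_density a (1/2) x)))"
    using prob_space_log_beta_law[of a "1/2"] a by (simp add: log_beta_law_def)
qed (use a in auto)

text \<open>Lowering the rate by \<open>1/2\<close> contributes a factor \<open>exp (y / 2)\<close>,
  and this turns the ratio into a constant times the square root of \<open>(exp y - 1) / y\<close>.
  This is again increasing, now in the opposite direction of comparison.\<close>

lemma stoch_le_log_beta_gamma:
  assumes a: "a > 1/2"
  shows "stoch_le (log_beta_law a (1/2)) (gamma_law (1/2) (a - 1/2))"
  unfolding gamma_law_def log_beta_law_def
proof (rule stoch_le_densityI)
  define C where "C = Gamma (a + 1/2) / (Gamma a * Gamma (1/2))"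
  define K where "K = ((a - 1/2) powr (1/2) / Gamma (1/2)) / C"
  have C: "C > 0" using a by (auto simp: C_def intro!: divide_pos_pos mult_pos_pos Gamma_real_pos)
  have K: "K \<ge> 0" using C by (auto simp: K_def intro!: divide_nonneg_nonneg mult_nonneg_nonneg less_imp_le[OF Gamma_real_pos])
  let ?r = "\<lambda>y. K * ((exp y - 1) / y) powr (1/2)"
  show "gamma_density (1/2) (a - 1/2) x = ?r x * log_beta_density a (1/2) x" if x: "0 < x" for x
  proof -
    have e: "1 - exp (- x) > 0" using x by simp
    have ex: "exp x - 1 = exp x * (1 - exp (- x))" by (simp add: algebra_simps exp_add[symmetric])
    have "((exp x - 1) / x) powr (1/2) * (1 - exp (- x)) powr (1/2 - 1) = exp x powr (1/2) * x powr (1/2 - 1)"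
      unfolding ex using x e by (simp add: powr_divide powr_mult powr_minus divide_simps powr_add[symmetric])
    moreover have "exp (- ((a - 1/2) * x)) = exp x powr (1/2) * exp (- (a * x))"
      by (simp add: powr_def exp_add[symmetric] algebra_simps)
    moreover have "?r x * log_beta_density a (1/2) x = (a - 1/2) powr (1/2) / Gamma (1/2) * exp (- (a * x)) *
       (((exp x - 1) / x) powr (1/2) * (1 - exp (- x)) powr (1/2 - 1))"
      using x C by (simp add: K_def log_beta_density_def C_def[symmetric])
    ultimately show ?thesis
      using x by (simp add: gamma_density_def)
  qed
  show "?r x \<le> ?r y" if xy: "0 < x" "x \<le> y" for x y
  proof -
    have y: "y > 0" using xy by simp
    have "exp x \<le> x / y * exp y + (1 - x / y)" using exp_chord[OF xy, of "1"] by simp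
    then have "exp x - 1 \<le> x / y * (exp y - 1)" by (simp add: algebra_simps)
    then have "(exp x - 1) / x \<le> (exp y - 1) / y" using y xy by (simp add: field_simps)
    then show ?thesis using K xy by (intro mult_left_mono powr_mono2) auto
  qed
  show "gamma_density (1/2) (a - 1/2) x = 0" if "x \<le> 0" for x using that by (simp add: gamma_density_def)
  show "prob_space (density lborel (\<lambda>x. ennreal (gamma_density (1/2) (a - 1/2) x)))"
    using prob_space_gamma_law[of "1/2" "a - 1/2"] a by (simp add: gamma_law_def)
  show "prob_space (density lborel (\<lambda>x. ennreal (log_beta_density a (1/2) x)))"
    using prob_space_log_beta_law[of a "1/2"] a by (simp add: log_beta_law_def)
qed (use a in auto)

section \<open>Convolutions of lists of laws\<close>

primrec convs :: "real measure list \<Rightarrow> real measure" where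
  "convs [] = return borel 0"
| "convs (M # Ms) = (M \<star> convs Ms)"

lemma real_distribution_convolution:
  assumes "real_distribution M" "real_distribution N"
  shows "real_distribution (M \<star> N)"
proof -
  interpret M: real_distribution M by fact
  interpret N: real_distribution N by fact
  interpret P: pair_prob_space M N ..
  show ?thesis unfolding convolution_def
    by (intro P.real_distribution_distr) simp
qed

lemma real_distribution_return: "real_distribution (return borel (x :: real))"
  by (simp add: real_distribution_def real_distribution_axioms_def prob_space_return)

lemma real_distribution_convs: "(\<And>M. M \<in> set Ms \<Longrightarrow> real_distribution M) \<Longrightarrow> real_distribution (convs Ms)"
  by (induction Ms) (auto intro: real_distribution_convolution real_distribution_return)

lemma real_distribution_finite: "real_distribution M \<Longrightarrow> finite_measure M"
  by (simp add: real_distribution_def prob_space_def)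

lemma real_distribution_sets: "real_distribution M \<Longrightarrow> sets M = sets borel"
  by (rule real_distribution.events_eq_borel)

lemma return_zero_convolution:
  assumes "real_distribution M"
  shows "(return borel 0 \<star> M) = M"
proof (rule measure_eqI)
  interpret M: real_distribution M by fact
  fix A assume "A \<in> sets (return borel 0 \<star> M)"
  then have [measurable]: "A \<in> sets borel" by simp
  interpret R: prob_space "return borel (0::real)" by (rule prob_space_return) simp
  have "emeasure (return borel 0 \<star> M) A = (\<integral>\<^sup>+x. \<integral>\<^sup>+y. indicator A (x + y) \<partial>M \<partial>return borel 0)"
    by (rule convolution_emeasure') (auto intro: M.finite_measure_axioms R.finite_measure_axioms)
  also have "\<dots> = emeasure M A" by (subst nn_integral_return) (auto simp: nn_integral_indicator)
  finally show "emeasure (return borel 0 \<star> M) A = emeasure M A" .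
qed (use real_distribution_sets[OF assms] in simp)

lemma convs_append:
  assumes "\<And>M. M \<in> set Ms \<Longrightarrow> real_distribution M" "\<And>M. M \<in> set Ns \<Longrightarrow> real_distribution M"
  shows "convs (Ms @ Ns) = (convs Ms \<star> convs Ns)"
  using assms
proof (induction Ms)
  case Nil
  then show ?case using return_zero_convolution[OF real_distribution_convs[of Ns]] by simp
next
  case (Cons M Ms)
  have "real_distribution M" "real_distribution (convs Ms)" "real_distribution (convs Ns)"
    using Cons.prems by (auto intro: real_distribution_convs)
  then show ?case using Cons
    by (simp add: convolution_associative real_distribution_finite real_distribution_sets)
qed

lemma emeasure_convolution_tail:
  assumes "real_distribution M" "real_distribution N"
  shows "emeasure (M \<star> N) {q<..} = (\<integral>\<^sup>+x. emeasure N {q - x<..} \<partial>M)"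
proof -
  interpret M: real_distribution M by fact
  interpret N: real_distribution N by fact
  have "emeasure (M \<star> N) {q<..} = (\<integral>\<^sup>+x. emeasure N {a. a + x \<in> {q<..}} \<partial>M)"
    by (rule convolution_emeasure) (auto intro: M.finite_measure_axioms N.finite_measure_axioms)
  moreover have "{a. a + x \<in> {q<..}} = {q - x<..}" for x by auto
  ultimately show ?thesis by simp
qed

text \<open>One factor is exchanged at a time: conditioning on the first summand compares the
  second, and commutativity reduces the other exchange to this one.\<close>

lemma stoch_le_convolution:
  assumes "real_distribution M" "real_distribution N" "real_distribution M'" "real_distribution N'"
    and "stoch_le M M'" "stoch_le N N'"
  shows "stoch_le (M \<star> N) (M' \<star> N')"
proof (rule stoch_le_trans)
  have le: "stoch_le (M \<star> N) (M \<star> N')"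
    if "real_distribution M" "real_distribution N" "real_distribution N'" "stoch_le N N'" for M N N'
    using that unfolding stoch_le_def by (auto simp: emeasure_convolution_tail intro!: nn_integral_mono)
  show "stoch_le (M \<star> N) (M \<star> N')" by (intro le assms)
  have "stoch_le (N' \<star> M) (N' \<star> M')" by (intro le assms)
  then show "stoch_le (M \<star> N') (M' \<star> N')"
    using assms by (simp add: convolution_commutative real_distribution_finite real_distribution_sets)
qed

lemma stoch_le_convs:
  assumes "\<And>x. x \<in> set xs \<Longrightarrow> stoch_le (F x) (G x)"
    and "\<And>x. x \<in> set xs \<Longrightarrow> real_distribution (F x)" "\<And>x. x \<in> set xs \<Longrightarrow> real_distribution (G x)"
  shows "stoch_le (convs (map F xs)) (convs (map G xs))"
  using assms
proof (induction xs)
  case (Cons x xs)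
  then show ?case by (auto intro!: stoch_le_convolution real_distribution_convs)
qed simp

text \<open>For equal rates the shapes add up, so a sum with constant weights is an exact multiple
  of a chi-squared variable. The crude bounds below rest on this.\<close>

lemma convs_replicate_gamma_law:
  assumes "c > 0" "m > 0"
  shows "convs (replicate m (gamma_law (1/2) c)) = gamma_law (real m / 2) c"
  using assms(2)
proof (induction m rule: nat_induct_non_zero)
  case 1
  have "(gamma_law (1/2) c \<star> return borel 0) = (return borel 0 \<star> gamma_law (1/2) c)"
    using assms by (intro convolution_commutative) (auto intro!: real_distribution_finite real_distribution_return real_distribution_gamma_law)
  then show ?case using assms by (simp add: return_zero_convolution real_distribution_gamma_law)
next
  case (Suc m)
  then show ?case using assms gamma_law_convolution[of "1/2" "real m / 2" c]
    by (simp add: add_divide_distrib)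
qed

section \<open>Normal approximation\<close>

abbreviation \<Phi> :: "real \<Rightarrow> real" where "\<Phi> \<equiv> cdf std_normal_distribution"

text \<open>The second bound, from \<open>exp (t^2 / 2) \<ge> 1 + t^2 / 2 \<ge> |t|\<close>, means
  density at most \<open>1 / |t|\<close>; it makes a change of scale harmless uniformly in the
  argument.\<close>

lemma std_normal_density_le:
  "std_normal_density t \<le> 1" "\<bar>t\<bar> * std_normal_density t \<le> 1"
proof -
  have "1 \<le> sqrt (2 * pi)" using pi_ge_two by simp
  then have c: "1 / sqrt (2 * pi) \<le> 1" "0 \<le> 1 / sqrt (2 * pi)" by (auto simp: divide_simps)
  have e: "1 + t\<^sup>2 / 2 \<le> exp (t\<^sup>2 / 2)" by (rule exp_ge_add_one_self)
  have "0 \<le> (\<bar>t\<bar> - 1)\<^sup>2" by simp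
  then have "\<bar>t\<bar> \<le> 1 + t\<^sup>2 / 2" by (simp add: power2_eq_square algebra_simps)
  then have "\<bar>t\<bar> \<le> exp (t\<^sup>2 / 2)" using e by linarith
  then have "\<bar>t\<bar> * exp (- t\<^sup>2 / 2) \<le> 1" by (simp add: exp_minus field_simps)
  moreover have "exp (- t\<^sup>2 / 2) \<le> 1" by simp
  ultimately show "std_normal_density t \<le> 1" "\<bar>t\<bar> * std_normal_density t \<le> 1"
    unfolding std_normal_density_def using c
    mult_mono[of "1 / sqrt (2 * pi)" 1 "exp (- t\<^sup>2 / 2)" 1]
    mult_mono[of "1 / sqrt (2 * pi)" 1 "\<bar>t\<bar> * exp (- t\<^sup>2 / 2)" 1]
    by (auto simp: mult_ac)
qed

lemma std_normal_interval_le: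
  assumes "x \<le> y" "\<And>t. x \<le> t \<Longrightarrow> t \<le> y \<Longrightarrow> std_normal_density t \<le> B"
  shows "\<Phi> y - \<Phi> x \<le> B * (y - x)"
proof (cases "x = y")
  case False
  interpret N: real_distribution std_normal_distribution by (rule real_dist_normal_dist)
  have xy: "x < y" using assms False by simp
  have B: "0 \<le> B" using assms(2)[of x] assms(1) normal_density_nonneg[of 0 1 x] by linarith
  have "emeasure std_normal_distribution {x<..y} = (\<integral>\<^sup>+t. ennreal (std_normal_density t) * indicator {x<..y} t \<partial>lborel)"
    by (subst emeasure_density) auto
  also have "\<dots> \<le> (\<integral>\<^sup>+t. ennreal B * indicator {x<..y} t \<partial>lborel)"
    using assms(2) by (intro nn_integral_mono) (auto split: split_indicator intro!: ennreal_leI)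
  also have "\<dots> = ennreal (B * (y - x))"
    using xy B by (simp add: nn_integral_cmult_indicator ennreal_mult[symmetric])
  finally have "N.prob {x<..y} \<le> B * (y - x)"
    using xy B by (simp add: N.emeasure_eq_measure)
  then show ?thesis using N.cdf_diff_eq[OF xy] by simp
qed simp

lemma \<Phi>_mono: "x \<le> y \<Longrightarrow> \<Phi> x \<le> \<Phi> y"
proof -
  interpret N: real_distribution std_normal_distribution by (rule real_dist_normal_dist)
  show "x \<le> y \<Longrightarrow> \<Phi> x \<le> \<Phi> y" by (rule N.cdf_nondecreasing)
qed

lemma \<Phi>_strict_mono: assumes "x < y" shows "\<Phi> x < \<Phi> y"
proof -
  interpret N: real_distribution std_normal_distribution by (rule real_dist_normal_dist)
  have "N.prob {x<..y} \<noteq> 0"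
  proof
    assume "N.prob {x<..y} = 0"
    then have "emeasure std_normal_distribution {x<..y} = 0" by (simp add: N.emeasure_eq_measure)
    then have "(\<integral>\<^sup>+t. ennreal (std_normal_density t) * indicator {x<..y} t \<partial>lborel) = 0"
      by (subst (asm) emeasure_density) auto
    then have "AE t in lborel. ennreal (std_normal_density t) * indicator {x<..y} t = 0"
      by (subst (asm) nn_integral_0_iff_AE) auto
    then have "AE t in lborel. t \<notin> {x<..y}"
    proof eventually_elim
      case (elim t)
      have "std_normal_density t > 0" by (rule normal_density_pos) simp
      then show ?case using elim by (auto simp: indicator_def split: if_splits)
    qed
    then have "emeasure lborel {x<..y} = 0"
      by (subst (asm) AE_iff_measurable[of "{x<..y}"]) auto
    then show False using assms by simp
  qed
  then have "0 < N.prob {x<..y}" by (simp add: less_le)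
  then show ?thesis using N.cdf_diff_eq[OF assms] by simp
qed

lemma \<Phi>_lipschitz: "\<bar>\<Phi> y - \<Phi> x\<bar> \<le> \<bar>y - x\<bar>"
proof -
  have "\<bar>\<Phi> y - \<Phi> x\<bar> \<le> \<bar>y - x\<bar>" if "x \<le> y" for x y
    using std_normal_interval_le[OF that, of 1] std_normal_density_le(1) \<Phi>_mono[OF that] that by simp
  from this[of x y] this[of y x] show ?thesis by linarith
qed

text \<open>Since \<open>a \<ge> 1/2\<close>, all points between \<open>x\<close> and
  \<open>a * x\<close> have modulus at least \<open>|x| / 2\<close>, where the density is at most
  \<open>2 / |x|\<close>. The interval has length \<open>|a - 1| * |x|\<close>, so \<open>x\<close>
  cancels and the bound is uniform.\<close>

lemma \<Phi>_affine:
  assumes a: "\<bar>a - 1\<bar> \<le> 1/2"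
  shows "\<bar>\<Phi> (a * x + b) - \<Phi> x\<bar> \<le> \<bar>b\<bar> + 2 * \<bar>a - 1\<bar>"
proof -
  have "\<bar>\<Phi> (a * x) - \<Phi> x\<bar> \<le> 2 * \<bar>a - 1\<bar>"
  proof (cases "x = 0")
    case False
    have a0: "1/2 \<le> a" using a by linarith
    have B: "std_normal_density t \<le> 2 / \<bar>x\<bar>" if "\<bar>x\<bar> / 2 \<le> \<bar>t\<bar>" for t
    proof -
      have t0: "\<bar>t\<bar> > 0" using that False by (cases "t = 0") auto
      have "std_normal_density t \<le> 1 / \<bar>t\<bar>"
        using std_normal_density_le(2)[of t] t0 by (simp add: field_simps)
      also have "\<dots> \<le> 2 / \<bar>x\<bar>" using that t0 False by (simp add: divide_simps)
      finally show ?thesis .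
    qed
    have h: "\<bar>x\<bar> / 2 \<le> \<bar>t\<bar>" if "min x (a * x) \<le> t" "t \<le> max x (a * x)" for t
    proof (cases "x > 0")
      case True
      then have "x / 2 \<le> a * x" using mult_right_mono[OF a0, of x] by simp
      moreover have "min x (a * x) \<le> \<bar>t\<bar>" using that by linarith
      ultimately show ?thesis using True by linarith
    next
      case F: False
      then have "a * x \<le> x / 2" using mult_right_mono_neg[OF a0, of x] by simp
      moreover have "- max x (a * x) \<le> \<bar>t\<bar>" using that by linarith
      ultimately show ?thesis using F by linarith
    qed
    have "\<Phi> (max x (a * x)) - \<Phi> (min x (a * x)) \<le> 2 / \<bar>x\<bar> * (max x (a * x) - min x (a * x))"
      by (rule std_normal_interval_le) (auto intro!: B h)
    also have "max x (a * x) - min x (a * x) = \<bar>a - 1\<bar> * \<bar>x\<bar>"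
      by (auto simp: max_def min_def abs_mult[symmetric] algebra_simps)
    also have "2 / \<bar>x\<bar> * (\<bar>a - 1\<bar> * \<bar>x\<bar>) = 2 * \<bar>a - 1\<bar>" using False by simp
    finally show ?thesis
      using \<Phi>_mono[of "min x (a * x)" "max x (a * x)"] by (auto simp: max_def min_def split: if_splits)
  qed simp
  moreover have "\<bar>\<Phi> (a * x + b) - \<Phi> (a * x)\<bar> \<le> \<bar>b\<bar>" using \<Phi>_lipschitz[of "a * x + b" "a * x"] by simp
  ultimately show ?thesis by linarith
qed

text \<open>Polya's theorem for the normal distribution: compare on the quantiles of order \<open>i / K\<close>.\<close>

lemma weak_conv_normal_uniform:
  fixes M :: "nat \<Rightarrow> real measure"
  assumes M: "\<And>n. real_distribution (M n)" and w: "weak_conv_m M std_normal_distribution" and e: "\<epsilon> > 0"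
  shows "\<forall>\<^sub>F n in sequentially. \<forall>x. \<bar>cdf (M n) x - \<Phi> x\<bar> \<le> \<epsilon>"
proof -
  interpret N: real_distribution std_normal_distribution by (rule real_dist_normal_dist)
  interpret M: real_distribution "M n" for n by (rule M)
  have contAt: "isCont \<Phi> x" for x
  proof (rule continuous_at_eps_delta[THEN iffD2, rule_format])
    fix e :: real assume "e > 0"
    then show "\<exists>d>0. \<forall>x'. dist x' x < d \<longrightarrow> dist (\<Phi> x') (\<Phi> x) < e"
      using \<Phi>_lipschitz by (intro exI[of _ e]) (auto simp: dist_real_def intro: le_less_trans)
  qed
  have pw: "(\<lambda>n. cdf (M n) x) \<longlonglongrightarrow> \<Phi> x" for x
    using w contAt by (simp add: weak_conv_m_def weak_conv_def)
  obtain K :: nat where K: "3 / \<epsilon> < real K" using reals_Archimedean2 by blast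
  have K0: "real K > 0" using K e by (meson divide_pos_pos less_trans zero_less_numeral)
  \<comment> \<open>The error consists of at most two steps of the grid and one pointwise deviation,
    each of size \<open>1 / K\<close>.\<close>
  have K3: "3 / real K \<le> \<epsilon>" using K K0 e by (simp add: field_simps)
  \<comment> \<open>Only interior orders have quantiles; the cells at both ends are handled by the
    trivial bounds 0 and 1 on distribution functions.\<close>
  have "\<exists>x. \<Phi> x = real i / real K" if i: "0 < i" "i < K" for i
  proof -
    have "\<forall>\<^sub>F x in at_top. real i / real K < \<Phi> x"
      using i by (intro order_tendstoD[OF N.cdf_lim_at_top_prob]) auto
    moreover have "\<forall>\<^sub>F x in at_bot. \<Phi> x < real i / real K"
      using i by (intro order_tendstoD[OF N.cdf_lim_at_bot]) auto
    ultimately obtain u v where "\<Phi> u < real i / real K" "real i / real K < \<Phi> v"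
      by (meson eventually_happens trivial_limit_at_bot_linorder trivial_limit_at_top_linorder)
    moreover from this have "u \<le> v" using \<Phi>_mono[of v u] by (cases "u \<le> v") auto
    ultimately show ?thesis using IVT'[of \<Phi> u "real i / real K" v] contAt
      by (auto simp: continuous_at_imp_continuous_on)
  qed
  then obtain q where q: "\<And>i. 0 < i \<Longrightarrow> i < K \<Longrightarrow> \<Phi> (q i) = real i / real K" by metis
  have "\<forall>\<^sub>F n in sequentially. \<forall>i\<in>{..<K}. \<bar>cdf (M n) (q i) - \<Phi> (q i)\<bar> < 1 / real K"
  proof (intro eventually_ball_finite ballI)
    fix i
    have "\<forall>\<^sub>F n in sequentially. dist (cdf (M n) (q i)) (\<Phi> (q i)) < 1 / real K"
      using K0 by (intro tendstoD pw) auto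
    then show "\<forall>\<^sub>F n in sequentially. \<bar>cdf (M n) (q i) - \<Phi> (q i)\<bar> < 1 / real K" by (simp add: dist_real_def)
  qed simp
  then show ?thesis
  proof eventually_elim
    case (elim n)
    show ?case
    proof
      fix x
      define i where "i = nat \<lfloor>\<Phi> x * real K\<rfloor>"
      have b: "0 \<le> \<Phi> x" "\<Phi> x \<le> 1" "0 \<le> cdf (M n) x" "cdf (M n) x \<le> 1"
        using N.cdf_nonneg N.cdf_bounded_prob M.cdf_nonneg M.cdf_bounded_prob by auto
      have i: "real i \<le> \<Phi> x * real K" "\<Phi> x * real K < real i + 1"
        using b K0 by (auto simp: i_def)
      have i': "real i / real K \<le> \<Phi> x" "\<Phi> x < (real i + 1) / real K" using i K0 by (auto simp: field_simps)
      have "cdf (M n) x \<le> \<Phi> x + 3 / real K"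
      proof (cases "Suc i < K")
        case True
        have "\<Phi> x < \<Phi> (q (Suc i))" using q[of "Suc i"] True i' by (simp add: add.commute)
        then have "x \<le> q (Suc i)" using \<Phi>_mono[of "q (Suc i)" x] by (cases "x \<le> q (Suc i)") auto
        then have "cdf (M n) x \<le> cdf (M n) (q (Suc i))" by (rule M.cdf_nondecreasing)
        also have "\<dots> \<le> real (Suc i) / real K + 1 / real K" using elim[rule_format, of "Suc i"] q[of "Suc i"] True by simp
        also have "\<dots> \<le> \<Phi> x + 3 / real K" using i' K0 by (simp add: add_divide_distrib)
        finally show ?thesis .
      next
        case False
        then have "real K \<le> real i + 1" by linarith
        then have "1 \<le> (real i + 1) / real K" using K0 by simp
        also have "\<dots> \<le> \<Phi> x + 1 / real K" using i' by (simp add: add_divide_distrib)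
        also have "\<dots> \<le> \<Phi> x + 3 / real K" using K0 by (simp add: divide_right_mono)
        finally show ?thesis using b by linarith
      qed
      \<comment> \<open>The quantile with index \<open>i - 1\<close> instead of \<open>i\<close>
        gives a strict inequality, from which \<open>q (i - 1) \<le> x\<close> follows by
        monotonicity alone; it also keeps the index below \<open>K\<close>.\<close>
      moreover have "\<Phi> x - 3 / real K \<le> cdf (M n) x"
      proof (cases "i \<ge> 2")
        case True
        have "\<Phi> x * real K \<le> 1 * real K" using b by (intro mult_right_mono) auto
        then have "real i < real K + 1" using i by linarith
        then have iK: "i - 1 < K" using True by linarith
        have "\<Phi> (q (i - 1)) = (real i - 1) / real K" using q[of "i - 1"] True iK by (simp add: of_nat_diff)
        moreover have "(real i - 1) / real K < real i / real K" using K0 by (simp add: divide_strict_right_mono)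
        ultimately have "\<Phi> (q (i - 1)) < \<Phi> x" using i' by simp
        then have "q (i - 1) \<le> x" using \<Phi>_mono[of x "q (i - 1)"] by (cases "q (i - 1) \<le> x") auto
        then have "cdf (M n) (q (i - 1)) \<le> cdf (M n) x" by (rule M.cdf_nondecreasing)
        moreover have "(real i - 1) / real K - 1 / real K \<le> cdf (M n) (q (i - 1))"
          using elim[rule_format, of "i - 1"] iK \<open>\<Phi> (q (i - 1)) = (real i - 1) / real K\<close> by (simp add: abs_less_iff)
        moreover have "\<Phi> x - 3 / real K \<le> (real i - 1) / real K - 1 / real K"
          using i' by (simp add: add_divide_distrib diff_divide_distrib)
        ultimately show ?thesis by linarith
      next
        case False
        then have "\<Phi> x * real K \<le> 3" using i by linarith
        then have "\<Phi> x \<le> 3 / real K" using K0 by (simp add: field_simps)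
        then show ?thesis using b by linarith
      qed
      ultimately show "\<bar>cdf (M n) x - \<Phi> x\<bar> \<le> \<epsilon>" using K3 by linarith
    qed
  qed
qed

section \<open>Characteristic functions and a central limit theorem uniform in the weights\<close>

lemma char_convolution:
  assumes "real_distribution M" "real_distribution N"
  shows "char (M \<star> N) t = char M t * char N t"
proof -
  interpret M: real_distribution M by fact
  interpret N: real_distribution N by fact
  interpret P: pair_prob_space M N ..
  have m[measurable]: "(\<lambda>z. iexp (t * fst z) * iexp (t * snd z)) \<in> borel_measurable (M \<Otimes>\<^sub>M N)" by measurable
  have int: "integrable (M \<Otimes>\<^sub>M N) (\<lambda>z. iexp (t * fst z) * iexp (t * snd z))"
    by (rule P.integrable_const_bound[of _ 1]) (auto simp: norm_mult)
  have "char (M \<star> N) t = (CLINT z|M \<Otimes>\<^sub>M N. iexp (t * fst z) * iexp (t * snd z))"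
    unfolding convolution_def char_def
    by (subst integral_distr) (auto simp: case_prod_beta exp_add[symmetric] algebra_simps)
  also have "\<dots> = (CLINT x|M. CLINT y|N. iexp (t * x) * iexp (t * y))"
    using P.integral_fst'[OF int] by simp
  also have "\<dots> = char M t * char N t" by (simp add: char_def)
  finally show ?thesis .
qed

lemma char_convs:
  "(\<And>M. M \<in> set Ms \<Longrightarrow> real_distribution M) \<Longrightarrow> char (convs Ms) t = prod_list (map (\<lambda>M. char M t) Ms)"
proof (induction Ms)
  case Nil
  show ?case by (simp add: char_def integral_return)
next
  case (Cons M Ms)
  then show ?case by (simp add: char_convolution real_distribution_convs)
qed

lemma norm_prod_list_diff:
  fixes f g :: "'b \<Rightarrow> complex"
  assumes "\<And>x. x \<in> set xs \<Longrightarrow> norm (f x) \<le> 1" "\<And>x. x \<in> set xs \<Longrightarrow> norm (g x) \<le> 1"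
  shows "norm (prod_list (map f xs) - prod_list (map g xs)) \<le> (\<Sum>x\<leftarrow>xs. norm (f x - g x))"
proof -
  have eq: "prod_list (map h xs) = (\<Prod>i<length xs. h (xs ! i))" for h :: "'b \<Rightarrow> complex"
    by (simp add: prod.list_conv_set_nth atLeast0LessThan)
  have "(\<Sum>x\<leftarrow>xs. norm (f x - g x)) = (\<Sum>i<length xs. norm (f (xs ! i) - g (xs ! i)))"
    by (simp add: sum.list_conv_set_nth atLeast0LessThan)
  then show ?thesis unfolding eq using assms by (auto intro!: norm_prod_diff)
qed

text \<open>Every half-Gamma law is a shifted and rescaled copy of this one, so a single expansion
  of its characteristic function serves all rates.\<close>

definition centered_half_gamma :: "real measure" where
  "centered_half_gamma = distr (gamma_law (1/2) 1) borel (\<lambda>x. x - 1/2)"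

lemma real_distribution_centered_half_gamma: "real_distribution centered_half_gamma"
proof -
  interpret G: prob_space "gamma_law (1/2) 1" by (rule prob_space_gamma_law) auto
  show ?thesis unfolding centered_half_gamma_def by simp
qed

text \<open>The mean is 0 and the variance 1/2, which explains \<open>u^2 / 4\<close>. The remainder
  is governed by the third absolute moment, finite because \<open>|x - 1/2| ^ 3\<close> is at most
  \<open>x ^ 4 + 2\<close> for \<open>x \<ge> 0\<close>.\<close>

lemma char_centered_half_gamma:
  "\<exists>C\<ge>0. \<forall>u. norm (char centered_half_gamma u - of_real (1 - u\<^sup>2 / 4)) \<le> C * \<bar>u\<bar> ^ 3"
proof -
  interpret G: prob_space "gamma_law (1/2) 1" by (rule prob_space_gamma_law) auto
  note mv = gamma_law_mean_variance[of "1/2", simplified]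
  let ?X = "\<lambda>x :: real. x - 1/2"
  have i1: "integrable (gamma_law (1/2) 1) ?X" using mv by auto
  have m0: "G.expectation ?X = 0" using mv G.prob_space by simp
  have var: "G.variance ?X = 1/2" unfolding m0 using mv(4) by simp
  have i3: "integrable (gamma_law (1/2) 1) (\<lambda>x. \<bar>?X x\<bar> ^ 3)"
  proof (rule Bochner_Integration.integrable_bound)
    show "integrable (gamma_law (1/2) 1) (\<lambda>x. x ^ 4 + 2)"
      using gamma_law_moment[of "1/2" 4] by (auto simp: has_bochner_integral_iff)
    have "\<bar>x - 1/2\<bar> ^ 3 \<le> x ^ 4 + 2" if "x \<ge> 0" for x :: real
    proof (cases "x \<ge> 1")
      case True
      have "\<bar>x - 1/2\<bar> ^ 3 \<le> x ^ 3" using True by (intro power_mono) auto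
      also have "\<dots> \<le> x ^ 4" using True by (intro power_increasing) auto
      finally show ?thesis by simp
    next
      case False
      then have "\<bar>x - 1/2\<bar> ^ 3 \<le> 1" using that by (intro power_le_one) auto
      also have "\<dots> \<le> x ^ 4 + 2" using zero_le_even_power[of 4 x] by simp
      finally show ?thesis .
    qed
    then have bd: "norm (\<bar>x - 1/2\<bar> ^ 3) \<le> norm (x ^ 4 + 2)" if "x \<ge> 0" for x :: real
      using that by (smt (verit) real_norm_def zero_le_power abs_ge_zero)
    have "AE x in gamma_law (1/2) 1. x \<ge> 0"
      unfolding gamma_law_def by (subst AE_density) (auto simp: gamma_density_def intro!: AE_I2)
    then show "AE x in gamma_law (1/2) 1. norm (\<bar>x - 1/2\<bar> ^ 3) \<le> norm (x ^ 4 + 2)"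
      by (rule eventually_mono) (rule bd)
  qed simp
  define C where "C = G.expectation (\<lambda>x. \<bar>?X x\<bar> ^ 3) / 6"
  have C0: "C \<ge> 0" unfolding C_def by simp
  have "norm (char centered_half_gamma u - of_real (1 - u\<^sup>2 / 4)) \<le> C * \<bar>u\<bar> ^ 3" for u
  proof -
    have "norm (char centered_half_gamma u - (1 - u\<^sup>2 * (1/2) / 2)) \<le>
       (u\<^sup>2 / 6) * G.expectation (\<lambda>x. min (6 * (?X x)\<^sup>2) (\<bar>u\<bar> * \<bar>?X x\<bar> ^ 3))"
      by (rule G.char_approx3'[OF _ i1 _ m0 var centered_half_gamma_def]) (simp, rule mv(3))
    also have "\<dots> \<le> (u\<^sup>2 / 6) * G.expectation (\<lambda>x. \<bar>u\<bar> * \<bar>?X x\<bar> ^ 3)"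
    proof (intro mult_left_mono integral_mono)
      show "integrable (gamma_law (1/2) 1) (\<lambda>x. min (6 * (?X x)\<^sup>2) (\<bar>u\<bar> * \<bar>?X x\<bar> ^ 3))"
        using mv i3 by (intro integrable_min integrable_mult_right) auto
      show "integrable (gamma_law (1/2) 1) (\<lambda>x. \<bar>u\<bar> * \<bar>?X x\<bar> ^ 3)" using i3 by (intro integrable_mult_right)
    qed auto
    also have "\<dots> = C * (u\<^sup>2 * \<bar>u\<bar>)" using i3 by (simp add: C_def)
    also have "u\<^sup>2 * \<bar>u\<bar> = \<bar>u\<bar> ^ 3" by (simp add: power2_eq_square power3_eq_cube)
    finally show ?thesis by simp
  qed
  then show ?thesis by (intro exI[of _ C] conjI allI C0)
qed

lemma char_gamma_law_half:
  assumes c: "c > 0"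
  shows "char (gamma_law (1/2) c) t = iexp (t / (2 * c)) * char centered_half_gamma (t / c)"
proof -
  have d: "gamma_law (1/2) c = distr (gamma_law (1/2) 1) borel (\<lambda>x. x / c)"
  proof (rule measure_eqI)
    fix A assume "A \<in> sets (gamma_law (1/2) c)"
    then have [measurable]: "A \<in> sets borel" by simp
    have "emeasure (gamma_law (1/2) c) A = (\<integral>\<^sup>+x. indicator A x \<partial>gamma_law (1/2) c)" by simp
    also have "\<dots> = (\<integral>\<^sup>+x. indicator A (x / c) \<partial>gamma_law (1/2) 1)"
      using c by (intro gamma_law_scale) auto
    also have "\<dots> = (\<integral>\<^sup>+x. indicator A x \<partial>distr (gamma_law (1/2) 1) borel (\<lambda>x. x / c))"
      by (subst nn_integral_distr) auto
    finally show "emeasure (gamma_law (1/2) c) A = emeasure (distr (gamma_law (1/2) 1) borel (\<lambda>x. x / c)) A" by simp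
  qed simp
  have "char (gamma_law (1/2) c) t = (CLINT x|gamma_law (1/2) 1. iexp (t / (2 * c)) * iexp (t / c * (x - 1/2)))"
    unfolding d char_def using c
    by (subst integral_distr) (auto intro!: Bochner_Integration.integral_cong simp: exp_add[symmetric] field_simps)
  also have "\<dots> = iexp (t / (2 * c)) * char centered_half_gamma (t / c)"
    unfolding centered_half_gamma_def char_def by (subst integral_distr) auto
  finally show ?thesis .
qed

text \<open>A half-Gamma variable of rate \<open>c\<close> has mean \<open>1 / (2 * c)\<close> and
  variance \<open>1 / (2 * c^2)\<close>; these are the mean and the standard deviation of the
  convolution over all rates.\<close>

definition hg_mean :: "real list \<Rightarrow> real" where "hg_mean cs = (\<Sum>c\<leftarrow>cs. 1 / (2 * c))"
definition hg_sd :: "real list \<Rightarrow> real" where "hg_sd cs = sqrt (\<Sum>c\<leftarrow>cs. 1 / (2 * c\<^sup>2))"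
lemma char_convs_half_gamma:
  assumes "\<And>c. c \<in> set cs \<Longrightarrow> c > 0"
  shows "char (convs (map (gamma_law (1/2)) cs)) t =
    iexp (t * hg_mean cs) * prod_list (map (\<lambda>c. char centered_half_gamma (t / c)) cs)"
proof -
  have "char (convs (map (gamma_law (1/2)) cs)) t = prod_list (map (\<lambda>c. char (gamma_law (1/2) c) t) cs)"
    using assms by (subst char_convs) (auto simp: comp_def intro: real_distribution_gamma_law)
  also have "\<dots> = iexp (t * hg_mean cs) * prod_list (map (\<lambda>c. char centered_half_gamma (t / c)) cs)"
    using assms
  proof (induction cs)
    case (Cons c cs)
    then show ?case
      by (simp add: char_gamma_law_half hg_mean_def exp_add[symmetric] algebra_simps)
  qed (simp add: hg_mean_def)
  finally show ?thesis .
qed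

lemma prod_list_gaussian: "prod_list (map (\<lambda>c. of_real (exp (- (t / c)\<^sup>2 / 4)) :: complex) cs) =
    of_real (exp (- t\<^sup>2 / 2 * (\<Sum>c\<leftarrow>cs. 1 / (2 * c\<^sup>2))))"
proof (induction cs)
  case (Cons c cs)
  have "exp (- (t / c)\<^sup>2 / 4) * exp (- t\<^sup>2 / 2 * (\<Sum>c\<leftarrow>cs. 1 / (2 * c\<^sup>2)))
    = exp (- t\<^sup>2 / 2 * (1 / (2 * c\<^sup>2) + (\<Sum>c\<leftarrow>cs. 1 / (2 * c\<^sup>2))))"
    by (simp add: exp_add[symmetric] power_divide algebra_simps)
  then show ?case using Cons by (simp del: of_real_mult add: of_real_mult[symmetric])
qed simp

lemma exp_minus_approx:
  fixes z :: real
  assumes "z \<ge> 0"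
  shows "\<bar>exp (- z) - (1 - z)\<bar> \<le> z\<^sup>2 / 2"
proof -
  have 1: "1 - z \<le> exp (- z)" using exp_ge_add_one_self[of "- z"] by simp
  \<comment> \<open>The quadratic polynomials in \<open>- z\<close> and in \<open>z\<close> have
    product \<open>1 + z^4 / 4\<close>, so the lower Taylor bound for \<open>exp z\<close> becomes
    an upper bound for \<open>exp (- z)\<close>.\<close>
  have "1 \<le> (1 - z + z\<^sup>2 / 2) * (1 + z + z\<^sup>2 / 2)"
  proof -
    have "(1 - z + z\<^sup>2 / 2) * (1 + z + z\<^sup>2 / 2) = 1 + z ^ 4 / 4" by (simp add: field_simps power2_eq_square power4_eq_xxxx)
    then show ?thesis by simp
  qed
  also have "\<dots> \<le> (1 - z + z\<^sup>2 / 2) * exp z"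
  proof (rule mult_left_mono)
    show "1 + z + z\<^sup>2 / 2 \<le> exp z" using exp_lower_Taylor_quadratic[OF assms] by simp
    have "0 \<le> (1 - z)\<^sup>2" by simp
    then show "0 \<le> 1 - z + z\<^sup>2 / 2" by (simp add: power2_eq_square algebra_simps)
  qed
  finally have "exp (- z) * 1 \<le> exp (- z) * ((1 - z + z\<^sup>2 / 2) * exp z)" by (intro mult_left_mono) auto
  then have "exp (- z) \<le> 1 - z + z\<^sup>2 / 2" by (simp add: exp_minus field_simps)
  then show ?thesis using 1 by linarith
qed

text \<open>From \<open>c \<le> 2 * \<kappa>\<close> each variance term is at least
  \<open>1 / (8 * \<kappa>^2)\<close>; hence every standardized argument is at most
  \<open>U\<close>, in which the rates no longer occur. This is where the factor 2 between the rates
  and the \<open>sqrt 8\<close> come from, and why the estimate is uniform.\<close>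

lemma char_convs_half_gamma_bound:
  fixes t :: real
  assumes C: "C \<ge> 0" "\<And>u. norm (char centered_half_gamma u - of_real (1 - u\<^sup>2 / 4)) \<le> C * \<bar>u\<bar> ^ 3"
    and cs: "cs \<noteq> []" "\<kappa> > 0" "\<And>c. c \<in> set cs \<Longrightarrow> \<kappa> \<le> c \<and> c \<le> 2 * \<kappa>"
  defines "U \<equiv> \<bar>t\<bar> * sqrt 8 / sqrt (real (length cs))"
  shows "norm (iexp (- t / hg_sd cs * hg_mean cs) * char (convs (map (gamma_law (1/2)) cs)) (t / hg_sd cs) - of_real (exp (- t\<^sup>2 / 2)))
    \<le> 2 * t\<^sup>2 * (C * U + U\<^sup>2 / 32)"
proof -
  let ?s = "hg_sd cs"
  have c0: "c > 0" if "c \<in> set cs" for c using cs(2) cs(3)[OF that] by linarith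
  have len: "real (length cs) > 0" using cs(1) by simp
  have "real (length cs) / (8 * \<kappa>\<^sup>2) = (\<Sum>c\<leftarrow>cs. 1 / (8 * \<kappa>\<^sup>2))" by (simp add: sum_list_triv)
  also have "\<dots> \<le> (\<Sum>c\<leftarrow>cs. 1 / (2 * c\<^sup>2))"
  proof (rule sum_list_mono)
    fix c assume c: "c \<in> set cs"
    have "c\<^sup>2 \<le> (2 * \<kappa>)\<^sup>2" using cs(3)[OF c] c0[OF c] by (intro power_mono) auto
    then show "1 / (8 * \<kappa>\<^sup>2) \<le> 1 / (2 * c\<^sup>2)" using c0[OF c] cs(2) by (simp add: frac_le power_mult_distrib)
  qed
  finally have S: "real (length cs) / (8 * \<kappa>\<^sup>2) \<le> (\<Sum>c\<leftarrow>cs. 1 / (2 * c\<^sup>2))" .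
  then have "sqrt (real (length cs) / (8 * \<kappa>\<^sup>2)) \<le> ?s" unfolding hg_sd_def by (rule real_sqrt_le_mono)
  then have s_ge: "sqrt (real (length cs)) / (sqrt 8 * \<kappa>) \<le> ?s"
    using cs(2) by (simp add: real_sqrt_divide real_sqrt_mult)
  have s0: "?s > 0"
    using s_ge len cs(2) by (intro less_le_trans[OF _ s_ge] divide_pos_pos) auto
  have s2: "(\<Sum>c\<leftarrow>cs. 1 / (2 * c\<^sup>2)) = ?s\<^sup>2"
    unfolding hg_sd_def using S len cs(2)
    by (intro real_sqrt_pow2[symmetric] order_trans[OF _ S]) auto
  have U: "\<bar>t / ?s / c\<bar> \<le> U" if c: "c \<in> set cs" for c
  proof -
    have "sqrt (real (length cs)) / sqrt 8 \<le> ?s * \<kappa>" using s_ge cs(2) by (simp add: field_simps)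
    also have "\<dots> \<le> ?s * c" using s0 cs(3)[OF c] by simp
    finally have h: "sqrt (real (length cs)) / sqrt 8 \<le> ?s * c" .
    have "\<bar>t / ?s / c\<bar> = \<bar>t\<bar> / (?s * c)" using s0 c0[OF c] by (simp add: abs_divide)
    also have "\<dots> \<le> \<bar>t\<bar> / (sqrt (real (length cs)) / sqrt 8)"
      using h len s0 c0[OF c] by (intro divide_left_mono) auto
    finally show ?thesis by (simp add: U_def)
  qed
  have U0: "U \<ge> 0" unfolding U_def by simp
  interpret H: real_distribution centered_half_gamma by (rule real_distribution_centered_half_gamma)
  let ?f = "\<lambda>c. char centered_half_gamma (t / ?s / c)"
  let ?g = "\<lambda>c. of_real (exp (- (t / ?s / c)\<^sup>2 / 4)) :: complex"
  have "iexp (- t / ?s * hg_mean cs) * char (convs (map (gamma_law (1/2)) cs)) (t / ?s) = prod_list (map ?f cs)"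
    by (subst char_convs_half_gamma) (auto simp: c0 exp_add[symmetric] mult.assoc[symmetric])
  moreover have "of_real (exp (- t\<^sup>2 / 2)) = prod_list (map ?g cs)"
    unfolding prod_list_gaussian s2 using s0 by (simp add: power_divide)
  ultimately have "norm (iexp (- t / ?s * hg_mean cs) * char (convs (map (gamma_law (1/2)) cs)) (t / ?s) - of_real (exp (- t\<^sup>2 / 2)))
    = norm (prod_list (map ?f cs) - prod_list (map ?g cs))" by simp
  \<comment> \<open>Each factor is compared with the Gaussian one of the same variance; all factors
    lie in the unit disc, so the differences simply add up.\<close>
  also have "\<dots> \<le> (\<Sum>c\<leftarrow>cs. norm (?f c - ?g c))"
    by (rule norm_prod_list_diff) (auto intro: H.cmod_char_le_1)
  also have "\<dots> \<le> (\<Sum>c\<leftarrow>cs. (t / ?s)\<^sup>2 * (1 / c\<^sup>2) * (C * U + U\<^sup>2 / 32))"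
  proof (rule sum_list_mono)
    fix c assume c: "c \<in> set cs"
    define u where "u = t / ?s / c"
    have u: "\<bar>u\<bar> \<le> U" using U[OF c] by (simp add: u_def)
    have a: "norm (of_real (1 - u\<^sup>2 / 4) - (of_real (exp (- u\<^sup>2 / 4)) :: complex)) \<le> (u\<^sup>2 / 4)\<^sup>2 / 2"
      using exp_minus_approx[of "u\<^sup>2 / 4"] abs_minus_commute[of "exp (- (u\<^sup>2 / 4))" "1 - u\<^sup>2 / 4"]
      by (simp add: of_real_diff[symmetric] del: of_real_diff)
    have "norm (char centered_half_gamma u - of_real (exp (- u\<^sup>2 / 4))) \<le>
      norm (char centered_half_gamma u - of_real (1 - u\<^sup>2 / 4)) + norm (of_real (1 - u\<^sup>2 / 4) - (of_real (exp (- u\<^sup>2 / 4)) :: complex))"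
      using dist_triangle[of "char centered_half_gamma u" "of_real (exp (- u\<^sup>2 / 4))" "of_real (1 - u\<^sup>2 / 4)"]
      by (simp only: dist_norm)
    also have "\<dots> \<le> C * \<bar>u\<bar> ^ 3 + (u\<^sup>2 / 4)\<^sup>2 / 2" by (intro add_mono C(2) a)
    also have "\<dots> = u\<^sup>2 * (C * \<bar>u\<bar> + \<bar>u\<bar>\<^sup>2 / 32)"
      by (simp add: power2_eq_square power3_eq_cube algebra_simps)
    also have "\<dots> \<le> u\<^sup>2 * (C * U + U\<^sup>2 / 32)"
      using u U0 C(1) by (intro mult_left_mono add_mono divide_right_mono power_mono) auto
    also have "u\<^sup>2 * (C * U + U\<^sup>2 / 32) = (t / ?s)\<^sup>2 * (1 / c\<^sup>2) * (C * U + U\<^sup>2 / 32)"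
      by (simp add: u_def power_divide power_mult_distrib)
    finally show "norm (?f c - ?g c) \<le> (t / ?s)\<^sup>2 * (1 / c\<^sup>2) * (C * U + U\<^sup>2 / 32)"
      by (simp only: u_def)
  qed
  \<comment> \<open>The weights \<open>1 / c^2\<close> sum to twice the variance, which cancels the
    standardization.\<close>
  also have "\<dots> = 2 * (t / ?s)\<^sup>2 * (C * U + U\<^sup>2 / 32) * (\<Sum>c\<leftarrow>cs. 1 / (2 * c\<^sup>2))"
    unfolding sum_list_const_mult[symmetric] by (intro arg_cong[where f = sum_list] map_cong) auto
  also have "\<dots> = 2 * t\<^sup>2 * (C * U + U\<^sup>2 / 32)" unfolding s2 using s0 by (simp add: power_divide)
  finally show ?thesis .
qed

text \<open>A triangular array whose rows become long: \<open>U\<close> tends to 0, Levy's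
  continuity theorem applies, and Polya's theorem makes the convergence uniform in
  \<open>x\<close>.\<close>

lemma half_gamma_clt_aux:
  fixes cs :: "nat \<Rightarrow> real list" and \<kappa> :: "nat \<Rightarrow> real"
  assumes "\<And>n. n < length (cs n)" "\<And>n. \<kappa> n > 0" "\<And>n c. c \<in> set (cs n) \<Longrightarrow> \<kappa> n \<le> c \<and> c \<le> 2 * \<kappa> n"
    and e: "\<epsilon> > 0"
  shows "\<forall>\<^sub>F n in sequentially. \<forall>x.
    \<bar>measure (convs (map (gamma_law (1/2)) (cs n))) {hg_mean (cs n) + x * hg_sd (cs n)<..} - (1 - \<Phi> x)\<bar> \<le> \<epsilon>"
proof -
  obtain C where C: "C \<ge> 0" "\<And>u. norm (char centered_half_gamma u - of_real (1 - u\<^sup>2 / 4)) \<le> C * \<bar>u\<bar> ^ 3"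
    using char_centered_half_gamma by auto
  define V where "V n = convs (map (gamma_law (1/2)) (cs n))" for n
  have c0: "c > 0" if "c \<in> set (cs n)" for c n using assms(2)[of n] assms(3)[OF that] by linarith
  have V: "real_distribution (V n)" for n
    unfolding V_def using c0 by (intro real_distribution_convs) (auto intro: real_distribution_gamma_law)
  interpret V: real_distribution "V n" for n by (rule V)
  have ne: "cs n \<noteq> []" for n using assms(1)[of n] by auto
  have s0: "hg_sd (cs n) > 0" for n
  proof -
    have "(\<Sum>c\<leftarrow>cs n. 1 / (2 * c\<^sup>2)) > 0"
    proof (cases "cs n")
      case (Cons c cs')
      then have "0 < 1 / (2 * c\<^sup>2)" using c0[of c n] by simp
      moreover have "0 \<le> (\<Sum>c\<leftarrow>cs'. 1 / (2 * c\<^sup>2))" by (intro sum_list_nonneg) auto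
      ultimately show ?thesis unfolding Cons by (simp only: list.map sum_list.Cons add_pos_nonneg)
    qed (use ne in simp)
    then show ?thesis by (simp add: hg_sd_def)
  qed
  define D where "D n = distr (V n) borel (\<lambda>v. (v - hg_mean (cs n)) / hg_sd (cs n))" for n
  have D: "real_distribution (D n)" for n unfolding D_def by simp
  interpret D: real_distribution "D n" for n by (rule D)
  have charD: "char (D n) t = iexp (- t / hg_sd (cs n) * hg_mean (cs n)) * char (V n) (t / hg_sd (cs n))" for n t
  proof -
    have "char (D n) t = (CLINT v|V n. iexp (- t / hg_sd (cs n) * hg_mean (cs n)) * iexp (t / hg_sd (cs n) * v))"
      unfolding D_def char_def
      by (subst integral_distr) (auto intro!: Bochner_Integration.integral_cong simp: exp_add[symmetric] diff_divide_distrib algebra_simps)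
    then show ?thesis by (simp add: char_def)
  qed
  have "weak_conv_m D std_normal_distribution"
  proof (rule levy_continuity)
    fix t
    define U where "U n = \<bar>t\<bar> * sqrt 8 / sqrt (real (length (cs n)))" for n
    have "(\<lambda>n. \<bar>t\<bar> * sqrt 8 / sqrt (real n)) \<longlonglongrightarrow> 0"
      by (intro tendsto_divide_0[OF tendsto_const] filterlim_at_top_imp_at_infinity
          sqrt_at_top[THEN filterlim_compose] filterlim_real_sequentially)
    moreover have "\<forall>\<^sub>F n in sequentially. norm (U n) \<le> \<bar>t\<bar> * sqrt 8 / sqrt (real n)"
    proof (rule eventually_sequentiallyI[of 1])
      fix n :: nat assume "1 \<le> n"
      then show "norm (U n) \<le> \<bar>t\<bar> * sqrt 8 / sqrt (real n)"
        using assms(1)[of n] unfolding U_def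
        by (simp add: abs_mult) (intro divide_left_mono mult_pos_pos, auto)
    qed
    ultimately have U: "U \<longlonglongrightarrow> 0" by (rule Lim_null_comparison[rotated])
    have lim: "(\<lambda>n. 2 * t\<^sup>2 * (C * U n + (U n)\<^sup>2 / 32)) \<longlonglongrightarrow> 2 * t\<^sup>2 * (C * 0 + 0\<^sup>2 / 32)"
      by (intro tendsto_intros U) simp
    have "(\<lambda>n. char (D n) t - of_real (exp (- t\<^sup>2 / 2))) \<longlonglongrightarrow> 0"
    proof (rule Lim_null_comparison)
      show "\<forall>\<^sub>F n in sequentially. norm (char (D n) t - of_real (exp (- t\<^sup>2 / 2))) \<le> 2 * t\<^sup>2 * (C * U n + (U n)\<^sup>2 / 32)"
        unfolding charD V_def U_def
        by (intro always_eventually allI char_convs_half_gamma_bound[OF C ne assms(2,3)])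
      show "(\<lambda>n. 2 * t\<^sup>2 * (C * U n + (U n)\<^sup>2 / 32)) \<longlonglongrightarrow> 0" using lim by simp
    qed
    then show "(\<lambda>n. char (D n) t) \<longlonglongrightarrow> char std_normal_distribution t"
      by (simp add: char_std_normal_distribution LIM_zero_iff)
  qed (auto intro: D real_dist_normal_dist)
  from weak_conv_normal_uniform[OF D this e] show ?thesis
  proof eventually_elim
    case (elim n)
    show ?case
    proof
      fix x
      have "measure (V n) {hg_mean (cs n) + x * hg_sd (cs n)<..} = measure (D n) {x<..}"
      proof -
        have "(\<lambda>v. (v - hg_mean (cs n)) / hg_sd (cs n)) -` {x<..} \<inter> space (V n) = {hg_mean (cs n) + x * hg_sd (cs n)<..}"
          using s0[of n] by (auto simp: field_simps)
        then show ?thesis unfolding D_def by (subst measure_distr) auto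
      qed
      also have "\<dots> = 1 - cdf (D n) x"
      proof -
        have "{x<..} = UNIV - {..x}" by auto
        then show ?thesis using D.prob_compl[of "{..x}" n] by (simp add: cdf_def2 cdf_def)
      qed
      finally show "\<bar>measure (convs (map (gamma_law (1/2)) (cs n))) {hg_mean (cs n) + x * hg_sd (cs n)<..} - (1 - \<Phi> x)\<bar> \<le> \<epsilon>"
        using elim[rule_format, of x] by (simp add: V_def abs_minus_commute)
    qed
  qed
qed

text \<open>If no \<open>L\<close> worked, choosing one failing list for each length bound would
  produce a triangular array that contradicts the previous limit. In this way a statement about
  sequences becomes one about single lists, with \<open>L\<close> independent of the rates.\<close>

theorem half_gamma_clt:
  assumes e: "\<epsilon> > 0"
  obtains L :: nat where "\<And>cs \<kappa> x. \<kappa> > 0 \<Longrightarrow> length cs \<ge> L \<Longrightarrow> (\<And>c. c \<in> set cs \<Longrightarrow> \<kappa> \<le> c \<and> c \<le> 2 * \<kappa>) \<Longrightarrow>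
     \<bar>measure (convs (map (gamma_law (1/2)) cs)) {hg_mean cs + x * hg_sd cs<..} - (1 - \<Phi> x)\<bar> \<le> \<epsilon>"
proof -
  define bad where "bad L cs \<longleftrightarrow> L < length cs \<and> (\<exists>\<kappa>>0. \<forall>c\<in>set cs. \<kappa> \<le> c \<and> c \<le> 2 * \<kappa>) \<and>
     (\<exists>x. \<not> \<bar>measure (convs (map (gamma_law (1/2)) cs)) {hg_mean cs + x * hg_sd cs<..} - (1 - \<Phi> x)\<bar> \<le> \<epsilon>)" for L cs
  have "\<exists>L. \<forall>cs. \<not> bad L cs"
  proof (rule ccontr)
    assume "\<not> (\<exists>L. \<forall>cs. \<not> bad L cs)"
    then have "\<forall>L. \<exists>cs. bad L cs" by simp
    then obtain cs where b: "bad L (cs L)" for L by metis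
    then have "\<forall>L. \<exists>\<kappa>. \<kappa> > 0 \<and> (\<forall>c\<in>set (cs L). \<kappa> \<le> c \<and> c \<le> 2 * \<kappa>)" unfolding bad_def by metis
    then obtain \<kappa> where k: "\<kappa> L > 0" "\<forall>c\<in>set (cs L). \<kappa> L \<le> c \<and> c \<le> 2 * \<kappa> L" for L by metis
    have "\<forall>\<^sub>F n in sequentially. \<forall>x.
      \<bar>measure (convs (map (gamma_law (1/2)) (cs n))) {hg_mean (cs n) + x * hg_sd (cs n)<..} - (1 - \<Phi> x)\<bar> \<le> \<epsilon>"
      using b k by (intro half_gamma_clt_aux[of cs \<kappa>] e) (auto simp: bad_def)
    then show False using b unfolding bad_def eventually_sequentially by (meson order_refl)
  qed
  then obtain L where L: "\<not> bad L cs" for cs by blast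
  show ?thesis
  proof (rule that[of "Suc L"])
    fix cs \<kappa> x assume "(\<kappa>::real) > 0" "Suc L \<le> length cs" "\<And>c. c \<in> set cs \<Longrightarrow> \<kappa> \<le> c \<and> c \<le> 2 * \<kappa>"
    then show "\<bar>measure (convs (map (gamma_law (1/2)) cs)) {hg_mean cs + x * hg_sd cs<..} - (1 - \<Phi> x)\<bar> \<le> \<epsilon>"
      using L[of cs] unfolding bad_def by (meson Suc_le_eq)
  qed
qed

section \<open>Rotations and Gram determinants of Gaussian vectors\<close>

abbreviation gauss :: "nat set \<Rightarrow> (nat \<Rightarrow> real) measure" where
  "gauss I \<equiv> PiM I (\<lambda>_. std_normal_distribution)"

lemma prob_space_std_normal: "prob_space std_normal_distribution"
  using real_dist_normal_dist by (rule real_distribution.axioms)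

lemma product_prob_space_std_normal: "product_prob_space (\<lambda>_::'i. std_normal_distribution)"
  by (intro product_prob_spaceI prob_space_std_normal)

lemma product_sigma_finite_std_normal: "product_sigma_finite (\<lambda>_::'i. std_normal_distribution)"
  by (rule product_prob_space.axioms(1)[OF product_prob_space_std_normal])

lemma prob_space_gauss: "prob_space (gauss I)"
  using prob_space_std_normal by (rule prob_space_PiM)

lemma sets_gauss[measurable_cong]: "sets (gauss I) = sets (PiM I (\<lambda>_. borel))"
  by (rule sets_PiM_cong) auto

lemma shear_lborel:
  fixes G :: "real \<Rightarrow> real \<Rightarrow> ennreal"
  assumes [measurable]: "case_prod G \<in> borel_measurable (borel \<Otimes>\<^sub>M borel)"
  shows "(\<integral>\<^sup>+b. \<integral>\<^sup>+a. G (a + k * b) b \<partial>lborel \<partial>lborel) = (\<integral>\<^sup>+b. \<integral>\<^sup>+a. G a b \<partial>lborel \<partial>lborel)"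
proof (rule nn_integral_cong)
  fix b :: real
  show "(\<integral>\<^sup>+a. G (a + k * b) b \<partial>lborel) = (\<integral>\<^sup>+a. G a b \<partial>lborel)"
    using nn_integral_real_affine[of "\<lambda>a. G a b" 1 "k * b"] by (simp add: add.commute)
qed

text \<open>A rotation by an angle other than \<open>\<pi>\<close> is a product of three shears.\<close>

lemma rotation_lborel:
  fixes G :: "real \<Rightarrow> real \<Rightarrow> ennreal"
  assumes [measurable]: "case_prod G \<in> borel_measurable (borel \<Otimes>\<^sub>M borel)"
    and cs: "c\<^sup>2 + s\<^sup>2 = 1" "c \<noteq> - 1"
  shows "(\<integral>\<^sup>+b. \<integral>\<^sup>+a. G (c * a + s * b) (c * b - s * a) \<partial>lborel \<partial>lborel) = (\<integral>\<^sup>+b. \<integral>\<^sup>+a. G a b \<partial>lborel \<partial>lborel)"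
proof -
  \<comment> \<open>The tangent of half the angle, the parameter of the outer two shears; it exists
    because \<open>c \<noteq> - 1\<close>.\<close>
  define k where "k = s / (1 + c)"
  have c1: "1 + c \<noteq> 0" using cs(2) by auto
  have ks: "k * s = 1 - c"
  proof -
    have "s * s = (1 - c) * (1 + c)" using cs(1) by (simp add: power2_eq_square algebra_simps)
    then show ?thesis using c1 by (simp add: k_def field_simps)
  qed
  have kc: "k * (1 + c) = s" using c1 by (simp add: k_def)
  have e1: "c * a + s * b = (a + k * b) + k * (b + (- s) * (a + k * b))" for a b
  proof -
    have "(a + k * b) + k * (b + (- s) * (a + k * b)) = a * (1 - k * s) + k * b + k * b * (1 - k * s)"
      by (simp add: algebra_simps)
    also have "\<dots> = c * a + k * (1 + c) * b" by (simp add: ks algebra_simps)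
    finally show ?thesis by (simp add: kc)
  qed
  have e2: "c * b - s * a = b + (- s) * (a + k * b)" for a b
  proof -
    have "b + (- s) * (a + k * b) = b * (1 - k * s) - s * a" by (simp add: algebra_simps)
    then show ?thesis by (simp add: ks)
  qed
  have "(\<integral>\<^sup>+b. \<integral>\<^sup>+a. G (c * a + s * b) (c * b - s * a) \<partial>lborel \<partial>lborel)
    = (\<integral>\<^sup>+b. \<integral>\<^sup>+a. G (a + k * (b + (- s) * a)) (b + (- s) * a) \<partial>lborel \<partial>lborel)"
    unfolding e1 e2 by (rule shear_lborel) measurable
  also have "\<dots> = (\<integral>\<^sup>+a. \<integral>\<^sup>+b. G (a + k * (b + (- s) * a)) (b + (- s) * a) \<partial>lborel \<partial>lborel)"
    by (rule lborel_pair.Fubini') measurable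
  also have "\<dots> = (\<integral>\<^sup>+a. \<integral>\<^sup>+b. G (a + k * b) b \<partial>lborel \<partial>lborel)"
    by (rule shear_lborel) measurable
  also have "\<dots> = (\<integral>\<^sup>+b. \<integral>\<^sup>+a. G (a + k * b) b \<partial>lborel \<partial>lborel)"
    by (rule lborel_pair.Fubini'[symmetric]) measurable
  also have "\<dots> = (\<integral>\<^sup>+b. \<integral>\<^sup>+a. G a b \<partial>lborel \<partial>lborel)"
    by (rule shear_lborel) measurable
  finally show ?thesis .
qed

lemma rotation_std_normal:
  fixes G :: "real \<Rightarrow> real \<Rightarrow> ennreal"
  assumes [measurable]: "case_prod G \<in> borel_measurable (borel \<Otimes>\<^sub>M borel)"
    and cs: "c\<^sup>2 + s\<^sup>2 = 1" "c \<noteq> - 1"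
  shows "(\<integral>\<^sup>+b. \<integral>\<^sup>+a. G (c * a + s * b) (c * b - s * a) \<partial>std_normal_distribution \<partial>std_normal_distribution) =
    (\<integral>\<^sup>+b. \<integral>\<^sup>+a. G a b \<partial>std_normal_distribution \<partial>std_normal_distribution)"
proof -
  interpret N: sigma_finite_measure std_normal_distribution
    using prob_space_std_normal by (rule prob_space_imp_sigma_finite)
  have dens: "(\<integral>\<^sup>+b. \<integral>\<^sup>+a. H a b \<partial>std_normal_distribution \<partial>std_normal_distribution) =
    (\<integral>\<^sup>+b. \<integral>\<^sup>+a. ennreal (std_normal_density a * std_normal_density b) * H a b \<partial>lborel \<partial>lborel)"
    if [measurable]: "case_prod H \<in> borel_measurable (borel \<Otimes>\<^sub>M borel)" for H
  proof -
    have "(\<lambda>b. \<integral>\<^sup>+a. H a b \<partial>std_normal_distribution) \<in> borel_measurable borel" by measurable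
    then have "(\<integral>\<^sup>+b. \<integral>\<^sup>+a. H a b \<partial>std_normal_distribution \<partial>std_normal_distribution) =
      (\<integral>\<^sup>+b. ennreal (std_normal_density b) * (\<integral>\<^sup>+a. H a b \<partial>std_normal_distribution) \<partial>lborel)"
      by (subst nn_integral_density) auto
    also have "\<dots> = (\<integral>\<^sup>+b. ennreal (std_normal_density b) * (\<integral>\<^sup>+a. ennreal (std_normal_density a) * H a b \<partial>lborel) \<partial>lborel)"
      by (intro nn_integral_cong) (subst nn_integral_density, auto)
    also have "\<dots> = (\<integral>\<^sup>+b. \<integral>\<^sup>+a. ennreal (std_normal_density b) * (ennreal (std_normal_density a) * H a b) \<partial>lborel \<partial>lborel)"
      by (intro nn_integral_cong nn_integral_cmult[symmetric]) measurable
    finally show ?thesis by (simp add: ennreal_mult mult_ac)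
  qed
  have inv: "std_normal_density a * std_normal_density b =
     std_normal_density (c * a + s * b) * std_normal_density (c * b - s * a)" for a b
  proof -
    have "(c * a + s * b)\<^sup>2 + (c * b - s * a)\<^sup>2 = (c\<^sup>2 + s\<^sup>2) * (a\<^sup>2 + b\<^sup>2)"
      by (simp add: power2_eq_square algebra_simps)
    then have "- ((c * a + s * b)\<^sup>2) / 2 + - ((c * b - s * a)\<^sup>2) / 2 = - a\<^sup>2 / 2 + - b\<^sup>2 / 2"
      using cs by (simp add: field_simps)
    then show ?thesis by (simp add: std_normal_density_def exp_add[symmetric])
  qed
  have "(\<integral>\<^sup>+b. \<integral>\<^sup>+a. G (c * a + s * b) (c * b - s * a) \<partial>std_normal_distribution \<partial>std_normal_distribution) =
    (\<integral>\<^sup>+b. \<integral>\<^sup>+a. ennreal (std_normal_density (c * a + s * b) * std_normal_density (c * b - s * a)) *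
       G (c * a + s * b) (c * b - s * a) \<partial>lborel \<partial>lborel)"
    unfolding inv[symmetric] by (rule dens) measurable
  also have "\<dots> = (\<integral>\<^sup>+b. \<integral>\<^sup>+a. ennreal (std_normal_density a * std_normal_density b) * G a b \<partial>lborel \<partial>lborel)"
    by (rule rotation_lborel[OF _ cs, where G = "\<lambda>a b. ennreal (std_normal_density a * std_normal_density b) * G a b"]) measurable
  also have "\<dots> = (\<integral>\<^sup>+b. \<integral>\<^sup>+a. G a b \<partial>std_normal_distribution \<partial>std_normal_distribution)"
    by (rule dens[symmetric]) measurable
  finally show ?thesis .
qed

definition givens :: "nat \<Rightarrow> nat \<Rightarrow> real \<Rightarrow> real \<Rightarrow> (nat \<Rightarrow> real) \<Rightarrow> (nat \<Rightarrow> real)" where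
  "givens i j c s x = x(i := c * x i + s * x j, j := c * x j - s * x i)"

text \<open>An orthogonal map recorded by its effects instead of a matrix: it preserves the standard
  Gaussian law and the inner product of the first \<open>n\<close> coordinates. Both are inherited
  by compositions of plane rotations.\<close>

definition gauss_isometry :: "nat \<Rightarrow> ((nat \<Rightarrow> real) \<Rightarrow> (nat \<Rightarrow> real)) \<Rightarrow> bool" where
  "gauss_isometry n P \<longleftrightarrow> P \<in> PiM {..<n} (\<lambda>_. borel) \<rightarrow>\<^sub>M PiM {..<n} (\<lambda>_. borel) \<and>
     (\<forall>f\<in>borel_measurable (PiM {..<n} (\<lambda>_. borel)). (\<integral>\<^sup>+x. f (P x) \<partial>gauss {..<n}) = (\<integral>\<^sup>+x. f x \<partial>gauss {..<n})) \<and>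
     (\<forall>x y. (\<Sum>t<n. P x t * P y t) = (\<Sum>t<n. x t * y t))"

lemma gauss_isometry_id: "gauss_isometry n (\<lambda>x. x)"
  by (simp add: gauss_isometry_def)

lemma gauss_isometry_comp:
  assumes "gauss_isometry n P" "gauss_isometry n Q"
  shows "gauss_isometry n (\<lambda>x. P (Q x))"
  unfolding gauss_isometry_def
proof (intro conjI ballI allI)
  have P[measurable]: "P \<in> PiM {..<n} (\<lambda>_. borel) \<rightarrow>\<^sub>M PiM {..<n} (\<lambda>_. borel)"
    and Q[measurable]: "Q \<in> PiM {..<n} (\<lambda>_. borel) \<rightarrow>\<^sub>M PiM {..<n} (\<lambda>_. borel)"
    using assms by (auto simp: gauss_isometry_def)
  show "(\<lambda>x. P (Q x)) \<in> PiM {..<n} (\<lambda>_. borel) \<rightarrow>\<^sub>M PiM {..<n} (\<lambda>_. borel)" by measurable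
  fix f :: "(nat \<Rightarrow> real) \<Rightarrow> ennreal" assume [measurable]: "f \<in> borel_measurable (PiM {..<n} (\<lambda>_. borel))"
  have "(\<lambda>x. f (P x)) \<in> borel_measurable (PiM {..<n} (\<lambda>_. borel))" by measurable
  then have "(\<integral>\<^sup>+x. f (P (Q x)) \<partial>gauss {..<n}) = (\<integral>\<^sup>+x. f (P x) \<partial>gauss {..<n})"
    using assms(2) unfolding gauss_isometry_def by fast
  also have "\<dots> = (\<integral>\<^sup>+x. f x \<partial>gauss {..<n})"
    using assms(1) unfolding gauss_isometry_def by auto
  finally show "(\<integral>\<^sup>+x. f (P (Q x)) \<partial>gauss {..<n}) = (\<integral>\<^sup>+x. f x \<partial>gauss {..<n})" .
qed (use assms in \<open>auto simp: gauss_isometry_def\<close>)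

text \<open>Integrating the coordinates \<open>i\<close> and \<open>j\<close> innermost reduces
  invariance to the rotation of two independent normal variables.\<close>

lemma gauss_isometry_givens:
  assumes ij: "i < n" "j < n" "i \<noteq> j" and cs: "c\<^sup>2 + s\<^sup>2 = 1" "c \<noteq> - 1"
  shows "gauss_isometry n (givens i j c s)"
  unfolding gauss_isometry_def
proof (intro conjI ballI allI)
  interpret product_sigma_finite "\<lambda>_::nat. std_normal_distribution" by (rule product_sigma_finite_std_normal)
  have ins: "insert i (insert j ({..<n} - {i, j})) = {..<n}" using ij by auto
  show meas[measurable]: "givens i j c s \<in> PiM {..<n} (\<lambda>_. borel) \<rightarrow>\<^sub>M PiM {..<n} (\<lambda>_. borel)"
  proof (rule measurable_PiM_single')
    fix k assume "k \<in> {..<n}"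
    then show "(\<lambda>x. givens i j c s x k) \<in> borel_measurable (PiM {..<n} (\<lambda>_. borel))"
      using ij unfolding givens_def fun_upd_apply by simp measurable
  next
    show "givens i j c s \<in> space (PiM {..<n} (\<lambda>_. borel)) \<rightarrow> ({..<n} \<rightarrow>\<^sub>E space borel)"
      using ij by (auto simp: space_PiM givens_def PiE_def extensional_def)
  qed
  fix f :: "(nat \<Rightarrow> real) \<Rightarrow> ennreal" assume f[measurable]: "f \<in> borel_measurable (PiM {..<n} (\<lambda>_. borel))"
  have split: "(\<integral>\<^sup>+x. h x \<partial>gauss {..<n}) = (\<integral>\<^sup>+x. \<integral>\<^sup>+b. \<integral>\<^sup>+a. h (x(j := b, i := a)) \<partial>std_normal_distribution \<partial>std_normal_distribution \<partial>gauss ({..<n} - {i, j}))"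
    if h[measurable]: "h \<in> borel_measurable (PiM {..<n} (\<lambda>_. borel))" for h :: "(nat \<Rightarrow> real) \<Rightarrow> ennreal"
  proof -
    have h': "h \<in> borel_measurable (PiM (insert i (insert j ({..<n} - {i, j}))) (\<lambda>_. std_normal_distribution))"
      unfolding ins by measurable
    have h2[measurable]: "h \<in> borel_measurable (PiM (insert i (insert j ({..<n} - {i, j}))) (\<lambda>_. borel))"
      unfolding ins by measurable
    have "(\<integral>\<^sup>+x. h x \<partial>gauss {..<n}) = (\<integral>\<^sup>+x. h x \<partial>gauss (insert i (insert j ({..<n} - {i, j}))))" by (simp only: ins)
    also have "\<dots> = (\<integral>\<^sup>+x. \<integral>\<^sup>+a. h (x(i := a)) \<partial>std_normal_distribution \<partial>gauss (insert j ({..<n} - {i, j})))"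
      using ij by (intro product_nn_integral_insert h') auto
    also have "\<dots> = (\<integral>\<^sup>+x. \<integral>\<^sup>+b. \<integral>\<^sup>+a. h (x(j := b, i := a)) \<partial>std_normal_distribution \<partial>std_normal_distribution \<partial>gauss ({..<n} - {i, j}))"
    proof (rule product_nn_integral_insert)
      interpret N: sigma_finite_measure std_normal_distribution
        using prob_space_std_normal by (rule prob_space_imp_sigma_finite)
      show "(\<lambda>x. \<integral>\<^sup>+a. h (x(i := a)) \<partial>std_normal_distribution) \<in> borel_measurable (gauss (insert j ({..<n} - {i, j})))"
        by measurable
    qed auto
    finally show ?thesis .
  qed
  have "(\<integral>\<^sup>+x. f (givens i j c s x) \<partial>gauss {..<n}) =
    (\<integral>\<^sup>+x. \<integral>\<^sup>+b. \<integral>\<^sup>+a. f (givens i j c s (x(j := b, i := a))) \<partial>std_normal_distribution \<partial>std_normal_distribution \<partial>gauss ({..<n} - {i, j}))"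
    by (rule split) measurable
  also have "\<dots> = (\<integral>\<^sup>+x. \<integral>\<^sup>+b. \<integral>\<^sup>+a. f (x(j := b, i := a)) \<partial>std_normal_distribution \<partial>std_normal_distribution \<partial>gauss ({..<n} - {i, j}))"
  proof (rule nn_integral_cong)
    fix x assume x: "x \<in> space (gauss ({..<n} - {i, j}))"
    have g: "givens i j c s (x(j := b, i := a)) = x(j := c * b - s * a, i := c * a + s * b)" for a b
      using ij by (auto simp: givens_def fun_eq_iff)
    have m: "(\<lambda>p. x(j := snd p, i := fst p)) \<in> borel \<Otimes>\<^sub>M borel \<rightarrow>\<^sub>M PiM {..<n} (\<lambda>_. borel)"
    proof (rule measurable_PiM_single')
      fix k assume "k \<in> {..<n}"
      then show "(\<lambda>p. (x(j := snd p, i := fst p)) k) \<in> borel_measurable (borel \<Otimes>\<^sub>M borel)"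
        unfolding fun_upd_apply by simp
    next
      show "(\<lambda>p. x(j := snd p, i := fst p)) \<in> space (borel \<Otimes>\<^sub>M borel) \<rightarrow> ({..<n} \<rightarrow>\<^sub>E space borel)"
        using ij x by (auto simp: space_PiM PiE_def extensional_def)
    qed
    have "(\<lambda>p. f (x(j := snd p, i := fst p))) \<in> borel_measurable (borel \<Otimes>\<^sub>M borel)"
      by (rule measurable_compose[OF m f])
    then have "case_prod (\<lambda>a b. f (x(j := b, i := a))) \<in> borel_measurable (borel \<Otimes>\<^sub>M borel)"
      by (simp add: case_prod_beta')
    from rotation_std_normal[OF this cs]
    show "(\<integral>\<^sup>+b. \<integral>\<^sup>+a. f (givens i j c s (x(j := b, i := a))) \<partial>std_normal_distribution \<partial>std_normal_distribution) =
      (\<integral>\<^sup>+b. \<integral>\<^sup>+a. f (x(j := b, i := a)) \<partial>std_normal_distribution \<partial>std_normal_distribution)"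
      unfolding g .
  qed
  also have "\<dots> = (\<integral>\<^sup>+x. f x \<partial>gauss {..<n})" by (rule split[symmetric]) measurable
  finally show "(\<integral>\<^sup>+x. f (givens i j c s x) \<partial>gauss {..<n}) = (\<integral>\<^sup>+x. f x \<partial>gauss {..<n})" .
next
  fix x y :: "nat \<Rightarrow> real"
  have spl: "(\<Sum>t<n. h t) = h i + h j + (\<Sum>t\<in>{..<n} - {i, j}. h t)" for h :: "nat \<Rightarrow> real"
  proof -
    have "(\<Sum>t<n. h t) = h i + (\<Sum>t\<in>{..<n} - {i}. h t)" using ij by (intro sum.remove) auto
    also have "(\<Sum>t\<in>{..<n} - {i}. h t) = h j + (\<Sum>t\<in>{..<n} - {i} - {j}. h t)" using ij by (intro sum.remove) auto
    also have "{..<n} - {i} - {j} = {..<n} - {i, j}" by auto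
    finally show ?thesis by simp
  qed
  have "(\<Sum>t\<in>{..<n} - {i, j}. givens i j c s x t * givens i j c s y t) = (\<Sum>t\<in>{..<n} - {i, j}. x t * y t)"
    by (intro sum.cong) (auto simp: givens_def)
  moreover have "givens i j c s x i * givens i j c s y i + givens i j c s x j * givens i j c s y j = x i * y i + x j * y j"
  proof -
    have "givens i j c s x i * givens i j c s y i + givens i j c s x j * givens i j c s y j = (c\<^sup>2 + s\<^sup>2) * (x i * y i + x j * y j)"
      using ij by (simp add: givens_def power2_eq_square algebra_simps)
    then show ?thesis using cs by simp
  qed
  ultimately show "(\<Sum>t<n. givens i j c s x t * givens i j c s y t) = (\<Sum>t<n. x t * y t)"
    by (simp only: spl)
qed

text \<open>Rotations in the planes \<open>(v, m)\<close> for growing \<open>m\<close> clear one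
  coordinate of \<open>y\<close> after the other. They only touch coordinates from \<open>v\<close>
  on and hence fix every vector that vanishes there.\<close>

lemma gauss_isometry_zeroing:
  assumes v: "v < n"
  shows "\<exists>R. gauss_isometry n R \<and> (\<forall>t. v < t \<and> t < n \<longrightarrow> R y t = 0) \<and>
    (\<forall>x. (\<forall>t. v \<le> t \<and> t < n \<longrightarrow> x t = 0) \<longrightarrow> R x = x)"
proof -
  have "\<exists>R. gauss_isometry n R \<and> (\<forall>t. v < t \<and> t < m \<longrightarrow> R y t = 0) \<and>
    (\<forall>x. (\<forall>t. v \<le> t \<and> t < n \<longrightarrow> x t = 0) \<longrightarrow> R x = x)" if "m \<le> n" for m
    using that
  proof (induction m)
    case 0
    show ?case by (rule exI[of _ "\<lambda>x. x"]) (auto intro: gauss_isometry_id)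
  next
    case (Suc m)
    then obtain R where R: "gauss_isometry n R" "\<And>t. v < t \<Longrightarrow> t < m \<Longrightarrow> R y t = 0"
      "\<And>x. (\<forall>t. v \<le> t \<and> t < n \<longrightarrow> x t = 0) \<Longrightarrow> R x = x" by auto
    show ?case
    proof (cases "m \<le> v \<or> R y m = 0")
      case True
      then show ?thesis using R by (intro exI[of _ R]) (auto simp: less_Suc_eq)
    next
      case False
      then have m: "v < m" "R y m \<noteq> 0" "m < n" using Suc.prems by auto
      define r where "r = sqrt ((R y v)\<^sup>2 + (R y m)\<^sup>2)"
      have r2: "r\<^sup>2 = (R y v)\<^sup>2 + (R y m)\<^sup>2" unfolding r_def by simp
      have r0: "r > 0" unfolding r_def using m by (simp add: add_nonneg_pos)
      define c s where "c = R y v / r" and "s = R y m / r"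
      have cs: "c\<^sup>2 + s\<^sup>2 = 1"
        using r0 m by (simp add: c_def s_def power_divide add_divide_distrib[symmetric] r2[symmetric])
      \<comment> \<open>A rotation is inserted only if the entry to be cleared is nonzero, and this
        excludes the half turn \<open>c = - 1\<close>.\<close>
      have "s \<noteq> 0" using m r0 by (simp add: s_def)
      then have c1: "c \<noteq> - 1" using cs by auto
      let ?Q = "\<lambda>x. givens v m c s (R x)"
      show ?thesis
      proof (intro exI[of _ ?Q] conjI allI impI)
        show "gauss_isometry n ?Q"
          using m v cs c1 by (intro gauss_isometry_comp[OF _ R(1)] gauss_isometry_givens) auto
        fix t assume t: "v < t \<and> t < Suc m"
        show "?Q y t = 0"
          using t R(2)[of t] m by (auto simp: givens_def c_def s_def less_Suc_eq)
      next
        fix x :: "nat \<Rightarrow> real" assume x: "\<forall>t. v \<le> t \<and> t < n \<longrightarrow> x t = 0"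
        then have "x v = 0" "x m = 0" using m v by auto
        then show "?Q x = x" using R(3)[OF x] by (auto simp: givens_def)
      qed
    qed
  qed
  from this[of n] show ?thesis by simp
qed

text \<open>The triangular form of a QR decomposition. Vectors treated before are zero from
  coordinate \<open>v\<close> on, so the rotations for the vector \<open>v\<close> leave them
  alone.\<close>

lemma gauss_isometry_triangular:
  "\<exists>P. gauss_isometry n P \<and> (\<forall>r<v. \<forall>t. r < t \<and> t < n \<longrightarrow> P (Y r) t = 0)"
proof (induction v)
  case 0
  show ?case by (rule exI[of _ "\<lambda>x. x"]) (auto intro: gauss_isometry_id)
next
  case (Suc v)
  then obtain P where P: "gauss_isometry n P" "\<And>r t. r < v \<Longrightarrow> r < t \<Longrightarrow> t < n \<Longrightarrow> P (Y r) t = 0" by auto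
  show ?case
  proof (cases "v < n")
    case True
    obtain R where R: "gauss_isometry n R" "\<And>t. v < t \<Longrightarrow> t < n \<Longrightarrow> R (P (Y v)) t = 0"
      "\<And>x. (\<forall>t. v \<le> t \<and> t < n \<longrightarrow> x t = 0) \<Longrightarrow> R x = x"
      using gauss_isometry_zeroing[OF True, of "P (Y v)"] by auto
    have "R (P (Y r)) t = 0" if "r < Suc v" "r < t" "t < n" for r t
    proof (cases "r = v")
      case False
      then have "R (P (Y r)) = P (Y r)" using that P(2) by (intro R(3)) auto
      then show ?thesis using P(2) that False by simp
    qed (use R(2) that in auto)
    then show ?thesis
      by (intro exI[of _ "\<lambda>x. R (P x)"]) (auto intro: gauss_isometry_comp[OF R(1) P(1)])
  next
    case False
    then show ?thesis using P by (intro exI[of _ P]) (auto simp: less_Suc_eq)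
  qed
qed

section \<open>Centred inner products and Gram determinants\<close>

definition centered_ip :: "nat \<Rightarrow> (nat \<Rightarrow> real) \<Rightarrow> (nat \<Rightarrow> real) \<Rightarrow> real" where
  "centered_ip n x y = (\<Sum>t<n. (x t - (\<Sum>i<n. x i) / real n) * (y t - (\<Sum>i<n. y i) / real n))"

lemma centered_ip_eq:
  assumes "n > 0"
  shows "centered_ip n x y = (\<Sum>t<n. x t * y t) - (\<Sum>t<n. x t) * (\<Sum>t<n. y t) / real n"
proof -
  define a b where "a = (\<Sum>i<n. x i) / real n" and "b = (\<Sum>i<n. y i) / real n"
  have a: "(\<Sum>i<n. x i) = real n * a" and b: "(\<Sum>i<n. y i) = real n * b" using assms by (auto simp: a_def b_def)
  have "centered_ip n x y = (\<Sum>t<n. x t * y t - x t * b - a * y t + a * b)"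
    unfolding centered_ip_def a_def[symmetric] b_def[symmetric] by (intro sum.cong) (auto simp: algebra_simps)
  also have "\<dots> = (\<Sum>t<n. x t * y t) - (\<Sum>t<n. x t) * b - a * (\<Sum>t<n. y t) + real n * (a * b)"
    by (simp add: sum.distrib sum_subtractf sum_distrib_left sum_distrib_right)
  also have "\<dots> = (\<Sum>t<n. x t * y t) - (\<Sum>t<n. x t) * (\<Sum>t<n. y t) / real n"
    unfolding a b using assms by simp
  finally show ?thesis .
qed

text \<open>The constant vector is put in front of the list, so it is rotated into coordinate 0, and
  centring amounts to deleting this coordinate. It occupies one place, hence \<open>Y r\<close>
  vanishes beyond \<open>Suc r\<close> and not beyond \<open>r\<close>.\<close>

lemma gauss_isometry_centered:
  assumes n: "n > 0"
  shows "\<exists>P. gauss_isometry n P \<and> (\<forall>x y. centered_ip n x y = (\<Sum>t=1..<n. P x t * P y t)) \<and>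
    (\<forall>r<v. \<forall>t. Suc r < t \<and> t < n \<longrightarrow> P (Y r) t = 0)"
proof -
  define Z where "Z r = (case r of 0 \<Rightarrow> (\<lambda>_. 1) | Suc r \<Rightarrow> Y r)" for r
  obtain P where P: "gauss_isometry n P" "\<And>r t. r < Suc v \<Longrightarrow> r < t \<Longrightarrow> t < n \<Longrightarrow> P (Z r) t = 0"
    using gauss_isometry_triangular[of n "Suc v" Z] by auto
  have ip: "(\<Sum>t<n. P x t * P y t) = (\<Sum>t<n. x t * y t)" for x y using P(1) by (simp add: gauss_isometry_def)
  have one: "P (\<lambda>_. 1) t = 0" if "0 < t" "t < n" for t using P(2)[of 0 t] that by (simp add: Z_def)
  have s0: "(\<Sum>t<n. P (\<lambda>_. 1) t * P x t) = P (\<lambda>_. 1) 0 * P x 0" for x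
  proof -
    have "(\<Sum>t<n. P (\<lambda>_. 1) t * P x t) = (\<Sum>t\<in>{0}. P (\<lambda>_. 1) t * P x t)"
      using n one by (intro sum.mono_neutral_right) auto
    then show ?thesis by simp
  qed
  have m: "(\<Sum>t<n. x t) = P (\<lambda>_. 1) 0 * P x 0" for x
    using ip[of "\<lambda>_. 1" x] s0[of x] by simp
  \<comment> \<open>The image of the constant vector sits in coordinate 0 with square
    \<open>n\<close>, so the correction by the means is exactly the product of the two coordinates
    with index 0.\<close>
  have n1: "P (\<lambda>_. 1) 0 * P (\<lambda>_. 1) 0 = real n" using m[of "\<lambda>_. 1"] by simp
  have "centered_ip n x y = (\<Sum>t=1..<n. P x t * P y t)" for x y
  proof -
    have "centered_ip n x y = (\<Sum>t<n. P x t * P y t) - P (\<lambda>_. 1) 0 * P x 0 * (P (\<lambda>_. 1) 0 * P y 0) / real n"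
      using n by (simp add: centered_ip_eq ip m)
    also have "P (\<lambda>_. 1) 0 * P x 0 * (P (\<lambda>_. 1) 0 * P y 0) = real n * (P x 0 * P y 0)"
      unfolding n1[symmetric] by (simp add: mult_ac)
    also have "(\<Sum>t<n. P x t * P y t) = P x 0 * P y 0 + (\<Sum>t=1..<n. P x t * P y t)"
      using n by (simp add: lessThan_atLeast0 sum.atLeast_Suc_lessThan)
    finally show ?thesis using n by simp
  qed
  moreover have "P (Y r) t = 0" if "r < v" "Suc r < t" "t < n" for r t
    using P(2)[of "Suc r" t] that by (simp add: Z_def)
  ultimately show ?thesis using P(1) by blast
qed

definition gram_det :: "nat \<Rightarrow> nat \<Rightarrow> (nat \<Rightarrow> nat \<Rightarrow> real) \<Rightarrow> real" where
  "gram_det n v Y = Determinant.det (Matrix.mat v v (\<lambda>(a, b). centered_ip n (Y a) (Y b)))"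

lemma gram_det_cong:
  assumes "\<And>r. r < v \<Longrightarrow> Y r = Z r"
  shows "gram_det n v Y = gram_det n v Z"
  unfolding gram_det_def by (intro arg_cong[where f = Determinant.det] eq_matI) (auto simp: assms)

lemma gram_det_0[simp]: "gram_det n 0 Y = 1"
  by (simp add: gram_det_def det_dim_zero)

text \<open>Rows and columns are permuted alike, and the two signs cancel.\<close>

lemma gram_det_permute:
  assumes p: "\<sigma> permutes {0..<v}"
  shows "gram_det n v (\<lambda>r. Y (\<sigma> r)) = gram_det n v Y"
proof -
  let ?A = "Matrix.mat v v (\<lambda>(a, b). centered_ip n (Y a) (Y b))"
  let ?B = "Matrix.mat v v (\<lambda>(i, j). ?A $$ (\<sigma> i, j))"
  have s: "\<sigma> i < v" if "i < v" for i using permutes_in_image[OF p, of i] that by simp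
  have "gram_det n v (\<lambda>r. Y (\<sigma> r)) = Determinant.det (transpose_mat (Matrix.mat v v (\<lambda>(i, j). transpose_mat ?B $$ (\<sigma> i, j))))"
    unfolding gram_det_def using s by (intro arg_cong[where f = Determinant.det] eq_matI) auto
  also have "\<dots> = Determinant.det (Matrix.mat v v (\<lambda>(i, j). transpose_mat ?B $$ (\<sigma> i, j)))"
    by (rule det_transpose[of _ v]) simp
  also have "\<dots> = signof \<sigma> * Determinant.det (transpose_mat ?B)"
    by (rule det_permute_rows[OF _ p]) simp
  also have "\<dots> = signof \<sigma> * Determinant.det ?B" by (subst det_transpose[of _ v]) auto
  also have "Determinant.det ?B = signof \<sigma> * Determinant.det ?A"
    by (rule det_permute_rows[OF _ p]) simp
  also have "signof \<sigma> * (signof \<sigma> * Determinant.det ?A) = Determinant.det ?A"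
    by (simp add: sign_def)
  finally show ?thesis by (simp add: gram_det_def)
qed

text \<open>The coordinates \<open>1, ..., w\<close> form an upper triangular factor
  \<open>R\<close> with Gram matrix \<open>R^T R\<close>, so the determinant is the squared product
  of its diagonal. Coordinate 0 belongs to the constant vector, hence the shift by
  \<open>Suc\<close>.\<close>

lemma det_gram_triangular:
  fixes Z :: "nat \<Rightarrow> nat \<Rightarrow> real"
  assumes w: "w < n" and Z: "\<And>r t. r < w \<Longrightarrow> Suc r < t \<Longrightarrow> t < n \<Longrightarrow> Z r t = 0"
  shows "Determinant.det (Matrix.mat w w (\<lambda>(a, b). \<Sum>t=1..<n. Z a t * Z b t)) = (\<Prod>r<w. (Z r (Suc r))\<^sup>2)"
proof -
  define R where "R = Matrix.mat w w (\<lambda>(r, c). Z c (Suc r))"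
  have R: "R \<in> carrier_mat w w" by (simp add: R_def)
  have "Matrix.mat w w (\<lambda>(a, b). \<Sum>t=1..<n. Z a t * Z b t) = transpose_mat R * R"
  proof (rule eq_matI)
    fix a b assume "a < dim_row (transpose_mat R * R)" "b < dim_col (transpose_mat R * R)"
    then have ab: "a < w" "b < w" by (auto simp: R_def)
    have "(\<Sum>t=1..<n. Z a t * Z b t) = (\<Sum>t=1..<Suc w. Z a t * Z b t)"
      using w ab Z by (intro sum.mono_neutral_right) auto
    also have "\<dots> = (\<Sum>i=0..<w. Z a (Suc i) * Z b (Suc i))"
      by (simp only: One_nat_def sum.shift_bounds_Suc_ivl)
    finally show "Matrix.mat w w (\<lambda>(a, b). \<Sum>t=1..<n. Z a t * Z b t) $$ (a, b) = (transpose_mat R * R) $$ (a, b)"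
      using ab by (simp add: R_def scalar_prod_def)
  qed (auto simp: R_def)
  then have "Determinant.det (Matrix.mat w w (\<lambda>(a, b). \<Sum>t=1..<n. Z a t * Z b t)) = (Determinant.det R)\<^sup>2"
    using R by (simp add: det_mult[of _ w] det_transpose[of _ w] power2_eq_square)
  also have "Determinant.det R = (\<Prod>r<w. Z r (Suc r))"
  proof -
    have "upper_triangular R" using w Z by (auto simp: R_def upper_triangular_def)
    then have "Determinant.det R = prod_list (diag_mat R)" using R by (rule det_upper_triangular)
    also have "\<dots> = (\<Prod>r<w. Z r (Suc r))"
      by (simp add: prod_list_diag_prod R_def lessThan_atLeast0)
    finally show ?thesis .
  qed
  finally show ?thesis by (simp add: prod_power_distrib)
qed

text \<open>For a rotated column this plays the role of the residual sum of squares: what remains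
  after the first \<open>u\<close> coordinates are projected away.\<close>

definition tail_sq :: "nat \<Rightarrow> nat \<Rightarrow> (nat \<Rightarrow> real) \<Rightarrow> real" where
  "tail_sq n u x = (\<Sum>t=u..<n. (x t)\<^sup>2)"

text \<open>Replacing \<open>P z\<close> beyond coordinate \<open>w\<close> by its norm, placed in coordinate \<open>w + 1\<close>, changes no inner product.\<close>

lemma gram_det_extend:
  assumes w: "Suc w < n"
    and P: "\<And>x y. centered_ip n x y = (\<Sum>t=1..<n. P x t * P y t)"
    and Y: "\<And>r t. r < w \<Longrightarrow> Suc r < t \<Longrightarrow> t < n \<Longrightarrow> P (Y r) t = 0"
  shows "gram_det n (Suc w) (Y(w := z)) = gram_det n w Y * tail_sq n (Suc w) (P z)"
proof -
  define q where "q = sqrt (tail_sq n (Suc w) (P z))"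
  have q2: "q * q = tail_sq n (Suc w) (P z)" unfolding q_def tail_sq_def by (simp add: sum_nonneg)
  define zs where "zs t = (if t \<le> w then P z t else if t = Suc w then q else 0)" for t
  define Z where "Z r = (if r < w then P (Y r) else zs)" for r
  have Zz: "Z r t = 0" if "r < Suc w" "Suc r < t" "t < n" for r t
    using that Y by (auto simp: Z_def zs_def)
  have ent: "centered_ip n ((Y(w := z)) a) ((Y(w := z)) b) = (\<Sum>t=1..<n. Z a t * Z b t)" if ab: "a < Suc w" "b < Suc w" for a b
  proof -
    have mixed: "(\<Sum>t=1..<n. P (Y r) t * P z t) = (\<Sum>t=1..<n. P (Y r) t * zs t)" if "r < w" for r
      using that Y by (intro sum.cong) (auto simp: zs_def)
    have last: "(\<Sum>t=1..<n. P z t * P z t) = (\<Sum>t=1..<n. zs t * zs t)"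
    proof -
      have split: "(\<Sum>t=1..<n. h t) = (\<Sum>t=1..<Suc w. h t) + (\<Sum>t=Suc w..<n. h t)" for h :: "nat \<Rightarrow> real"
        using w by (intro sum.atLeastLessThan_concat[symmetric]) auto
      have "(\<Sum>t=Suc w..<n. zs t * zs t) = zs (Suc w) * zs (Suc w)"
        using w by (subst sum.atLeast_Suc_lessThan) (auto simp: zs_def intro!: sum.neutral)
      then have "(\<Sum>t=Suc w..<n. zs t * zs t) = (\<Sum>t=Suc w..<n. P z t * P z t)"
        by (simp add: zs_def q2 tail_sq_def power2_eq_square)
      moreover have "(\<Sum>t=1..<Suc w. zs t * zs t) = (\<Sum>t=1..<Suc w. P z t * P z t)"
        by (intro sum.cong) (auto simp: zs_def)
      ultimately show ?thesis unfolding split by simp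
    qed
    consider "a < w" "b < w" | "a < w" "b = w" | "a = w" "b < w" | "a = w" "b = w" using ab by (metis less_Suc_eq)
    then show ?thesis
    proof cases
      case 1
      then show ?thesis by (simp add: P Z_def)
    next
      case 2
      then show ?thesis using mixed[of a] by (simp add: P Z_def)
    next
      case 3
      then show ?thesis using mixed[of b] by (simp add: P Z_def mult.commute)
    next
      case 4
      then show ?thesis using last by (simp add: P Z_def)
    qed
  qed
  have "gram_det n (Suc w) (Y(w := z)) = Determinant.det (Matrix.mat (Suc w) (Suc w) (\<lambda>(a, b). \<Sum>t=1..<n. Z a t * Z b t))"
    unfolding gram_det_def by (intro arg_cong[where f = Determinant.det] eq_matI) (simp_all add: ent del: fun_upd_apply One_nat_def)
  also have "\<dots> = (\<Prod>r<Suc w. (Z r (Suc r))\<^sup>2)"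
    by (rule det_gram_triangular[OF w Zz])
  also have "\<dots> = (\<Prod>r<w. (P (Y r) (Suc r))\<^sup>2) * tail_sq n (Suc w) (P z)"
    by (simp add: Z_def zs_def power2_eq_square q2)
  also have "(\<Prod>r<w. (P (Y r) (Suc r))\<^sup>2) = gram_det n w Y"
    unfolding gram_det_def P using w Y by (intro det_gram_triangular[symmetric]) auto
  finally show ?thesis .
qed

text \<open>One rotation has to serve two determinants, that of all columns and that of the current
  block. This works if the earlier columns of the block are rotated first: they then occupy the
  leading coordinates, and the block determinant grows by a tail that starts earlier than the one
  for the full determinant.\<close>

lemma gram_det_column:
  assumes st: "st \<le> a" and a: "Suc a < n"
  shows "\<exists>P. gauss_isometry n P \<and> (\<forall>z.
     gram_det n (Suc a) (Y(a := z)) = gram_det n a Y * tail_sq n (Suc a) (P z) \<and>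
     gram_det n (Suc a - st) (\<lambda>r. (Y(a := z)) (st + r)) =
       gram_det n (a - st) (\<lambda>r. Y (st + r)) * tail_sq n (Suc a - st) (P z))"
proof -
  \<comment> \<open>Moves the indices from \<open>st\<close> to \<open>a - 1\<close> to the front
    and leaves the new column \<open>a\<close> in its place.\<close>
  define \<sigma> where "\<sigma> r = (if r < a - st then st + r else if r < a then r - (a - st) else r)" for r
  have inj: "inj_on \<sigma> {0..<a}"
    using st by (auto simp: inj_on_def \<sigma>_def split: if_splits)
  have "\<sigma> ` {0..<a} \<subseteq> {0..<a}" using st by (auto simp: \<sigma>_def)
  then have "\<sigma> ` {0..<a} = {0..<a}" using inj by (intro endo_inj_surj) auto
  then have perm: "\<sigma> permutes {0..<a}"
    using inj by (intro bij_imp_permutes) (auto simp: bij_betw_def \<sigma>_def)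
  then have perm': "\<sigma> permutes {0..<Suc a}" by (rule permutes_subset) auto
  let ?Y = "\<lambda>r. Y (\<sigma> r)"
  obtain P where P: "gauss_isometry n P" "\<And>x y. centered_ip n x y = (\<Sum>t=1..<n. P x t * P y t)"
    "\<And>r t. r < a \<Longrightarrow> Suc r < t \<Longrightarrow> t < n \<Longrightarrow> P (?Y r) t = 0"
    using gauss_isometry_centered[of n a ?Y] a by auto
  have "gram_det n (Suc a) (Y(a := z)) = gram_det n a Y * tail_sq n (Suc a) (P z)" for z
  proof -
    have "gram_det n (Suc a) (Y(a := z)) = gram_det n (Suc a) (\<lambda>r. (Y(a := z)) (\<sigma> r))"
      by (rule gram_det_permute[OF perm', symmetric])
    also have "\<dots> = gram_det n (Suc a) (?Y(a := z))"
      using st by (intro gram_det_cong) (auto simp: \<sigma>_def)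
    also have "\<dots> = gram_det n a ?Y * tail_sq n (Suc a) (P z)"
      by (rule gram_det_extend[OF a P(2,3)])
    also have "gram_det n a ?Y = gram_det n a Y" by (rule gram_det_permute[OF perm])
    finally show ?thesis .
  qed
  moreover have "gram_det n (Suc a - st) (\<lambda>r. (Y(a := z)) (st + r)) =
       gram_det n (a - st) (\<lambda>r. Y (st + r)) * tail_sq n (Suc a - st) (P z)" for z
  proof -
    have e: "Suc a - st = Suc (a - st)" using st by simp
    have "gram_det n (Suc a - st) (\<lambda>r. (Y(a := z)) (st + r)) = gram_det n (Suc (a - st)) (?Y(a - st := z))"
      unfolding e using st by (intro gram_det_cong) (auto simp: \<sigma>_def)
    also have "\<dots> = gram_det n (a - st) ?Y * tail_sq n (Suc (a - st)) (P z)"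
      using a by (intro gram_det_extend P(2,3)) auto
    also have "gram_det n (a - st) ?Y = gram_det n (a - st) (\<lambda>r. Y (st + r))"
      by (intro gram_det_cong) (auto simp: \<sigma>_def)
    finally show ?thesis by (simp add: e)
  qed
  ultimately show ?thesis using P(1) by blast
qed

lemma measurable_det:
  assumes "\<And>a b. a < v \<Longrightarrow> b < v \<Longrightarrow> (\<lambda>\<omega>. A \<omega> a b) \<in> borel_measurable M"
  shows "(\<lambda>\<omega>. Determinant.det (Matrix.mat v v (\<lambda>(a, b). A \<omega> a b :: real))) \<in> borel_measurable M"
proof -
  have eq: "Determinant.det (Matrix.mat v v (\<lambda>(a, b). A \<omega> a b)) =
    (\<Sum>p\<in>{p. p permutes {0..<v}}. signof p * (\<Prod>i = 0..<v. A \<omega> i (p i)))" for \<omega>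
    by (subst det_def'[of _ v]) (auto intro!: sum.cong prod.cong simp: permutes_in_image)
  show ?thesis unfolding eq
    by (intro borel_measurable_sum borel_measurable_times borel_measurable_const borel_measurable_prod assms)
      (auto simp: permutes_in_image)
qed

lemma measurable_gram_det:
  assumes "\<And>r t. r < v \<Longrightarrow> t < n \<Longrightarrow> (\<lambda>\<omega>. Y \<omega> r t) \<in> borel_measurable M"
  shows "(\<lambda>\<omega>. gram_det n v (Y \<omega>)) \<in> borel_measurable M"
  unfolding gram_det_def centered_ip_def
  by (intro measurable_det borel_measurable_sum borel_measurable_times borel_measurable_diff borel_measurable_divide assms) auto

section \<open>Laws of tail sums of squares of a Gaussian vector\<close>

lemma half_square_std_normal:
  fixes h :: "real \<Rightarrow> ennreal"
  assumes [measurable]: "h \<in> borel_measurable borel"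
  shows "(\<integral>\<^sup>+z. h (z\<^sup>2 / 2) \<partial>std_normal_distribution) = (\<integral>\<^sup>+x. h x \<partial>gamma_law (1/2) 1)"
proof -
  define F where "F z = ennreal (std_normal_density z) * h (z\<^sup>2 / 2)" for z
  have [measurable]: "F \<in> borel_measurable borel" unfolding F_def[abs_def] by measurable
  have even: "F (- z) = F z" for z by (simp add: F_def std_normal_density_def)
  have "(\<integral>\<^sup>+z. h (z\<^sup>2 / 2) \<partial>std_normal_distribution) = (\<integral>\<^sup>+z. F z \<partial>lborel)"
    by (subst nn_integral_density) (auto simp: F_def[abs_def])
  also have "\<dots> = (\<integral>\<^sup>+z. F z * indicator {0<..} z + F z * indicator {..<0} z \<partial>lborel)"
    by (intro nn_integral_cong_AE AE_I[of _ _ "{0}"]) (auto simp: indicator_def split: if_splits)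
  also have "\<dots> = (\<integral>\<^sup>+z. F z * indicator {0<..} z \<partial>lborel) + (\<integral>\<^sup>+z. F z * indicator {..<0} z \<partial>lborel)"
    by (rule nn_integral_add) auto
  also have "(\<integral>\<^sup>+z. F z * indicator {..<0} z \<partial>lborel) = (\<integral>\<^sup>+z. F z * indicator {0<..} z \<partial>lborel)"
    using nn_integral_real_affine[of "\<lambda>z. F z * indicator {..<0} z" "-1" 0]
    by (simp add: even indicator_def)
  also have "(\<integral>\<^sup>+z. F z * indicator {0<..} z \<partial>lborel) + (\<integral>\<^sup>+z. F z * indicator {0<..} z \<partial>lborel) =
    2 * (\<integral>\<^sup>+y. F (exp y) * ennreal (exp y) \<partial>lborel)"
    by (simp add: nn_integral_exp_substitution mult_2)
  finally have L: "(\<integral>\<^sup>+z. h (z\<^sup>2 / 2) \<partial>std_normal_distribution) = 2 * (\<integral>\<^sup>+y. F (exp y) * ennreal (exp y) \<partial>lborel)" .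
  define G where "G x = ennreal (gamma_density (1/2) 1 x) * h x" for x
  have [measurable]: "G \<in> borel_measurable borel" unfolding G_def[abs_def] by measurable
  have "(\<integral>\<^sup>+x. h x \<partial>gamma_law (1/2) 1) = (\<integral>\<^sup>+x. G x * indicator {0<..} x \<partial>lborel)"
    by (subst nn_integral_gamma_law) (auto intro!: nn_integral_cong simp: G_def gamma_density_def split: split_indicator)
  also have "\<dots> = (\<integral>\<^sup>+w. G (exp w) * ennreal (exp w) \<partial>lborel)"
    by (rule nn_integral_exp_substitution) measurable
  \<comment> \<open>In logarithmic coordinates \<open>x = z^2 / 2\<close> is affine: with
    \<open>x = exp w\<close> and \<open>z = exp y\<close> it reads \<open>w = 2 * y - ln 2\<close>.
    The factor 2 is the one that the symmetry of \<open>F\<close> produced on the other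
    side.\<close>
  also have "\<dots> = ennreal \<bar>2\<bar> * (\<integral>\<^sup>+y. G (exp (- ln 2 + 2 * y)) * ennreal (exp (- ln 2 + 2 * y)) \<partial>lborel)"
    by (rule nn_integral_real_affine) auto
  also have "(\<integral>\<^sup>+y. G (exp (- ln 2 + 2 * y)) * ennreal (exp (- ln 2 + 2 * y)) \<partial>lborel) =
    (\<integral>\<^sup>+y. F (exp y) * ennreal (exp y) \<partial>lborel)"
  proof (rule nn_integral_cong)
    fix y :: real
    have e: "exp (- ln 2 + 2 * y) = (exp y)\<^sup>2 / 2"
    proof -
      have "exp (2 * y) = (exp y)\<^sup>2" by (rule exp_double)
      then show ?thesis by (simp only: exp_add exp_minus) simp
    qed
    have "gamma_density (1/2) 1 ((exp y)\<^sup>2 / 2) * ((exp y)\<^sup>2 / 2) = std_normal_density (exp y) * exp y"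
    proof -
      have p: "((exp y)\<^sup>2 / 2) powr (1/2 - 1) = sqrt 2 / exp y"
        by (simp add: powr_minus powr_half_sqrt powr_divide real_sqrt_divide field_simps)
      have "gamma_density (1/2) 1 ((exp y)\<^sup>2 / 2) = ((exp y)\<^sup>2 / 2) powr (1/2 - 1) * exp (- (exp y)\<^sup>2 / 2) / sqrt pi"
        unfolding gamma_density_def by (simp add: Gamma_one_half_real)
      then have "gamma_density (1/2) 1 ((exp y)\<^sup>2 / 2) * ((exp y)\<^sup>2 / 2) =
        sqrt 2 / 2 * exp (- (exp y)\<^sup>2 / 2) / sqrt pi * exp y"
        unfolding p by (simp add: power2_eq_square)
      moreover have "sqrt (2 * pi) = sqrt 2 * sqrt pi" by (rule real_sqrt_mult)
      moreover have "sqrt 2 / 2 = 1 / sqrt 2" by (simp add: field_simps)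
      ultimately show ?thesis
        by (simp add: std_normal_density_def)
    qed
    then have "ennreal (gamma_density (1/2) 1 ((exp y)\<^sup>2 / 2)) * ennreal ((exp y)\<^sup>2 / 2) = ennreal (std_normal_density (exp y)) * ennreal (exp y)"
      by (simp add: ennreal_mult[symmetric])
    then have "ennreal (gamma_density (1/2) 1 ((exp y)\<^sup>2 / 2)) * ennreal ((exp y)\<^sup>2 / 2) * h ((exp y)\<^sup>2 / 2) =
      ennreal (std_normal_density (exp y)) * ennreal (exp y) * h ((exp y)\<^sup>2 / 2)" by simp
    then show "G (exp (- ln 2 + 2 * y)) * ennreal (exp (- ln 2 + 2 * y)) = F (exp y) * ennreal (exp y)"
      unfolding e by (simp only: G_def F_def mult_ac)
  qed
  finally show ?thesis using L by simp
qed

lemma tail_sq_nonneg[simp]: "0 \<le> tail_sq n u x"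
  by (simp add: tail_sq_def sum_nonneg)

lemma tail_sq_Suc: "u < n \<Longrightarrow> tail_sq n u x = (x u)\<^sup>2 + tail_sq n (Suc u) x"
  unfolding tail_sq_def by (rule sum.atLeast_Suc_lessThan)

lemma tail_sq_upd: "tail_sq n (Suc u) (x(u := z)) = tail_sq n (Suc u) x"
  unfolding tail_sq_def by (intro sum.cong) auto

lemma tail_sq_antimono: "u \<le> v \<Longrightarrow> tail_sq n v x \<le> tail_sq n u x"
  unfolding tail_sq_def by (intro sum_mono2) auto

lemma measurable_tail_sq[measurable]:
  "{u..<n} \<subseteq> I \<Longrightarrow> tail_sq n u \<in> borel_measurable (PiM I (\<lambda>_. borel))"
  unfolding tail_sq_def[abs_def] by (intro borel_measurable_sum borel_measurable_power measurable_component_singleton) auto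

lemma gauss_tail_insert:
  fixes f :: "(nat \<Rightarrow> real) \<Rightarrow> ennreal"
  assumes u: "u < n" and [measurable]: "f \<in> borel_measurable (PiM {u..<n} (\<lambda>_. borel))"
  shows "(\<integral>\<^sup>+x. f x \<partial>gauss {u..<n}) = (\<integral>\<^sup>+x. \<integral>\<^sup>+z. f (x(u := z)) \<partial>std_normal_distribution \<partial>gauss {Suc u..<n})"
proof -
  interpret product_sigma_finite "\<lambda>_::nat. std_normal_distribution" by (rule product_sigma_finite_std_normal)
  have e: "{u..<n} = insert u {Suc u..<n}" using u by auto
  have "f \<in> borel_measurable (gauss (insert u {Suc u..<n}))" unfolding e[symmetric] by measurable
  then show ?thesis unfolding e by (intro product_nn_integral_insert) auto
qed

text \<open>Every further coordinate adds an independent Gamma variable of shape 1/2; the induction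
  descends from the last coordinate.\<close>

lemma tail_sq_law:
  assumes "u < n" and [measurable]: "h \<in> borel_measurable borel"
  shows "(\<integral>\<^sup>+x. h (tail_sq n u x / 2) \<partial>gauss {u..<n}) = (\<integral>\<^sup>+s. h s \<partial>gamma_law (real (n - u) / 2) 1)"
  using assms
proof (induction "n - u" arbitrary: u h)
  case (Suc k)
  note [measurable] = Suc.prems(2)
  show ?case
  proof (cases "Suc u < n")
    case True
    let ?b = "real (n - Suc u) / 2"
    have b: "?b > 0" using True by simp
    interpret G: real_distribution "gamma_law (1/2) 1" by (rule real_distribution_gamma_law) auto
    interpret B: real_distribution "gamma_law ?b 1" by (rule real_distribution_gamma_law) (use b in auto)
    have "(\<integral>\<^sup>+x. h (tail_sq n u x / 2) \<partial>gauss {u..<n}) =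
      (\<integral>\<^sup>+x. \<integral>\<^sup>+z. h (tail_sq n u (x(u := z)) / 2) \<partial>std_normal_distribution \<partial>gauss {Suc u..<n})"
      by (rule gauss_tail_insert[OF Suc.prems(1)]) measurable
    also have "\<dots> = (\<integral>\<^sup>+x. \<integral>\<^sup>+z. h (tail_sq n (Suc u) x / 2 + z\<^sup>2 / 2) \<partial>std_normal_distribution \<partial>gauss {Suc u..<n})"
      using Suc.prems(1) by (simp add: tail_sq_Suc tail_sq_upd add_divide_distrib add.commute)
    also have "\<dots> = (\<integral>\<^sup>+x. \<integral>\<^sup>+d. h (tail_sq n (Suc u) x / 2 + d) \<partial>gamma_law (1/2) 1 \<partial>gauss {Suc u..<n})"
      by (intro nn_integral_cong half_square_std_normal[where h = "\<lambda>d. h (_ + d)"]) measurable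
    also have "\<dots> = (\<integral>\<^sup>+s. \<integral>\<^sup>+d. h (s + d) \<partial>gamma_law (1/2) 1 \<partial>gamma_law ?b 1)"
      using Suc.hyps(2) True by (intro Suc.hyps(1)) auto
    also have "\<dots> = (\<integral>\<^sup>+s. h s \<partial>(gamma_law ?b 1 \<star> gamma_law (1/2) 1))"
      by (rule nn_integral_convolution[symmetric]) (auto intro: G.finite_measure_axioms B.finite_measure_axioms)
    also have "(gamma_law ?b 1 \<star> gamma_law (1/2) 1) = gamma_law (?b + 1/2) 1"
      using b by (intro gamma_law_convolution) auto
    also have "?b + 1/2 = real (n - u) / 2" using Suc.prems(1) by (simp add: of_nat_diff field_simps)
    finally show ?thesis .
  next
    case False
    then have n: "n = Suc u" using Suc.prems by simp
    interpret product_sigma_finite "\<lambda>_::nat. std_normal_distribution" by (rule product_sigma_finite_std_normal)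
    have "(\<integral>\<^sup>+x. h (tail_sq n u x / 2) \<partial>gauss {u..<n}) = (\<integral>\<^sup>+x. h ((x u)\<^sup>2 / 2) \<partial>gauss {u})"
      by (simp add: n tail_sq_def atLeastLessThanSuc)
    also have "\<dots> = (\<integral>\<^sup>+z. h (z\<^sup>2 / 2) \<partial>std_normal_distribution)"
      by (rule product_nn_integral_singleton) measurable
    also have "\<dots> = (\<integral>\<^sup>+s. h s \<partial>gamma_law (1/2) 1)" by (rule half_square_std_normal) measurable
    finally show ?thesis by (simp add: n)
  qed
qed simp

abbreviation half_betas :: "nat \<Rightarrow> nat list \<Rightarrow> real measure list" where
  "half_betas n ts \<equiv> map (\<lambda>t. log_beta_law (real (n - Suc t) / 2) (1/2)) ts"

lemma real_distribution_half_betas: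
  "(\<And>t. t \<in> set ts \<Longrightarrow> Suc t < n) \<Longrightarrow> M \<in> set (half_betas n ts) \<Longrightarrow> real_distribution M"
  by (auto intro!: real_distribution_log_beta_law)

text \<open>The Beta-gamma algebra peels off one coordinate at a time.\<close>

lemma tail_sq_ratio_law:
  fixes H :: "real \<Rightarrow> real \<Rightarrow> ennreal"
  assumes "u \<le> v" "v < n" and [measurable]: "case_prod H \<in> borel_measurable (borel \<Otimes>\<^sub>M borel)"
  shows "(\<integral>\<^sup>+x. H (tail_sq n u x / 2) (ln (tail_sq n u x / 2) - ln (tail_sq n v x / 2)) \<partial>gauss {u..<n}) =
    (\<integral>\<^sup>+s. \<integral>\<^sup>+y. H s y \<partial>convs (half_betas n [u..<v]) \<partial>gamma_law (real (n - u) / 2) 1)"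
  using assms
proof (induction "v - u" arbitrary: u H)
  case 0
  then have uv: "u = v" by simp
  note [measurable] = "0.prems"(3)
  have "(\<integral>\<^sup>+x. H (tail_sq n v x / 2) 0 \<partial>gauss {v..<n}) = (\<integral>\<^sup>+s. H s 0 \<partial>gamma_law (real (n - v) / 2) 1)"
    using 0 by (intro tail_sq_law) auto
  moreover have "(\<integral>\<^sup>+y. H s y \<partial>return borel 0) = H s 0" for s by (rule nn_integral_return) auto
  ultimately show ?case by (simp add: uv)
next
  case (Suc k)
  note [measurable] = Suc.prems(3)
  have u: "u < v" "Suc u \<le> v" "Suc u < n" "u < n" using Suc by auto
  let ?b = "real (n - Suc u) / 2"
  let ?C = "convs (half_betas n [Suc u..<v])"
  let ?L = "log_beta_law ?b (1/2)"
  have b: "?b > 0" using u by simp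
  interpret G: real_distribution "gamma_law (1/2) 1" by (rule real_distribution_gamma_law) auto
  interpret B: real_distribution "gamma_law ?b 1" by (rule real_distribution_gamma_law) (use b in auto)
  interpret B2: real_distribution "gamma_law (?b + 1/2) 1" using b by (intro real_distribution_gamma_law) linarith+
  interpret L: real_distribution ?L by (rule real_distribution_log_beta_law) (use b in auto)
  interpret C: real_distribution ?C
    by (rule real_distribution_convs, rule real_distribution_half_betas[of "[Suc u..<v]" n]) (use Suc.prems(2) in auto)
  interpret CG: pair_prob_space "gamma_law (1/2) 1" ?C ..
  interpret CB: pair_prob_space "gamma_law ?b 1" ?C ..
  interpret CB2: pair_prob_space "gamma_law (?b + 1/2) 1" ?C ..
  interpret CL: pair_prob_space ?L ?C ..
  \<comment> \<open>The remaining terms are integrated out first, so that the algebra is applied to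
    a function of one sum and one Beta logarithm only.\<close>
  define K where "K s w = (\<integral>\<^sup>+y. H s (w + y) \<partial>?C)" for s w
  have K: "case_prod K \<in> borel_measurable (borel \<Otimes>\<^sub>M borel)"
    unfolding K_def[abs_def] by measurable
  have "(\<integral>\<^sup>+x. H (tail_sq n u x / 2) (ln (tail_sq n u x / 2) - ln (tail_sq n v x / 2)) \<partial>gauss {u..<n}) =
    (\<integral>\<^sup>+x. \<integral>\<^sup>+z. H (tail_sq n u (x(u := z)) / 2) (ln (tail_sq n u (x(u := z)) / 2) - ln (tail_sq n v (x(u := z)) / 2))
      \<partial>std_normal_distribution \<partial>gauss {Suc u..<n})"
  proof (rule gauss_tail_insert[OF u(4)])
    have [measurable]: "tail_sq n v \<in> borel_measurable (PiM {u..<n} (\<lambda>_. borel))" "tail_sq n u \<in> borel_measurable (PiM {u..<n} (\<lambda>_. borel))"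
      using u by (auto intro!: measurable_tail_sq)
    show "(\<lambda>x. H (tail_sq n u x / 2) (ln (tail_sq n u x / 2) - ln (tail_sq n v x / 2))) \<in> borel_measurable (PiM {u..<n} (\<lambda>_. borel))"
      by measurable
  qed
  also have "\<dots> = (\<integral>\<^sup>+x. \<integral>\<^sup>+z. H (tail_sq n (Suc u) x / 2 + z\<^sup>2 / 2)
      (ln (tail_sq n (Suc u) x / 2 + z\<^sup>2 / 2) - ln (tail_sq n v x / 2))
      \<partial>std_normal_distribution \<partial>gauss {Suc u..<n})"
  proof -
    have "tail_sq n v (x(u := z)) = tail_sq n v x" for x z
      using u unfolding tail_sq_def by (intro sum.cong) auto
    moreover have "tail_sq n u (x(u := z)) / 2 = tail_sq n (Suc u) x / 2 + z\<^sup>2 / 2" for x z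
      using u by (simp add: tail_sq_Suc tail_sq_upd add_divide_distrib add.commute)
    ultimately show ?thesis by (simp only:)
  qed
  also have "\<dots> = (\<integral>\<^sup>+x. \<integral>\<^sup>+d. H (tail_sq n (Suc u) x / 2 + d)
      (ln (tail_sq n (Suc u) x / 2 + d) - ln (tail_sq n v x / 2)) \<partial>gamma_law (1/2) 1 \<partial>gauss {Suc u..<n})"
    by (intro nn_integral_cong half_square_std_normal[where h = "\<lambda>d. H (_ + d) (ln (_ + d) - _)"]) measurable
  \<comment> \<open>The new square enters both the total and the logarithm, so the induction
    hypothesis is needed for the joint law. This is the reason for the two arguments of
    \<open>H\<close>.\<close>
  also have "\<dots> = (\<integral>\<^sup>+x. (\<lambda>s y. \<integral>\<^sup>+d. H (s + d) (ln (s + d) - ln s + y) \<partial>gamma_law (1/2) 1)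
      (tail_sq n (Suc u) x / 2) (ln (tail_sq n (Suc u) x / 2) - ln (tail_sq n v x / 2)) \<partial>gauss {Suc u..<n})"
    by simp
  also have "\<dots> = (\<integral>\<^sup>+s. \<integral>\<^sup>+y. \<integral>\<^sup>+d. H (s + d) (ln (s + d) - ln s + y) \<partial>gamma_law (1/2) 1 \<partial>?C \<partial>gamma_law ?b 1)"
    using u Suc.hyps(2) Suc.prems(2) by (intro Suc.hyps(1)) auto
  also have "\<dots> = (\<integral>\<^sup>+s. \<integral>\<^sup>+d. \<integral>\<^sup>+y. H (s + d) (ln (s + d) - ln s + y) \<partial>?C \<partial>gamma_law (1/2) 1 \<partial>gamma_law ?b 1)"
    by (intro nn_integral_cong CG.Fubini') measurable
  also have "\<dots> = (\<integral>\<^sup>+s. \<integral>\<^sup>+d. K (s + d) (ln (s + d) - ln s) \<partial>gamma_law (1/2) 1 \<partial>gamma_law ?b 1)"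
    by (simp only: K_def)
  also have "\<dots> = (\<integral>\<^sup>+s. \<integral>\<^sup>+w. K s w \<partial>?L \<partial>gamma_law (?b + 1/2) 1)"
    by (rule beta_gamma_algebra[OF b _ K]) simp
  also have "\<dots> = (\<integral>\<^sup>+s. \<integral>\<^sup>+w. \<integral>\<^sup>+y. H s (w + y) \<partial>?C \<partial>?L \<partial>gamma_law (?b + 1/2) 1)"
    by (simp only: K_def)
  also have "\<dots> = (\<integral>\<^sup>+s. \<integral>\<^sup>+y. H s y \<partial>(?L \<star> ?C) \<partial>gamma_law (?b + 1/2) 1)"
  proof (rule nn_integral_cong)
    fix s
    have "H s \<in> borel_measurable borel" by measurable
    from nn_integral_convolution[OF L.finite_measure_axioms C.finite_measure_axioms C.events_eq_borel L.events_eq_borel this]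
    show "(\<integral>\<^sup>+w. \<integral>\<^sup>+y. H s (w + y) \<partial>?C \<partial>?L) = (\<integral>\<^sup>+y. H s y \<partial>(?L \<star> ?C))" ..
  qed
  also have "?b + 1/2 = real (n - u) / 2" using u by (simp add: of_nat_diff field_simps)
  \<comment> \<open>The new factor has first parameter \<open>(n - Suc u) / 2\<close>, which is the
    term with index \<open>u\<close> at the head of the list.\<close>
  also have "(?L \<star> ?C) = convs (half_betas n [u..<v])"
    using u by (simp add: upt_conv_Cons)
  finally show ?case .
qed

lemma tail_sq_pos_AE:
  assumes "v < n"
  shows "AE x in gauss {v..<n}. tail_sq n v x > 0"
proof -
  have "tail_sq n v \<in> borel_measurable (PiM {v..<n} (\<lambda>_. borel))" by (rule measurable_tail_sq) auto
  then have [measurable]: "tail_sq n v \<in> borel_measurable (gauss {v..<n})" by (simp cong: measurable_cong_sets[OF sets_gauss refl])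
  have "(\<integral>\<^sup>+x. indicator {..0} (tail_sq n v x / 2) \<partial>gauss {v..<n}) = (\<integral>\<^sup>+s. indicator {..0} s \<partial>gamma_law (real (n - v) / 2) 1)"
    by (rule tail_sq_law[OF assms]) auto
  also have "\<dots> = 0"
    by (subst nn_integral_gamma_law) (auto intro!: nn_integral_zero' AE_I2 simp: gamma_density_def split: split_indicator)
  finally have "AE x in gauss {v..<n}. indicator {..0} (tail_sq n v x / 2) = (0 :: ennreal)"
    by (subst (asm) nn_integral_0_iff_AE) auto
  then show ?thesis by eventually_elim (auto simp: indicator_def split: if_splits)
qed

text \<open>The marginal in \<open>y\<close> of the joint law, after restriction to the coordinates
  from \<open>u\<close> on; the halves cancel in the difference of logarithms. The indicator removes
  a null set on which the logarithms would have no meaning.\<close>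

lemma column_law:
  fixes h :: "real \<Rightarrow> ennreal"
  assumes uv: "u \<le> v" "v < n" and [measurable]: "h \<in> borel_measurable borel"
  shows "(\<integral>\<^sup>+x. h (ln (tail_sq n u x) - ln (tail_sq n v x)) * indicator {0<..} (tail_sq n v x) \<partial>gauss {..<n}) =
    (\<integral>\<^sup>+y. h y \<partial>convs (half_betas n [u..<v]))"
proof -
  interpret product_prob_space "\<lambda>_::nat. std_normal_distribution" by (rule product_prob_space_std_normal)
  interpret Gm: real_distribution "gamma_law (real (n - u) / 2) 1"
    by (rule real_distribution_gamma_law) (use uv in auto)
  let ?f = "\<lambda>x. h (ln (tail_sq n u x) - ln (tail_sq n v x)) * indicator {0<..} (tail_sq n v x)"
  have restr: "tail_sq n w (restrict x {u..<n}) = tail_sq n w x" if "u \<le> w" for w x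
    unfolding tail_sq_def using that by (intro sum.cong) auto
  have [measurable]: "tail_sq n v \<in> borel_measurable (PiM {u..<n} (\<lambda>_. borel))" "tail_sq n u \<in> borel_measurable (PiM {u..<n} (\<lambda>_. borel))"
    using uv by (auto intro!: measurable_tail_sq)
  note measurable_tail_sq[measurable del]
  have d: "distr (gauss {..<n}) (gauss {u..<n}) (\<lambda>x. restrict x {u..<n}) = gauss {u..<n}"
    by (rule distr_restrict[symmetric]) auto
  have "(\<integral>\<^sup>+x. ?f x \<partial>gauss {u..<n}) = (\<integral>\<^sup>+x. ?f (restrict x {u..<n}) \<partial>gauss {..<n})"
    unfolding d[symmetric, THEN arg_cong, of "\<lambda>M. \<integral>\<^sup>+x. ?f x \<partial>M"]
  proof (rule nn_integral_distr)
    show "(\<lambda>x. restrict x {u..<n}) \<in> gauss {..<n} \<rightarrow>\<^sub>M gauss {u..<n}"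
      by (rule measurable_restrict_subset) auto
    show "?f \<in> borel_measurable (distr (gauss {..<n}) (gauss {u..<n}) (\<lambda>x. restrict x {u..<n}))"
      by measurable
  qed
  then have "(\<integral>\<^sup>+x. ?f x \<partial>gauss {..<n}) = (\<integral>\<^sup>+x. ?f x \<partial>gauss {u..<n})"
    using uv by (simp add: restr)
  also have "\<dots> = (\<integral>\<^sup>+x. h (ln (tail_sq n u x / 2) - ln (tail_sq n v x / 2)) \<partial>gauss {u..<n})"
  proof (rule nn_integral_cong_AE)
    have [measurable]: "tail_sq n v \<in> borel_measurable (PiM {v..<n} (\<lambda>_. borel))" by (rule measurable_tail_sq) simp
    have dv: "distr (gauss {u..<n}) (gauss {v..<n}) (\<lambda>x. restrict x {v..<n}) = gauss {v..<n}"
      using uv by (intro distr_restrict[symmetric]) auto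
    have "AE x in distr (gauss {u..<n}) (gauss {v..<n}) (\<lambda>x. restrict x {v..<n}). tail_sq n v x > 0"
      unfolding dv by (rule tail_sq_pos_AE[OF uv(2)])
    then have "AE x in gauss {u..<n}. tail_sq n v (restrict x {v..<n}) > 0"
      using uv by (subst (asm) AE_distr_iff) (auto intro!: measurable_restrict_subset, measurable)
    moreover have "tail_sq n v (restrict x {v..<n}) = tail_sq n v x" for x
      unfolding tail_sq_def by (intro sum.cong) auto
    ultimately have "AE x in gauss {u..<n}. tail_sq n v x > 0" by simp
    then show "AE x in gauss {u..<n}. ?f x = h (ln (tail_sq n u x / 2) - ln (tail_sq n v x / 2))"
    proof eventually_elim
      case (elim x)
      have "tail_sq n u x > 0" using elim tail_sq_antimono[OF uv(1), of n x] by linarith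
      then show ?case using elim by (simp add: ln_div)
    qed
  qed
  also have "\<dots> = (\<integral>\<^sup>+s. \<integral>\<^sup>+y. h y \<partial>convs (half_betas n [u..<v]) \<partial>gamma_law (real (n - u) / 2) 1)"
    using uv by (intro tail_sq_ratio_law[where H = "\<lambda>_ y. h y"]) auto
  also have "\<dots> = (\<integral>\<^sup>+y. h y \<partial>convs (half_betas n [u..<v]))"
    using Gm.emeasure_space_1 by simp
  finally show ?thesis .
qed

section \<open>The law of the likelihood ratio\<close>

text \<open>The logarithm of the block determinants over the full determinant, written as a sum of
  the increments due to single columns, so that it can be exposed one column at a time;
  \<open>st a\<close> is the beginning of the block of column \<open>a\<close>.\<close>

definition log_ratio :: "nat \<Rightarrow> (nat \<Rightarrow> nat) \<Rightarrow> nat \<Rightarrow> (nat \<Rightarrow> nat \<Rightarrow> real) \<Rightarrow> real" where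
  "log_ratio n st m Y = (\<Sum>a<m. ln (gram_det n a Y) - ln (gram_det n (Suc a) Y)
     + (ln (gram_det n (Suc a - st a) (\<lambda>r. Y (st a + r))) - ln (gram_det n (a - st a) (\<lambda>r. Y (st a + r)))))"

text \<open>For \<open>st\<close> constant on blocks this event guarantees that all logarithms in
  \<open>log_ratio\<close> have positive arguments.\<close>

definition nondegenerate :: "nat \<Rightarrow> (nat \<Rightarrow> nat) \<Rightarrow> nat \<Rightarrow> (nat \<Rightarrow> nat \<Rightarrow> real) \<Rightarrow> bool" where
  "nondegenerate n st m Y \<longleftrightarrow>
     (\<forall>a\<in>{..<m}. 0 < gram_det n (Suc a) Y \<and> 0 < gram_det n (Suc a - st a) (\<lambda>r. Y (st a + r)))"

text \<open>Relative to its own block, column \<open>a\<close> has \<open>st a\<close> additional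
  predecessors, and each of them costs one Beta factor. The indices fill the gap between the two
  cuts \<open>Suc a - st a\<close> and \<open>Suc a\<close> of
  \<open>gram_det_column\<close>.\<close>

definition beta_indices :: "(nat \<Rightarrow> nat) \<Rightarrow> nat \<Rightarrow> nat list" where
  "beta_indices st m = concat (map (\<lambda>a. [Suc a - st a..<Suc a]) [0..<m])"

lemma beta_indices_less: "t \<in> set (beta_indices st m) \<Longrightarrow> t < m"
  by (auto simp: beta_indices_def)

lemma measurable_gram_det_shift:
  assumes "s + v \<le> m"
  shows "(\<lambda>Y. gram_det n v (\<lambda>r. Y (s + r))) \<in> borel_measurable (PiM {..<m} (\<lambda>_. PiM {..<n} (\<lambda>_. borel)))"
proof (rule measurable_gram_det)
  fix r t assume rt: "r < v" "t < n"
  have 1: "(\<lambda>Y. Y (s + r)) \<in> PiM {..<m} (\<lambda>_::nat. PiM {..<n} (\<lambda>_. borel :: real measure)) \<rightarrow>\<^sub>M PiM {..<n} (\<lambda>_. borel)"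
    using rt assms by (intro measurable_component_singleton) auto
  have 2: "(\<lambda>y. y t) \<in> PiM {..<n} (\<lambda>_. borel :: real measure) \<rightarrow>\<^sub>M borel"
    using rt by (intro measurable_component_singleton) auto
  show "(\<lambda>Y. Y (s + r) t :: real) \<in> borel_measurable (PiM {..<m} (\<lambda>_. PiM {..<n} (\<lambda>_. borel)))"
    using measurable_compose[OF 1 2] by simp
qed

lemma measurable_log_ratio:
  assumes st: "\<And>a. st a \<le> a"
  shows "log_ratio n st m \<in> borel_measurable (PiM {..<m} (\<lambda>_. PiM {..<n} (\<lambda>_. borel)))"
  unfolding log_ratio_def[abs_def]
proof (intro borel_measurable_sum borel_measurable_add borel_measurable_diff borel_measurable_ln)
  fix a assume a: "a \<in> {..<m}"
  have "st a \<le> a" by (rule st)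
  show "(\<lambda>Y. gram_det n a Y) \<in> borel_measurable (PiM {..<m} (\<lambda>_. PiM {..<n} (\<lambda>_. borel)))"
    using measurable_gram_det_shift[of 0 a m n] a by simp
  show "(\<lambda>Y. gram_det n (Suc a) Y) \<in> borel_measurable (PiM {..<m} (\<lambda>_. PiM {..<n} (\<lambda>_. borel)))"
    using measurable_gram_det_shift[of 0 "Suc a" m n] a by simp
  show "(\<lambda>Y. gram_det n (Suc a - st a) (\<lambda>r. Y (st a + r))) \<in> borel_measurable (PiM {..<m} (\<lambda>_. PiM {..<n} (\<lambda>_. borel)))"
    "(\<lambda>Y. gram_det n (a - st a) (\<lambda>r. Y (st a + r))) \<in> borel_measurable (PiM {..<m} (\<lambda>_. PiM {..<n} (\<lambda>_. borel)))"
    using a \<open>st a \<le> a\<close> by (auto intro!: measurable_gram_det_shift)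
qed

lemma measurable_nondegenerate:
  assumes st: "\<And>a. st a \<le> a"
  shows "Measurable.pred (PiM {..<m} (\<lambda>_. PiM {..<n} (\<lambda>_. borel))) (nondegenerate n st m)"
  unfolding nondegenerate_def[abs_def]
proof (intro pred_intros_finite pred_intros_logic)
  fix a assume a: "a \<in> {..<m}"
  have "st a \<le> a" by (rule st)
  have 1: "(\<lambda>Y. gram_det n (Suc a) Y) \<in> borel_measurable (PiM {..<m} (\<lambda>_. PiM {..<n} (\<lambda>_. borel)))"
    using measurable_gram_det_shift[of 0 "Suc a" m n] a by simp
  have 2: "(\<lambda>Y. gram_det n (Suc a - st a) (\<lambda>r. Y (st a + r))) \<in> borel_measurable (PiM {..<m} (\<lambda>_. PiM {..<n} (\<lambda>_. borel)))"
    using a \<open>st a \<le> a\<close> by (intro measurable_gram_det_shift) auto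
  show "Measurable.pred (PiM {..<m} (\<lambda>_. PiM {..<n} (\<lambda>_. borel))) (\<lambda>Y. 0 < gram_det n (Suc a) Y)"
    using 1 by measurable
  show "Measurable.pred (PiM {..<m} (\<lambda>_. PiM {..<n} (\<lambda>_. borel))) (\<lambda>Y. 0 < gram_det n (Suc a - st a) (\<lambda>r. Y (st a + r)))"
    using 2 by measurable
qed simp

abbreviation gauss_columns :: "nat \<Rightarrow> nat \<Rightarrow> (nat \<Rightarrow> nat \<Rightarrow> real) measure" where
  "gauss_columns n m \<equiv> PiM {..<m} (\<lambda>_. gauss {..<n})"

lemma sets_gauss_columns: "sets (gauss_columns n m) = sets (PiM {..<m} (\<lambda>_. PiM {..<n} (\<lambda>_. borel)))"
  by (intro sets_PiM_cong sets_gauss) auto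

text \<open>Given the previous columns, the next one contributes an independent ratio of chi-squared variables.\<close>

lemma log_ratio_law:
  fixes h :: "real \<Rightarrow> ennreal"
  assumes st: "\<And>a. st a \<le> a" "\<And>a. st (Suc a) < Suc a \<Longrightarrow> st (Suc a) = st a"
    and "m < n" and "h \<in> borel_measurable borel"
  shows "(\<integral>\<^sup>+Y. h (log_ratio n st m Y) * indicator {Y. nondegenerate n st m Y} Y \<partial>gauss_columns n m) =
    (\<integral>\<^sup>+y. h y \<partial>convs (half_betas n (beta_indices st m)))"
  using assms(3,4)
proof (induction m arbitrary: h)
  case 0
  have "(\<integral>\<^sup>+y. h y \<partial>return borel 0) = h 0" using 0 by (intro nn_integral_return) auto
  moreover have "(\<integral>\<^sup>+Y. h (log_ratio n st 0 Y) * indicator {Y. nondegenerate n st 0 Y} Y \<partial>gauss_columns n 0) = h 0"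
    by (simp add: log_ratio_def nondegenerate_def PiM_empty nn_integral_count_space_finite)
  ultimately show ?case by (simp add: beta_indices_def)
next
  case (Suc m)
  note [measurable] = Suc.prems(2)
  interpret product_sigma_finite "\<lambda>_::nat. gauss {..<n}"
    by (intro product_sigma_finite.intro prob_space_imp_sigma_finite prob_space_gauss)
  let ?u = "Suc m - st m"
  let ?C = "convs (half_betas n [?u..<Suc m])" and ?D = "convs (half_betas n (beta_indices st m))"
  have rC: "real_distribution ?C"
    by (rule real_distribution_convs, rule real_distribution_half_betas[of "[?u..<Suc m]" n]) (use Suc.prems(1) in auto)
  have rD: "real_distribution ?D"
    by (rule real_distribution_convs, rule real_distribution_half_betas[of "beta_indices st m" n])
      (use Suc.prems(1) in \<open>auto dest!: beta_indices_less\<close>)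
  interpret C: real_distribution ?C by (rule rC)
  interpret D: real_distribution ?D by (rule rD)
  let ?F = "\<lambda>m Y. h (log_ratio n st m Y) * indicator {Y. nondegenerate n st m Y} Y"
  have F: "?F (Suc m) \<in> borel_measurable (gauss_columns n (Suc m))"
  proof -
    note [measurable] = measurable_log_ratio[OF st(1)] measurable_nondegenerate[OF st(1)]
    have "?F (Suc m) \<in> borel_measurable (PiM {..<Suc m} (\<lambda>_. PiM {..<n} (\<lambda>_. borel)))" by measurable
    then show ?thesis by (simp cong: measurable_cong_sets[OF sets_gauss_columns refl])
  qed
  have sm: "st m \<le> m" by (rule st)
  have loc: "gram_det n (Suc a) (Y(m := z)) = gram_det n (Suc a) Y"
    "gram_det n a (Y(m := z)) = gram_det n a Y"
    "gram_det n (Suc a - st a) (\<lambda>r. (Y(m := z)) (st a + r)) = gram_det n (Suc a - st a) (\<lambda>r. Y (st a + r))"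
    "gram_det n (a - st a) (\<lambda>r. (Y(m := z)) (st a + r)) = gram_det n (a - st a) (\<lambda>r. Y (st a + r))"
    if "a < m" for a Y z
    using that by (auto intro!: gram_det_cong)
  have loc_m: "gram_det n m (Y(m := z)) = gram_det n m Y"
    "gram_det n (m - st m) (\<lambda>r. (Y(m := z)) (st m + r)) = gram_det n (m - st m) (\<lambda>r. Y (st m + r))" for Y z
    using sm by (auto intro!: gram_det_cong)
  have ndm: "nondegenerate n st m (Y(m := z)) \<longleftrightarrow> nondegenerate n st m Y" for Y z
    by (simp add: nondegenerate_def loc del: fun_upd_apply)
  define K where "K x = (\<integral>\<^sup>+y. h (x + y) \<partial>?C)" for x
  have K: "K \<in> borel_measurable borel"
    unfolding K_def[abs_def] by measurable
  have inner: "(\<integral>\<^sup>+z. ?F (Suc m) (Y(m := z)) \<partial>gauss {..<n}) =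
    K (log_ratio n st m Y) * indicator {Y. nondegenerate n st m Y} Y" for Y
  proof (cases "nondegenerate n st m Y")
    case False
    then have "\<not> nondegenerate n st (Suc m) (Y(m := z))" for z
      unfolding ndm[symmetric, of Y z] by (simp add: nondegenerate_def lessThan_Suc del: fun_upd_apply)
    then show ?thesis using False by simp
  next
    case True
    \<comment> \<open>If column \<open>m\<close> opens a block, its block determinant is the empty
      one; otherwise \<open>st m\<close> agrees with the value for the preceding column, where
      positivity was already required.\<close>
    have pos: "gram_det n m Y > 0" "gram_det n (m - st m) (\<lambda>r. Y (st m + r)) > 0"
    proof -
      show "gram_det n m Y > 0" using True by (cases m) (auto simp: nondegenerate_def)
      show "gram_det n (m - st m) (\<lambda>r. Y (st m + r)) > 0"
      proof (cases "st m < m")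
        case True': True
        then obtain a where a: "m = Suc a" by (cases m) auto
        then have "st m = st a" using st(2)[of a] True' by simp
        moreover have "0 < gram_det n (Suc a - st a) (\<lambda>r. Y (st a + r))" using True a by (simp add: nondegenerate_def)
        ultimately show ?thesis using a by simp
      next
        case False
        then have "m - st m = 0" by simp
        then show ?thesis by (simp only: gram_det_0)
      qed
    qed
    \<comment> \<open>The rotation depends on the earlier columns, which are fixed during the inner
      integration; this is what permits the use of its Gaussian invariance.\<close>
    obtain P where P: "gauss_isometry n P" "\<And>z. gram_det n (Suc m) (Y(m := z)) = gram_det n m Y * tail_sq n (Suc m) (P z)"
      "\<And>z. gram_det n ?u (\<lambda>r. (Y(m := z)) (st m + r)) = gram_det n (m - st m) (\<lambda>r. Y (st m + r)) * tail_sq n ?u (P z)"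
      using gram_det_column[OF sm Suc.prems(1), of Y] by auto
    let ?g = "\<lambda>x. h (log_ratio n st m Y + (ln (tail_sq n ?u x) - ln (tail_sq n (Suc m) x))) * indicator {0<..} (tail_sq n (Suc m) x)"
    have [measurable]: "tail_sq n (Suc m) \<in> borel_measurable (PiM {..<n} (\<lambda>_. borel))" "tail_sq n ?u \<in> borel_measurable (PiM {..<n} (\<lambda>_. borel))"
      by (auto intro!: measurable_tail_sq)
    note measurable_tail_sq[measurable del]
    have "?F (Suc m) (Y(m := z)) = ?g (P z)" for z
    proof -
      have uS: "tail_sq n (Suc m) (P z) \<le> tail_sq n ?u (P z)" by (rule tail_sq_antimono) simp
      have "nondegenerate n st (Suc m) (Y(m := z)) \<longleftrightarrow> nondegenerate n st m (Y(m := z)) \<and>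
         0 < gram_det n (Suc m) (Y(m := z)) \<and> 0 < gram_det n ?u (\<lambda>r. (Y(m := z)) (st m + r))"
        by (auto simp: nondegenerate_def lessThan_Suc simp del: fun_upd_apply)
      also have "nondegenerate n st m (Y(m := z)) \<longleftrightarrow> True"
        using True by (simp add: ndm)
      \<comment> \<open>Both determinants gain a tail sum as a factor, and the tail from
        \<open>Suc m\<close> on is the smaller one, so its positivity decides about both.\<close>
      also have "True \<and> 0 < gram_det n (Suc m) (Y(m := z)) \<and> 0 < gram_det n ?u (\<lambda>r. (Y(m := z)) (st m + r)) \<longleftrightarrow> 0 < tail_sq n (Suc m) (P z)"
        unfolding P(2,3) using pos uS by (auto simp: zero_less_mult_iff)
      finally have nd: "nondegenerate n st (Suc m) (Y(m := z)) \<longleftrightarrow> 0 < tail_sq n (Suc m) (P z)" .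
      show ?thesis
      proof (cases "0 < tail_sq n (Suc m) (P z)")
        case pz: True
        then have pu: "0 < tail_sq n ?u (P z)" using uS by linarith
        have "log_ratio n st (Suc m) (Y(m := z)) = log_ratio n st m (Y(m := z)) + (ln (gram_det n m (Y(m := z))) - ln (gram_det n (Suc m) (Y(m := z)))
           + (ln (gram_det n ?u (\<lambda>r. (Y(m := z)) (st m + r))) - ln (gram_det n (m - st m) (\<lambda>r. (Y(m := z)) (st m + r)))))"
          by (simp add: log_ratio_def del: fun_upd_apply)
        also have "log_ratio n st m (Y(m := z)) = log_ratio n st m Y"
          unfolding log_ratio_def by (intro sum.cong refl) (simp add: loc del: fun_upd_apply)
        also have "ln (gram_det n m (Y(m := z))) - ln (gram_det n (Suc m) (Y(m := z)))
           + (ln (gram_det n ?u (\<lambda>r. (Y(m := z)) (st m + r))) - ln (gram_det n (m - st m) (\<lambda>r. (Y(m := z)) (st m + r))))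
           = ln (tail_sq n ?u (P z)) - ln (tail_sq n (Suc m) (P z))"
          unfolding P(2,3) loc_m using pos pz pu by (simp add: ln_mult)
        finally show ?thesis using nd pz by (simp del: fun_upd_apply)
      qed (use nd in \<open>simp del: fun_upd_apply\<close>)
    qed
    then have "(\<integral>\<^sup>+z. ?F (Suc m) (Y(m := z)) \<partial>gauss {..<n}) = (\<integral>\<^sup>+z. ?g (P z) \<partial>gauss {..<n})" by simp
    also have "\<dots> = (\<integral>\<^sup>+z. ?g z \<partial>gauss {..<n})"
    proof -
      have "?g \<in> borel_measurable (PiM {..<n} (\<lambda>_. borel))" by measurable
      from P(1)[unfolded gauss_isometry_def, THEN conjunct2, THEN conjunct1, rule_format, OF this]
      show ?thesis .
    qed
    also have "\<dots> = (\<integral>\<^sup>+y. h (log_ratio n st m Y + y) \<partial>?C)"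
      using Suc.prems(1) sm by (intro column_law) auto
    finally show ?thesis using True by (simp add: K_def)
  qed
  have ins: "{..<Suc m} = insert m {..<m}" by auto
  have "(\<integral>\<^sup>+Y. ?F (Suc m) Y \<partial>gauss_columns n (Suc m)) = (\<integral>\<^sup>+Y. \<integral>\<^sup>+z. ?F (Suc m) (Y(m := z)) \<partial>gauss {..<n} \<partial>gauss_columns n m)"
    using F unfolding ins by (intro product_nn_integral_insert) auto
  also have "\<dots> = (\<integral>\<^sup>+Y. K (log_ratio n st m Y) * indicator {Y. nondegenerate n st m Y} Y \<partial>gauss_columns n m)"
    unfolding inner ..
  also have "\<dots> = (\<integral>\<^sup>+x. K x \<partial>?D)"
    using Suc.prems(1) K by (intro Suc.IH) auto
  also have "\<dots> = (\<integral>\<^sup>+x. \<integral>\<^sup>+y. h (x + y) \<partial>?C \<partial>?D)" by (simp only: K_def)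
  also have "\<dots> = (\<integral>\<^sup>+x. h x \<partial>(?D \<star> ?C))"
    by (rule nn_integral_convolution[OF D.finite_measure_axioms C.finite_measure_axioms C.events_eq_borel D.events_eq_borel, symmetric]) measurable
  also have "(?D \<star> ?C) = convs (half_betas n (beta_indices st m) @ half_betas n [?u..<Suc m])"
    using Suc.prems(1) by (intro convs_append[symmetric])
      (auto intro!: real_distribution_log_beta_law dest!: beta_indices_less)
  also have "half_betas n (beta_indices st m) @ half_betas n [?u..<Suc m] = half_betas n (beta_indices st (Suc m))"
    by (simp add: beta_indices_def)
  finally show ?case .
qed

section \<open>Interchanging rows and columns of a product measure\<close>

lemma uncurry_PiM:
  assumes N: "prob_space N" and I: "finite I" and J: "finite J"
  shows "distr (PiM I (\<lambda>_. PiM J (\<lambda>_. N))) (PiM (I \<times> J) (\<lambda>_. N)) (\<lambda>\<omega>. \<lambda>p\<in>I \<times> J. \<omega> (fst p) (snd p)) = PiM (I \<times> J) (\<lambda>_. N)"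
proof (rule product_sigma_finite.PiM_eqI)
  interpret N: prob_space N by fact
  interpret J: product_sigma_finite "\<lambda>_. N" by (intro product_sigma_finite.intro N.sigma_finite_measure_axioms)
  interpret PJ: prob_space "PiM J (\<lambda>_. N)" by (intro prob_space_PiM N)
  interpret I: product_sigma_finite "\<lambda>_. PiM J (\<lambda>_. N)"
    by (intro product_sigma_finite.intro PJ.sigma_finite_measure_axioms)
  show "product_sigma_finite (\<lambda>_. N)" by (rule product_sigma_finite.intro) (rule N.sigma_finite_measure_axioms)
  show "finite (I \<times> J)" using I J by simp
  show "sets (distr (PiM I (\<lambda>_. PiM J (\<lambda>_. N))) (PiM (I \<times> J) (\<lambda>_. N)) (\<lambda>\<omega>. \<lambda>p\<in>I \<times> J. \<omega> (fst p) (snd p))) = sets (PiM (I \<times> J) (\<lambda>_. N))"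
    by simp
  fix A assume A: "\<And>p. p \<in> I \<times> J \<Longrightarrow> A p \<in> sets N"
  have m: "(\<lambda>\<omega>. \<lambda>p\<in>I \<times> J. \<omega> (fst p) (snd p)) \<in> PiM I (\<lambda>_. PiM J (\<lambda>_. N)) \<rightarrow>\<^sub>M PiM (I \<times> J) (\<lambda>_. N)"
  proof (rule measurable_restrict)
    fix p assume p: "p \<in> I \<times> J"
    show "(\<lambda>\<omega>. \<omega> (fst p) (snd p)) \<in> PiM I (\<lambda>_. PiM J (\<lambda>_. N)) \<rightarrow>\<^sub>M N"
      using p by (intro measurable_compose[OF measurable_component_singleton[of "fst p" I] measurable_component_singleton]) auto
  qed
  have pre: "(\<lambda>\<omega>. \<lambda>p\<in>I \<times> J. \<omega> (fst p) (snd p)) -` (PiE (I \<times> J) A) \<inter> space (PiM I (\<lambda>_. PiM J (\<lambda>_. N))) =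
     PiE I (\<lambda>i. PiE J (\<lambda>j. A (i, j)))"
  proof (rule Set.set_eqI, rule iffI)
    fix \<omega> assume "\<omega> \<in> (\<lambda>\<omega>. \<lambda>p\<in>I \<times> J. \<omega> (fst p) (snd p)) -` (PiE (I \<times> J) A) \<inter> space (PiM I (\<lambda>_. PiM J (\<lambda>_. N)))"
    then have w: "(\<lambda>p\<in>I \<times> J. \<omega> (fst p) (snd p)) \<in> PiE (I \<times> J) A" "\<omega> \<in> PiE I (\<lambda>_. PiE J (\<lambda>_. space N))"
      by (auto simp: space_PiM)
    show "\<omega> \<in> PiE I (\<lambda>i. PiE J (\<lambda>j. A (i, j)))"
    proof (intro PiE_I)
      fix i j assume "i \<in> I" "j \<in> J"
      then show "\<omega> i j \<in> A (i, j)" using PiE_mem[OF w(1), of "(i, j)"] by simp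
    next
      fix i j assume "i \<in> I" "j \<notin> J"
      then show "\<omega> i j = undefined" using PiE_mem[OF w(2), of i] by (intro PiE_arb)
    next
      fix i assume "i \<notin> I"
      then show "\<omega> i = undefined" using w(2) by (intro PiE_arb)
    qed
  next
    fix \<omega> assume w: "\<omega> \<in> PiE I (\<lambda>i. PiE J (\<lambda>j. A (i, j)))"
    have mem: "\<omega> i j \<in> A (i, j)" if "i \<in> I" "j \<in> J" for i j
      using PiE_mem[OF PiE_mem[OF w that(1)] that(2)] .
    have "\<omega> \<in> PiE I (\<lambda>_. PiE J (\<lambda>_. space N))"
    proof (intro PiE_I)
      fix i j assume "i \<in> I" "j \<in> J"
      then show "\<omega> i j \<in> space N" using mem[of i j] sets.sets_into_space[OF A[of "(i, j)"]] by auto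
    next
      fix i j assume "i \<in> I" "j \<notin> J"
      then show "\<omega> i j = undefined" using PiE_mem[OF w, of i] by (intro PiE_arb)
    next
      fix i assume "i \<notin> I"
      then show "\<omega> i = undefined" using w by (intro PiE_arb)
    qed
    moreover have "(\<lambda>p\<in>I \<times> J. \<omega> (fst p) (snd p)) \<in> PiE (I \<times> J) A"
      unfolding restrict_PiE_iff using mem by auto
    ultimately show "\<omega> \<in> (\<lambda>\<omega>. \<lambda>p\<in>I \<times> J. \<omega> (fst p) (snd p)) -` (PiE (I \<times> J) A) \<inter> space (PiM I (\<lambda>_. PiM J (\<lambda>_. N)))"
      by (simp add: space_PiM)
  qed
  have "emeasure (distr (PiM I (\<lambda>_. PiM J (\<lambda>_. N))) (PiM (I \<times> J) (\<lambda>_. N)) (\<lambda>\<omega>. \<lambda>p\<in>I \<times> J. \<omega> (fst p) (snd p))) (PiE (I \<times> J) A)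
    = emeasure (PiM I (\<lambda>_. PiM J (\<lambda>_. N))) (PiE I (\<lambda>i. PiE J (\<lambda>j. A (i, j))))"
    using A I J by (subst emeasure_distr[OF m]) (auto simp: pre intro!: sets_PiM_I_finite)
  also have "\<dots> = (\<Prod>i\<in>I. emeasure (PiM J (\<lambda>_. N)) (PiE J (\<lambda>j. A (i, j))))"
    using A I J by (intro I.emeasure_PiM) (auto intro!: sets_PiM_I_finite)
  also have "\<dots> = (\<Prod>i\<in>I. \<Prod>j\<in>J. emeasure N (A (i, j)))"
    using A J by (intro prod.cong refl J.emeasure_PiM) auto
  also have "\<dots> = (\<Prod>p\<in>I \<times> J. emeasure N (A p))"
    by (simp add: prod.cartesian_product)
  finally show "emeasure (distr (PiM I (\<lambda>_. PiM J (\<lambda>_. N))) (PiM (I \<times> J) (\<lambda>_. N)) (\<lambda>\<omega>. \<lambda>p\<in>I \<times> J. \<omega> (fst p) (snd p))) (PiE (I \<times> J) A)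
    = (\<Prod>p\<in>I \<times> J. emeasure N (A p))" .
qed

text \<open>The sample consists of independent rows, whereas the Gram determinants are exposed
  column by column. Both iterated products are compared with the product over pairs of indices,
  where the order is immaterial.\<close>

lemma transpose_PiM:
  assumes N: "prob_space N" and I: "finite I" and J: "finite J"
    and F: "F \<in> borel_measurable (PiM J (\<lambda>_. PiM I (\<lambda>_. N)))"
  shows "(\<integral>\<^sup>+\<omega>. F (\<lambda>j\<in>J. \<lambda>i\<in>I. \<omega> i j) \<partial>PiM I (\<lambda>_. PiM J (\<lambda>_. N))) = (\<integral>\<^sup>+Y. F Y \<partial>PiM J (\<lambda>_. PiM I (\<lambda>_. N)))"
proof -
  let ?Q = "PiM (J \<times> I) (\<lambda>_. N)" and ?R = "PiM (I \<times> J) (\<lambda>_. N)"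
  let ?c = "\<lambda>q. \<lambda>j\<in>J. \<lambda>i\<in>I. q (j, i)" and ?c' = "\<lambda>q. \<lambda>j\<in>J. \<lambda>i\<in>I. q (i, j)"
  have c: "?c \<in> ?Q \<rightarrow>\<^sub>M PiM J (\<lambda>_. PiM I (\<lambda>_. N))" "?c' \<in> ?R \<rightarrow>\<^sub>M PiM J (\<lambda>_. PiM I (\<lambda>_. N))"
    by (auto intro!: measurable_restrict measurable_component_singleton)
  have s: "(\<lambda>q. \<lambda>p\<in>J \<times> I. q (snd p, fst p)) \<in> ?R \<rightarrow>\<^sub>M ?Q"
    by (auto intro!: measurable_restrict measurable_component_singleton)
  interpret N: prob_space N by fact
  interpret P: product_sigma_finite "\<lambda>_::'b \<times> 'c. N" by (intro product_sigma_finite.intro N.sigma_finite_measure_axioms)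
  interpret P2: product_sigma_finite "\<lambda>_::'c \<times> 'b. N" by (intro product_sigma_finite.intro N.sigma_finite_measure_axioms)
  have swap: "distr ?R ?Q (\<lambda>q. \<lambda>p\<in>J \<times> I. q (snd p, fst p)) = ?Q"
  proof (rule P2.PiM_eqI)
    fix A assume A: "\<And>p. p \<in> J \<times> I \<Longrightarrow> A p \<in> sets N"
    have pre: "(\<lambda>q. \<lambda>p\<in>J \<times> I. q (snd p, fst p)) -` PiE (J \<times> I) A \<inter> space ?R = PiE (I \<times> J) (\<lambda>p. A (snd p, fst p))"
    proof (rule Set.set_eqI, rule iffI)
      fix q assume q: "q \<in> PiE (I \<times> J) (\<lambda>p. A (snd p, fst p))"
      have mem: "q (i, j) \<in> A (j, i)" if "i \<in> I" "j \<in> J" for i j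
        using PiE_mem[OF q, of "(i, j)"] that by simp
      have "q \<in> PiE (I \<times> J) (\<lambda>_. space N)"
      proof (intro PiE_I)
        fix p assume "p \<in> I \<times> J"
        then show "q p \<in> space N"
          using mem[of "fst p" "snd p"] sets.sets_into_space[OF A[of "(snd p, fst p)"]] by auto
      next
        fix p assume "p \<notin> I \<times> J"
        then show "q p = undefined" using q by (intro PiE_arb)
      qed
      moreover have "(\<lambda>p\<in>J \<times> I. q (snd p, fst p)) \<in> PiE (J \<times> I) A"
        unfolding restrict_PiE_iff using mem by auto
      ultimately show "q \<in> (\<lambda>q. \<lambda>p\<in>J \<times> I. q (snd p, fst p)) -` PiE (J \<times> I) A \<inter> space ?R"
        by (simp add: space_PiM)
    next
      fix q assume "q \<in> (\<lambda>q. \<lambda>p\<in>J \<times> I. q (snd p, fst p)) -` PiE (J \<times> I) A \<inter> space ?R"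
      then have q: "(\<lambda>p\<in>J \<times> I. q (snd p, fst p)) \<in> PiE (J \<times> I) A" "q \<in> PiE (I \<times> J) (\<lambda>_. space N)"
        by (auto simp: space_PiM)
      show "q \<in> PiE (I \<times> J) (\<lambda>p. A (snd p, fst p))"
      proof (intro PiE_I)
        fix p assume "p \<in> I \<times> J"
        then show "q p \<in> A (snd p, fst p)" using PiE_mem[OF q(1), of "(snd p, fst p)"] by auto
      next
        fix p assume "p \<notin> I \<times> J"
        then show "q p = undefined" using q(2) by (intro PiE_arb)
      qed
    qed
    have "emeasure (distr ?R ?Q (\<lambda>q. \<lambda>p\<in>J \<times> I. q (snd p, fst p))) (PiE (J \<times> I) A) = emeasure ?R (PiE (I \<times> J) (\<lambda>p. A (snd p, fst p)))"
      using A I J by (subst emeasure_distr[OF s]) (auto simp: pre intro!: sets_PiM_I_finite)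
    also have "\<dots> = (\<Prod>p\<in>I \<times> J. emeasure N (A (snd p, fst p)))"
      using A I J by (intro P.emeasure_PiM) auto
    also have "\<dots> = (\<Prod>p\<in>J \<times> I. emeasure N (A p))"
      by (rule prod.reindex_bij_witness[of _ "\<lambda>p. (snd p, fst p)" "\<lambda>p. (snd p, fst p)"]) auto
    finally show "emeasure (distr ?R ?Q (\<lambda>q. \<lambda>p\<in>J \<times> I. q (snd p, fst p))) (PiE (J \<times> I) A) = (\<Prod>p\<in>J \<times> I. emeasure N (A p))" .
  qed (use I J in auto)
  have mu: "(\<lambda>\<omega>. \<lambda>p\<in>A \<times> B. \<omega> (fst p) (snd p)) \<in> PiM A (\<lambda>_. PiM B (\<lambda>_. N)) \<rightarrow>\<^sub>M PiM (A \<times> B) (\<lambda>_. N)" for A :: "'x set" and B :: "'y set"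
  proof (rule measurable_restrict)
    fix p assume p: "p \<in> A \<times> B"
    show "(\<lambda>\<omega>. \<omega> (fst p) (snd p)) \<in> PiM A (\<lambda>_. PiM B (\<lambda>_. N)) \<rightarrow>\<^sub>M N"
      using p by (intro measurable_compose[OF measurable_component_singleton[of "fst p" A] measurable_component_singleton]) auto
  qed
  have Fc: "(\<lambda>q. F (?c q)) \<in> borel_measurable ?Q" "(\<lambda>q. F (?c' q)) \<in> borel_measurable ?R"
    using measurable_compose[OF c(1) F] measurable_compose[OF c(2) F] by auto
  have "(\<integral>\<^sup>+Y. F Y \<partial>PiM J (\<lambda>_. PiM I (\<lambda>_. N))) = (\<integral>\<^sup>+Y. F (?c (\<lambda>p\<in>J \<times> I. Y (fst p) (snd p))) \<partial>PiM J (\<lambda>_. PiM I (\<lambda>_. N)))"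
  proof (rule nn_integral_cong)
    fix Y assume "Y \<in> space (PiM J (\<lambda>_. PiM I (\<lambda>_. N)))"
    then have "?c (\<lambda>p\<in>J \<times> I. Y (fst p) (snd p)) = Y"
      by (auto simp: space_PiM PiE_iff fun_eq_iff extensional_def restrict_def)
    then show "F Y = F (?c (\<lambda>p\<in>J \<times> I. Y (fst p) (snd p)))" by simp
  qed
  also have "\<dots> = (\<integral>\<^sup>+q. F (?c q) \<partial>?Q)"
    by (subst uncurry_PiM[OF N J I, symmetric], subst nn_integral_distr[OF mu]) (use Fc in auto)
  also have "\<dots> = (\<integral>\<^sup>+q. F (?c (\<lambda>p\<in>J \<times> I. q (snd p, fst p))) \<partial>?R)"
    by (subst swap[symmetric], subst nn_integral_distr[OF s]) (use Fc in auto)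
  also have "\<dots> = (\<integral>\<^sup>+q. F (?c' q) \<partial>?R)"
    by (intro nn_integral_cong arg_cong[where f = F]) (auto simp: fun_eq_iff restrict_def)
  also have "\<dots> = (\<integral>\<^sup>+\<omega>. F (?c' (\<lambda>p\<in>I \<times> J. \<omega> (fst p) (snd p))) \<partial>PiM I (\<lambda>_. PiM J (\<lambda>_. N)))"
    by (subst uncurry_PiM[OF N I J, symmetric], subst nn_integral_distr[OF mu]) (use Fc in auto)
  also have "\<dots> = (\<integral>\<^sup>+\<omega>. F (\<lambda>j\<in>J. \<lambda>i\<in>I. \<omega> i j) \<partial>PiM I (\<lambda>_. PiM J (\<lambda>_. N)))"
    by (intro nn_integral_cong arg_cong[where f = F]) (auto simp: fun_eq_iff restrict_def)
  finally show ?thesis ..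
qed

section \<open>Whitening the observations\<close>

lemma product_sigma_finite_lborel: "product_sigma_finite (\<lambda>_::'i. lborel :: real measure)"
  by (intro product_sigma_finite.intro lborel.sigma_finite_measure_axioms)

lemma nn_integral_affine_lborel:
  fixes F :: "real \<Rightarrow> ennreal"
  assumes [measurable]: "F \<in> borel_measurable borel" and c: "c > 0"
  shows "(\<integral>\<^sup>+y. F (c * y + t) \<partial>lborel) = ennreal (1 / c) * (\<integral>\<^sup>+y. F y \<partial>lborel)"
proof -
  have "(\<integral>\<^sup>+y. F y \<partial>lborel) = ennreal \<bar>c\<bar> * (\<integral>\<^sup>+y. F (t + c * y) \<partial>lborel)"
    by (rule nn_integral_real_affine) (use c in auto)
  then have "ennreal (1 / c) * (\<integral>\<^sup>+y. F y \<partial>lborel) = (ennreal (1 / c) * ennreal c) * (\<integral>\<^sup>+y. F (c * y + t) \<partial>lborel)"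
    using c by (simp add: mult.assoc add.commute)
  also have "ennreal (1 / c) * ennreal c = 1" using c by (simp add: ennreal_mult[symmetric])
  finally show ?thesis by simp
qed

lemma measurable_lower_triangular:
  fixes B :: "nat \<Rightarrow> nat \<Rightarrow> real"
  shows "(\<lambda>x. \<lambda>a\<in>{..<p}. (\<Sum>b\<le>a. B a b * x b) + c a) \<in> PiM {..<p} (\<lambda>_. borel) \<rightarrow>\<^sub>M PiM {..<p} (\<lambda>_. borel)"
proof (rule measurable_restrict)
  fix a assume a: "a \<in> {..<p}"
  have "(\<lambda>x. x b) \<in> borel_measurable (PiM {..<p} (\<lambda>_. borel :: real measure))" if "b \<le> a" for b
    using a that by (intro measurable_component_singleton) auto
  then show "(\<lambda>x. (\<Sum>b\<le>a. B a b * x b) + c a) \<in> borel_measurable (PiM {..<p} (\<lambda>_. borel))"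
    by (intro borel_measurable_add borel_measurable_sum borel_measurable_times borel_measurable_const) auto
qed

lemma sets_PiM_lborel: "sets (PiM I (\<lambda>_. lborel :: real measure)) = sets (PiM I (\<lambda>_. borel))"
  by (intro sets_PiM_cong) auto

text \<open>The last coordinate occurs only in the last row, where it undergoes an affine
  substitution; removing it leaves the same problem in one dimension less. The Jacobian is therefore
  the product of the diagonal.\<close>

lemma lower_triangular_lborel:
  fixes B :: "nat \<Rightarrow> nat \<Rightarrow> real"
  assumes "\<And>a. a < p \<Longrightarrow> B a a > 0" and "F \<in> borel_measurable (PiM {..<p} (\<lambda>_. borel))"
  shows "(\<integral>\<^sup>+x. F (\<lambda>a\<in>{..<p}. (\<Sum>b\<le>a. B a b * x b) + c a) \<partial>PiM {..<p} (\<lambda>_. lborel)) =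
    ennreal (\<Prod>a<p. 1 / B a a) * (\<integral>\<^sup>+x. F x \<partial>PiM {..<p} (\<lambda>_. lborel))"
  using assms
proof (induction p arbitrary: F)
  case 0
  show ?case by (simp add: PiM_empty nn_integral_count_space_finite restrict_def)
next
  case (Suc p)
  interpret product_sigma_finite "\<lambda>_::nat. lborel :: real measure" by (rule product_sigma_finite_lborel)
  have ins: "{..<Suc p} = insert p {..<p}" by auto
  let ?T = "\<lambda>p x. \<lambda>a\<in>{..<p}. (\<Sum>b\<le>a. B a b * x b) + c a"
  note F = Suc.prems(2)
  note [measurable] = sets_PiM_lborel[measurable_cong]
  have F'[measurable]: "F \<in> borel_measurable (PiM (insert p {..<p}) (\<lambda>_. borel))" using F unfolding ins .
  have FT: "(\<lambda>x. F (?T (Suc p) x)) \<in> borel_measurable (PiM {..<Suc p} (\<lambda>_. borel))"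
    by (rule measurable_compose[OF measurable_lower_triangular F])
  define G where "G x = (\<integral>\<^sup>+y. F (x(p := y)) \<partial>lborel)" for x
  have G: "G \<in> borel_measurable (PiM {..<p} (\<lambda>_. borel))" unfolding G_def[abs_def] by measurable
  have "(\<integral>\<^sup>+x. F (?T (Suc p) x) \<partial>PiM {..<Suc p} (\<lambda>_. lborel)) =
    (\<integral>\<^sup>+x. \<integral>\<^sup>+y. F (?T (Suc p) (x(p := y))) \<partial>lborel \<partial>PiM {..<p} (\<lambda>_. lborel))"
    unfolding ins
  proof (rule product_nn_integral_insert)
    show "(\<lambda>x. F (restrict (\<lambda>a. (\<Sum>b\<le>a. B a b * x b) + c a) (insert p {..<p}))) \<in> borel_measurable (PiM (insert p {..<p}) (\<lambda>_. lborel))"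
      using FT unfolding ins by (simp cong: measurable_cong_sets[OF sets_PiM_lborel refl])
  qed auto
  also have "\<dots> = (\<integral>\<^sup>+x. ennreal (1 / B p p) * G (?T p x) \<partial>PiM {..<p} (\<lambda>_. lborel))"
  proof (rule nn_integral_cong)
    fix x :: "nat \<Rightarrow> real"
    have T: "?T (Suc p) (x(p := y)) = (?T p x)(p := B p p * y + ((\<Sum>b<p. B p b * x b) + c p))" for y
    proof
      fix a
      consider "a < p" | "a = p" | "a > p" by linarith
      then show "?T (Suc p) (x(p := y)) a = ((?T p x)(p := B p p * y + ((\<Sum>b<p. B p b * x b) + c p))) a"
      proof cases
        case 1
        then show ?thesis by (auto intro!: sum.cong)
      next
        case 2
        have "(\<Sum>b\<le>p. B p b * (x(p := y)) b) = (\<Sum>b<p. B p b * x b) + B p p * y"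
          unfolding lessThan_Suc_atMost[symmetric] by (simp add: sum.lessThan_Suc)
        then show ?thesis using 2 by simp
      qed auto
    qed
    have "(\<lambda>y. F ((?T p x)(p := y))) \<in> borel_measurable borel"
    proof -
      have "?T p x \<in> space (PiM {..<p} (\<lambda>_. borel))" by (auto simp: space_PiM)
      then have "(\<lambda>y. (?T p x)(p := y)) \<in> borel \<rightarrow>\<^sub>M PiM (insert p {..<p}) (\<lambda>_. borel)" by measurable
      then show ?thesis by measurable
    qed
    then show "(\<integral>\<^sup>+y. F (?T (Suc p) (x(p := y))) \<partial>lborel) = ennreal (1 / B p p) * G (?T p x)"
      unfolding T G_def by (intro nn_integral_affine_lborel Suc.prems(1)) auto
  qed
  also have "\<dots> = ennreal (1 / B p p) * (\<integral>\<^sup>+x. G (?T p x) \<partial>PiM {..<p} (\<lambda>_. lborel))"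
    using measurable_compose[OF measurable_lower_triangular G] by (intro nn_integral_cmult) (simp cong: measurable_cong_sets[OF sets_PiM_lborel refl])
  also have "(\<integral>\<^sup>+x. G (?T p x) \<partial>PiM {..<p} (\<lambda>_. lborel)) = ennreal (\<Prod>a<p. 1 / B a a) * (\<integral>\<^sup>+x. G x \<partial>PiM {..<p} (\<lambda>_. lborel))"
    using Suc.prems(1) by (intro Suc.IH G) auto
  also have "(\<integral>\<^sup>+x. G x \<partial>PiM {..<p} (\<lambda>_. lborel)) = (\<integral>\<^sup>+x. F x \<partial>PiM {..<Suc p} (\<lambda>_. lborel))"
    unfolding ins G_def by (rule product_nn_integral_insert[symmetric]) auto
  also have "ennreal (1 / B p p) * (ennreal (\<Prod>a<p. 1 / B a a) * (\<integral>\<^sup>+x. F x \<partial>PiM {..<Suc p} (\<lambda>_. lborel))) =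
    ennreal (\<Prod>a<Suc p. 1 / B a a) * (\<integral>\<^sup>+x. F x \<partial>PiM {..<Suc p} (\<lambda>_. lborel))"
  proof -
    have "0 \<le> (\<Prod>a<p. 1 / B a a)" using Suc.prems(1) by (intro prod_nonneg) (auto intro: less_imp_le)
    moreover have "0 \<le> 1 / B p p" using Suc.prems(1)[of p] by simp
    ultimately have "ennreal (\<Prod>a<Suc p. 1 / B a a) = ennreal (\<Prod>a<p. 1 / B a a) * ennreal (1 / B p p)"
      unfolding prod.lessThan_Suc by (rule ennreal_mult)
    then show ?thesis by (simp only: mult_ac)
  qed
  finally show ?case .
qed

lemma gauss_density:
  "gauss {..<p} = density (PiM {..<p} (\<lambda>_. lborel)) (\<lambda>x. ennreal (\<Prod>a<p. std_normal_density (x a)))"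
proof (rule product_sigma_finite.PiM_eqI[OF product_sigma_finite_std_normal, symmetric])
  interpret L: product_sigma_finite "\<lambda>_::nat. lborel :: real measure" by (rule product_sigma_finite_lborel)
  note [measurable] = sets_PiM_lborel[measurable_cong]
  show "sets (density (PiM {..<p} (\<lambda>_. lborel)) (\<lambda>x. ennreal (\<Prod>a<p. std_normal_density (x a)))) = sets (gauss {..<p})"
    by (simp add: sets_PiM_lborel sets_gauss)
  fix A assume "\<And>a. a \<in> {..<p} \<Longrightarrow> A a \<in> sets std_normal_distribution"
  then have A[measurable]: "\<And>a. a \<in> {..<p} \<Longrightarrow> A a \<in> sets borel" by simp
  have [measurable]: "(\<lambda>x. ennreal (\<Prod>a<p. std_normal_density (x a))) \<in> borel_measurable (PiM {..<p} (\<lambda>_. lborel))"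
    by measurable
  have "emeasure (density (PiM {..<p} (\<lambda>_. lborel)) (\<lambda>x. ennreal (\<Prod>a<p. std_normal_density (x a)))) (PiE {..<p} A) =
    (\<integral>\<^sup>+x. ennreal (\<Prod>a<p. std_normal_density (x a)) * indicator (PiE {..<p} A) x \<partial>PiM {..<p} (\<lambda>_. lborel))"
    using A by (intro emeasure_density) (auto intro!: sets_PiM_I_finite)
  also have "\<dots> = (\<integral>\<^sup>+x. (\<Prod>a<p. ennreal (std_normal_density (x a)) * indicator (A a) (x a)) \<partial>PiM {..<p} (\<lambda>_. lborel))"
  proof (rule nn_integral_cong)
    fix x assume x: "x \<in> space (PiM {..<p} (\<lambda>_. lborel :: real measure))"
    have "(indicator (PiE {..<p} A) x :: ennreal) = (\<Prod>a<p. indicator (A a) (x a))"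
    proof (cases "\<forall>a<p. x a \<in> A a")
      case True
      then have "x \<in> PiE {..<p} A" using x by (auto simp: space_PiM PiE_def)
      then show ?thesis using True by simp
    next
      case False
      then obtain a where "a < p" "x a \<notin> A a" by auto
      then have "x \<notin> PiE {..<p} A" by (auto dest: PiE_mem)
      moreover have "(\<Prod>a<p. indicator (A a) (x a) :: ennreal) = 0"
        using \<open>a < p\<close> \<open>x a \<notin> A a\<close> by (intro prod_zero bexI[of _ a]) auto
      ultimately show ?thesis by simp
    qed
    then show "ennreal (\<Prod>a<p. std_normal_density (x a)) * indicator (PiE {..<p} A) x =
      (\<Prod>a<p. ennreal (std_normal_density (x a)) * indicator (A a) (x a))"
      by (simp add: prod.distrib prod_ennreal)
  qed
  also have "\<dots> = (\<Prod>a<p. \<integral>\<^sup>+x. ennreal (std_normal_density x) * indicator (A a) x \<partial>lborel)"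
    using A by (intro L.product_nn_integral_prod) auto
  also have "\<dots> = (\<Prod>a<p. emeasure std_normal_distribution (A a))"
    using A by (intro prod.cong refl) (simp add: emeasure_density)
  finally show "emeasure (density (PiM {..<p} (\<lambda>_. lborel)) (\<lambda>x. ennreal (\<Prod>a<p. std_normal_density (x a)))) (PiE {..<p} A) =
    (\<Prod>a<p. emeasure std_normal_distribution (A a))" .
qed simp

definition bform :: "nat \<Rightarrow> (nat \<Rightarrow> nat \<Rightarrow> real) \<Rightarrow> (nat \<Rightarrow> real) \<Rightarrow> (nat \<Rightarrow> real) \<Rightarrow> real" where
  "bform p S x y = (\<Sum>c<p. \<Sum>e<p. x c * S c e * y e)"

lemma bform_Suc:
  "bform (Suc p) S x y = bform p S x y + (\<Sum>c<p. x c * S c p) * y p + x p * (\<Sum>e<p. S p e * y e) + x p * S p p * y p"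
  by (simp add: bform_def sum.distrib sum_distrib_left sum_distrib_right mult_ac)

lemma bform_cong:
  assumes "\<And>c. c < p \<Longrightarrow> x c = x' c" "\<And>c. c < p \<Longrightarrow> y c = y' c"
  shows "bform p S x y = bform p S x' y'"
  unfolding bform_def using assms by (intro sum.cong) auto

lemma bform_combination:
  "bform p S x (\<lambda>e. - (\<Sum>a<m. w a * B a e)) = - (\<Sum>a<m. w a * bform p S x (B a))"
proof -
  have "bform p S x (\<lambda>e. - (\<Sum>a<m. w a * B a e)) = - (\<Sum>c<p. \<Sum>e<p. \<Sum>a<m. w a * (x c * S c e * B a e))"
    by (simp add: bform_def sum_negf sum_distrib_left mult_ac)
  also have "(\<Sum>c<p. \<Sum>e<p. \<Sum>a<m. w a * (x c * S c e * B a e)) = (\<Sum>c<p. \<Sum>a<m. \<Sum>e<p. w a * (x c * S c e * B a e))"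
    by (intro sum.cong refl sum.swap)
  also have "\<dots> = (\<Sum>a<m. \<Sum>c<p. \<Sum>e<p. w a * (x c * S c e * B a e))" by (rule sum.swap)
  finally show ?thesis by (simp add: bform_def sum_distrib_left)
qed

lemma bform_commute:
  assumes "\<And>a b. a < p \<Longrightarrow> b < p \<Longrightarrow> S a b = S b a"
  shows "bform p S x y = bform p S y x"
proof -
  have "bform p S x y = (\<Sum>e<p. \<Sum>c<p. x c * S c e * y e)" unfolding bform_def by (rule sum.swap)
  also have "\<dots> = bform p S y x" unfolding bform_def using assms by (intro sum.cong refl) (auto simp: mult_ac)
  finally show ?thesis .
qed

text \<open>Gram--Schmidt for the form \<open>S\<close> preserves every block structure of \<open>S\<close>.\<close>

lemma triangular_whitening:
  fixes S :: "nat \<Rightarrow> nat \<Rightarrow> real" and blk :: "nat \<Rightarrow> nat"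
  assumes "\<And>a b. a < p \<Longrightarrow> b < p \<Longrightarrow> S a b = S b a"
    and "\<And>v. (\<exists>a<p. v a \<noteq> 0) \<Longrightarrow> bform p S v v > 0"
    and "\<And>a b. a < p \<Longrightarrow> b < p \<Longrightarrow> blk a \<noteq> blk b \<Longrightarrow> S a b = 0"
  shows "\<exists>B. (\<forall>a<p. B a a > 0) \<and> (\<forall>a<p. \<forall>b. a < b \<longrightarrow> B a b = 0) \<and>
    (\<forall>a<p. \<forall>b<p. blk a \<noteq> blk b \<longrightarrow> B a b = 0) \<and> (\<forall>a<p. \<forall>b<p. bform p S (B a) (B b) = of_bool (a = b))"
  using assms
proof (induction p)
  case (Suc p)
  note sym = Suc.prems(1) and pd = Suc.prems(2) and sp = Suc.prems(3)
  have pd': "bform p S v v > 0" if "\<exists>a<p. v a \<noteq> 0" for v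
  proof -
    have "0 < bform (Suc p) S (v(p := 0)) (v(p := 0))" using that by (intro pd) auto
    also have "\<dots> = bform p S (v(p := 0)) (v(p := 0))" by (simp add: bform_Suc)
    also have "\<dots> = bform p S v v" by (intro bform_cong) auto
    finally show ?thesis .
  qed
  obtain B where B: "\<And>a. a < p \<Longrightarrow> B a a > 0" "\<And>a b. a < p \<Longrightarrow> a < b \<Longrightarrow> B a b = 0"
    "\<And>a b. a < p \<Longrightarrow> b < p \<Longrightarrow> blk a \<noteq> blk b \<Longrightarrow> B a b = 0"
    "\<And>a b. a < p \<Longrightarrow> b < p \<Longrightarrow> bform p S (B a) (B b) = of_bool (a = b)"
  proof -
    have "\<exists>B. (\<forall>a<p. B a a > 0) \<and> (\<forall>a<p. \<forall>b. a < b \<longrightarrow> B a b = 0) \<and>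
      (\<forall>a<p. \<forall>b<p. blk a \<noteq> blk b \<longrightarrow> B a b = 0) \<and> (\<forall>a<p. \<forall>b<p. bform p S (B a) (B b) = of_bool (a = b))"
      by (rule Suc.IH[OF sym pd' sp]) auto
    then obtain B where "\<forall>a<p. B a a > 0" "\<forall>a<p. \<forall>b. a < b \<longrightarrow> B a b = 0"
      "\<forall>a<p. \<forall>b<p. blk a \<noteq> blk b \<longrightarrow> B a b = 0" "\<forall>a<p. \<forall>b<p. bform p S (B a) (B b) = of_bool (a = b)"
      by (elim exE conjE)
    then show ?thesis by (intro that[of B]) simp_all
  qed
  \<comment> \<open>The \<open>S\<close>-products of the new basis vector with the rows already
    found. Subtracting the corresponding combination leaves \<open>u\<close>, orthogonal to them and
    with last entry 1, and dividing by its \<open>S\<close>-norm completes the step.\<close>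
  define w where "w a = (\<Sum>c<p. B a c * S c p)" for a
  define u0 where "u0 e = - (\<Sum>a<p. w a * B a e)" for e
  define u where "u = u0(p := 1)"
  have up: "u p = 1" by (simp add: u_def)
  have u_lt: "u e = u0 e" if "e < p" for e using that by (simp add: u_def)
  have Bu: "bform (Suc p) S (B a) u = 0" if a: "a < p" for a
  proof -
    have "bform (Suc p) S (B a) u = bform p S (B a) u + w a"
      using a B(2)[of a p] by (simp add: bform_Suc up w_def)
    also have "bform p S (B a) u = bform p S (B a) u0" by (intro bform_cong) (auto simp: u_lt)
    also have "\<dots> = - (\<Sum>a'<p. w a' * bform p S (B a) (B a'))"
      unfolding u0_def by (rule bform_combination)
    also have "(\<Sum>a'<p. w a' * bform p S (B a) (B a')) = (\<Sum>a'<p. if a' = a then w a' else 0)"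
      using a by (intro sum.cong) (auto simp: B(4))
    also have "\<dots> = w a" using a by simp
    finally show ?thesis by simp
  qed
  define \<sigma> where "\<sigma> = sqrt (bform (Suc p) S u u)"
  have uu: "bform (Suc p) S u u > 0" using up by (intro pd) auto
  then have s0: "\<sigma> > 0" and s2: "\<sigma> * \<sigma> = bform (Suc p) S u u" by (auto simp: \<sigma>_def)
  define B' where "B' a = (if a < p then B a else if a = p then (\<lambda>e. if e \<le> p then u e / \<sigma> else 0) else (\<lambda>_. 0))" for a
  have B'p: "bform (Suc p) S x (B' p) = bform (Suc p) S x u / \<sigma>" for x
  proof -
    have "bform (Suc p) S x (B' p) = bform (Suc p) S x (\<lambda>e. u e / \<sigma>)" by (intro bform_cong) (auto simp: B'_def)
    then show ?thesis by (simp add: bform_def sum_divide_distrib del: sum.lessThan_Suc)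
  qed
  have comm: "bform (Suc p) S x y = bform (Suc p) S y x" for x y using sym by (rule bform_commute)
  show ?case
  proof (intro exI[of _ B'] conjI allI impI)
    fix a assume a: "a < Suc p"
    show "B' a a > 0" using a B(1)[of a] s0 up by (auto simp: B'_def less_Suc_eq)
    fix b
    show "B' a b = 0" if "a < b" using a that B(2)[of a b] by (auto simp: B'_def less_Suc_eq)
    assume b: "b < Suc p"
    show "B' a b = 0" if ne: "blk a \<noteq> blk b"
    proof (cases "a < p")
      case True
      then show ?thesis using B(2)[of a p] B(3)[of a b] b ne by (auto simp: B'_def less_Suc_eq)
    next
      case False
      then have ap: "a = p" using a by simp
      with ne have bp: "b < p" using b by (cases "b = p") auto
      \<comment> \<open>Either row \<open>a'\<close> lies in the block of \<open>b\<close>, which is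
        not that of \<open>p\<close>, and then all terms of \<open>w a'\<close> vanish; or it lies
        in another block than \<open>b\<close>, and then its entry at \<open>b\<close> is
        zero.\<close>
      have "w a' * B a' b = 0" if "a' < p" for a'
      proof (cases "blk a' = blk b")
        case True
        have "B a' c * S c p = 0" if "c < p" for c
          using B(3)[OF \<open>a' < p\<close> that] sp[of c p] that True ne ap by (cases "blk a' = blk c") auto
        then have "w a' = 0" unfolding w_def by (intro sum.neutral) auto
        then show ?thesis by simp
      next
        case False
        then show ?thesis using B(3)[OF that bp] by simp
      qed
      then have "u0 b = 0" unfolding u0_def by (simp add: sum.neutral del: mult_eq_0_iff)
      then show ?thesis using ap bp by (simp add: B'_def u_lt)
    qed
    show "bform (Suc p) S (B' a) (B' b) = of_bool (a = b)"
    proof -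
      consider "a < p" "b < p" | "a < p" "b = p" | "a = p" "b < p" | "a = p" "b = p"
        using a b by (auto simp: less_Suc_eq)
      then show ?thesis
      proof cases
        case 1
        then have "bform (Suc p) S (B' a) (B' b) = bform p S (B a) (B b)"
          using B(2)[of a p] B(2)[of b p] by (simp add: bform_Suc B'_def)
        then show ?thesis using B(4) 1 by simp
      next
        case 2
        have "bform (Suc p) S (B' a) (B' p) = bform (Suc p) S (B' a) u / \<sigma>" by (rule B'p)
        moreover have "B' a = B a" using 2 by (simp add: B'_def)
        ultimately show ?thesis using Bu[of a] 2 by simp
      next
        case 3
        have "bform (Suc p) S (B' b) (B' p) = bform (Suc p) S (B' b) u / \<sigma>" by (rule B'p)
        moreover have "B' b = B b" using 3 by (simp add: B'_def)
        ultimately have "bform (Suc p) S (B' b) (B' p) = 0" using Bu[of b] 3 by simp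
        then show ?thesis using comm[of "B' b" "B' p"] 3 by simp
      next
        case 4
        have "bform (Suc p) S (B' p) (B' p) = bform (Suc p) S (B' p) u / \<sigma>" by (rule B'p)
        also have "bform (Suc p) S (B' p) u = bform (Suc p) S u u / \<sigma>" unfolding comm[of "B' p" u] by (rule B'p)
        finally show ?thesis using 4 s0 s2[symmetric] by simp
      qed
    qed
  qed
qed simp

abbreviation tri_mat :: "nat \<Rightarrow> (nat \<Rightarrow> nat \<Rightarrow> real) \<Rightarrow> real mat" where
  "tri_mat p B \<equiv> Matrix.mat p p (\<lambda>(a, b). B a b)"

text \<open>The equation \<open>B S B^T = 1\<close> with positive diagonal makes \<open>B\<close>
  the inverse of the lower triangular Cholesky factor of \<open>S\<close>.\<close>

definition whitening :: "nat \<Rightarrow> real mat \<Rightarrow> (nat \<Rightarrow> nat \<Rightarrow> real) \<Rightarrow> bool" where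
  "whitening p S B \<longleftrightarrow> (\<forall>a<p. B a a > 0) \<and> (\<forall>a<p. \<forall>b. a < b \<longrightarrow> B a b = 0) \<and>
     tri_mat p B * (S * transpose_mat (tri_mat p B)) = 1\<^sub>m p"

lemma whitening_exists:
  fixes blk :: "nat \<Rightarrow> nat"
  assumes S: "pos_def_mat p S" and sp: "\<And>a b. a < p \<Longrightarrow> b < p \<Longrightarrow> blk a \<noteq> blk b \<Longrightarrow> S $$ (a, b) = 0"
  shows "\<exists>B. whitening p S B \<and> (\<forall>a<p. \<forall>b<p. blk a \<noteq> blk b \<longrightarrow> B a b = 0)"
proof -
  have Sc[simp]: "S \<in> carrier_mat p p" "dim_row S = p" "dim_col S = p" and St: "transpose_mat S = S"
    using S by (auto simp: pos_def_mat_def)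
  let ?S = "\<lambda>a b. S $$ (a, b)"
  have sym: "?S a b = ?S b a" if "a < p" "b < p" for a b
    using arg_cong[OF St, of "\<lambda>A. A $$ (b, a)"] that by simp
  have pd: "bform p ?S v v > 0" if v: "\<exists>a<p. v a \<noteq> 0" for v
  proof -
    let ?v = "Matrix.vec p v"
    have "?v \<noteq> 0\<^sub>v p"
    proof
      assume "?v = 0\<^sub>v p"
      then have "?v $ a = 0" if "a < p" for a using that by simp
      then show False using v by auto
    qed
    then have "0 < scalar_prod ?v (S *\<^sub>v ?v)" using S by (auto simp: pos_def_mat_def)
    also have "scalar_prod ?v (S *\<^sub>v ?v) = bform p ?S v v"
      by (simp add: scalar_prod_def bform_def lessThan_atLeast0 sum_distrib_left mult.assoc)
    finally show ?thesis .
  qed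
  obtain B where B: "\<forall>a<p. B a a > 0" "\<forall>a<p. \<forall>b. a < b \<longrightarrow> B a b = 0"
    "\<forall>a<p. \<forall>b<p. blk a \<noteq> blk b \<longrightarrow> B a b = 0" "\<forall>a<p. \<forall>b<p. bform p ?S (B a) (B b) = of_bool (a = b)"
  proof -
    have "\<exists>B. (\<forall>a<p. B a a > 0) \<and> (\<forall>a<p. \<forall>b. a < b \<longrightarrow> B a b = 0) \<and>
      (\<forall>a<p. \<forall>b<p. blk a \<noteq> blk b \<longrightarrow> B a b = 0) \<and> (\<forall>a<p. \<forall>b<p. bform p ?S (B a) (B b) = of_bool (a = b))"
      by (rule triangular_whitening) (use sym pd sp in auto)
    then show ?thesis using that by (elim exE conjE)
  qed
  have "tri_mat p B * (S * transpose_mat (tri_mat p B)) = 1\<^sub>m p"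
  proof (rule eq_matI)
    fix a b assume "a < dim_row (1\<^sub>m p :: real mat)" "b < dim_col (1\<^sub>m p :: real mat)"
    then have ab: "a < p" "b < p" by auto
    have "(tri_mat p B * (S * transpose_mat (tri_mat p B))) $$ (a, b) = bform p ?S (B a) (B b)"
      using ab by (simp add: scalar_prod_def bform_def lessThan_atLeast0 sum_distrib_left mult.assoc)
    then show "(tri_mat p B * (S * transpose_mat (tri_mat p B))) $$ (a, b) = 1\<^sub>m p $$ (a, b)"
      using B(4) ab by simp
  qed auto
  then show ?thesis using B by (auto simp: whitening_def)
qed

lemma det_tri_mat:
  assumes "\<forall>a<p. \<forall>b. a < b \<longrightarrow> B a b = 0"
  shows "Determinant.det (tri_mat p B) = (\<Prod>a<p. B a a)"
proof -
  have "Determinant.det (tri_mat p B) = prod_list (diag_mat (tri_mat p B))"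
    using assms by (intro det_lower_triangular[of p]) auto
  then show ?thesis by (simp add: prod_list_diag_prod lessThan_atLeast0)
qed

text \<open>From \<open>B S B^T = 1\<close> follow \<open>B^T B\<close> for the inverse of
  \<open>S\<close> and \<open>1 / (det B)^2\<close> for its determinant, and the quadratic form
  becomes the squared length of the whitened vector.\<close>

lemma mvn_density_whitened:
  assumes S: "S \<in> carrier_mat p p" and B: "whitening p S B" and mu: "\<mu> \<in> carrier_vec p"
  shows "mvn_density p \<mu> S x =
    (\<Prod>a<p. B a a) * (\<Prod>a<p. std_normal_density ((\<Sum>b\<le>a. B a b * x b) + - (\<Sum>b\<le>a. B a b * \<mu> $ b)))"
proof -
  let ?B = "tri_mat p B" and ?D = "\<Prod>a<p. B a a"
  have Bc[simp]: "?B \<in> carrier_mat p p" "transpose_mat ?B \<in> carrier_mat p p" by auto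
  have low: "\<forall>a<p. \<forall>b. a < b \<longrightarrow> B a b = 0" and diag: "\<And>a. a < p \<Longrightarrow> B a a > 0"
    and one: "?B * (S * transpose_mat ?B) = 1\<^sub>m p" using B by (auto simp: whitening_def)
  have D0: "?D > 0" using diag by (intro prod_pos) auto
  have "(S * transpose_mat ?B) * ?B = 1\<^sub>m p"
    using S by (intro mat_mult_left_right_inverse[OF _ _ one]) auto
  then have inv1: "S * (transpose_mat ?B * ?B) = 1\<^sub>m p" using S by (simp add: assoc_mult_mat[of _ p p _ p _ p])
  then have inv2: "(transpose_mat ?B * ?B) * S = 1\<^sub>m p"
    using S by (intro mat_mult_left_right_inverse[OF _ _ inv1]) auto
  have BB: "transpose_mat ?B * ?B \<in> carrier_mat p p" by (rule mult_carrier_mat) auto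
  \<comment> \<open>\<open>None\<close> would contradict that \<open>S\<close> is a unit; a value
    \<open>Some C\<close> is a two-sided inverse and hence unique.\<close>
  have "mat_inverse S = Some (transpose_mat ?B * ?B)"
  proof (cases "mat_inverse S")
    case None
    have "S \<in> Units (ring_mat TYPE(real) p ())"
      unfolding Units_def ring_mat_def using S inv1 inv2 BB
      by (auto intro!: bexI[of _ "transpose_mat ?B * ?B"] simp del: index_mult_mat)
    then show ?thesis using mat_inverse(1)[OF S None, of "()"] by simp
  next
    case (Some C)
    then have C: "S * C = 1\<^sub>m p" "C * S = 1\<^sub>m p" "C \<in> carrier_mat p p" using mat_inverse(2)[OF S] by auto
    have "C = C * (S * (transpose_mat ?B * ?B))" using C inv1 by simp
    also have "\<dots> = (C * S) * (transpose_mat ?B * ?B)" using S C(3) by (intro assoc_mult_mat[symmetric]) auto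
    also have "\<dots> = transpose_mat ?B * ?B" using C by (simp add: left_mult_one_mat[of _ p p])
    finally show ?thesis using Some by simp
  qed
  note inverse = this
  have det: "?D * ?D * Determinant.det S = 1"
  proof -
    have "Determinant.det (?B * (S * transpose_mat ?B)) = Determinant.det ?B * (Determinant.det S * Determinant.det ?B)"
      using S by (simp add: det_mult[of _ p] det_transpose[of _ p])
    then show ?thesis unfolding one det_tri_mat[OF low] by (simp add: mult_ac)
  qed
  let ?v = "Matrix.vec p x - \<mu>"
  let ?y = "\<lambda>a. (\<Sum>b\<le>a. B a b * x b) + - (\<Sum>b\<le>a. B a b * \<mu> $ b)"
  have v: "?v \<in> carrier_vec p" using mu by auto
  have Bv: "(?B *\<^sub>v ?v) $ a = ?y a" if a: "a < p" for a
  proof -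
    have "(?B *\<^sub>v ?v) $ a = (\<Sum>b=0..<p. B a b * (x b - \<mu> $ b))" using a mu by (simp add: scalar_prod_def)
    also have "\<dots> = (\<Sum>b\<le>a. B a b * (x b - \<mu> $ b))"
      using a low by (intro sum.mono_neutral_right) auto
    also have "\<dots> = ?y a" by (simp add: right_diff_distrib sum_subtractf)
    finally show ?thesis .
  qed
  have quad: "scalar_prod ?v ((transpose_mat ?B * ?B) *\<^sub>v ?v) = (\<Sum>a<p. (?y a)\<^sup>2)"
  proof -
    have "(transpose_mat ?B * ?B) *\<^sub>v ?v = transpose_mat ?B *\<^sub>v (?B *\<^sub>v ?v)"
      using v by (intro assoc_mult_mat_vec) auto
    moreover have w: "?B *\<^sub>v ?v \<in> carrier_vec p" "transpose_mat ?B *\<^sub>v (?B *\<^sub>v ?v) \<in> carrier_vec p"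
      using v by (auto intro!: mult_mat_vec_carrier[of _ p p])
    ultimately have "scalar_prod ?v ((transpose_mat ?B * ?B) *\<^sub>v ?v) = scalar_prod (transpose_mat ?B *\<^sub>v (?B *\<^sub>v ?v)) ?v"
      using v by (simp add: comm_scalar_prod[of _ p])
    also have "\<dots> = scalar_prod (?B *\<^sub>v ?v) (?B *\<^sub>v ?v)"
      using v w by (intro transpose_vec_mult_scalar[of _ p p]) auto
    also have "\<dots> = (\<Sum>a=0..<p. (?B *\<^sub>v ?v) $ a * (?B *\<^sub>v ?v) $ a)"
      unfolding scalar_prod_def by simp
    also have "\<dots> = (\<Sum>a<p. (?y a)\<^sup>2)"
      unfolding lessThan_atLeast0 by (intro sum.cong refl) (simp only: Bv power2_eq_square atLeastLessThan_iff)
    finally show ?thesis .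
  qed
  have "sqrt ((2 * pi) ^ p * Determinant.det S) = sqrt (2 * pi) ^ p / ?D"
  proof -
    have dS: "s = 1 / (d * d)" if "d > 0" "d * d * s = 1" for d s :: real using that by (simp add: field_simps)
    have rt: "sqrt (c ^ p * (1 / (d * d))) = sqrt c ^ p / d" if "d > 0" for c d :: real
      using that by (simp add: real_sqrt_mult real_sqrt_divide real_sqrt_power)
    show ?thesis unfolding dS[OF D0 det] by (rule rt[OF D0])
  qed
  then have "mvn_density p \<mu> S x = exp (- (\<Sum>a<p. (?y a)\<^sup>2) / 2) / (sqrt (2 * pi) ^ p / ?D)"
    by (simp only: mvn_density_def Let_def inverse option.sel quad)
  also have "\<dots> = ?D * ((1 / sqrt (2 * pi)) ^ p * exp (\<Sum>a<p. - (?y a)\<^sup>2 / 2))"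
    by (simp add: power_one_over sum_negf sum_divide_distrib)
  also have "(1 / sqrt (2 * pi)) ^ p * exp (\<Sum>a<p. - (?y a)\<^sup>2 / 2) = (\<Prod>a<p. std_normal_density (?y a))"
    by (simp only: std_normal_density_def prod.distrib prod_constant card_lessThan exp_sum[OF finite_lessThan])
  finally show ?thesis .
qed

definition whiten :: "nat \<Rightarrow> (nat \<Rightarrow> nat \<Rightarrow> real) \<Rightarrow> real Matrix.vec \<Rightarrow> (nat \<Rightarrow> real) \<Rightarrow> nat \<Rightarrow> real" where
  "whiten p B \<mu> x = (\<lambda>a\<in>{..<p}. (\<Sum>b\<le>a. B a b * x b) + - (\<Sum>b\<le>a. B a b * \<mu> $ b))"

lemma measurable_whiten[measurable]: "whiten p B \<mu> \<in> PiM {..<p} (\<lambda>_. borel) \<rightarrow>\<^sub>M PiM {..<p} (\<lambda>_. borel)"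
  unfolding whiten_def[abs_def] by (rule measurable_lower_triangular)

text \<open>The determinant of \<open>B\<close> in the density cancels against the Jacobian of the
  triangular substitution, which leaves the product of standard normal densities.\<close>

lemma distr_whiten:
  assumes M: "prob_space M" and X: "mvn_distributed M p \<mu> S Y" and B: "whitening p S B"
  shows "distr M (PiM {..<p} (\<lambda>_. borel)) (\<lambda>\<omega>. whiten p B \<mu> (Y \<omega>)) = gauss {..<p}"
proof (rule measure_eqI)
  have mu: "\<mu> \<in> carrier_vec p" and S: "S \<in> carrier_mat p p"
    and D: "distributed M (PiM {..<p} (\<lambda>_. lborel)) Y (\<lambda>x. ennreal (mvn_density p \<mu> S x))"
    using X by (auto simp: mvn_distributed_def pos_def_mat_def)
  note [measurable_cong] = sets_PiM_lborel
  have Y[measurable]: "Y \<in> M \<rightarrow>\<^sub>M PiM {..<p} (\<lambda>_. borel)"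
    using distributed_measurable[OF D] by (simp cong: measurable_cong_sets[OF refl sets_PiM_lborel])
  show "sets (distr M (PiM {..<p} (\<lambda>_. borel)) (\<lambda>\<omega>. whiten p B \<mu> (Y \<omega>))) = sets (gauss {..<p})"
    by (simp add: sets_gauss)
  fix A assume "A \<in> sets (distr M (PiM {..<p} (\<lambda>_. borel)) (\<lambda>\<omega>. whiten p B \<mu> (Y \<omega>)))"
  then have A[measurable]: "A \<in> sets (PiM {..<p} (\<lambda>_. borel))" by simp
  let ?D = "\<Prod>a<p. B a a"
  have diag: "\<And>a. a < p \<Longrightarrow> B a a > 0" using B by (auto simp: whitening_def)
  have D0: "?D > 0" using diag by (intro prod_pos) auto
  let ?G = "\<lambda>x. ennreal (\<Prod>a<p. std_normal_density (x a)) * indicator A x"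
  have G: "?G \<in> borel_measurable (PiM {..<p} (\<lambda>_. borel))" by measurable
  have "emeasure (distr M (PiM {..<p} (\<lambda>_. borel)) (\<lambda>\<omega>. whiten p B \<mu> (Y \<omega>))) A = (\<integral>\<^sup>+\<omega>. indicator A (whiten p B \<mu> (Y \<omega>)) \<partial>M)"
    by (subst nn_integral_distr[symmetric, of _ M "PiM {..<p} (\<lambda>_. borel)"]) auto
  also have "\<dots> = (\<integral>\<^sup>+x. ennreal (mvn_density p \<mu> S x) * indicator A (whiten p B \<mu> x) \<partial>PiM {..<p} (\<lambda>_. lborel))"
    by (rule distributed_nn_integral[OF D, symmetric]) measurable
  also have "\<dots> = (\<integral>\<^sup>+x. ennreal ?D * ?G (whiten p B \<mu> x) \<partial>PiM {..<p} (\<lambda>_. lborel))"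
  proof (rule nn_integral_cong)
    fix x
    have "mvn_density p \<mu> S x = ?D * (\<Prod>a<p. std_normal_density (whiten p B \<mu> x a))"
      unfolding mvn_density_whitened[OF S B mu] whiten_def by simp
    moreover have "0 \<le> (\<Prod>a<p. std_normal_density (whiten p B \<mu> x a))" by (intro prod_nonneg) auto
    ultimately have "ennreal (mvn_density p \<mu> S x) = ennreal ?D * ennreal (\<Prod>a<p. std_normal_density (whiten p B \<mu> x a))"
      using D0 by (simp add: ennreal_mult)
    then show "ennreal (mvn_density p \<mu> S x) * indicator A (whiten p B \<mu> x) = ennreal ?D * ?G (whiten p B \<mu> x)"
      by (simp only: mult.assoc)
  qed
  also have "\<dots> = ennreal ?D * (\<integral>\<^sup>+x. ?G (whiten p B \<mu> x) \<partial>PiM {..<p} (\<lambda>_. lborel))"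
    using measurable_compose[OF measurable_whiten G] by (intro nn_integral_cmult) (simp cong: measurable_cong_sets[OF sets_PiM_lborel refl])
  also have "(\<integral>\<^sup>+x. ?G (whiten p B \<mu> x) \<partial>PiM {..<p} (\<lambda>_. lborel)) = ennreal (\<Prod>a<p. 1 / B a a) * (\<integral>\<^sup>+x. ?G x \<partial>PiM {..<p} (\<lambda>_. lborel))"
    unfolding whiten_def by (rule lower_triangular_lborel[OF diag G])
  also have "ennreal ?D * (ennreal (\<Prod>a<p. 1 / B a a) * (\<integral>\<^sup>+x. ?G x \<partial>PiM {..<p} (\<lambda>_. lborel))) = (\<integral>\<^sup>+x. ?G x \<partial>PiM {..<p} (\<lambda>_. lborel))"
  proof -
    have "?D * (\<Prod>a<p. 1 / B a a) = (\<Prod>a<p. B a a * (1 / B a a))" by (rule prod.distrib[symmetric])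
    also have "\<dots> = 1" using less_imp_neq[OF diag] by (intro prod.neutral) force
    finally have "?D * (\<Prod>a<p. 1 / B a a) = 1" .
    moreover have "0 \<le> (\<Prod>a<p. 1 / B a a)" using diag by (intro prod_nonneg) (auto intro: less_imp_le)
    ultimately have "ennreal ?D * ennreal (\<Prod>a<p. 1 / B a a) = 1" using D0 by (simp add: ennreal_mult[symmetric])
    then show ?thesis by (simp add: mult.assoc[symmetric])
  qed
  also have "\<dots> = emeasure (gauss {..<p}) A"
  proof -
    have "(\<lambda>x. ennreal (\<Prod>a<p. std_normal_density (x a))) \<in> borel_measurable (PiM {..<p} (\<lambda>_. lborel))"
      by measurable
    then show ?thesis unfolding gauss_density using A by (simp add: emeasure_density sets_PiM_lborel)
  qed
  finally show "emeasure (distr M (PiM {..<p} (\<lambda>_. borel)) (\<lambda>\<omega>. whiten p B \<mu> (Y \<omega>))) A = emeasure (gauss {..<p}) A" .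
qed

text \<open>Independence makes the joint law of the whitened observations a product over rows;
  transposition then turns it into independent Gaussian columns.\<close>

lemma whitened_sample:
  assumes X: "iid_mvn_sample M n p \<mu> S X" and n: "n > 0" and B: "whitening p S B"
    and F: "F \<in> borel_measurable (PiM {..<p} (\<lambda>_. PiM {..<n} (\<lambda>_. borel)))"
  shows "(\<integral>\<^sup>+\<omega>. F (\<lambda>a\<in>{..<p}. \<lambda>i\<in>{..<n}. whiten p B \<mu> (X i \<omega>) a) \<partial>M) = (\<integral>\<^sup>+Y. F Y \<partial>gauss_columns n p)"
proof -
  interpret M: prob_space M using X by (simp add: iid_mvn_sample_def)
  let ?Z = "\<lambda>i \<omega>. whiten p B \<mu> (X i \<omega>)"
  have D: "\<And>i. i < n \<Longrightarrow> mvn_distributed M p \<mu> S (X i)" and ind: "M.indep_vars (\<lambda>_. PiM {..<p} (\<lambda>_. borel)) X {..<n}"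
    using X by (auto simp: iid_mvn_sample_def)
  have Xm: "X i \<in> M \<rightarrow>\<^sub>M PiM {..<p} (\<lambda>_. borel)" if "i < n" for i
    using ind that by (auto simp: M.indep_vars_def2)
  have Zm: "?Z i \<in> M \<rightarrow>\<^sub>M PiM {..<p} (\<lambda>_. borel)" if "i < n" for i
    using measurable_compose[OF Xm[OF that] measurable_whiten] by simp
  have "M.indep_vars (\<lambda>_. PiM {..<p} (\<lambda>_. borel)) ?Z {..<n}"
    by (rule M.indep_vars_compose2[OF ind]) simp
  then have "distr M (PiM {..<n} (\<lambda>_. PiM {..<p} (\<lambda>_. borel))) (\<lambda>\<omega>. \<lambda>i\<in>{..<n}. ?Z i \<omega>) =
    PiM {..<n} (\<lambda>i. distr M (PiM {..<p} (\<lambda>_. borel)) (?Z i))"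
    using n Zm by (subst (asm) M.indep_vars_iff_distr_eq_PiM') auto
  also have "\<dots> = PiM {..<n} (\<lambda>_. gauss {..<p})"
    using distr_whiten[OF M.prob_space_axioms D B] by (intro PiM_cong) auto
  finally have joint: "distr M (PiM {..<n} (\<lambda>_. PiM {..<p} (\<lambda>_. borel))) (\<lambda>\<omega>. \<lambda>i\<in>{..<n}. ?Z i \<omega>) = PiM {..<n} (\<lambda>_. gauss {..<p})" .
  let ?t = "\<lambda>w. \<lambda>a\<in>{..<p}. \<lambda>i\<in>{..<n}. w i a"
  have t: "?t \<in> PiM {..<n} (\<lambda>_. PiM {..<p} (\<lambda>_. borel :: real measure)) \<rightarrow>\<^sub>M PiM {..<p} (\<lambda>_. PiM {..<n} (\<lambda>_. borel))"
  proof (intro measurable_restrict)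
    fix a i assume ai: "a \<in> {..<p}" "i \<in> {..<n}"
    show "(\<lambda>w. w i a) \<in> PiM {..<n} (\<lambda>_. PiM {..<p} (\<lambda>_. borel :: real measure)) \<rightarrow>\<^sub>M borel"
      using ai by (intro measurable_compose[OF measurable_component_singleton[of i "{..<n}"] measurable_component_singleton]) auto
  qed
  have Ft: "(\<lambda>w. F (?t w)) \<in> borel_measurable (PiM {..<n} (\<lambda>_. PiM {..<p} (\<lambda>_. borel)))"
    by (rule measurable_compose[OF t F])
  have "(\<integral>\<^sup>+Y. F Y \<partial>gauss_columns n p) = (\<integral>\<^sup>+w. F (?t w) \<partial>PiM {..<n} (\<lambda>_. gauss {..<p}))"
    using F by (intro transpose_PiM[symmetric] prob_space_std_normal)
      (auto cong: measurable_cong_sets[OF sets_gauss_columns refl])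
  also have "\<dots> = (\<integral>\<^sup>+\<omega>. F (?t (\<lambda>i\<in>{..<n}. ?Z i \<omega>)) \<partial>M)"
    unfolding joint[symmetric] using Ft Zm by (intro nn_integral_distr) (auto intro!: measurable_restrict)
  also have "\<dots> = (\<integral>\<^sup>+\<omega>. F (\<lambda>a\<in>{..<p}. \<lambda>i\<in>{..<n}. ?Z i \<omega> a) \<partial>M)"
    by (intro nn_integral_cong arg_cong[where f = F]) (auto simp: fun_eq_iff restrict_def)
  finally show ?thesis ..
qed

text \<open>Centring removes the shift \<open>c\<close>, and the linear part changes the Gram matrix
  \<open>G\<close> into \<open>B G B^T\<close>.\<close>

lemma gram_det_affine:
  assumes y: "\<And>a i. a < q \<Longrightarrow> i < n \<Longrightarrow> y a i = (\<Sum>b\<le>a. B a b * x b i) + c a"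
    and low: "\<forall>a<q. \<forall>b. a < b \<longrightarrow> B a b = 0"
  shows "gram_det n q y = (\<Prod>a<q. B a a)\<^sup>2 * gram_det n q x"
\<comment> \<open>For an empty sample the mean is a division by zero; all inner products are then
  empty sums, and both sides vanish unless \<open>q = 0\<close>.\<close>
proof (cases "n = 0")
  case True
  then show ?thesis
  proof (cases q)
    case (Suc q')
    have z: "Matrix.mat q q (\<lambda>(a, b). 0 :: real) = 0 \<cdot>\<^sub>m 1\<^sub>m q" by (rule eq_matI) auto
    show ?thesis using Suc by (simp add: gram_det_def centered_ip_def True z[simplified Suc])
  qed simp
next
  case False
  let ?dev = "\<lambda>x i. x i - (\<Sum>j<n. x j) / real n"
  have dev: "?dev (y a) i = (\<Sum>b<q. B a b * ?dev (x b) i)" if a: "a < q" and i: "i < n" for a i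
  proof -
    have "(\<Sum>j<n. y a j) = (\<Sum>j<n. (\<Sum>b\<le>a. B a b * x b j) + c a)" using a by (intro sum.cong) (auto simp: y)
    also have "\<dots> = (\<Sum>b\<le>a. B a b * (\<Sum>j<n. x b j)) + real n * c a"
      unfolding sum.distrib by (subst sum.swap) (simp add: sum_distrib_left)
    finally have "?dev (y a) i = (\<Sum>b\<le>a. B a b * x b i) - (\<Sum>b\<le>a. B a b * (\<Sum>j<n. x b j)) / real n"
      using False a i by (simp add: y add_divide_distrib)
    also have "\<dots> = (\<Sum>b\<le>a. B a b * ?dev (x b) i)"
      by (simp add: sum_divide_distrib[symmetric] sum_subtractf right_diff_distrib)
    also have "\<dots> = (\<Sum>b<q. B a b * ?dev (x b) i)"
      using a low by (intro sum.mono_neutral_left) auto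
    finally show ?thesis .
  qed
  have ip: "centered_ip n (y a) (y b) = (\<Sum>c<q. \<Sum>e<q. B a c * centered_ip n (x c) (x e) * B b e)" if "a < q" "b < q" for a b
  proof -
    have "centered_ip n (y a) (y b) = (\<Sum>t<n. (\<Sum>c<q. B a c * ?dev (x c) t) * (\<Sum>e<q. B b e * ?dev (x e) t))"
      unfolding centered_ip_def using that by (intro sum.cong refl) (simp add: dev)
    also have "\<dots> = (\<Sum>t<n. \<Sum>c<q. \<Sum>e<q. B a c * (?dev (x c) t * ?dev (x e) t) * B b e)"
      by (simp only: sum_product) (simp add: mult_ac)
    also have "\<dots> = (\<Sum>c<q. \<Sum>t<n. \<Sum>e<q. B a c * (?dev (x c) t * ?dev (x e) t) * B b e)" by (rule sum.swap)
    also have "\<dots> = (\<Sum>c<q. \<Sum>e<q. \<Sum>t<n. B a c * (?dev (x c) t * ?dev (x e) t) * B b e)"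
      by (intro sum.cong refl sum.swap)
    also have "\<dots> = (\<Sum>c<q. \<Sum>e<q. B a c * centered_ip n (x c) (x e) * B b e)"
      by (simp only: centered_ip_def sum_distrib_left sum_distrib_right)
    finally show ?thesis .
  qed
  let ?B = "tri_mat q B" and ?G = "Matrix.mat q q (\<lambda>(a, b). centered_ip n (x a) (x b))"
  have "Matrix.mat q q (\<lambda>(a, b). centered_ip n (y a) (y b)) = ?B * (?G * transpose_mat ?B)"
  proof (rule eq_matI)
    fix a b assume "a < dim_row (?B * (?G * transpose_mat ?B))" "b < dim_col (?B * (?G * transpose_mat ?B))"
    then have ab: "a < q" "b < q" by auto
    have "(?B * (?G * transpose_mat ?B)) $$ (a, b) = (\<Sum>c<q. \<Sum>e<q. B a c * centered_ip n (x c) (x e) * B b e)"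
      using ab by (simp add: scalar_prod_def lessThan_atLeast0 sum_distrib_left mult.assoc)
    then show "Matrix.mat q q (\<lambda>(a, b). centered_ip n (y a) (y b)) $$ (a, b) = (?B * (?G * transpose_mat ?B)) $$ (a, b)"
      using ab by (simp add: ip)
  qed auto
  then have "gram_det n q y = Determinant.det ?B * (Determinant.det ?G * Determinant.det ?B)"
    unfolding gram_det_def by (simp add: det_mult[of _ q] det_transpose[of _ q] mult_carrier_mat[of _ q q _ q])
  then show ?thesis unfolding gram_det_def det_tri_mat[OF low] by (simp add: power2_eq_square mult_ac)
qed

section \<open>Block structure of the indices and invariance of the statistic\<close>

lemma block_start_Suc[simp]: "block_start d (Suc j) = block_start d j + d j"
  by (simp add: block_start_def)

lemma block_start_mono: "i \<le> j \<Longrightarrow> block_start d i \<le> block_start d j"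
  unfolding block_start_def by (intro sum_mono2) auto

definition block_of :: "(nat \<Rightarrow> nat) \<Rightarrow> nat \<Rightarrow> nat" where
  "block_of d a = (LEAST j. a < block_start d (Suc j))"

text \<open>The first index of the block containing \<open>a\<close>; indices outside the partition form their own blocks.\<close>

definition col_start :: "nat \<Rightarrow> (nat \<Rightarrow> nat) \<Rightarrow> nat \<Rightarrow> nat" where
  "col_start k d a = (if a < block_start d k then block_start d (block_of d a) else a)"

lemma block_decomposition: "a < block_start d k \<Longrightarrow> \<exists>j<k. \<exists>i<d j. a = block_start d j + i"
proof (induction k)
  case 0
  then show ?case by (simp add: block_start_def)
next
  case (Suc k)
  show ?case
  proof (cases "a < block_start d k")
    case True
    then show ?thesis using Suc.IH by (meson less_SucI)
  next
    case False
    then show ?thesis using Suc.prems by (intro exI[of _ k] conjI exI[of _ "a - block_start d k"]) auto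
  qed
qed

lemma block_of_eq: "i < d j \<Longrightarrow> block_of d (block_start d j + i) = j"
  unfolding block_of_def
proof (rule Least_equality)
  fix l assume i: "i < d j" and l: "block_start d j + i < block_start d (Suc l)"
  show "j \<le> l"
  proof (rule ccontr)
    assume "\<not> j \<le> l"
    then have "block_start d (Suc l) \<le> block_start d j" by (intro block_start_mono) simp
    then show False using l by linarith
  qed
qed simp

lemma block_start_less: "j < k \<Longrightarrow> i < d j \<Longrightarrow> block_start d j + i < block_start d k"
  using block_start_mono[of "Suc j" k d] by simp

lemma col_start_eq: "j < k \<Longrightarrow> i < d j \<Longrightarrow> col_start k d (block_start d j + i) = block_start d j"
  by (simp add: col_start_def block_of_eq block_start_less)

lemma col_start_le: "col_start k d a \<le> a"
proof (cases "a < block_start d k")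
  case True
  then obtain j i where "j < k" "i < d j" "a = block_start d j + i" using block_decomposition by blast
  then show ?thesis by (simp add: col_start_eq)
qed (simp add: col_start_def)

text \<open>This is the condition on \<open>st\<close> in \<open>log_ratio_law\<close>: a column
  that does not open a block lies in the same block as its predecessor.\<close>

lemma col_start_Suc:
  assumes "col_start k d (Suc a) < Suc a"
  shows "col_start k d (Suc a) = col_start k d a"
proof -
  have "Suc a < block_start d k" using assms by (auto simp: col_start_def split: if_splits)
  then obtain j i where ji: "j < k" "i < d j" "Suc a = block_start d j + i" using block_decomposition by blast
  have c: "col_start k d (Suc a) = block_start d j" using ji col_start_eq by metis
  then have "i > 0" using assms ji by (cases i) auto
  then have "a = block_start d j + (i - 1)" "i - 1 < d j" using ji by auto
  then have "col_start k d a = block_start d j" using ji(1) col_start_eq by metis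
  then show ?thesis using c by simp
qed

lemma sum_lessThan_add: "(\<Sum>a<m + n. F a) = (\<Sum>a<m. F a) + (\<Sum>i<n. F (m + i))"
  for F :: "nat \<Rightarrow> 'a::comm_monoid_add" and m n :: nat
  by (induction n) (auto simp: add.assoc)

lemma sum_blocks: "(\<Sum>a<block_start d k. F a) = (\<Sum>j<k. \<Sum>i<d j. F (block_start d j + i))"
  for F :: "nat \<Rightarrow> 'a::comm_monoid_add"
proof (induction k)
  case 0
  then show ?case by (simp add: block_start_def)
qed (simp add: sum_lessThan_add)

text \<open>Both sums of increments telescope, the one for the full determinant over all columns and
  the other one within every single block, where \<open>col_start\<close> is constant.\<close>

lemma log_ratio_blocks:
  "log_ratio n (col_start k d) (block_start d k) Y =
    (\<Sum>j<k. ln (gram_det n (d j) (\<lambda>r. Y (block_start d j + r)))) - ln (gram_det n (block_start d k) Y)"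
proof -
  let ?g = "\<lambda>a s. ln (gram_det n (a - s) (\<lambda>r. Y (s + r)))"
  have "log_ratio n (col_start k d) (block_start d k) Y =
    (\<Sum>a<block_start d k. ln (gram_det n a Y) - ln (gram_det n (Suc a) Y)) +
    (\<Sum>a<block_start d k. ?g (Suc a) (col_start k d a) - ?g a (col_start k d a))"
    by (simp add: log_ratio_def sum.distrib)
  also have "(\<Sum>a<block_start d k. ln (gram_det n a Y) - ln (gram_det n (Suc a) Y)) = - ln (gram_det n (block_start d k) Y)"
    by (subst sum_lessThan_telescope') simp
  also have "(\<Sum>a<block_start d k. ?g (Suc a) (col_start k d a) - ?g a (col_start k d a)) =
    (\<Sum>j<k. ln (gram_det n (d j) (\<lambda>r. Y (block_start d j + r))))"
    unfolding sum_blocks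
  proof (intro sum.cong refl)
    fix j assume j: "j \<in> {..<k}"
    have "(\<Sum>i<d j. ?g (Suc (block_start d j + i)) (col_start k d (block_start d j + i)) -
        ?g (block_start d j + i) (col_start k d (block_start d j + i))) =
      (\<Sum>i<d j. ln (gram_det n (Suc i) (\<lambda>r. Y (block_start d j + r))) - ln (gram_det n i (\<lambda>r. Y (block_start d j + r))))"
      using j by (intro sum.cong refl) (simp add: col_start_eq Suc_diff_le)
    also have "\<dots> = ln (gram_det n (d j) (\<lambda>r. Y (block_start d j + r)))"
      by (subst sum_lessThan_telescope) simp
    finally show "(\<Sum>i<d j. ?g (Suc (block_start d j + i)) (col_start k d (block_start d j + i)) -
        ?g (block_start d j + i) (col_start k d (block_start d j + i))) = ln (gram_det n (d j) (\<lambda>r. Y (block_start d j + r)))" .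
  qed
  finally show ?thesis by simp
qed

lemma det_scatter_mat: "Determinant.det (scatter_mat n q x) = gram_det n q (\<lambda>a i. x i a)"
  by (simp add: gram_det_def scatter_mat_def centered_ip_def sample_mean_def)

lemma ln_lrt_stat:
  assumes "gram_det n p (\<lambda>a i. x i a) > 0"
    and "\<And>j. j < k \<Longrightarrow> gram_det n (d j) (\<lambda>r i. x i (block_start d j + r)) > 0"
  shows "ln (lrt_stat n p k d x) = real n / 2 * (ln (gram_det n p (\<lambda>a i. x i a)) -
    (\<Sum>j<k. ln (gram_det n (d j) (\<lambda>r i. x i (block_start d j + r)))))"
proof -
  have sub: "(\<lambda>a i. subvector d j (x i) a) = (\<lambda>r i. x i (block_start d j + r))" for j
    by (simp add: subvector_def)
  have "ln (\<Prod>j<k. gram_det n (d j) (\<lambda>r i. x i (block_start d j + r)) powr (- (real n / 2))) =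
    (\<Sum>j<k. ln (gram_det n (d j) (\<lambda>r i. x i (block_start d j + r)) powr (- (real n / 2))))"
    using less_imp_neq[OF assms(2)] by (intro ln_prod) force+
  also have "\<dots> = (\<Sum>j<k. - (real n / 2) * ln (gram_det n (d j) (\<lambda>r i. x i (block_start d j + r))))"
    by (simp add: ln_powr)
  finally have P: "ln (\<Prod>j<k. gram_det n (d j) (\<lambda>r i. x i (block_start d j + r)) powr (- (real n / 2))) =
    - (real n / 2) * (\<Sum>j<k. ln (gram_det n (d j) (\<lambda>r i. x i (block_start d j + r))))"
    by (simp only: sum_distrib_left)
  have pos: "(\<Prod>j<k. gram_det n (d j) (\<lambda>r i. x i (block_start d j + r)) powr (- (real n / 2))) > 0"
    using less_imp_neq[OF assms(2)] by (intro prod_pos) force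
  show ?thesis
    unfolding lrt_stat_def det_scatter_mat sub
    using ln_mult_pos[OF _ pos, of "gram_det n p (\<lambda>a i. x i a) powr (real n / 2)"] assms(1)
    unfolding P by (simp add: ln_powr right_diff_distrib)
qed

text \<open>Under the hypothesis \<open>B\<close> is block diagonal as well as triangular. It
  multiplies the full determinant and the product of the block determinants by the same number, so
  the data and the whitened Gaussian columns have the same ratio. The exponent \<open>n / 2\<close>
  of the statistic accounts for \<open>2 * t / n\<close>.\<close>

theorem lrt_stat_law:
  assumes X: "iid_mvn_sample M n p \<mu> S X" and H0: "block_independence_hyp k d S"
    and p: "block_start d k = p" and d: "\<And>j. j < k \<Longrightarrow> d j > 0" and k: "k > 0" and pn: "p < n"
  shows "measure M {\<omega> \<in> space M. - ln (lrt_stat n p k d (\<lambda>i. X i \<omega>)) > t} =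
    measure (convs (half_betas n (beta_indices (col_start k d) p))) {2 * t / real n<..}"
proof -
  interpret M: prob_space M using X by (simp add: iid_mvn_sample_def)
  let ?K = "convs (half_betas n (beta_indices (col_start k d) p))"
  interpret K: real_distribution ?K
    by (rule real_distribution_convs, rule real_distribution_half_betas[of "beta_indices (col_start k d) p" n])
      (use pn in \<open>auto dest!: beta_indices_less\<close>)
  have n: "n > 0" using pn by simp
  have "d 0 > 0" using d k by simp
  then have p0: "p > 0" using block_start_mono[of 1 k d] k p by (simp add: block_start_def)
  have D: "mvn_distributed M p \<mu> S (X i)" if "i < n" for i
    using X that by (auto simp: iid_mvn_sample_def)
  have ind: "M.indep_vars (\<lambda>_. PiM {..<p} (\<lambda>_. borel)) X {..<n}" using X by (auto simp: iid_mvn_sample_def)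
  have S: "pos_def_mat p S" using D[OF n] by (simp add: mvn_distributed_def)
  have Sc: "S \<in> carrier_mat p p" "transpose_mat S = S" using S by (auto simp: pos_def_mat_def)
  have sym: "S $$ (a, b) = S $$ (b, a)" if "a < p" "b < p" for a b
    using arg_cong[OF Sc(2), of "\<lambda>A. A $$ (b, a)"] that Sc(1) by simp
  have sp: "S $$ (a, b) = 0" if ab: "a < p" "b < p" and ne: "block_of d a \<noteq> block_of d b" for a b
  proof -
    obtain j i where j: "j < k" "i < d j" "a = block_start d j + i" using block_decomposition ab p by blast
    obtain l m where l: "l < k" "m < d l" "b = block_start d l + m" using block_decomposition ab p by blast
    have z: "S $$ (block_start d j + i, block_start d l + m) = 0" if "j < l" "l < k" "i < d j" "m < d l" for j l i m
    proof -
      have "mat_block d S j l = 0\<^sub>m (d j) (d l)" using H0 that by (auto simp: block_independence_hyp_def)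
      then have "mat_block d S j l $$ (i, m) = 0" using that by simp
      then show ?thesis using that by (simp add: mat_block_def)
    qed
    have "j \<noteq> l" using ne j l by (auto simp: block_of_eq)
    then consider "j < l" | "l < j" by linarith
    then show ?thesis
    proof cases
      case 1
      then show ?thesis using z[of j l i m] j l by simp
    next
      case 2
      then show ?thesis using z[of l j m i] j l sym[OF ab] by simp
    qed
  qed
  obtain B where B: "whitening p S B" and Bsp: "\<And>a b. a < p \<Longrightarrow> b < p \<Longrightarrow> block_of d a \<noteq> block_of d b \<Longrightarrow> B a b = 0"
    using whitening_exists[OF S, of "block_of d"] sp by auto
  have diag: "\<And>a. a < p \<Longrightarrow> B a a > 0" and low: "\<And>a b. a < p \<Longrightarrow> a < b \<Longrightarrow> B a b = 0" using B by (auto simp: whitening_def)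
  define Z where "Z \<omega> = (\<lambda>a\<in>{..<p}. \<lambda>i\<in>{..<n}. whiten p B \<mu> (X i \<omega>) a)" for \<omega>
  define c where "c a = - (\<Sum>b\<le>a. B a b * \<mu> $ b)" for a
  have Z: "Z \<omega> a i = (\<Sum>b\<le>a. B a b * X i \<omega> b) + c a" if "a < p" "i < n" for \<omega> a i
    using that by (simp add: Z_def whiten_def c_def)
  have Gp: "gram_det n p (Z \<omega>) = (\<Prod>a<p. B a a)\<^sup>2 * gram_det n p (\<lambda>a i. X i \<omega> a)" for \<omega>
    using low by (intro gram_det_affine[where c = c]) (auto simp: Z)
  have Gj: "gram_det n (d j) (\<lambda>r. Z \<omega> (block_start d j + r)) =
    (\<Prod>r<d j. B (block_start d j + r) (block_start d j + r))\<^sup>2 * gram_det n (d j) (\<lambda>r i. X i \<omega> (block_start d j + r))" if j: "j < k" for j \<omega>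
  proof (rule gram_det_affine[where c = "\<lambda>a. c (block_start d j + a)" and B = "\<lambda>r s. B (block_start d j + r) (block_start d j + s)"])
    fix r i assume r: "r < d j" and i: "i < n"
    have rp: "block_start d j + r < p" using block_start_less[of j k r d] j r p by simp
    have "(\<Sum>b\<le>block_start d j + r. B (block_start d j + r) b * X i \<omega> b) =
      (\<Sum>b<block_start d j + Suc r. B (block_start d j + r) b * X i \<omega> b)"
      by (simp add: lessThan_Suc_atMost)
    also have "\<dots> = (\<Sum>b<block_start d j. B (block_start d j + r) b * X i \<omega> b) +
      (\<Sum>s<Suc r. B (block_start d j + r) (block_start d j + s) * X i \<omega> (block_start d j + s))"
      by (rule sum_lessThan_add)
    also have "(\<Sum>b<block_start d j. B (block_start d j + r) b * X i \<omega> b) = 0"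
    \<comment> \<open>Entries to the left of the block belong to other blocks, where
      \<open>B\<close> is zero; hence the rows of one block transform among themselves.\<close>
    proof (intro sum.neutral ballI)
      fix b assume b: "b \<in> {..<block_start d j}"
      then obtain l m where l: "l < j" "m < d l" "b = block_start d l + m" using block_decomposition[of b d j] by auto
      then have "block_of d (block_start d j + r) \<noteq> block_of d b" using r by (simp add: block_of_eq)
      then have "B (block_start d j + r) b = 0" using b rp by (intro Bsp) auto
      then show "B (block_start d j + r) b * X i \<omega> b = 0" by simp
    qed
    finally show "Z \<omega> (block_start d j + r) i = (\<Sum>s\<le>r. B (block_start d j + r) (block_start d j + s) * X i \<omega> (block_start d j + s)) + c (block_start d j + r)"
      using Z[OF rp i] by (simp add: lessThan_Suc_atMost)
  next
    show "\<forall>a<d j. \<forall>b. a < b \<longrightarrow> B (block_start d j + a) (block_start d j + b) = 0"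
      using low block_start_less[OF j] p by auto
  qed
  \<comment> \<open>The diagonal of \<open>B\<close> is the union of the diagonals of its blocks, so
    the determinant factors cancel in the ratio.\<close>
  have prods: "(\<Sum>j<k. ln ((\<Prod>r<d j. B (block_start d j + r) (block_start d j + r))\<^sup>2)) = ln ((\<Prod>a<p. B a a)\<^sup>2)"
  proof -
    have lnp: "ln ((\<Prod>a<m. f a)\<^sup>2) = (\<Sum>a<m. 2 * ln (f a))" if "\<And>a. a < m \<Longrightarrow> f a > 0" for f :: "nat \<Rightarrow> real" and m
    proof -
      have "0 < (\<Prod>a<m. f a)" using that by (intro prod_pos) auto
      moreover have "ln (\<Prod>a<m. f a) = (\<Sum>a<m. ln (f a))" using less_imp_neq[OF that] that by (intro ln_prod) force+
      ultimately show ?thesis by (simp add: ln_realpow sum_distrib_left)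
    qed
    have "(\<Sum>j<k. ln ((\<Prod>r<d j. B (block_start d j + r) (block_start d j + r))\<^sup>2)) =
      (\<Sum>j<k. \<Sum>r<d j. 2 * ln (B (block_start d j + r) (block_start d j + r)))"
    proof (intro sum.cong refl lnp)
      fix j r assume "j \<in> {..<k}" "r < d j"
      then show "B (block_start d j + r) (block_start d j + r) > 0" using block_start_less[of j k r d] p by (intro diag) auto
    qed
    also have "\<dots> = (\<Sum>a<p. 2 * ln (B a a))" by (simp only: p[symmetric] sum_blocks)
    also have "\<dots> = ln ((\<Prod>a<p. B a a)\<^sup>2)" by (rule lnp[symmetric]) (rule diag)
    finally show ?thesis .
  qed
  have stat: "- ln (lrt_stat n p k d (\<lambda>i. X i \<omega>)) = real n / 2 * log_ratio n (col_start k d) p (Z \<omega>)"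
    if nd: "nondegenerate n (col_start k d) p (Z \<omega>)" for \<omega>
  proof -
    have Zp: "gram_det n p (Z \<omega>) > 0"
      using nd p0 by (cases p) (auto simp: nondegenerate_def)
    have Zj: "gram_det n (d j) (\<lambda>r. Z \<omega> (block_start d j + r)) > 0" if j: "j < k" for j
    proof -
      \<comment> \<open>Only at the last column of block \<open>j\<close> does
        \<open>nondegenerate\<close> speak of the determinant of the whole block; this column exists
        because \<open>d j > 0\<close>.\<close>
      let ?a = "block_start d j + (d j - 1)"
      have dj: "d j > 0" by (rule d[OF j])
      have "?a < p" using block_start_less[of j k "d j - 1" d] j dj p by simp
      then have "0 < gram_det n (Suc ?a - col_start k d ?a) (\<lambda>r. Z \<omega> (col_start k d ?a + r))"
        using nd by (auto simp: nondegenerate_def)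
      moreover have "col_start k d ?a = block_start d j" using dj j by (intro col_start_eq) auto
      ultimately show ?thesis using dj by simp
    qed
    have D2: "(\<Prod>a<p. B a a)\<^sup>2 > 0" "\<And>j. j < k \<Longrightarrow> (\<Prod>r<d j. B (block_start d j + r) (block_start d j + r))\<^sup>2 > 0"
    proof -
      have "(\<Prod>a<p. B a a) > 0" using diag by (intro prod_pos) auto
      then show "(\<Prod>a<p. B a a)\<^sup>2 > 0" by (rule zero_less_power)
      fix j assume j: "j < k"
      have "(\<Prod>r<d j. B (block_start d j + r) (block_start d j + r)) > 0"
        using block_start_less[OF j] p by (intro prod_pos) (auto intro!: diag)
      then show "(\<Prod>r<d j. B (block_start d j + r) (block_start d j + r))\<^sup>2 > 0" by (rule zero_less_power)
    qed
    have Xp: "gram_det n p (\<lambda>a i. X i \<omega> a) > 0" using Zp D2(1) by (simp add: Gp zero_less_mult_iff)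
    have Xj: "gram_det n (d j) (\<lambda>r i. X i \<omega> (block_start d j + r)) > 0" if "j < k" for j
      using Zj[OF that] D2(2)[OF that] by (simp add: Gj[OF that] zero_less_mult_iff)
    have "log_ratio n (col_start k d) p (Z \<omega>) =
      (\<Sum>j<k. ln (gram_det n (d j) (\<lambda>r. Z \<omega> (block_start d j + r)))) - ln (gram_det n p (Z \<omega>))"
      using log_ratio_blocks[of n k d "Z \<omega>"] by (simp add: p)
    also have "(\<Sum>j<k. ln (gram_det n (d j) (\<lambda>r. Z \<omega> (block_start d j + r)))) =
      (\<Sum>j<k. ln ((\<Prod>r<d j. B (block_start d j + r) (block_start d j + r))\<^sup>2) + ln (gram_det n (d j) (\<lambda>r i. X i \<omega> (block_start d j + r))))"
    proof (rule sum.cong[OF refl])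
      fix j assume "j \<in> {..<k}"
      then have j: "j < k" by simp
      show "ln (gram_det n (d j) (\<lambda>r. Z \<omega> (block_start d j + r))) =
        ln ((\<Prod>r<d j. B (block_start d j + r) (block_start d j + r))\<^sup>2) + ln (gram_det n (d j) (\<lambda>r i. X i \<omega> (block_start d j + r)))"
        unfolding Gj[OF j] by (rule ln_mult_pos[OF D2(2)[OF j] Xj[OF j]])
    qed
    also have "\<dots> = ln ((\<Prod>a<p. B a a)\<^sup>2) + (\<Sum>j<k. ln (gram_det n (d j) (\<lambda>r i. X i \<omega> (block_start d j + r))))"
      unfolding sum.distrib prods ..
    also have "ln (gram_det n p (Z \<omega>)) = ln ((\<Prod>a<p. B a a)\<^sup>2) + ln (gram_det n p (\<lambda>a i. X i \<omega> a))"
      unfolding Gp by (rule ln_mult_pos[OF D2(1) Xp])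
    finally show ?thesis using ln_lrt_stat[OF Xp, of k d] Xj by (simp add: right_diff_distrib)
  qed
  have st: "\<And>a. col_start k d a \<le> a" "\<And>a. col_start k d (Suc a) < Suc a \<Longrightarrow> col_start k d (Suc a) = col_start k d a"
    by (rule col_start_le, rule col_start_Suc)
  let ?nd = "\<lambda>Y. indicator {Y. nondegenerate n (col_start k d) p Y} Y :: ennreal"
  have law: "(\<integral>\<^sup>+\<omega>. h (log_ratio n (col_start k d) p (Z \<omega>)) * ?nd (Z \<omega>) \<partial>M) = (\<integral>\<^sup>+y. h y \<partial>?K)"
    if h[measurable]: "h \<in> borel_measurable borel" for h :: "real \<Rightarrow> ennreal"
  proof -
    note [measurable] = measurable_log_ratio[OF st(1)] measurable_nondegenerate[OF st(1)]
    have F: "(\<lambda>Y. h (log_ratio n (col_start k d) p Y) * ?nd Y) \<in> borel_measurable (PiM {..<p} (\<lambda>_. PiM {..<n} (\<lambda>_. borel)))"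
      by measurable
    show ?thesis
      using whitened_sample[OF X n B F] log_ratio_law[OF st pn h] by (simp add: Z_def)
  qed
  have Xm: "X i \<in> M \<rightarrow>\<^sub>M PiM {..<p} (\<lambda>_. borel)" if "i < n" for i
    using ind that by (auto simp: M.indep_vars_def2)
  have Xia: "(\<lambda>\<omega>. X i \<omega> a) \<in> borel_measurable M" if "i < n" "a < p" for i a
    using measurable_compose[OF Xm[OF that(1)] measurable_component_singleton[of a "{..<p}" "\<lambda>_. borel"]] that by simp
  have Zm: "Z \<in> M \<rightarrow>\<^sub>M PiM {..<p} (\<lambda>_. PiM {..<n} (\<lambda>_. borel))"
    unfolding Z_def
  proof (intro measurable_restrict)
    fix a i assume ai: "a \<in> {..<p}" "i \<in> {..<n}"
    have "(\<lambda>\<omega>. whiten p B \<mu> (X i \<omega>)) \<in> M \<rightarrow>\<^sub>M PiM {..<p} (\<lambda>_. borel)"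
      using ai by (intro measurable_compose[OF Xm measurable_whiten]) auto
    from measurable_compose[OF this measurable_component_singleton[of a "{..<p}" "\<lambda>_. borel"]] ai
    show "(\<lambda>\<omega>. whiten p B \<mu> (X i \<omega>) a) \<in> borel_measurable M" by simp
  qed
  have lrtm: "(\<lambda>\<omega>. lrt_stat n p k d (\<lambda>i. X i \<omega>)) \<in> borel_measurable M"
    unfolding lrt_stat_def det_scatter_mat subvector_def
  proof (intro borel_measurable_times borel_measurable_prod)
    have [measurable]: "(\<lambda>\<omega>. gram_det n p (\<lambda>a i. X i \<omega> a)) \<in> borel_measurable M"
      by (intro measurable_gram_det Xia)
    show "(\<lambda>\<omega>. gram_det n p (\<lambda>a i. X i \<omega> a) powr (real n / 2)) \<in> borel_measurable M" by measurable
    fix j assume j: "j \<in> {..<k}"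
    have [measurable]: "(\<lambda>\<omega>. gram_det n (d j) (\<lambda>a i. X i \<omega> (block_start d j + a))) \<in> borel_measurable M"
    proof (intro measurable_gram_det Xia)
      fix r assume "r < d j"
      then show "block_start d j + r < p" using block_start_less[of j k r d] j p by simp
    qed
    show "(\<lambda>\<omega>. gram_det n (d j) (\<lambda>a i. X i \<omega> (block_start d j + a)) powr (- (real n / 2))) \<in> borel_measurable M" by measurable
  qed
  have meas: "{\<omega> \<in> space M. - ln (lrt_stat n p k d (\<lambda>i. X i \<omega>)) > t} \<in> sets M"
    using lrtm by measurable
  have ndm: "Measurable.pred M (\<lambda>\<omega>. nondegenerate n (col_start k d) p (Z \<omega>))"
    by (rule measurable_compose[OF Zm measurable_nondegenerate[OF st(1)]])
  \<comment> \<open>The law of the truncated statistic has mass 1, so taking \<open>h = 1\<close>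
    proves that degenerate samples form a null set.\<close>
  have one: "(\<integral>\<^sup>+\<omega>. ?nd (Z \<omega>) \<partial>M) = 1"
    using law[of "\<lambda>_. 1"] K.emeasure_space_1 by simp
  have AEnd: "AE \<omega> in M. nondegenerate n (col_start k d) p (Z \<omega>)"
  proof -
    have "emeasure M {\<omega> \<in> space M. nondegenerate n (col_start k d) p (Z \<omega>)} = (\<integral>\<^sup>+\<omega>. indicator {\<omega> \<in> space M. nondegenerate n (col_start k d) p (Z \<omega>)} \<omega> \<partial>M)"
      using ndm by (intro nn_integral_indicator[symmetric]) (simp add: pred_def)
    also have "\<dots> = 1" unfolding one[symmetric] by (intro nn_integral_cong) (auto simp: indicator_def)
    finally have "emeasure M {\<omega> \<in> space M. nondegenerate n (col_start k d) p (Z \<omega>)} = 1" .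
    then have "M.prob {\<omega> \<in> space M. nondegenerate n (col_start k d) p (Z \<omega>)} = 1" by (simp add: M.emeasure_eq_measure)
    then show ?thesis using ndm by (subst (asm) M.prob_Collect_eq_1) (simp_all add: pred_def)
  qed
  have "emeasure M {\<omega> \<in> space M. - ln (lrt_stat n p k d (\<lambda>i. X i \<omega>)) > t} =
    (\<integral>\<^sup>+\<omega>. indicator {\<omega> \<in> space M. - ln (lrt_stat n p k d (\<lambda>i. X i \<omega>)) > t} \<omega> \<partial>M)"
    using meas by simp
  also have "\<dots> = (\<integral>\<^sup>+\<omega>. indicator {2 * t / real n<..} (log_ratio n (col_start k d) p (Z \<omega>)) * ?nd (Z \<omega>) \<partial>M)"
  proof (rule nn_integral_cong_AE)
    show "AE \<omega> in M. indicator {\<omega> \<in> space M. - ln (lrt_stat n p k d (\<lambda>i. X i \<omega>)) > t} \<omega> =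
      indicator {2 * t / real n<..} (log_ratio n (col_start k d) p (Z \<omega>)) * ?nd (Z \<omega>)"
      using AEnd AE_space
    proof eventually_elim
      case (elim \<omega>)
      have "- ln (lrt_stat n p k d (\<lambda>i. X i \<omega>)) > t \<longleftrightarrow> log_ratio n (col_start k d) p (Z \<omega>) > 2 * t / real n"
        unfolding stat[OF elim(1)] using n by (simp add: field_simps)
      then show ?case using elim by (simp add: indicator_def)
    qed
  qed
  also have "\<dots> = (\<integral>\<^sup>+y. indicator {2 * t / real n<..} y \<partial>?K)" by (rule law) simp
  also have "\<dots> = emeasure ?K {2 * t / real n<..}" by simp
  finally show ?thesis by (simp add: measure_def)
qed

section \<open>Comparison with the chi-squared law\<close>

lemma chi_squared_eq_gamma_law: "chi_squared f = gamma_law (f / 2) (1 / 2)"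
proof -
  have "chi_squared_density f x = gamma_density (f / 2) (1 / 2) x" for x
    by (simp add: chi_squared_density_def gamma_density_def powr_divide)
  then show ?thesis by (simp add: chi_squared_def gamma_law_def)
qed

text \<open>The chi-squared tail expressed at rate 1, so that scaling the argument only moves the
  endpoints of intervals under one fixed law.\<close>

definition chi_tail :: "real \<Rightarrow> real \<Rightarrow> real" where
  "chi_tail f q = measure (gamma_law (f / 2) 1) {q / 2<..}"

lemma measure_gamma_law_tail:
  "b > 0 \<Longrightarrow> c > 0 \<Longrightarrow> measure (gamma_law b c) {q<..} = measure (gamma_law b 1) {c * q<..}"
  by (simp add: measure_def emeasure_gamma_law_tail[of b c])

lemma measure_chi_squared: "f > 0 \<Longrightarrow> measure (chi_squared f) {q<..} = chi_tail f q"
  by (simp add: chi_squared_eq_gamma_law chi_tail_def measure_gamma_law_tail[of "f / 2" "1 / 2"])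

lemma chi_tail_nonpos: "f > 0 \<Longrightarrow> q \<le> 0 \<Longrightarrow> chi_tail f q = 1"
  by (simp add: chi_tail_def measure_def emeasure_gamma_law_nonpos)

lemma chi_tail_diff:
  assumes f: "f > 0" and xy: "x \<le> y"
  shows "chi_tail f x - chi_tail f y = measure (gamma_law (f / 2) 1) {x / 2<..y / 2}"
proof -
  interpret G: real_distribution "gamma_law (f / 2) 1" by (rule real_distribution_gamma_law) (use f in auto)
  have "{x / 2<..} = {x / 2<..y / 2} \<union> {y / 2<..}" using xy by auto
  then have "chi_tail f x = measure (gamma_law (f / 2) 1) ({x / 2<..y / 2} \<union> {y / 2<..})" by (simp add: chi_tail_def)
  also have "\<dots> = measure (gamma_law (f / 2) 1) {x / 2<..y / 2} + chi_tail f y"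
    unfolding chi_tail_def by (rule G.finite_measure_Union) auto
  finally show ?thesis by simp
qed

text \<open>The endpoints \<open>v * q / 2\<close> and \<open>w * q / 2\<close> have ratio
  \<open>w / v\<close> for every \<open>q\<close>, hence a bound in which \<open>q\<close> does not
  occur.\<close>

lemma chi_tail_scale_bound:
  assumes f: "f > 0" and q: "q > 0" and v: "0 < v" "v \<le> w" and w: "1 \<le> w / v"
  shows "chi_tail f (v * q) - chi_tail f (w * q) \<le> sqrt (f / 2) * ln (w / v)"
proof -
  have "v * q \<le> w * q" using q v by simp
  then have "chi_tail f (v * q) - chi_tail f (w * q) = measure (gamma_law (f / 2) 1) {v * q / 2<..v * q / 2 * (w / v)}"
  proof -
    have "v * q / 2 * (w / v) = w * q / 2" using v by simp
    then show ?thesis using \<open>v * q \<le> w * q\<close> by (simp only: chi_tail_diff[OF f])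
  qed
  also have "\<dots> \<le> sqrt (f / 2) * ln (w / v)"
    using f q v w by (intro gamma_law_interval_bound) auto
  finally show ?thesis .
qed

lemma chi_tail_strict:
  assumes f: "f > 0" and xy: "0 \<le> x" "x < y"
  shows "chi_tail f y < chi_tail f x"
proof -
  interpret G: real_distribution "gamma_law (f / 2) 1" by (rule real_distribution_gamma_law) (use f in auto)
  have "measure (gamma_law (f / 2) 1) {x / 2<..y / 2} \<noteq> 0"
  proof
    assume "measure (gamma_law (f / 2) 1) {x / 2<..y / 2} = 0"
    then have "emeasure (gamma_law (f / 2) 1) {x / 2<..y / 2} = 0" by (simp add: G.emeasure_eq_measure)
    then have "(\<integral>\<^sup>+t. ennreal (gamma_density (f / 2) 1 t) * indicator {x / 2<..y / 2} t \<partial>lborel) = 0"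
      unfolding gamma_law_def by (subst (asm) emeasure_density) auto
    then have "AE t in lborel. ennreal (gamma_density (f / 2) 1 t) * indicator {x / 2<..y / 2} t = 0"
      by (subst (asm) nn_integral_0_iff_AE) auto
    then have "AE t in lborel. t \<notin> {x / 2<..y / 2}"
    proof eventually_elim
      case (elim t)
      have "gamma_density (f / 2) 1 t > 0" if "t > 0"
        using that f by (simp add: gamma_density_def Gamma_real_pos)
      then show ?case using elim xy by (auto simp: indicator_def not_le split: if_splits)
    qed
    then have "emeasure lborel {x / 2<..y / 2} = 0"
      by (subst (asm) AE_iff_measurable[of "{x / 2<..y / 2}"]) auto
    then show False using xy by simp
  qed
  then have "0 < measure (gamma_law (f / 2) 1) {x / 2<..y / 2}" by (simp add: less_le)
  then show ?thesis using chi_tail_diff[OF f, of x y] xy by simp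
qed

lemma chi_tail_surj:
  assumes f: "f > 0" and a: "0 < \<alpha>" "\<alpha> < 1"
  shows "\<exists>q>0. chi_tail f q = \<alpha>"
proof -
  interpret G: real_distribution "gamma_law (f / 2) 1" by (rule real_distribution_gamma_law) (use f in auto)
  have t: "chi_tail f q = 1 - cdf (gamma_law (f / 2) 1) (q / 2)" for q
  proof -
    have "{q / 2<..} = UNIV - {..q / 2}" by auto
    then show ?thesis using G.prob_compl[of "{..q / 2}"] by (simp add: chi_tail_def cdf_def)
  qed
  have c: "isCont (cdf (gamma_law (f / 2) 1)) x" for x
  proof -
    have "emeasure (gamma_law (f / 2) 1) {x} = 0"
      unfolding gamma_law_def by (subst emeasure_density) (auto simp: nn_integral_0_iff_AE intro!: AE_I[of _ _ "{x}"] split: split_indicator)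
    then show ?thesis by (simp add: G.isCont_cdf measure_def)
  qed
  have "\<forall>\<^sub>F x in at_top. 1 - \<alpha> < cdf (gamma_law (f / 2) 1) x"
    using a by (intro order_tendstoD[OF G.cdf_lim_at_top_prob]) auto
  then obtain y where "1 - \<alpha> < cdf (gamma_law (f / 2) 1) y" by (auto simp: eventually_at_top_linorder)
  then have "1 - \<alpha> \<le> cdf (gamma_law (f / 2) 1) (max 0 y)" using G.cdf_nondecreasing[of y "max 0 y"] by simp
  moreover have "cdf (gamma_law (f / 2) 1) 0 \<le> 1 - \<alpha>" using t[of 0] chi_tail_nonpos[OF f, of 0] a by simp
  ultimately obtain x where x: "0 \<le> x" "cdf (gamma_law (f / 2) 1) x = 1 - \<alpha>"
    using IVT'[of "cdf (gamma_law (f / 2) 1)" 0 "1 - \<alpha>" "max 0 y"] c by (auto simp: continuous_at_imp_continuous_on)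
  have "chi_tail f (2 * x) = \<alpha>" using x t[of "2 * x"] by simp
  moreover have "2 * x > 0" using x calculation chi_tail_nonpos[OF f, of "2 * x"] a by (cases "x = 0") auto
  ultimately show ?thesis by blast
qed

text \<open>Strict decrease on the positive half-line makes the point selected by \<open>THE\<close>
  unique there, and the remaining points are excluded because their tail is 1.\<close>

lemma chi_squared_upper_quantile_eq:
  assumes f: "f > 0" and q: "q > 0"
  shows "chi_squared_upper_quantile f (chi_tail f q) = q"
  unfolding chi_squared_upper_quantile_def measure_chi_squared[OF f]
proof (rule the_equality)
  fix y assume y: "chi_tail f y = chi_tail f q"
  have "chi_tail f q < 1" using chi_tail_strict[OF f order_refl q] chi_tail_nonpos[OF f, of 0] by simp
  then have "y > 0" using y chi_tail_nonpos[OF f, of y] by (cases "y \<le> 0") auto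
  then show "y = q" using chi_tail_strict[OF f, of y q] chi_tail_strict[OF f, of q y] y q by (cases y q rule: linorder_cases) auto
qed simp

lemma chi_tail_range: "f > 0 \<Longrightarrow> q > 0 \<Longrightarrow> chi_tail f q \<in> {0<..<1}"
proof -
  assume fq: "f > 0" "q > 0"
  have "0 \<le> chi_tail f (q + 1)" by (simp add: chi_tail_def)
  then show ?thesis
    using chi_tail_strict[of f 0 q] chi_tail_nonpos[of f 0] chi_tail_strict[of f q "q + 1"] fq by simp
qed

text \<open>Every level is the tail of some \<open>q > 0\<close>, so the supremum over levels
  becomes a supremum over \<open>q\<close>, and no quantile has to be computed.\<close>

lemma level_error_le:
  assumes f: "f > 0" and T: "\<And>q. q > 0 \<Longrightarrow> \<bar>measure M {\<omega> \<in> space M. T \<omega> > q} - chi_tail f q\<bar> \<le> \<epsilon>"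
  shows "chi_squared_level_error M T f \<le> \<epsilon>"
  unfolding chi_squared_level_error_def
proof (rule cSUP_least)
  fix \<alpha> :: real assume "\<alpha> \<in> {0<..<1}"
  then obtain q where "q > 0" "chi_tail f q = \<alpha>" using chi_tail_surj[OF f] by auto
  then show "\<bar>measure M {\<omega> \<in> space M. T \<omega> > chi_squared_upper_quantile f \<alpha>} - \<alpha>\<bar> \<le> \<epsilon>"
    using T[of q] chi_squared_upper_quantile_eq[OF f, of q] by simp
qed simp

text \<open>All differences are at most 1, so the supremum is taken over a bounded set and dominates
  each of its members.\<close>

lemma level_error_ge:
  assumes M: "prob_space M" and f: "f > 0" and q: "q > 0"
  shows "\<bar>measure M {\<omega> \<in> space M. T \<omega> > q} - chi_tail f q\<bar> \<le> chi_squared_level_error M T f"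
proof -
  have "\<bar>measure M {\<omega> \<in> space M. T \<omega> > chi_squared_upper_quantile f (chi_tail f q)} - chi_tail f q\<bar> \<le> chi_squared_level_error M T f"
    unfolding chi_squared_level_error_def
  proof (rule cSUP_upper)
    show "chi_tail f q \<in> {0<..<1}" by (rule chi_tail_range[OF f q])
    have "\<bar>measure M A - \<alpha>\<bar> \<le> 1" if "\<alpha> \<in> {0<..<1}" for A \<alpha>
      using prob_space.prob_le_1[OF M, of A] measure_nonneg[of M A] that by (simp only: greaterThanLessThan_iff) linarith
    then show "bdd_above ((\<lambda>\<alpha>. \<bar>measure M {\<omega> \<in> space M. T \<omega> > chi_squared_upper_quantile f \<alpha>} - \<alpha>\<bar>) ` {0<..<1})"
      by (intro bdd_aboveI2[of _ _ 1]) auto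
  qed
  then show ?thesis by (simp add: chi_squared_upper_quantile_eq[OF f q])
qed

lemma stoch_leD:
  assumes "real_distribution M" "real_distribution N" "stoch_le M N"
  shows "measure M {q<..} \<le> measure N {q<..}"
proof -
  interpret M: real_distribution M by fact
  interpret N: real_distribution N by fact
  have "emeasure M {q<..} \<le> emeasure N {q<..}" using assms(3) by (simp add: stoch_le_def)
  then show ?thesis by (simp add: M.emeasure_eq_measure N.emeasure_eq_measure)
qed

abbreviation half_gammas :: "real list \<Rightarrow> real measure" where
  "half_gammas cs \<equiv> convs (map (gamma_law (1/2)) cs)"

lemma real_distribution_half_gammas: "(\<And>c. c \<in> set cs \<Longrightarrow> c > 0) \<Longrightarrow> real_distribution (half_gammas cs)"
  by (intro real_distribution_convs) (auto intro: real_distribution_gamma_law)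

lemma half_gammas_rate_mono:
  assumes "\<And>t. t \<in> set ts \<Longrightarrow> 0 < c t \<and> c t \<le> c' t"
  shows "measure (half_gammas (map c' ts)) {q<..} \<le> measure (half_gammas (map c ts)) {q<..}"
proof (rule stoch_leD)
  have pos: "0 < c t" "0 < c' t" if "t \<in> set ts" for t using assms[OF that] by auto
  show "real_distribution (half_gammas (map c' ts))"
    by (rule real_distribution_half_gammas) (use pos in auto)
  show "real_distribution (half_gammas (map c ts))"
    by (rule real_distribution_half_gammas) (use pos in auto)
  have "stoch_le (convs (map (\<lambda>t. gamma_law (1/2) (c' t)) ts)) (convs (map (\<lambda>t. gamma_law (1/2) (c t)) ts))"
    using assms pos by (intro stoch_le_convs stoch_le_gamma_rate real_distribution_gamma_law) auto
  then show "stoch_le (half_gammas (map c' ts)) (half_gammas (map c ts))" by (simp add: comp_def)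
qed

lemma measure_half_gammas_const:
  assumes "c > 0" "ts \<noteq> []"
  shows "measure (half_gammas (map (\<lambda>_. c) ts)) {q<..} = chi_tail (real (length ts)) (2 * c * q)"
proof -
  have "map (gamma_law (1/2)) (map (\<lambda>_. c) ts) = replicate (length ts) (gamma_law (1/2) c)"
    by (simp add: map_replicate_const comp_def)
  then have "half_gammas (map (\<lambda>_. c) ts) = gamma_law (real (length ts) / 2) c"
    using assms by (simp add: convs_replicate_gamma_law del: map_map)
  then show ?thesis using assms by (simp add: measure_gamma_law_tail[of _ c] chi_tail_def)
qed

text \<open>The conclusion of the uniform central limit theorem as a predicate: \<open>L\<close> can
  be fixed from \<open>\<epsilon>\<close> before the sample size, and then be used for all lists of
  rates.\<close>

definition normal_tail_bound :: "real \<Rightarrow> nat \<Rightarrow> bool" where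
  "normal_tail_bound \<epsilon> L \<longleftrightarrow> (\<forall>cs \<kappa> x. \<kappa> > 0 \<longrightarrow> L \<le> length cs \<longrightarrow> (\<forall>c\<in>set cs. \<kappa> \<le> c \<and> c \<le> 2 * \<kappa>) \<longrightarrow>
     \<bar>measure (half_gammas cs) {hg_mean cs + x * hg_sd cs<..} - (1 - \<Phi> x)\<bar> \<le> \<epsilon>)"

lemma normal_tail_bound_exists: "\<epsilon> > 0 \<Longrightarrow> \<exists>L. normal_tail_bound \<epsilon> L"
  unfolding normal_tail_bound_def by (rule half_gamma_clt[of \<epsilon>]) blast+

lemma normal_tail_boundD:
  assumes "normal_tail_bound \<epsilon> L" "L \<le> length cs" "\<kappa> > 0" "\<And>c. c \<in> set cs \<Longrightarrow> \<kappa> \<le> c \<and> c \<le> 2 * \<kappa>" "hg_sd cs > 0"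
  shows "\<bar>measure (half_gammas cs) {q<..} - (1 - \<Phi> ((q - hg_mean cs) / hg_sd cs))\<bar> \<le> \<epsilon>"
proof -
  have "hg_mean cs + (q - hg_mean cs) / hg_sd cs * hg_sd cs = q" using assms(5) by simp
  moreover have "\<bar>measure (half_gammas cs) {hg_mean cs + (q - hg_mean cs) / hg_sd cs * hg_sd cs<..} - (1 - \<Phi> ((q - hg_mean cs) / hg_sd cs))\<bar> \<le> \<epsilon>"
    using assms unfolding normal_tail_bound_def by blast
  ultimately show ?thesis by simp
qed

text \<open>Chi-squared with \<open>m\<close> degrees of freedom is the case of \<open>m\<close>
  equal rates 1/2, with mean \<open>m\<close> and variance \<open>2 * m\<close>; the same
  \<open>L\<close> therefore serves the reference law.\<close>

lemma chi_tail_normal: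
  assumes "normal_tail_bound \<epsilon> L" "L \<le> m" "m > 0"
  shows "\<bar>chi_tail (real m) q - (1 - \<Phi> ((q - real m) / sqrt (2 * real m)))\<bar> \<le> \<epsilon>"
proof -
  let ?cs = "map (\<lambda>_. 1/2 :: real) [0..<m]"
  have m: "hg_mean ?cs = real m" by (simp add: hg_mean_def comp_def sum_list_triv)
  have s: "hg_sd ?cs = sqrt (2 * real m)" by (simp add: hg_sd_def comp_def sum_list_triv power2_eq_square)
  have "\<bar>measure (half_gammas ?cs) {q<..} - (1 - \<Phi> ((q - hg_mean ?cs) / hg_sd ?cs))\<bar> \<le> \<epsilon>"
    using assms by (intro normal_tail_boundD[where \<kappa> = "1/2"]) (auto simp: s)
  moreover have "measure (half_gammas ?cs) {q<..} = chi_tail (real m) q"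
    using measure_half_gammas_const[of "1/2" "[0..<m]" q] assms by simp
  ultimately show ?thesis unfolding m s by simp
qed

text \<open>For \<open>s = 0\<close> and \<open>s = 1\<close> these rates bound the sample law from below and from above.\<close>

definition shifted_rates :: "nat \<Rightarrow> nat list \<Rightarrow> real \<Rightarrow> real list" where
  "shifted_rates n ts s = map (\<lambda>t. (real (n - Suc t) - s) / 2) ts"

text \<open>The sum, not the average, of the squared deviations; the use of \<open>Suc t\<close> in
  place of \<open>t\<close> does not affect it.\<close>

definition index_variance :: "nat list \<Rightarrow> real" where
  "index_variance ts = (\<Sum>t\<leftarrow>ts. (real (Suc t) - (\<Sum>t\<leftarrow>ts. real (Suc t)) / real (length ts))\<^sup>2)"

section \<open>Estimates for one sample size and a list of indices\<close>

context
  fixes n p :: nat and ts :: "nat list"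
  assumes ts: "ts \<noteq> []" "\<And>t. t \<in> set ts \<Longrightarrow> t < p" and pn: "p + 1 < n"
begin

lemma real_distribution_sample: "real_distribution (convs (half_betas n ts))"
proof (rule real_distribution_convs)
  have a: "Suc t < n" if "t \<in> set ts" for t using ts(2)[OF that] pn by linarith
  show "real_distribution M" if "M \<in> set (half_betas n ts)" for M
    using a that by (rule real_distribution_half_betas[of ts n M])
qed

lemma log_beta_ge_half_gammas:
  assumes "\<And>t. t \<in> set ts \<Longrightarrow> real (n - Suc t) / 2 \<le> c t"
  shows "measure (half_gammas (map c ts)) {q<..} \<le> measure (convs (half_betas n ts)) {q<..}"
proof -
  have pos: "0 < real (n - Suc t) / 2" if "t \<in> set ts" for t using ts(2)[OF that] pn by simp
  have "measure (half_gammas (map c ts)) {q<..} \<le> measure (half_gammas (map (\<lambda>t. real (n - Suc t) / 2) ts)) {q<..}"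
    using assms pos by (intro half_gammas_rate_mono) auto
  also have "\<dots> \<le> measure (convs (half_betas n ts)) {q<..}"
  proof (rule stoch_leD[OF real_distribution_half_gammas real_distribution_sample])
    have "stoch_le (convs (map (\<lambda>t. gamma_law (1/2) (real (n - Suc t) / 2)) ts)) (convs (half_betas n ts))"
      using pos by (intro stoch_le_convs stoch_le_gamma_log_beta real_distribution_gamma_law real_distribution_log_beta_law) auto
    then show "stoch_le (half_gammas (map (\<lambda>t. real (n - Suc t) / 2) ts)) (convs (half_betas n ts))" by (simp add: comp_def)
    show "c > 0" if "c \<in> set (map (\<lambda>t. real (n - Suc t) / 2) ts)" for c using that pos by auto
  qed
  finally show ?thesis .
qed

lemma log_beta_le_half_gammas:
  assumes "\<And>t. t \<in> set ts \<Longrightarrow> 0 < c t \<and> c t \<le> (real (n - Suc t) - 1) / 2"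
  shows "measure (convs (half_betas n ts)) {q<..} \<le> measure (half_gammas (map c ts)) {q<..}"
proof -
  have gt: "real (n - Suc t) / 2 > 1/2" if "t \<in> set ts" for t
  proof -
    \<comment> \<open>\<open>Suc t \<le> p\<close> and \<open>p + 1 < n\<close> leave at least 2, so
      that the upper Gamma law has a positive rate.\<close>
    have "2 \<le> n - Suc t" using ts(2)[OF that] pn by linarith
    then have "2 \<le> real (n - Suc t)" by linarith
    then show ?thesis by simp
  qed
  have "measure (convs (half_betas n ts)) {q<..} \<le> measure (half_gammas (map (\<lambda>t. (real (n - Suc t) - 1) / 2) ts)) {q<..}"
  proof (rule stoch_leD[OF real_distribution_sample real_distribution_half_gammas])
    have "stoch_le (convs (half_betas n ts)) (convs (map (\<lambda>t. gamma_law (1/2) (real (n - Suc t) / 2 - 1/2)) ts))"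
    proof (intro stoch_le_convs stoch_le_log_beta_gamma real_distribution_gamma_law real_distribution_log_beta_law)
      fix t assume "t \<in> set ts"
      from gt[OF this] show "1/2 < real (n - Suc t) / 2" "0 < real (n - Suc t) / 2" "0 < real (n - Suc t) / 2 - 1/2"
        by linarith+
    qed auto
    then show "stoch_le (convs (half_betas n ts)) (half_gammas (map (\<lambda>t. (real (n - Suc t) - 1) / 2) ts))"
      by (simp add: comp_def diff_divide_distrib)
    fix c assume "c \<in> set (map (\<lambda>t. (real (n - Suc t) - 1) / 2) ts)"
    then show "c > 0" using gt by fastforce
  qed
  also have "\<dots> \<le> measure (half_gammas (map c ts)) {q<..}"
    using assms by (intro half_gammas_rate_mono) auto
  finally show ?thesis .
qed

text \<open>All rates are replaced by the extreme ones, \<open>n / 2\<close> from above and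
  \<open>(n - p - 1) / 2\<close> from below. Both enclosing laws are then exact multiples of
  chi-squared, and \<open>r\<close> lies between the two scalings, so only
  \<open>chi_tail_scale_bound\<close> is needed. No normal approximation enters, hence the bound is
  good for small \<open>f\<close> too.\<close>

lemma crude_bound:
  assumes q: "q > 0" and r: "real (n - p - 1) / real n \<le> r" "r \<le> 1"
  shows "\<bar>measure (convs (half_betas n ts)) {q / (r * real n)<..} - chi_tail (real (length ts)) q\<bar> \<le>
    sqrt (real (length ts) / 2) * ln (real n / real (n - p - 1))"
proof -
  let ?f = "real (length ts)" and ?N = "real (n - p - 1)"
  have f: "?f > 0" using ts by simp
  have N: "?N > 0" "?N \<le> real n" "real n > 0" using pn by auto
  have r0: "r > 0" using r(1) N by (meson divide_pos_pos less_le_trans)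
  have "chi_tail ?f ((1 / r) * q) = measure (half_gammas (map (\<lambda>_. real n / 2) ts)) {q / (r * real n)<..}"
    using N r0 ts by (subst measure_half_gammas_const) auto
  also have "\<dots> \<le> measure (convs (half_betas n ts)) {q / (r * real n)<..}"
    by (rule log_beta_ge_half_gammas) simp
  finally have lo: "chi_tail ?f ((1 / r) * q) \<le> measure (convs (half_betas n ts)) {q / (r * real n)<..}" .
  have "measure (convs (half_betas n ts)) {q / (r * real n)<..} \<le> measure (half_gammas (map (\<lambda>_. ?N / 2) ts)) {q / (r * real n)<..}"
  proof (rule log_beta_le_half_gammas)
    fix t assume "t \<in> set ts"
    then have "n - p - 1 \<le> n - Suc t - 1" "n - Suc t \<ge> 1" using ts(2)[of t] pn by auto
    then show "0 < ?N / 2 \<and> ?N / 2 \<le> (real (n - Suc t) - 1) / 2" using N by (auto simp: of_nat_diff)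
  qed
  also have "\<dots> = chi_tail ?f (?N / (r * real n) * q)"
  proof -
    have "2 * (?N / 2) * (q / (r * real n)) = ?N / (r * real n) * q" by simp
    then show ?thesis using measure_half_gammas_const[of "?N / 2" ts "q / (r * real n)"] N ts by (simp only:) simp
  qed
  finally have hi: "measure (convs (half_betas n ts)) {q / (r * real n)<..} \<le> chi_tail ?f (?N / (r * real n) * q)" .
  have sf: "0 \<le> sqrt (?f / 2)" by simp
  have v1: "?N / (r * real n) \<le> 1" using r r0 N by (simp add: field_simps)
  have "chi_tail ?f (?N / (r * real n) * q) - chi_tail ?f (1 * q) \<le> sqrt (?f / 2) * ln (1 / (?N / (r * real n)))"
    using N r0 v1 by (intro chi_tail_scale_bound f q) auto
  also have "\<dots> \<le> sqrt (?f / 2) * ln (real n / ?N)"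
  proof -
    have "1 / (?N / (r * real n)) = r * (real n / ?N)" by simp
    also have "\<dots> \<le> 1 * (real n / ?N)" using N r by (intro mult_right_mono) auto
    finally show ?thesis using N r0 sf by (intro mult_left_mono) (simp_all del: of_nat_diff)
  qed
  finally have h1: "chi_tail ?f (?N / (r * real n) * q) - chi_tail ?f q \<le> sqrt (?f / 2) * ln (real n / ?N)" by simp
  have "chi_tail ?f (1 * q) - chi_tail ?f ((1 / r) * q) \<le> sqrt (?f / 2) * ln ((1 / r) / 1)"
    using r0 r by (intro chi_tail_scale_bound f q) auto
  also have "\<dots> \<le> sqrt (?f / 2) * ln (real n / ?N)"
    using N r0 r sf by (intro mult_left_mono) (auto simp: field_simps)
  finally have h2: "chi_tail ?f q - chi_tail ?f ((1 / r) * q) \<le> sqrt (?f / 2) * ln (real n / ?N)" by simp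
  show ?thesis using lo hi h1 h2 by linarith
qed

text \<open>At \<open>q = f\<close>, with the weights \<open>1 + (t + 1) / n\<close> of the chi-squared variables below the sample law.\<close>

lemma uncorrected_lower_bound:
  assumes L: "normal_tail_bound \<epsilon> L" "L \<le> length ts"
  defines "f \<equiv> real (length ts)"
  shows "\<Phi> 0 - \<Phi> (- ((\<Sum>t\<leftarrow>ts. real (Suc t)) / (real n * sqrt (8 * f)))) - 2 * \<epsilon> \<le>
    measure (convs (half_betas n ts)) {f / real n<..} - chi_tail f f"
proof -
  have f0: "f > 0" and n0: "real n > 0" using ts pn by (auto simp: f_def)
  \<comment> \<open>From \<open>1 / (1 - x) \<ge> 1 + x\<close> at \<open>x = (t + 1) / n\<close>:
    the rate \<open>n / (2 * w t)\<close> is at least the one of the lower enclosing law. The linear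
    weight makes the mean explicit, and \<open>w t \<le> 2\<close> keeps the rates between
    \<open>n / 4\<close> and \<open>n / 2\<close>.\<close>
  define w where "w t = 1 + real (Suc t) / real n" for t
  have w: "1 \<le> w t" "w t \<le> 2" if "t \<in> set ts" for t
    using ts(2)[OF that] pn by (auto simp: w_def)
  let ?cs = "map (\<lambda>t. real n / (2 * w t)) ts"
  have m: "hg_mean ?cs = (\<Sum>t\<leftarrow>ts. w t) / real n"
  proof -
    have "hg_mean ?cs = (\<Sum>t\<leftarrow>ts. (1 / real n) * w t)" by (simp add: hg_mean_def comp_def)
    then show ?thesis by (simp only: sum_list_const_mult) simp
  qed
  have S: "(\<Sum>t\<leftarrow>ts. w t) = f + (\<Sum>t\<leftarrow>ts. real (Suc t)) / real n"
  proof -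
    have "(\<Sum>t\<leftarrow>ts. w t) = (\<Sum>t\<leftarrow>ts. 1) + (\<Sum>t\<leftarrow>ts. (1 / real n) * real (Suc t))"
      unfolding sum_list_addf[symmetric] w_def by simp
    then show ?thesis unfolding sum_list_const_mult by (simp add: f_def sum_list_triv)
  qed
  have v: "(\<Sum>c\<leftarrow>?cs. 1 / (2 * c\<^sup>2)) = (\<Sum>t\<leftarrow>ts. 2 * (w t)\<^sup>2 / (real n)\<^sup>2)"
    using n0 by (simp add: comp_def power_divide power_mult_distrib)
  have v2: "(\<Sum>t\<leftarrow>ts. 2 * (w t)\<^sup>2 / (real n)\<^sup>2) \<le> 8 * f / (real n)\<^sup>2"
  proof -
    have "(\<Sum>t\<leftarrow>ts. 2 * (w t)\<^sup>2 / (real n)\<^sup>2) \<le> (\<Sum>t\<leftarrow>ts. 8 / (real n)\<^sup>2)"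
    proof (rule sum_list_mono)
      fix t assume t: "t \<in> set ts"
      have "(w t)\<^sup>2 \<le> 2\<^sup>2" using w[OF t] by (intro power_mono) auto
      then show "2 * (w t)\<^sup>2 / (real n)\<^sup>2 \<le> 8 / (real n)\<^sup>2" using n0 by (intro divide_right_mono) auto
    qed
    then show ?thesis by (simp add: sum_list_triv f_def mult.commute)
  qed
  have v1: "2 * f / (real n)\<^sup>2 \<le> (\<Sum>t\<leftarrow>ts. 2 * (w t)\<^sup>2 / (real n)\<^sup>2)"
  proof -
    have "(\<Sum>t\<leftarrow>ts. 2 / (real n)\<^sup>2) \<le> (\<Sum>t\<leftarrow>ts. 2 * (w t)\<^sup>2 / (real n)\<^sup>2)"
    proof (rule sum_list_mono)
      fix t assume t: "t \<in> set ts"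
      have "1\<^sup>2 \<le> (w t)\<^sup>2" using w[OF t] by (intro power_mono) auto
      then show "2 / (real n)\<^sup>2 \<le> 2 * (w t)\<^sup>2 / (real n)\<^sup>2" using n0 by (intro divide_right_mono) auto
    qed
    then show ?thesis by (simp add: sum_list_triv f_def mult.commute)
  qed
  have sd: "0 < hg_sd ?cs" "hg_sd ?cs \<le> sqrt (8 * f) / real n"
  proof -
    have "0 < 2 * f / (real n)\<^sup>2" using f0 n0 by simp
    then show "0 < hg_sd ?cs" unfolding hg_sd_def v using v1 by (simp del: power2_eq_square)
    have "hg_sd ?cs \<le> sqrt (8 * f / (real n)\<^sup>2)" unfolding hg_sd_def v using v2 by (rule real_sqrt_le_mono)
    then show "hg_sd ?cs \<le> sqrt (8 * f) / real n" using n0 by (simp add: real_sqrt_divide)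
  qed
  let ?b = "(f / real n - hg_mean ?cs) / hg_sd ?cs"
  have S0: "0 \<le> (\<Sum>t\<leftarrow>ts. real (Suc t))" by (intro sum_list_nonneg) auto
  have "?b = - ((\<Sum>t\<leftarrow>ts. real (Suc t)) / (real n * real n) / hg_sd ?cs)"
    unfolding m S using n0 by (simp add: add_divide_distrib)
  also have "\<dots> \<le> - ((\<Sum>t\<leftarrow>ts. real (Suc t)) / (real n * real n) / (sqrt (8 * f) / real n))"
    using sd S0 f0 n0 by (intro le_imp_neg_le divide_left_mono) auto
  also have "\<dots> = - ((\<Sum>t\<leftarrow>ts. real (Suc t)) / (real n * sqrt (8 * f)))" using n0 by simp
  finally have b: "?b \<le> - ((\<Sum>t\<leftarrow>ts. real (Suc t)) / (real n * sqrt (8 * f)))" .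
  have 1: "1 - \<Phi> ?b - \<epsilon> \<le> measure (half_gammas ?cs) {f / real n<..}"
  proof -
    have "\<bar>measure (half_gammas ?cs) {f / real n<..} - (1 - \<Phi> ?b)\<bar> \<le> \<epsilon>"
    proof (rule normal_tail_boundD[OF L(1), where \<kappa> = "real n / 4"])
      show "L \<le> length ?cs" using L by simp
      show "real n / 4 > 0" using n0 by simp
      fix c assume "c \<in> set ?cs"
      then obtain t where t: "t \<in> set ts" "c = real n / (2 * w t)" by auto
      have "real n / 4 \<le> real n / (2 * w t)" using w[OF t(1)] n0 by (intro divide_left_mono) auto
      moreover have "real n / (2 * w t) \<le> real n / 2" using w[OF t(1)] n0 by (intro divide_left_mono) auto
      ultimately show "real n / 4 \<le> c \<and> c \<le> 2 * (real n / 4)" using t by simp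
    qed (rule sd)
    then show ?thesis by linarith
  qed
  have 2: "measure (half_gammas ?cs) {f / real n<..} \<le> measure (convs (half_betas n ts)) {f / real n<..}"
  proof (rule log_beta_ge_half_gammas)
    fix t assume t: "t \<in> set ts"
    have "real (n - Suc t) * w t \<le> real n"
    proof -
      have "real (n - Suc t) = real n - real (Suc t)" using ts(2)[OF t] pn by (simp add: of_nat_diff)
      then have "real (n - Suc t) * w t = real n - real (Suc t) * real (Suc t) / real n"
        using n0 by (simp add: w_def field_simps)
      then show ?thesis using n0 by simp
    qed
    then show "real (n - Suc t) / 2 \<le> real n / (2 * w t)" using w[OF t] by (simp add: field_simps)
  qed
  have 3: "chi_tail f f \<le> 1 - \<Phi> 0 + \<epsilon>"
    using chi_tail_normal[OF L, of f] ts by (simp add: f_def abs_le_iff)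
  show ?thesis using 1 2 3 \<Phi>_mono[OF b] by linarith
qed

lemma shifted_rates_bounds:
  assumes s: "s = 0 \<or> s = 1" and t: "t \<in> set ts"
  shows "real (n - p - 1) \<le> real (n - Suc t) - s" "real (n - Suc t) - s \<le> real n"
    "real (n - Suc t) = real n - real (Suc t)"
  using ts(2)[OF t] pn s by (auto simp: of_nat_diff)

text \<open>A rate \<open>g / 2\<close> has variance \<open>2 / g^2\<close>, and all
  \<open>g\<close> lie between \<open>n - p - 1\<close> and \<open>n\<close>.\<close>

lemma hg_sd_shifted_rates:
  assumes s: "s = 0 \<or> s = 1"
  defines "f \<equiv> real (length ts)"
  shows "sqrt (2 * f) / real n \<le> hg_sd (shifted_rates n ts s)" "hg_sd (shifted_rates n ts s) \<le> sqrt (2 * f) / real (n - p - 1)"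
proof -
  let ?N = "real (n - p - 1)" and ?g = "\<lambda>t. real (n - Suc t) - s"
  have N: "?N > 0" "real n > 0" using pn by auto
  have v: "(\<Sum>c\<leftarrow>shifted_rates n ts s. 1 / (2 * c\<^sup>2)) = (\<Sum>t\<leftarrow>ts. 2 / (?g t)\<^sup>2)"
    by (simp add: shifted_rates_def comp_def power_divide)
  have "(\<Sum>t\<leftarrow>ts. 2 / (real n)\<^sup>2) \<le> (\<Sum>t\<leftarrow>ts. 2 / (?g t)\<^sup>2)"
  proof (rule sum_list_mono)
    fix t assume "t \<in> set ts"
    from shifted_rates_bounds[OF s this] have g: "0 < ?g t" "?g t \<le> real n" using N by linarith+
    have "(?g t)\<^sup>2 \<le> (real n)\<^sup>2" using g by (intro power_mono) auto
    then show "2 / (real n)\<^sup>2 \<le> 2 / (?g t)\<^sup>2" using g N by (intro divide_left_mono mult_pos_pos zero_less_power) auto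
  qed
  then have 1: "2 * f / (real n)\<^sup>2 \<le> (\<Sum>t\<leftarrow>ts. 2 / (?g t)\<^sup>2)" by (simp add: sum_list_triv f_def mult.commute)
  have "(\<Sum>t\<leftarrow>ts. 2 / (?g t)\<^sup>2) \<le> (\<Sum>t\<leftarrow>ts. 2 / ?N\<^sup>2)"
  proof (rule sum_list_mono)
    fix t assume "t \<in> set ts"
    from shifted_rates_bounds[OF s this] have g: "0 < ?g t" "?N \<le> ?g t" using N by linarith+
    have "?N\<^sup>2 \<le> (?g t)\<^sup>2" using g N by (intro power_mono) auto
    then show "2 / (?g t)\<^sup>2 \<le> 2 / ?N\<^sup>2" using g N by (intro divide_left_mono mult_pos_pos zero_less_power) auto
  qed
  then have 2: "(\<Sum>t\<leftarrow>ts. 2 / (?g t)\<^sup>2) \<le> 2 * f / ?N\<^sup>2" by (simp add: sum_list_triv f_def mult.commute)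
  have "sqrt (2 * f / (real n)\<^sup>2) \<le> hg_sd (shifted_rates n ts s)" unfolding hg_sd_def v by (rule real_sqrt_le_mono[OF 1])
  then show "sqrt (2 * f) / real n \<le> hg_sd (shifted_rates n ts s)" using N by (simp add: real_sqrt_divide)
  have "hg_sd (shifted_rates n ts s) \<le> sqrt (2 * f / ?N\<^sup>2)" unfolding hg_sd_def v by (rule real_sqrt_le_mono[OF 2])
  then show "hg_sd (shifted_rates n ts s) \<le> sqrt (2 * f) / ?N" using N by (simp add: real_sqrt_divide del: of_nat_diff)
qed

text \<open>Since \<open>\<rho> n\<close> is the average of the \<open>n - t - 3/2\<close>, the terms of first order in the deviation from the
  average cancel.\<close>

lemma hg_mean_shifted_rates:
  assumes s: "s = 0 \<or> s = 1" and rho: "(\<Sum>t\<leftarrow>ts. real (Suc t) + 1/2) = real n * (1 - \<rho>) * real (length ts)"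
  defines "f \<equiv> real (length ts)" and "N \<equiv> real (n - p - 1)"
  shows "index_variance ts / (real n)\<^sup>2 - f / (2 * N) \<le> \<rho> * real n * hg_mean (shifted_rates n ts s) - f"
    "\<bar>\<rho> * real n * hg_mean (shifted_rates n ts s) - f\<bar> \<le> index_variance ts / N\<^sup>2 + f / (2 * N)"
proof -
  \<comment> \<open>Twice the enclosing rates differ from the midpoint \<open>n - t - 3/2\<close> by
    one half, on opposite sides for the two values of \<open>s\<close>.\<close>
  define \<sigma> where "\<sigma> = s - 1/2"
  define g where "g t = real (n - Suc t) - s" for t
  define c where "c = real n * (1 - \<rho>)"
  \<comment> \<open>\<open>h\<close> is the average of the numbers \<open>g t\<close>, and
    \<open>g t = h - dv t\<close>, where the deviations \<open>dv t\<close> sum to zero.\<close>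
  define h where "h = real n - c - \<sigma>"
  define dv where "dv t = real (Suc t) + 1/2 - c" for t
  have N0: "N > 0" "real n > 0" using pn by (auto simp: N_def)
  have f0: "f > 0" using ts by (simp add: f_def)
  have g: "N \<le> g t" "g t \<le> real n" "0 < g t" "g t = real n - (real (Suc t) + 1/2) - \<sigma>" if "t \<in> set ts" for t
    using shifted_rates_bounds[OF s that] N0 by (auto simp: g_def N_def \<sigma>_def)
  have sum_e: "(\<Sum>t\<leftarrow>ts. real (Suc t) + 1/2) = c * f" using rho by (simp add: c_def f_def)
  have sum_e': "(\<Sum>t\<leftarrow>ts. real (Suc t)) = (c - 1/2) * f"
    using sum_e unfolding sum_list_addf by (simp add: sum_list_triv f_def algebra_simps)
  have dv_sum: "(\<Sum>t\<leftarrow>ts. dv t) = 0"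
  proof -
    have "(\<Sum>t\<leftarrow>ts. dv t) = (\<Sum>t\<leftarrow>ts. real (Suc t) + 1/2) - (\<Sum>t\<leftarrow>ts. c)"
      unfolding dv_def by (rule sum_list_subtractf)
    then show ?thesis using sum_e by (simp add: sum_list_triv f_def)
  qed
  have V: "index_variance ts = (\<Sum>t\<leftarrow>ts. (dv t)\<^sup>2)"
  proof -
    have "(\<Sum>t\<leftarrow>ts. real (Suc t)) / f = c - 1/2" unfolding sum_e' using f0 by simp
    then have "index_variance ts = (\<Sum>t\<leftarrow>ts. (real (Suc t) - (c - 1/2))\<^sup>2)"
      unfolding index_variance_def f_def by (simp only:)
    then show ?thesis by (simp add: dv_def algebra_simps)
  qed
  have gsum: "(\<Sum>t\<leftarrow>ts. g t) = h * f"
  proof -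
    have "(\<Sum>t\<leftarrow>ts. g t) = (\<Sum>t\<leftarrow>ts. h - dv t)"
      by (intro arg_cong[where f = sum_list] map_cong refl) (simp add: g(4) h_def dv_def)
    also have "\<dots> = (\<Sum>t\<leftarrow>ts. h) - (\<Sum>t\<leftarrow>ts. dv t)" by (rule sum_list_subtractf)
    finally show ?thesis by (simp add: dv_sum sum_list_triv f_def)
  qed
  have h: "N \<le> h" "h \<le> real n"
  proof -
    have "(\<Sum>t\<leftarrow>ts. N) \<le> (\<Sum>t\<leftarrow>ts. g t)" by (rule sum_list_mono) (rule g)
    then have "N * f \<le> h * f" unfolding gsum by (simp add: sum_list_triv f_def mult.commute)
    then show "N \<le> h" using f0 by simp
    have "(\<Sum>t\<leftarrow>ts. g t) \<le> (\<Sum>t\<leftarrow>ts. real n)" by (rule sum_list_mono) (rule g)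
    then have "h * f \<le> real n * f" unfolding gsum by (simp add: sum_list_triv f_def mult.commute)
    then show "h \<le> real n" using f0 by simp
  qed
  have h0: "h > 0" using h N0 by linarith
  have m: "hg_mean (shifted_rates n ts s) = (\<Sum>t\<leftarrow>ts. 1 / g t)"
    unfolding hg_mean_def shifted_rates_def map_map comp_def g_def
    by (intro arg_cong[where f = sum_list] map_cong refl) (simp del: right_diff_distrib_numeral)
  have "\<rho> * real n * hg_mean (shifted_rates n ts s) - f = (\<Sum>t\<leftarrow>ts. \<rho> * real n * (1 / g t)) - (\<Sum>t\<leftarrow>ts. 1)"
    unfolding m sum_list_const_mult by (simp add: f_def sum_list_triv)
  also have "\<dots> = (\<Sum>t\<leftarrow>ts. \<rho> * real n * (1 / g t) - 1)" by (rule sum_list_subtractf[symmetric])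
  \<comment> \<open>Each term equals \<open>(dv + \<sigma>) / g\<close>, and
    \<open>dv / g = dv / h + dv^2 / (g * h)\<close> because \<open>h - g = dv\<close>. The first
    part sums to zero, the second is the index variance up to scale, and \<open>\<sigma> / g\<close>
    is the price of the enclosure.\<close>
  also have "\<dots> = (\<Sum>t\<leftarrow>ts. (1 / h) * dv t + ((dv t)\<^sup>2 / (g t * h) + \<sigma> / g t))"
  proof (intro arg_cong[where f = sum_list] map_cong refl)
    fix t assume t: "t \<in> set ts"
    have gh: "g t = h - dv t" using g(4)[OF t] by (simp add: h_def dv_def)
    have rn: "\<rho> * real n = h + \<sigma>" by (simp add: h_def c_def algebra_simps)
    have "(1 / h) * dv t + ((dv t)\<^sup>2 / (g t * h) + \<sigma> / g t) = (dv t * (g t + dv t) + \<sigma> * h) / (g t * h)"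
      using g(3)[OF t] h0 by (simp add: field_simps power2_eq_square)
    also have "\<dots> = (dv t + \<sigma>) / g t" using h0 by (simp add: gh divide_simps) (simp add: algebra_simps)
    also have "\<dots> = (\<rho> * real n - g t) / g t" using rn gh by simp
    also have "\<dots> = \<rho> * real n * (1 / g t) - 1" using g(3)[OF t] by (simp add: diff_divide_distrib)
    finally show "\<rho> * real n * (1 / g t) - 1 = (1 / h) * dv t + ((dv t)\<^sup>2 / (g t * h) + \<sigma> / g t)" by simp
  qed
  also have "\<dots> = (\<Sum>t\<leftarrow>ts. (dv t)\<^sup>2 / (g t * h)) + (\<Sum>t\<leftarrow>ts. \<sigma> / g t)"
    by (simp add: sum_list_addf sum_list_const_mult dv_sum del: mult_1 times_divide_eq_left)
  finally have E: "\<rho> * real n * hg_mean (shifted_rates n ts s) - f = (\<Sum>t\<leftarrow>ts. (dv t)\<^sup>2 / (g t * h)) + (\<Sum>t\<leftarrow>ts. \<sigma> / g t)" .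
  have sg: "\<bar>\<sigma>\<bar> = 1/2" using s by (auto simp: \<sigma>_def)
  have b1: "\<bar>\<Sum>t\<leftarrow>ts. \<sigma> / g t\<bar> \<le> f / (2 * N)"
  proof -
    have "\<bar>\<Sum>t\<leftarrow>ts. \<sigma> / g t\<bar> \<le> (\<Sum>t\<leftarrow>ts. \<bar>\<sigma> / g t\<bar>)" using sum_list_abs[of "map (\<lambda>t. \<sigma> / g t) ts"] by (simp add: comp_def)
    also have "\<dots> \<le> (\<Sum>t\<leftarrow>ts. 1 / (2 * N))"
    proof (rule sum_list_mono)
      fix t assume t: "t \<in> set ts"
      have "\<bar>\<sigma> / g t\<bar> = 1 / (2 * g t)" using g(3)[OF t] sg by (simp add: field_simps)
      also have "\<dots> \<le> 1 / (2 * N)" using g[OF t] N0 by (intro divide_left_mono) auto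
      finally show "\<bar>\<sigma> / g t\<bar> \<le> 1 / (2 * N)" .
    qed
    finally show ?thesis by (simp add: sum_list_triv f_def)
  qed
  have b2: "index_variance ts / (real n)\<^sup>2 \<le> (\<Sum>t\<leftarrow>ts. (dv t)\<^sup>2 / (g t * h))"
  proof -
    have "index_variance ts / (real n)\<^sup>2 = (\<Sum>t\<leftarrow>ts. (1 / (real n)\<^sup>2) * (dv t)\<^sup>2)" unfolding V sum_list_const_mult by simp
    also have "\<dots> \<le> (\<Sum>t\<leftarrow>ts. (dv t)\<^sup>2 / (g t * h))"
    proof (rule sum_list_mono)
      fix t assume t: "t \<in> set ts"
      have "g t * h \<le> (real n)\<^sup>2" unfolding power2_eq_square using g[OF t] h h0 by (intro mult_mono) auto
      then have "(dv t)\<^sup>2 / (real n)\<^sup>2 \<le> (dv t)\<^sup>2 / (g t * h)" using g(3)[OF t] h0 N0 by (intro divide_left_mono) auto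
      then show "(1 / (real n)\<^sup>2) * (dv t)\<^sup>2 \<le> (dv t)\<^sup>2 / (g t * h)" by simp
    qed
    finally show ?thesis .
  qed
  have b3: "(\<Sum>t\<leftarrow>ts. (dv t)\<^sup>2 / (g t * h)) \<le> index_variance ts / N\<^sup>2"
  proof -
    have "(\<Sum>t\<leftarrow>ts. (dv t)\<^sup>2 / (g t * h)) \<le> (\<Sum>t\<leftarrow>ts. (1 / N\<^sup>2) * (dv t)\<^sup>2)"
    proof (rule sum_list_mono)
      fix t assume t: "t \<in> set ts"
      have "N\<^sup>2 \<le> g t * h" unfolding power2_eq_square using g[OF t] h N0 by (intro mult_mono) auto
      then have "(dv t)\<^sup>2 / (g t * h) \<le> (dv t)\<^sup>2 / N\<^sup>2" using g(3)[OF t] h0 N0 by (intro divide_left_mono) auto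
      then show "(dv t)\<^sup>2 / (g t * h) \<le> (1 / N\<^sup>2) * (dv t)\<^sup>2" by simp
    qed
    also have "\<dots> = index_variance ts / N\<^sup>2" unfolding V sum_list_const_mult by simp
    finally show ?thesis .
  qed
  have V0: "0 \<le> index_variance ts / (real n)\<^sup>2" unfolding V by (intro divide_nonneg_nonneg sum_list_nonneg) auto
  show "index_variance ts / (real n)\<^sup>2 - f / (2 * N) \<le> \<rho> * real n * hg_mean (shifted_rates n ts s) - f"
    "\<bar>\<rho> * real n * hg_mean (shifted_rates n ts s) - f\<bar> \<le> index_variance ts / N\<^sup>2 + f / (2 * N)"
    unfolding E using b1 b2 b3 V0 by linarith+
qed

text \<open>The numbers \<open>Suc t\<close> and their mean all lie between 0 and
  \<open>p\<close>.\<close>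

lemma index_variance_le: "index_variance ts \<le> real (length ts) * (real p)\<^sup>2"
proof -
  let ?f = "real (length ts)"
  let ?m = "(\<Sum>t\<leftarrow>ts. real (Suc t)) / ?f"
  have f: "?f > 0" using ts by simp
  have "(\<Sum>t\<leftarrow>ts. real (Suc t)) \<le> (\<Sum>t\<leftarrow>ts. real p)" using ts(2) by (intro sum_list_mono) (simp add: Suc_le_eq del: of_nat_Suc)
  then have m1: "?m \<le> real p" using f by (simp add: sum_list_triv field_simps del: of_nat_Suc)
  have m0: "0 \<le> ?m" by (intro divide_nonneg_nonneg sum_list_nonneg) auto
  have "index_variance ts \<le> (\<Sum>t\<leftarrow>ts. (real p)\<^sup>2)"
    unfolding index_variance_def
  proof (rule sum_list_mono)
    fix t assume "t \<in> set ts"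
    then have "real (Suc t) \<le> real p" using ts(2) by (simp add: Suc_le_eq del: of_nat_Suc)
    then have "\<bar>real (Suc t) - ?m\<bar> \<le> real p" using m0 m1 by (simp add: abs_le_iff del: of_nat_Suc)
    then have "\<bar>real (Suc t) - ?m\<bar>\<^sup>2 \<le> (real p)\<^sup>2" by (intro power_mono) auto
    then show "(real (Suc t) - ?m)\<^sup>2 \<le> (real p)\<^sup>2" by simp
  qed
  then show ?thesis by (simp add: sum_list_triv)
qed

text \<open>With \<open>N = n - p - 1\<close> the rates lie between \<open>N / 2\<close> and
  \<open>n / 2\<close>, and \<open>n \<le> 2 * N\<close> is what brings them within a factor
  2.\<close>

lemma normal_tail_shifted_rates:
  assumes L: "normal_tail_bound \<epsilon> L" "L \<le> length ts" and s: "s = 0 \<or> s = 1" and n2: "n \<le> 2 * (n - p - 1)"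
  shows "\<bar>measure (half_gammas (shifted_rates n ts s)) {q<..} - (1 - \<Phi> ((q - hg_mean (shifted_rates n ts s)) / hg_sd (shifted_rates n ts s)))\<bar> \<le> \<epsilon>"
proof (rule normal_tail_boundD[OF L(1), where \<kappa> = "real (n - p - 1) / 2"])
  show "L \<le> length (shifted_rates n ts s)" using L by (simp add: shifted_rates_def)
  show "real (n - p - 1) / 2 > 0" using pn by simp
  fix c assume "c \<in> set (shifted_rates n ts s)"
  then obtain t where t: "t \<in> set ts" "c = (real (n - Suc t) - s) / 2" by (auto simp: shifted_rates_def)
  have "real n \<le> 2 * real (n - p - 1)" using n2 by linarith
  then show "real (n - p - 1) / 2 \<le> c \<and> c \<le> 2 * (real (n - p - 1) / 2)"
    using shifted_rates_bounds(1,2)[OF s t(1)] unfolding t(2) by auto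
next
  have "0 < sqrt (2 * real (length ts)) / real n" using ts pn by simp
  then show "0 < hg_sd (shifted_rates n ts s)" using hg_sd_shifted_rates(1)[OF s] by linarith
qed

lemma shifted_rates_sandwich:
  "measure (half_gammas (shifted_rates n ts 0)) {q<..} \<le> measure (convs (half_betas n ts)) {q<..}"
  "measure (convs (half_betas n ts)) {q<..} \<le> measure (half_gammas (shifted_rates n ts 1)) {q<..}"
proof -
  show "measure (half_gammas (shifted_rates n ts 0)) {q<..} \<le> measure (convs (half_betas n ts)) {q<..}"
    unfolding shifted_rates_def by (rule log_beta_ge_half_gammas) simp
  show "measure (convs (half_betas n ts)) {q<..} \<le> measure (half_gammas (shifted_rates n ts 1)) {q<..}"
    unfolding shifted_rates_def
  proof (rule log_beta_le_half_gammas)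
    fix t assume t: "t \<in> set ts"
    have "0 < real (n - p - 1)" using pn by simp
    then show "0 < (real (n - Suc t) - 1) / 2 \<and> (real (n - Suc t) - 1) / 2 \<le> (real (n - Suc t) - 1) / 2"
      using shifted_rates_bounds(1)[OF disjI2[OF refl] t] by auto
  qed
qed

text \<open>Standardizing an enclosing law and chi-squared at the same \<open>q\<close> gives
  arguments related by an affine map: its slope is the ratio of the standard deviations, its offset
  the standardized difference of the means. The slope lies between \<open>1 / w\<close> and
  \<open>w\<close> for \<open>w = n / N\<close>, and \<open>w \<le> 3/2\<close> admits it to
  \<open>\<Phi>_affine\<close>.\<close>

lemma corrected_bound:
  assumes L: "normal_tail_bound \<epsilon> L" "L \<le> length ts"
    and rho: "(\<Sum>t\<leftarrow>ts. real (Suc t) + 1/2) = real n * (1 - \<rho>) * real (length ts)"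
    and r: "real (n - p - 1) / real n \<le> \<rho>" "\<rho> \<le> 1" and n3: "2 * n \<le> 3 * (n - p - 1)"
  defines "f \<equiv> real (length ts)" and "N \<equiv> real (n - p - 1)"
  shows "\<bar>measure (convs (half_betas n ts)) {q / (\<rho> * real n)<..} - chi_tail f q\<bar> \<le>
    2 * \<epsilon> + real n / N * sqrt (f / 2) * ((real p)\<^sup>2 / N\<^sup>2 + 1 / (2 * N)) + 2 * (real n / N - 1)"
proof -
  define w where "w = real n / N"
  let ?x = "(q - f) / sqrt (2 * f)"
  define B where "B = w * sqrt (f / 2) * ((real p)\<^sup>2 / N\<^sup>2 + 1 / (2 * N))"
  have N0: "N > 0" "real n > 0" "N \<le> real n" using pn by (auto simp: N_def)
  have f0: "f > 0" using ts by (simp add: f_def)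
  have wn: "real n = w * N" using N0 by (simp add: w_def)
  have w: "1 \<le> w" "w \<le> 3/2"
  proof -
    show "1 \<le> w" using N0 by (simp add: w_def)
    have "2 * real n \<le> 3 * N" using n3 unfolding N_def by linarith
    then show "w \<le> 3/2" using N0 by (simp add: w_def field_simps)
  qed
  have r0: "\<rho> > 0" "1 / w \<le> \<rho>"
  proof -
    show "1 / w \<le> \<rho>" using r(1) by (simp add: N_def w_def)
    moreover have "0 < 1 / w" using w by simp
    ultimately show "\<rho> > 0" by (rule less_le_trans[rotated])
  qed
  define S where "S = sqrt (2 * f)"
  have S0: "S > 0" using f0 by (simp add: S_def)
  have main: "\<bar>measure (half_gammas (shifted_rates n ts s)) {q / (\<rho> * real n)<..} - (1 - \<Phi> ?x)\<bar> \<le>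
    \<epsilon> + B + 2 * (w - 1)" if s: "s = 0 \<or> s = 1" for s
  proof -
    define m where "m = hg_mean (shifted_rates n ts s)"
    define d where "d = hg_sd (shifted_rates n ts s)"
    \<comment> \<open>The standard deviation after scaling by \<open>\<rho> * n\<close>, to be
      compared with \<open>S\<close>, that of chi-squared.\<close>
    define R where "R = \<rho> * (real n * d)"
    have d: "S / real n \<le> d" "d \<le> S / N" using hg_sd_shifted_rates[OF s] by (auto simp: d_def S_def f_def N_def)
    have d0: "d > 0" using d(1) S0 N0 by (intro less_le_trans[OF _ d(1)] divide_pos_pos)
    have D: "S \<le> real n * d" "real n * d \<le> w * S"
    proof -
      show "S \<le> real n * d" using d(1) N0 by (simp add: pos_divide_le_eq mult.commute)
      have "real n * d \<le> real n * (S / N)" using d(2) N0 by (intro mult_left_mono) auto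
      then show "real n * d \<le> w * S" by (simp add: w_def)
    qed
    have R1: "S / w \<le> R"
    proof -
      have "1 / w * S \<le> \<rho> * (real n * d)" using r0 D S0 by (intro mult_mono) auto
      then show ?thesis by (simp add: R_def)
    qed
    have R2: "R \<le> w * S"
    proof -
      have "\<rho> * (real n * d) \<le> 1 * (w * S)" using r r0 D(2) by (rule_tac mult_mono) (use S0 D(1) in linarith)+
      then show ?thesis by (simp add: R_def)
    qed
    have R0: "R > 0" unfolding R_def using r0 N0 d0 by simp
    let ?a = "S / R" and ?b = "(f - \<rho> * real n * m) / R"
    have eq: "(q / (\<rho> * real n) - m) / d = ?a * ?x + ?b"
    proof -
      have "?a * ?x = (q - f) / R" using S0 by (simp add: S_def)
      then have "?a * ?x + ?b = (q - \<rho> * real n * m) / R" by (simp add: add_divide_distrib[symmetric])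
      also have "\<dots> = (q / (\<rho> * real n) - m) / d" using r0 N0 d0 by (simp add: R_def field_simps)
      finally show ?thesis by simp
    qed
    have a: "?a \<le> w" "1 / w \<le> ?a"
    proof -
      show "?a \<le> w" using R1 R0 w by (simp add: pos_divide_le_eq mult.commute)
      show "1 / w \<le> ?a" using R2 R0 w by (simp add: pos_divide_le_eq pos_le_divide_eq mult.commute)
    qed
    \<comment> \<open>By \<open>w + 1 / w \<ge> 2\<close> the lower bound on the slope is at least
      as close to 1 as the upper one.\<close>
    have "1 - 1 / w \<le> w - 1"
    proof -
      have "0 \<le> (w - 1)\<^sup>2 / w" using w by (intro divide_nonneg_nonneg) auto
      also have "\<dots> = w - 2 + 1 / w" using w by (simp add: power2_eq_square field_simps)
      finally show ?thesis by simp
    qed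
    then have a1: "\<bar>?a - 1\<bar> \<le> w - 1" using a unfolding abs_le_iff by linarith
    have b: "\<bar>?b\<bar> \<le> B"
    proof -
      let ?C = "(real p)\<^sup>2 / N\<^sup>2 + 1 / (2 * N)"
      have C0: "0 \<le> ?C" using N0 by simp
      have "\<bar>f - \<rho> * real n * m\<bar> \<le> index_variance ts / N\<^sup>2 + f / (2 * N)"
        using hg_mean_shifted_rates(2)[OF s rho] by (simp add: m_def f_def N_def abs_minus_commute)
      also have "\<dots> \<le> f * (real p)\<^sup>2 / N\<^sup>2 + f / (2 * N)"
        using index_variance_le by (intro add_mono divide_right_mono) (use N0 in \<open>auto simp: f_def\<close>)
      also have "\<dots> = f * ?C" by (simp add: distrib_left)
      finally have *: "\<bar>f - \<rho> * real n * m\<bar> \<le> f * ?C" .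
      have "\<bar>?b\<bar> = \<bar>f - \<rho> * real n * m\<bar> / R" using R0 by (simp add: abs_divide)
      also have "\<dots> \<le> f * ?C / (S / w)"
        using * R1 S0 w f0 C0 by (intro frac_le mult_nonneg_nonneg divide_pos_pos) simp_all
      also have "\<dots> = w * (f / S) * ?C" by (simp add: mult.commute mult.left_commute)
      also have "f / S = sqrt (f / 2)"
      proof -
        have "f = sqrt (f / 2) * S" unfolding S_def using f0 by (simp add: real_sqrt_mult[symmetric])
        then show ?thesis using S0 by (metis nonzero_mult_div_cancel_right less_irrefl)
      qed
      finally show ?thesis unfolding B_def .
    qed
    have "\<bar>\<Phi> (?a * ?x + ?b) - \<Phi> ?x\<bar> \<le> \<bar>?b\<bar> + 2 * \<bar>?a - 1\<bar>"
      using a1 w by (intro \<Phi>_affine) linarith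
    also have "\<dots> \<le> B + 2 * (w - 1)" using a1 b by (intro add_mono mult_left_mono) simp_all
    finally have 1: "\<bar>\<Phi> (?a * ?x + ?b) - \<Phi> ?x\<bar> \<le> B + 2 * (w - 1)" .
    have "\<bar>measure (half_gammas (shifted_rates n ts s)) {q / (\<rho> * real n)<..} - (1 - \<Phi> ((q / (\<rho> * real n) - m) / d))\<bar> \<le> \<epsilon>"
      unfolding m_def d_def using n3 by (intro normal_tail_shifted_rates[OF L s]) linarith
    then have 2: "\<bar>measure (half_gammas (shifted_rates n ts s)) {q / (\<rho> * real n)<..} - (1 - \<Phi> (?a * ?x + ?b))\<bar> \<le> \<epsilon>"
      unfolding eq .
    have tri: "\<bar>x - (1 - z)\<bar> \<le> \<epsilon> + B + 2 * (w - 1)" if "\<bar>y - z\<bar> \<le> B + 2 * (w - 1)" "\<bar>x - (1 - y)\<bar> \<le> \<epsilon>" for x y z :: real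
      using that by linarith
    show ?thesis by (rule tri[OF 1 2])
  qed
  have chi: "\<bar>chi_tail f q - (1 - \<Phi> ?x)\<bar> \<le> \<epsilon>"
    using chi_tail_normal[OF L, of q] ts by (simp add: f_def)
  have tri: "\<bar>x - y\<bar> \<le> 2 * \<epsilon> + B + 2 * (w - 1)"
    if "\<bar>a - z\<bar> \<le> \<epsilon> + B + 2 * (w - 1)" "\<bar>b - z\<bar> \<le> \<epsilon> + B + 2 * (w - 1)" "\<bar>y - z\<bar> \<le> \<epsilon>" "a \<le> x" "x \<le> b"
    for a b x y z :: real
    using that by linarith
  show ?thesis
    using tri[OF main[of 0] main[of 1] chi shifted_rates_sandwich[of "q / (\<rho> * real n)"]]
    unfolding B_def w_def by simp
qed

text \<open>At \<open>q = f\<close> the chi-squared argument is 0, while the lower enclosing law has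
  its mean to the right of \<open>f / (\<rho> * n)\<close> by at least \<open>\<eta>\<close>
  standard deviations. The scale is at most \<open>2 * sqrt (2 * f)\<close> because of
  \<open>n \<le> 2 * N\<close>, whence this factor in the condition on
  \<open>\<eta>\<close>.\<close>

lemma corrected_lower_bound:
  assumes L: "normal_tail_bound \<epsilon> L" "L \<le> length ts"
    and rho: "(\<Sum>t\<leftarrow>ts. real (Suc t) + 1/2) = real n * (1 - \<rho>) * real (length ts)"
    and r: "0 < \<rho>" "\<rho> \<le> 1" and n2: "n \<le> 2 * (n - p - 1)"
  defines "f \<equiv> real (length ts)"
  assumes eta: "0 \<le> \<eta>" "\<eta> * (2 * sqrt (2 * f)) \<le> index_variance ts / (real n)\<^sup>2 - f / (2 * real (n - p - 1))"
  shows "\<Phi> 0 - \<Phi> (- \<eta>) - 2 * \<epsilon> \<le> measure (convs (half_betas n ts)) {f / (\<rho> * real n)<..} - chi_tail f f"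
proof -
  define m where "m = hg_mean (shifted_rates n ts 0)"
  define d where "d = hg_sd (shifted_rates n ts 0)"
  define R where "R = \<rho> * real n * d"
  let ?N = "real (n - p - 1)"
  have N0: "?N > 0" "real n > 0" "real n \<le> 2 * ?N" using pn n2 by auto
  have f0: "f > 0" using ts by (simp add: f_def)
  define S where "S = sqrt (2 * f)"
  have S0: "S > 0" using f0 by (simp add: S_def)
  have "S / real n \<le> d" "d \<le> S / ?N" using hg_sd_shifted_rates[of 0] by (auto simp: d_def S_def f_def)
  then have d: "0 < d" "real n * d \<le> 2 * S"
  proof -
    show "0 < d" using S0 N0 by (intro less_le_trans[OF _ \<open>S / real n \<le> d\<close>]) simp
    have "real n * d \<le> real n * (S / ?N)" using \<open>d \<le> S / ?N\<close> N0 by (intro mult_left_mono) auto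
    also have "\<dots> = (real n / ?N) * S" by simp
    also have "\<dots> \<le> 2 * S" using N0 S0 by (intro mult_right_mono) (auto simp: pos_divide_le_eq simp del: of_nat_diff)
    finally show "real n * d \<le> 2 * S" .
  qed
  have R0: "R > 0" unfolding R_def using r N0 d by simp
  have R2: "R \<le> 2 * S"
  proof -
    have "\<rho> * (real n * d) \<le> 1 * (real n * d)" using r N0 d by (intro mult_right_mono) auto
    then show ?thesis unfolding R_def using d by (simp add: mult.assoc)
  qed
  have "index_variance ts / (real n)\<^sup>2 - f / (2 * ?N) \<le> \<rho> * real n * m - f"
    using hg_mean_shifted_rates(1)[OF _ rho, of 0] by (simp add: m_def f_def)
  then have "\<eta> * (2 * S) \<le> \<rho> * real n * m - f" unfolding S_def by (rule order_trans[OF eta(2)])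
  moreover have "\<eta> * R \<le> \<eta> * (2 * S)" using eta R2 by (intro mult_left_mono)
  ultimately have "\<eta> * R \<le> \<rho> * real n * m - f" by linarith
  then have "\<eta> \<le> (\<rho> * real n * m - f) / R" using R0 by (simp add: pos_le_divide_eq)
  moreover have "(f / (\<rho> * real n) - m) / d = - ((\<rho> * real n * m - f) / R)"
    using r N0 d by (simp add: R_def field_simps)
  ultimately have b: "(f / (\<rho> * real n) - m) / d \<le> - \<eta>" by linarith
  have 1: "\<bar>measure (half_gammas (shifted_rates n ts 0)) {f / (\<rho> * real n)<..} - (1 - \<Phi> ((f / (\<rho> * real n) - m) / d))\<bar> \<le> \<epsilon>"
    unfolding m_def d_def by (intro normal_tail_shifted_rates[OF L _ n2]) simp
  have 2: "\<bar>chi_tail f f - (1 - \<Phi> 0)\<bar> \<le> \<epsilon>"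
    using chi_tail_normal[OF L, of f] ts by (simp add: f_def)
  show ?thesis using 1 2 shifted_rates_sandwich(1)[of "f / (\<rho> * real n)"] \<Phi>_mono[OF b] by linarith
qed

end

section \<open>Levels of the tests\<close>

lemma sum_list_concat: "sum_list (concat xss) = (\<Sum>xs\<leftarrow>xss. sum_list xs)" for xss :: "'a::monoid_add list list"
  by (induction xss) auto

lemma sum_list_upt: "(\<Sum>t\<leftarrow>[m..<n]. F t) = (\<Sum>l<n - m. F (m + l))" for F :: "nat \<Rightarrow> 'a::comm_monoid_add"
proof -
  have "(\<Sum>t\<leftarrow>[m..<n]. F t) = (\<Sum>t\<in>{m..<n}. F t)" by (simp add: sum_list_distinct_conv_sum_set)
  also have "\<dots> = (\<Sum>l<n - m. F (m + l))"
    by (rule sum.reindex_bij_witness[of _ "\<lambda>l. m + l" "\<lambda>t. t - m"]) auto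
  finally show ?thesis .
qed

text \<open>In a block that begins at \<open>s\<close>, the column with offset \<open>i\<close>
  contributes the indices \<open>i + 1, ..., i + s\<close>.\<close>

lemma sum_beta_indices:
  fixes F :: "nat \<Rightarrow> 'a::comm_monoid_add"
  shows "(\<Sum>t\<leftarrow>beta_indices (col_start k d) (block_start d k). F t) =
    (\<Sum>j<k. \<Sum>i<d j. \<Sum>l<block_start d j. F (Suc (i + l)))"
proof -
  let ?G = "\<lambda>a. \<Sum>l<col_start k d a. F (Suc a - col_start k d a + l)"
  have "(\<Sum>t\<leftarrow>beta_indices (col_start k d) (block_start d k). F t) = (\<Sum>a\<leftarrow>[0..<block_start d k]. ?G a)"
    unfolding beta_indices_def map_concat sum_list_concat map_map comp_def sum_list_upt
    by (intro arg_cong[where f = sum_list] map_cong sum.cong refl) (use col_start_le[of k d] in \<open>auto simp: Suc_diff_le le_SucI\<close>)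
  also have "\<dots> = (\<Sum>a<block_start d k. ?G a)" by (simp add: sum_list_upt)
  also have "\<dots> = (\<Sum>j<k. \<Sum>i<d j. ?G (block_start d j + i))" by (rule sum_blocks)
  also have "\<dots> = (\<Sum>j<k. \<Sum>i<d j. \<Sum>l<block_start d j. F (Suc (i + l)))"
    by (intro sum.cong refl) (simp_all add: col_start_eq Suc_diff_le)
  finally show ?thesis .
qed

lemma sum_lessThan_real: "(\<Sum>i<n. real i) = real n * (real n - 1) / 2"
  by (induction n) (auto simp: field_simps)

text \<open>Adding a block of size \<open>d\<close> to a total \<open>b\<close> uses
  \<open>(b + d)^2 - b^2 - d^2 = 2 * b * d\<close> and
  \<open>(b + d)^3 - b^3 - d^3 = 3 * b * d * (b + d)\<close>.\<close>

lemma block_power_sums: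
  shows "(\<Sum>j<k. real (d j) * real (block_start d j)) = (real (block_start d k) ^ 2 - (\<Sum>j<k. real (d j) ^ 2)) / 2"
    "(\<Sum>j<k. real (d j) * real (block_start d j) * (real (d j) + real (block_start d j))) =
      (real (block_start d k) ^ 3 - (\<Sum>j<k. real (d j) ^ 3)) / 3"
proof (induction k)
  case 0
  { case 1 show ?case by (simp add: block_start_def) next case 2 show ?case by (simp add: block_start_def) }
next
  case (Suc k)
  { case 1 show ?case using Suc(1) by (simp add: power2_eq_square field_simps)
  next case 2 show ?case using Suc(2) by (simp add: power3_eq_cube field_simps) }
qed

text \<open>Every column is paired with all columns of earlier blocks, so the indices are as many as
  the entries above the diagonal that the hypothesis sets to zero.\<close>

lemma length_beta_indices:
  "real (length (beta_indices (col_start k d) (block_start d k))) = lrt_df (block_start d k) k d"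
proof -
  have "real (length (beta_indices (col_start k d) (block_start d k))) = (\<Sum>t\<leftarrow>beta_indices (col_start k d) (block_start d k). 1)"
    by (simp add: sum_list_triv)
  then show ?thesis unfolding sum_beta_indices by (simp add: block_power_sums lrt_df_def)
qed

text \<open>Combined with \<open>length_beta_indices\<close> this identifies
  \<open>n * (1 - \<rho>)\<close> as the average of \<open>t + 3/2\<close>, which explains the form
  of \<open>bartlett_rho\<close>.\<close>

lemma sum_Suc_beta_indices:
  "(\<Sum>t\<leftarrow>beta_indices (col_start k d) (block_start d k). real (Suc t) + 1/2) =
    3 / 2 * lrt_df (block_start d k) k d + (real (block_start d k) ^ 3 - (\<Sum>j<k. real (d j) ^ 3)) / 6"
proof -
  have "(\<Sum>i<m. \<Sum>l<s. real (Suc (Suc (i + l))) + 1/2) = 3 / 2 * (real m * real s) + real m * real s * (real m + real s) / 2" for m s :: nat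
    by (simp add: sum.distrib sum_lessThan_real sum_distrib_left[symmetric]) (simp add: field_simps)
  then have "(\<Sum>t\<leftarrow>beta_indices (col_start k d) (block_start d k). real (Suc t) + 1/2) =
    (\<Sum>j<k. 3 / 2 * (real (d j) * real (block_start d j)) +
      real (d j) * real (block_start d j) * (real (d j) + real (block_start d j)) / 2)"
    unfolding sum_beta_indices by simp
  also have "\<dots> = 3 / 2 * (\<Sum>j<k. real (d j) * real (block_start d j)) +
      (\<Sum>j<k. real (d j) * real (block_start d j) * (real (d j) + real (block_start d j))) / 2"
    by (simp add: sum.distrib sum_distrib_left[symmetric] sum_divide_distrib[symmetric])
  finally show ?thesis by (simp add: block_power_sums lrt_df_def)
qed

text \<open>Decomposition about the mean \<open>(m - 1) / 2\<close> of the first \<open>m\<close>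
  integers, whose own sum of squared deviations is \<open>m * (m^2 - 1) / 12\<close>.\<close>

lemma sum_square_deviation_ge: "real m * ((real m)\<^sup>2 - 1) / 12 \<le> (\<Sum>i<m. (real i - y)\<^sup>2)"
proof -
  have "(\<Sum>i<m. (real i - y)\<^sup>2) = real m * (y - (real m - 1) / 2)\<^sup>2 + real m * ((real m)\<^sup>2 - 1) / 12"
    by (induction m) (simp_all add: power2_eq_square field_simps)
  then show ?thesis by simp
qed

text \<open>Dropping \<open>l\<close> from the index leaves the offset within the block, and already
  the average of \<open>i + 1\<close> over block \<open>j\<close> is
  \<open>(d j + 1) / 2\<close>.\<close>

lemma sum_beta_indices_ge:
  assumes D: "\<And>j. j < k \<Longrightarrow> D \<le> real (d j)"
  shows "lrt_df (block_start d k) k d * D / 2 \<le> (\<Sum>t\<leftarrow>beta_indices (col_start k d) (block_start d k). real (Suc t))"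
proof -
  have "lrt_df (block_start d k) k d * D / 2 = (\<Sum>j<k. real (d j) * real (block_start d j) * (D / 2))"
    by (simp add: lrt_df_def block_power_sums[symmetric] sum_distrib_right)
  also have "\<dots> \<le> (\<Sum>j<k. \<Sum>i<d j. \<Sum>l<block_start d j. real (Suc (Suc (i + l))))"
  proof (rule sum_mono)
    fix j assume "j \<in> {..<k}"
    then have "real (d j) * real (block_start d j) * (D / 2) \<le> real (d j) * real (block_start d j) * ((real (d j) + 1) / 2)"
      using D[of j] by (intro mult_left_mono) auto
    also have "\<dots> = (\<Sum>i<d j. \<Sum>l<block_start d j. real (Suc i))"
      by (simp add: sum.distrib sum_lessThan_real sum_distrib_left[symmetric]) (simp add: field_simps)
    also have "\<dots> \<le> (\<Sum>i<d j. \<Sum>l<block_start d j. real (Suc (Suc (i + l))))" by (intro sum_mono) simp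
    finally show "real (d j) * real (block_start d j) * (D / 2) \<le> (\<Sum>i<d j. \<Sum>l<block_start d j. real (Suc (Suc (i + l))))" .
  qed
  finally show ?thesis unfolding sum_beta_indices .
qed

text \<open>For fixed \<open>j\<close> and \<open>l\<close> the indices run through
  \<open>d j\<close> consecutive integers, which deviate from any centre by at least as much as from
  their own mean. So the common mean \<open>y\<close> need not be known.\<close>

lemma index_variance_ge:
  assumes D: "\<And>j. j < k \<Longrightarrow> D \<le> real (d j)" and D0: "0 \<le> D"
  shows "lrt_df (block_start d k) k d * (D\<^sup>2 - 1) / 12 \<le> index_variance (beta_indices (col_start k d) (block_start d k))"
proof -
  define y where "y = (\<Sum>t\<leftarrow>beta_indices (col_start k d) (block_start d k). real (Suc t)) /
    real (length (beta_indices (col_start k d) (block_start d k)))"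
  have "lrt_df (block_start d k) k d * (D\<^sup>2 - 1) / 12 = (\<Sum>j<k. real (d j) * real (block_start d j) * ((D\<^sup>2 - 1) / 12))"
    by (simp add: lrt_df_def block_power_sums[symmetric] sum_distrib_right)
  also have "\<dots> \<le> (\<Sum>j<k. \<Sum>i<d j. \<Sum>l<block_start d j. (real (Suc (Suc (i + l))) - y)\<^sup>2)"
  proof (rule sum_mono)
    fix j assume j: "j \<in> {..<k}"
    have "D\<^sup>2 \<le> (real (d j))\<^sup>2" using D[of j] D0 j by (intro power_mono) auto
    then have "real (d j) * real (block_start d j) * ((D\<^sup>2 - 1) / 12) \<le> real (d j) * real (block_start d j) * (((real (d j))\<^sup>2 - 1) / 12)"
      by (intro mult_left_mono) auto
    also have "\<dots> = (\<Sum>l<block_start d j. real (d j) * ((real (d j))\<^sup>2 - 1) / 12)" by simp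
    also have "\<dots> \<le> (\<Sum>l<block_start d j. \<Sum>i<d j. (real i - (y - real l - 2))\<^sup>2)"
      by (intro sum_mono sum_square_deviation_ge)
    also have "\<dots> = (\<Sum>i<d j. \<Sum>l<block_start d j. (real i - (y - real l - 2))\<^sup>2)" by (rule sum.swap)
    also have "\<dots> = (\<Sum>i<d j. \<Sum>l<block_start d j. (real (Suc (Suc (i + l))) - y)\<^sup>2)"
      by (intro sum.cong refl arg_cong[where f = "\<lambda>x. x\<^sup>2"]) simp
    finally show "real (d j) * real (block_start d j) * ((D\<^sup>2 - 1) / 12) \<le>
      (\<Sum>i<d j. \<Sum>l<block_start d j. (real (Suc (Suc (i + l))) - y)\<^sup>2)" .
  qed
  also have "\<dots> = index_variance (beta_indices (col_start k d) (block_start d k))"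
    unfolding index_variance_def y_def[symmetric] by (rule sum_beta_indices[symmetric])
  finally show ?thesis .
qed

text \<open>The first two blocks alone contribute \<open>d 0 * d 1\<close> to the degrees of
  freedom.\<close>

lemma lrt_df_bounds:
  assumes k: "2 \<le> k" and D: "\<And>j. j < k \<Longrightarrow> D \<le> real (d j)" "0 \<le> D"
  shows "D\<^sup>2 \<le> lrt_df (block_start d k) k d" "lrt_df (block_start d k) k d \<le> (real (block_start d k))\<^sup>2 / 2"
proof -
  have "D * D \<le> real (d 1) * real (d 0)" using D k by (intro mult_mono) auto
  also have "\<dots> = real (d 1) * real (block_start d 1)" by (simp add: block_start_def)
  also have "\<dots> \<le> (\<Sum>j<k. real (d j) * real (block_start d j))" using k by (intro member_le_sum) auto
  finally show "D\<^sup>2 \<le> lrt_df (block_start d k) k d" by (simp add: lrt_df_def block_power_sums power2_eq_square)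
  show "lrt_df (block_start d k) k d \<le> (real (block_start d k))\<^sup>2 / 2"
    by (simp add: lrt_df_def sum_nonneg)
qed

section \<open>Level errors for one sample size under the assumptions of the theorem\<close>

context
  fixes n p k :: nat and d :: "nat \<Rightarrow> nat" and \<delta> :: real
    and M :: "'a measure" and \<mu> :: "real Matrix.vec" and S :: "real mat" and X :: "nat \<Rightarrow> 'a \<Rightarrow> nat \<Rightarrow> real"
  assumes k: "2 \<le> k" and p: "(\<Sum>j<k. d j) = p" and pn: "p + 1 < n"
    and \<delta>: "0 < \<delta>" "\<And>i j. i < k \<Longrightarrow> j < k \<Longrightarrow> \<delta> < real (d i) / real (d j)"
    and X: "iid_mvn_sample M n p \<mu> S X" and H0: "block_independence_hyp k d S"
begin

abbreviation (input) indices :: "nat list" where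
  "indices \<equiv> beta_indices (col_start k d) p"

abbreviation (input) df :: real where
  "df \<equiv> lrt_df p k d"

abbreviation (input) rho :: real where
  "rho \<equiv> bartlett_rho n p k d"

abbreviation (input) stat :: "'a \<Rightarrow> real" where
  "stat \<omega> \<equiv> ln (lrt_stat n p k d (\<lambda>i. X i \<omega>))"

lemma block_start_total: "block_start d k = p"
  using p by (simp add: block_start_def)

lemma block_size_pos: "j < k \<Longrightarrow> 0 < d j"
  using \<delta>(1) \<delta>(2)[of j j] by (cases "d j = 0") auto

text \<open>Summing the comparison with block \<open>j\<close> over all blocks bounds
  \<open>\<delta> * p\<close> by \<open>k * d j\<close>. The constant \<open>\<delta> / k\<close>
  reappears as \<open>c\<close> in the limit arguments.\<close>

lemma block_size_ge: 
  assumes j: "j < k"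
  shows "\<delta> / real k * real p \<le> real (d j)"
proof -
  have "\<delta> * real (d i) \<le> real (d j)" if "i < k" for i
    using \<delta>(2)[OF j that] block_size_pos[OF that] by (simp add: pos_less_divide_eq)
  then have "(\<Sum>i<k. \<delta> * real (d i)) \<le> (\<Sum>i<k. real (d j))" by (intro sum_mono) auto
  moreover have "(\<Sum>i<k. \<delta> * real (d i)) = \<delta> * real p" unfolding p[symmetric] by (simp add: sum_distrib_left)
  ultimately show ?thesis using k by (simp add: pos_divide_le_eq mult.commute)
qed

lemma p_pos: "0 < p"
proof -
  have "d 0 \<le> (\<Sum>j<k. d j)" using k by (intro member_le_sum) auto
  then show ?thesis using block_size_pos[of 0] k p by linarith
qed

lemma df_bounds: "(\<delta> / real k * real p)\<^sup>2 \<le> df" "df \<le> (real p)\<^sup>2 / 2" "0 < df"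
proof -
  have c: "0 < \<delta> / real k * real p" using \<delta> p_pos k by simp
  show "(\<delta> / real k * real p)\<^sup>2 \<le> df" "df \<le> (real p)\<^sup>2 / 2"
    using lrt_df_bounds[OF k, of "\<delta> / real k * real p" d] block_size_ge c unfolding block_start_total by auto
  with c show "0 < df" by (intro less_le_trans[OF _ \<open>_ \<le> df\<close>]) (rule zero_less_power)
qed

lemma length_indices: "real (length indices) = df"
  using length_beta_indices[of k d] unfolding block_start_total .

lemma indices: "indices \<noteq> []" "\<And>t. t \<in> set indices \<Longrightarrow> t < p"
  using length_indices df_bounds(3) by (auto dest: beta_indices_less)

lemma sum_indices_rho: "(\<Sum>t\<leftarrow>indices. real (Suc t) + 1/2) = real n * (1 - rho) * real (length indices)"
proof -
  have n: "real n > 0" using pn by simp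
  have f: "real p ^ 2 - (\<Sum>i<k. real (d i) ^ 2) = 2 * df" by (simp add: lrt_df_def)
  have "real n * (1 - rho) * df = 3 / 2 * df + (real p ^ 3 - (\<Sum>i<k. real (d i) ^ 3)) / 6"
    using n df_bounds(3) unfolding bartlett_rho_def f by (simp add: field_simps)
  then show ?thesis using sum_Suc_beta_indices[of k d] unfolding block_start_total length_indices by linarith
qed

text \<open>\<open>\<rho> * n\<close> is the average of the numbers \<open>n - t - 3/2\<close>, all
  of which lie between \<open>n - p - 1\<close> and \<open>n\<close>.\<close>

lemma rho_bounds: "real (n - p - 1) / real n \<le> rho" "rho \<le> 1" "0 < rho"
proof -
  have n: "real n > 0" "real (n - p - 1) = real n - (real p + 1)" "0 < real (n - p - 1)" using pn by auto
  have "(\<Sum>t\<leftarrow>indices. real (Suc t) + 1/2) \<le> (\<Sum>t\<leftarrow>indices. real p + 1)"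
    using indices(2) by (intro sum_list_mono) force
  then have "(real n * (1 - rho)) * df \<le> (real p + 1) * df"
    unfolding sum_indices_rho length_indices by (simp add: sum_list_triv length_indices mult.commute)
  then have 1: "real n * (1 - rho) \<le> real p + 1" by (rule mult_right_le_imp_le[OF _ df_bounds(3)])
  have "0 \<le> (\<Sum>t\<leftarrow>indices. real (Suc t) + 1/2)" by (intro sum_list_nonneg) auto
  then have "0 \<le> (real n * (1 - rho)) * df" unfolding sum_indices_rho length_indices .
  then show "rho \<le> 1" using df_bounds(3) n by (simp add: zero_le_mult_iff)
  show r: "real (n - p - 1) / real n \<le> rho"
    using 1 n(1) unfolding n(2) by (simp add: pos_divide_le_eq algebra_simps)
  show "0 < rho" by (rule less_le_trans[OF divide_pos_pos[OF n(3,1)] r])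
qed

lemma stat_tail:
  assumes r: "0 < r"
  shows "measure M {\<omega> \<in> space M. - 2 * r * stat \<omega> > q} = measure (convs (half_betas n indices)) {q / (r * real n)<..}"
proof -
  have "- 2 * r * x > q \<longleftrightarrow> - x > q / (2 * r)" for x using r by (simp add: pos_divide_less_eq mult.commute mult.left_commute)
  then have "measure M {\<omega> \<in> space M. - 2 * r * stat \<omega> > q} = measure M {\<omega> \<in> space M. - stat \<omega> > q / (2 * r)}" by simp
  also have "\<dots> = measure (convs (half_betas n indices)) {2 * (q / (2 * r)) / real n<..}"
    using pn k by (intro lrt_stat_law[OF X H0 block_start_total block_size_pos]) auto
  finally show ?thesis by simp
qed

lemma level_error_nonneg: "0 \<le> chi_squared_level_error M T df"
  using level_error_ge[OF _ df_bounds(3), of M 1 T] X by (simp add: iid_mvn_sample_def)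

text \<open>\<open>sqrt (f / 2)\<close> is at most \<open>p\<close>, and \<open>ln (n / N)\<close>
  is at most \<open>n / N - 1 = (p + 1) / N\<close>; the product is of order p^2 / n as long as
  \<open>N\<close> is comparable to \<open>n\<close>.\<close>

lemma level_error_crude:
  assumes r: "r = 1 \<or> r = rho"
  shows "chi_squared_level_error M (\<lambda>\<omega>. - 2 * r * stat \<omega>) df \<le> real p * (real p + 1) / real (n - p - 1)"
proof (rule level_error_le[OF df_bounds(3)])
  fix q :: real assume q: "q > 0"
  define N where "N = real (n - p - 1)"
  have N: "0 < N" "0 < real n" "N \<le> real n" "real n - N = real p + 1" using pn by (auto simp: N_def)
  have r': "0 < r" "N / real n \<le> r" "r \<le> 1"
  proof -
    have "N / real n \<le> 1" using N by simp
    then show "N / real n \<le> r" using r rho_bounds(1) unfolding N_def by (elim disjE) simp_all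
    show "0 < r" "r \<le> 1" using r rho_bounds(2,3) by (elim disjE; simp)+
  qed
  have "\<bar>measure M {\<omega> \<in> space M. - 2 * r * stat \<omega> > q} - chi_tail df q\<bar> \<le> sqrt (df / 2) * ln (real n / N)"
    using crude_bound[OF indices pn q r'(2)[unfolded N_def] r'(3)] unfolding stat_tail[OF r'(1)] length_indices N_def .
  also have "\<dots> \<le> real p * ((real p + 1) / N)"
  proof (rule mult_mono)
    have "df / 2 \<le> (real p)\<^sup>2" using df_bounds by (simp add: power2_eq_square)
    then show "sqrt (df / 2) \<le> real p" by (intro real_le_lsqrt) auto
    have "ln (real n / N) \<le> real n / N - 1" using N by (intro ln_le_minus_one divide_pos_pos)
    also have "\<dots> = (real p + 1) / N" using N(1) unfolding N(4)[symmetric] by (simp add: diff_divide_distrib)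
    finally show "ln (real n / N) \<le> (real p + 1) / N" .
    show "0 \<le> ln (real n / N)" using N(1,3) by (intro ln_ge_zero) simp
  qed simp
  finally show "\<bar>measure M {\<omega> \<in> space M. - 2 * r * stat \<omega> > q} - chi_tail df q\<bar> \<le> real p * (real p + 1) / real (n - p - 1)" by (simp add: N_def)
qed

text \<open>The shift in \<open>uncorrected_lower_bound\<close> is at least
  \<open>(f * D / 2) / (n * sqrt (8 * f))\<close> with \<open>D = \<delta> / k * p\<close>, and
  \<open>sqrt f \<ge> D\<close> turns this into a multiple of \<open>D^2 / n\<close>. The condition
  on \<open>L\<close> ensures that there are enough indices.\<close>

lemma uncorrected_level_error_ge:
  assumes L: "normal_tail_bound \<epsilon> L" "real L \<le> (\<delta> / real k * real p)\<^sup>2"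
    and \<eta>: "\<eta> \<le> (\<delta> / real k)\<^sup>2 / 6 * ((real p)\<^sup>2 / real n)"
  shows "\<Phi> 0 - \<Phi> (- \<eta>) - 2 * \<epsilon> \<le> chi_squared_level_error M (\<lambda>\<omega>. - 2 * stat \<omega>) df"
proof -
  define D where "D = \<delta> / real k * real p"
  define s where "s = sqrt df"
  have L': "L \<le> length indices" using L(2) df_bounds(1) length_indices by linarith
  have D0: "0 < D" using \<delta> p_pos k by (simp add: D_def)
  have s: "D \<le> s" "0 < s" "df = s * s"
    unfolding s_def D_def using df_bounds by (auto intro: real_le_rsqrt)
  have n: "0 < real n" using pn by simp
  \<comment> \<open>The 6 in the condition on \<open>\<eta>\<close> comes from
    \<open>2 * sqrt 8 \<le> 6\<close>.\<close>
  have s8: "sqrt 8 \<le> (3 :: real)" by (intro real_le_lsqrt) auto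
  have "\<eta> \<le> D * D / (6 * real n)" using \<eta> by (simp add: D_def power2_eq_square field_simps)
  also have "\<dots> \<le> s * D / (2 * real n * sqrt 8)"
  proof (rule frac_le)
    show "D * D \<le> s * D" using s D0 by (intro mult_right_mono) auto
    show "2 * real n * sqrt 8 \<le> 6 * real n" using mult_left_mono[OF s8, of "2 * real n"] by simp
  qed (use s D0 n in auto)
  also have "\<dots> = (s * s * D / 2) / (real n * (sqrt 8 * s))" using s(2) n by (simp add: field_simps)
  also have "\<dots> = (df * D / 2) / (real n * sqrt (8 * df))"
    unfolding s(3)[symmetric] by (simp add: s_def real_sqrt_mult)
  also have "\<dots> \<le> (\<Sum>t\<leftarrow>indices. real (Suc t)) / (real n * sqrt (8 * df))"
    using sum_beta_indices_ge[of k D d] block_size_ge n df_bounds unfolding block_start_total D_def by (intro divide_right_mono) auto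
  finally have "\<Phi> (- ((\<Sum>t\<leftarrow>indices. real (Suc t)) / (real n * sqrt (8 * df)))) \<le> \<Phi> (- \<eta>)" by (intro \<Phi>_mono) simp
  moreover have "\<Phi> 0 - \<Phi> (- ((\<Sum>t\<leftarrow>indices. real (Suc t)) / (real n * sqrt (8 * df)))) - 2 * \<epsilon> \<le>
    measure (convs (half_betas n indices)) {df / real n<..} - chi_tail df df"
    using uncorrected_lower_bound[OF indices pn L(1) L'] unfolding length_indices .
  moreover have "measure (convs (half_betas n indices)) {df / real n<..} - chi_tail df df \<le> chi_squared_level_error M (\<lambda>\<omega>. - 2 * stat \<omega>) df"
    using level_error_ge[OF _ df_bounds(3,3), of M "\<lambda>\<omega>. - 2 * stat \<omega>"] stat_tail[of 1 df] X
    by (simp add: iid_mvn_sample_def)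
  ultimately show ?thesis by linarith
qed

text \<open>The assumption \<open>2 * n \<le> 3 * N\<close> gives \<open>n / N \<le> 3/2\<close> and
  \<open>1 / N \<le> 3 / (2 * n)\<close>, and \<open>f \<le> p^2 / 2\<close> gives
  \<open>sqrt (f / 2) \<le> p / 2\<close>. The resulting 27/16 and 9/16 + 6 are rounded up to 3 and
  8.\<close>

lemma corrected_level_error_le:
  assumes L: "normal_tail_bound \<epsilon> L" "real L \<le> (\<delta> / real k * real p)\<^sup>2" and n3: "2 * n \<le> 3 * (n - p - 1)"
  shows "chi_squared_level_error M (\<lambda>\<omega>. - 2 * rho * stat \<omega>) df \<le> 2 * \<epsilon> + 3 * (real p ^ 3 / (real n)\<^sup>2) + 8 * (real p / real n)"
proof (rule level_error_le[OF df_bounds(3)])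
  fix q :: real assume q: "q > 0"
  have L': "L \<le> length indices" using L(2) df_bounds(1) length_indices by linarith
  define N where "N = real (n - p - 1)"
  have N: "0 < N" "0 < real n" "2 * real n \<le> 3 * N" "real n - N = real p + 1" using pn n3 by (auto simp: N_def)
  have p1: "1 \<le> real p" using p_pos by simp
  have w: "real n / N \<le> 3 / 2" using N by (simp add: pos_divide_le_eq)
  have iN: "1 / N \<le> 3 / (2 * real n)" using N by (simp add: field_simps)
  have "real n / N * sqrt (df / 2) * ((real p)\<^sup>2 / N\<^sup>2 + 1 / (2 * N)) \<le>
    3 / 2 * (real p / 2) * ((real p)\<^sup>2 * (9 / (4 * (real n)\<^sup>2)) + 3 / (4 * real n))"
  proof (intro mult_mono add_mono w)
    have "df / 2 \<le> (real p / 2)\<^sup>2" using df_bounds by (simp add: power2_eq_square)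
    then show "sqrt (df / 2) \<le> real p / 2" by (intro real_le_lsqrt) auto
    have "(1 / N)\<^sup>2 \<le> (3 / (2 * real n))\<^sup>2" using iN N by (intro power_mono) auto
    then have "1 / N\<^sup>2 \<le> 9 / (4 * (real n)\<^sup>2)" by (simp add: power_divide power_mult_distrib)
    then have "(real p)\<^sup>2 * (1 / N\<^sup>2) \<le> (real p)\<^sup>2 * (9 / (4 * (real n)\<^sup>2))" by (intro mult_left_mono) auto
    then show "(real p)\<^sup>2 / N\<^sup>2 \<le> (real p)\<^sup>2 * (9 / (4 * (real n)\<^sup>2))" by simp
    show "1 / (2 * N) \<le> 3 / (4 * real n)" using iN by (simp add: field_simps)
  qed (use N df_bounds in auto)
  also have "\<dots> = 27 / 16 * (real p ^ 3 / (real n)\<^sup>2) + 9 / 16 * (real p / real n)"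
    using N(2) by (simp add: power2_eq_square power3_eq_cube field_simps)
  finally have 1: "real n / N * sqrt (df / 2) * ((real p)\<^sup>2 / N\<^sup>2 + 1 / (2 * N)) \<le>
    27 / 16 * (real p ^ 3 / (real n)\<^sup>2) + 9 / 16 * (real p / real n)" .
  have 2: "2 * (real n / N - 1) \<le> 6 * (real p / real n)"
  proof -
    have "2 * (real n / N - 1) = 2 * ((real p + 1) * (1 / N))" using N(1) unfolding N(4)[symmetric] by (simp add: diff_divide_distrib)
    also have "\<dots> \<le> 2 * ((2 * real p) * (3 / (2 * real n)))" using iN p1 N by (intro mult_left_mono mult_mono) auto
    finally show ?thesis by simp
  qed
  have 3: "0 \<le> real p ^ 3 / (real n)\<^sup>2" "0 \<le> real p / real n" by auto
  have "\<bar>measure M {\<omega> \<in> space M. - 2 * rho * stat \<omega> > q} - chi_tail df q\<bar> \<le>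
    2 * \<epsilon> + real n / N * sqrt (df / 2) * ((real p)\<^sup>2 / N\<^sup>2 + 1 / (2 * N)) + 2 * (real n / N - 1)"
    using corrected_bound[OF indices pn L(1) L' sum_indices_rho rho_bounds(1,2) n3, of q]
    unfolding stat_tail[OF rho_bounds(3)] length_indices N_def .
  also have "\<dots> \<le> 2 * \<epsilon> + (27 / 16 * (real p ^ 3 / (real n)\<^sup>2) + 9 / 16 * (real p / real n)) + 6 * (real p / real n)"
    by (intro add_mono order_refl 1 2)
  also have "\<dots> \<le> 2 * \<epsilon> + 3 * (real p ^ 3 / (real n)\<^sup>2) + 8 * (real p / real n)" using 3 by linarith
  finally show "\<bar>measure M {\<omega> \<in> space M. - 2 * rho * stat \<omega> > q} - chi_tail df q\<bar> \<le>
    2 * \<epsilon> + 3 * (real p ^ 3 / (real n)\<^sup>2) + 8 * (real p / real n)" .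
qed

text \<open>The index variance is at least of order \<open>f * D^2\<close>, so the standardized
  shift is of order p^3 / n^2; the subtracted \<open>p / n\<close> absorbs the width of the
  enclosure and the \<open>- 1\<close> in the variance of consecutive integers.\<close>

lemma corrected_level_error_ge:
  assumes L: "normal_tail_bound \<epsilon> L" "real L \<le> (\<delta> / real k * real p)\<^sup>2" and n3: "2 * n \<le> 3 * (n - p - 1)"
    and \<eta>: "0 \<le> \<eta>" "3 * \<eta> \<le> (\<delta> / real k) ^ 3 / 12 * (real p ^ 3 / (real n)\<^sup>2) - real p / real n"
  shows "\<Phi> 0 - \<Phi> (- \<eta>) - 2 * \<epsilon> \<le> chi_squared_level_error M (\<lambda>\<omega>. - 2 * rho * stat \<omega>) df"
proof -
  define D where "D = \<delta> / real k * real p"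
  define s where "s = sqrt df"
  have L': "L \<le> length indices" using L(2) df_bounds(1) length_indices by linarith
  have D0: "0 < D" using \<delta> p_pos k by (simp add: D_def)
  have s: "D \<le> s" "0 < s" "s \<le> real p" "df = s * s"
  proof -
    show "D \<le> s" unfolding s_def using df_bounds(1) by (intro real_le_rsqrt) (simp add: D_def)
    then show "0 < s" using D0 by linarith
    have "df \<le> (real p)\<^sup>2" using df_bounds(2) by (rule order_trans) simp
    then show "s \<le> real p" unfolding s_def by (intro real_le_lsqrt) auto
    show "df = s * s" unfolding s_def using df_bounds by simp
  qed
  let ?N = "real (n - p - 1)"
  have N: "0 < ?N" "0 < real n" "1 \<le> real n" "2 * real n \<le> 3 * ?N" using pn n3 by auto
  have var: "df * (D\<^sup>2 - 1) / 12 \<le> index_variance indices"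
    using index_variance_ge[of k D d] block_size_ge D0 unfolding block_start_total D_def by simp
  have "\<eta> * (2 * sqrt (2 * df)) \<le> 3 * \<eta> * s"
  proof -
    have "2 * sqrt 2 \<le> (3 :: real)"
    proof -
      have "sqrt 2 \<le> (3 / 2 :: real)" by (intro real_le_lsqrt) (auto simp: power2_eq_square)
      then show ?thesis by simp
    qed
    then have "\<eta> * s * (2 * sqrt 2) \<le> \<eta> * s * 3" using \<eta> s by (intro mult_left_mono) auto
    then show ?thesis unfolding s_def by (simp add: real_sqrt_mult mult.commute mult.left_commute)
  qed
  also have "\<dots> \<le> (D * D\<^sup>2 / (12 * (real n)\<^sup>2) - real p / real n) * s"
    using \<eta>(2) s by (intro mult_right_mono) (auto simp: D_def power2_eq_square power3_eq_cube field_simps)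
  \<comment> \<open>\<open>D \<le> s\<close> is used in the positive term and
    \<open>s \<le> p\<close> in the negative one, so that \<open>s * s = f\<close> can be factored
    out.\<close>
  also have "\<dots> \<le> (s * D\<^sup>2 / (12 * (real n)\<^sup>2) - s / real n) * s"
    using s N by (intro mult_right_mono diff_mono divide_right_mono) auto
  also have "\<dots> = df * (D\<^sup>2 / (12 * (real n)\<^sup>2) - 1 / real n)" unfolding s(4) by (simp add: algebra_simps)
  \<comment> \<open>The term \<open>1 / n\<close> pays for two losses: at most
    \<open>1 / (4 * n)\<close> for the \<open>- 1\<close> and, by \<open>2 * n \<le> 3 * N\<close>,
    at most \<open>3 / (4 * n)\<close> for the width of the enclosure.\<close>
  also have "\<dots> \<le> df * ((D\<^sup>2 - 1) / (12 * (real n)\<^sup>2) - 1 / (2 * ?N))"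
  proof (rule mult_left_mono)
    have "1 / (12 * (real n)\<^sup>2) \<le> 1 / (4 * real n)"
      using N by (intro divide_left_mono) (auto simp: power2_eq_square)
    moreover have "0 + 1 / (2 * ?N) \<le> 3 / (4 * real n)" using N(1,2,4) by (simp add: field_simps del: of_nat_diff)
    moreover have "1 / (4 * real n) + 3 / (4 * real n) = 1 / real n" using N by (simp add: field_simps)
    moreover have "a - w \<le> a - u - v" if "u \<le> x" "0 + v \<le> y" "x + y = w" for a u v w x y :: real using that by linarith
    ultimately show "D\<^sup>2 / (12 * (real n)\<^sup>2) - 1 / real n \<le> (D\<^sup>2 - 1) / (12 * (real n)\<^sup>2) - 1 / (2 * ?N)"
      unfolding diff_divide_distrib by blast
  qed (use df_bounds in simp)
  also have "\<dots> = df * (D\<^sup>2 - 1) / 12 / (real n)\<^sup>2 - df / (2 * ?N)" by (simp add: right_diff_distrib)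
  also have "\<dots> \<le> index_variance indices / (real n)\<^sup>2 - df / (2 * ?N)"
    using var by (intro diff_right_mono divide_right_mono) auto
  finally have eta: "\<eta> * (2 * sqrt (2 * real (length indices))) \<le>
    index_variance indices / (real n)\<^sup>2 - real (length indices) / (2 * ?N)"
    unfolding length_indices .
  have n2: "n \<le> 2 * (n - p - 1)" using n3 by linarith
  have "\<Phi> 0 - \<Phi> (- \<eta>) - 2 * \<epsilon> \<le> measure (convs (half_betas n indices)) {df / (rho * real n)<..} - chi_tail df df"
    using corrected_lower_bound[OF indices pn L(1) L' sum_indices_rho rho_bounds(3,2) n2 \<eta>(1) eta]
    unfolding length_indices .
  also have "\<dots> \<le> chi_squared_level_error M (\<lambda>\<omega>. - 2 * rho * stat \<omega>) df"
    using level_error_ge[OF _ df_bounds(3,3), of M "\<lambda>\<omega>. - 2 * rho * stat \<omega>"] stat_tail[OF rho_bounds(3), of df] X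
    by (simp add: iid_mvn_sample_def)
  finally show ?thesis .
qed

end

section \<open>Passage to the limit\<close>

lemma not_tendsto_zero_frequently:
  fixes x :: "nat \<Rightarrow> real"
  assumes "\<not> x \<longlonglongrightarrow> 0" "\<And>n. 0 \<le> x n"
  shows "\<exists>e>0. \<exists>\<^sub>F n in sequentially. e \<le> x n"
  using assms unfolding tendsto_iff not_all not_imp frequently_def by (simp add: not_less not_le)

lemma tendsto_zero_power:
  fixes x :: "nat \<Rightarrow> real"
  assumes "x \<longlonglongrightarrow> 0" "m > 0" "\<forall>\<^sub>F n in sequentially. x n ^ m = y n"
  shows "y \<longlonglongrightarrow> 0"
  using Lim_transform_eventually[OF tendsto_power[OF assms(1), of m] assms(3)] assms(2) by (simp add: zero_power)

text \<open>The estimates speak of p^2 / n and p^3 / n^2, which are powers of the quotients in the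
  theorem.\<close>

lemma normalized_power:
  assumes "0 < n"
  shows "(real p / real n powr (1 / 2)) ^ 2 = (real p)\<^sup>2 / real n"
    "(real p / real n powr (2 / 3)) ^ 3 = real p ^ 3 / (real n)\<^sup>2"
proof -
  have n: "0 < real n" using assms by simp
  have "(real n powr (1 / 2)) ^ 2 = real n powr (1 / 2 * real 2)" unfolding powr_powr[symmetric] using n by (simp add: powr_realpow)
  then show "(real p / real n powr (1 / 2)) ^ 2 = (real p)\<^sup>2 / real n" using n by (simp add: power_divide)
  have "(real n powr (2 / 3)) ^ 3 = real n powr (2 / 3 * real 3)" unfolding powr_powr[symmetric] using n by (simp add: powr_realpow)
  also have "\<dots> = real n powr (real 2)" by simp
  also have "\<dots> = (real n)\<^sup>2" using n by (simp only: powr_realpow)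
  finally show "(real p / real n powr (2 / 3)) ^ 3 = real p ^ 3 / (real n)\<^sup>2" by (simp add: power_divide)
qed

lemma eventually_le_linear:
  fixes a b :: real
  assumes "0 < a"
  shows "\<forall>\<^sub>F n in sequentially. b \<le> a * real n"
proof -
  have "\<forall>\<^sub>F n in sequentially. b / a \<le> real n"
    using filterlim_real_sequentially by (simp add: filterlim_at_top)
  then show ?thesis by eventually_elim (use assms in \<open>simp add: pos_divide_le_eq mult.commute\<close>)
qed

lemma crude_ratio_bound:
  assumes p: "0 < p" "p + 1 < n" and small: "real p / real n \<le> 1 / 4"
  shows "real p * (real p + 1) / real (n - p - 1) \<le> 4 * real p * (real p / real n)"
proof -
  have N: "real (n - p - 1) = real n - (real p + 1)" "0 < real n" "1 \<le> real p" using p by auto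
  have "real p \<le> real n / 4" using small N(2) by (simp add: pos_divide_le_eq)
  then have "real n / 2 \<le> real (n - p - 1)" unfolding N(1) using N(3) by linarith
  then have "real p * (real p + 1) / real (n - p - 1) \<le> real p * (2 * real p) / (real n / 2)"
    using N(2,3) by (intro frac_le mult_left_mono) auto
  then show ?thesis by simp
qed

text \<open>The crude bound is at most 4 p^2 / n and gives one direction without any normal
  approximation. Conversely, wherever p / sqrt n stays above some \<open>e\<close>, the dimension
  exceeds every fixed bound eventually, so the lower bound becomes available and stays away from
  zero.\<close>

lemma uncorrected_limit:
  fixes p :: "nat \<Rightarrow> nat" and E :: "nat \<Rightarrow> real"
  assumes c: "0 < c"
    and E: "\<forall>\<^sub>F n in sequentially. 0 < p n \<and> p n + 1 < n \<and> 0 \<le> E n \<and>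
      E n \<le> real (p n) * (real (p n) + 1) / real (n - p n - 1)"
    and lower: "\<And>\<epsilon> L \<eta>. normal_tail_bound \<epsilon> L \<Longrightarrow> \<forall>\<^sub>F n in sequentially. real L \<le> (c * real (p n))\<^sup>2 \<longrightarrow>
      \<eta> \<le> c\<^sup>2 / 6 * ((real (p n))\<^sup>2 / real n) \<longrightarrow> \<Phi> 0 - \<Phi> (- \<eta>) - 2 * \<epsilon> \<le> E n"
  shows "E \<longlonglongrightarrow> 0 \<longleftrightarrow> (\<lambda>n. real (p n) / real n powr (1 / 2)) \<longlonglongrightarrow> 0"
proof
  assume x: "(\<lambda>n. real (p n) / real n powr (1 / 2)) \<longlonglongrightarrow> 0"
  have x2: "(\<lambda>n. (real (p n))\<^sup>2 / real n) \<longlonglongrightarrow> 0"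
  proof (rule tendsto_zero_power[OF x])
    show "\<forall>\<^sub>F n in sequentially. (real (p n) / real n powr (1 / 2)) ^ 2 = (real (p n))\<^sup>2 / real n"
      using eventually_gt_at_top[of 0] by eventually_elim (rule normalized_power(1))
  qed simp
  have small: "\<forall>\<^sub>F n in sequentially. (real (p n))\<^sup>2 / real n < 1 / 4" by (rule order_tendstoD(2)[OF x2]) simp
  have "\<forall>\<^sub>F n in sequentially. E n \<le> 4 * ((real (p n))\<^sup>2 / real n)"
    using E small
  proof eventually_elim
    case (elim n)
    then have e: "0 < p n" "p n + 1 < n" "E n \<le> real (p n) * (real (p n) + 1) / real (n - p n - 1)"
      and lt: "(real (p n))\<^sup>2 / real n < 1 / 4" by blast+
    have "real (p n) * 1 \<le> real (p n) * real (p n)" using e(1) by (intro mult_left_mono) auto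
    then have "real (p n) / real n \<le> (real (p n))\<^sup>2 / real n" by (intro divide_right_mono) (auto simp: power2_eq_square)
    then have "real (p n) / real n \<le> 1 / 4" using lt by (meson less_imp_le order_trans)
    note e(3)
    also have "real (p n) * (real (p n) + 1) / real (n - p n - 1) \<le> 4 * real (p n) * (real (p n) / real n)"
      by (rule crude_ratio_bound) fact+
    also have "\<dots> = 4 * ((real (p n))\<^sup>2 / real n)" by (simp add: power2_eq_square)
    finally show ?case .
  qed
  note 1 = this
  have 2: "(\<lambda>n. 4 * ((real (p n))\<^sup>2 / real n)) \<longlonglongrightarrow> 0" using tendsto_mult_right_zero[OF x2] .
  have 3: "\<forall>\<^sub>F n in sequentially. 0 \<le> E n" using E by eventually_elim simp
  show "E \<longlonglongrightarrow> 0" by (rule tendsto_sandwich[OF 3 1 tendsto_const 2])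
next
  assume E0: "E \<longlonglongrightarrow> 0"
  show "(\<lambda>n. real (p n) / real n powr (1 / 2)) \<longlonglongrightarrow> 0"
  proof (rule ccontr)
    assume "\<not> ?thesis"
    then obtain e where e: "e > 0" and fr: "\<exists>\<^sub>F n in sequentially. e \<le> real (p n) / real n powr (1 / 2)"
      using not_tendsto_zero_frequently[of "\<lambda>n. real (p n) / real n powr (1 / 2)"] by (auto simp del: frequently_sequentially)
    \<comment> \<open>The shift guaranteed by \<open>lower\<close> with p^2 / n replaced by its
      lower bound \<open>e^2\<close>.\<close>
    define \<eta> where "\<eta> = c\<^sup>2 / 6 * e\<^sup>2"
    define g where "g = \<Phi> 0 - \<Phi> (- \<eta>)"
    have "\<eta> > 0" using c e by (simp add: \<eta>_def)
    then have g: "g > 0" using \<Phi>_strict_mono[of "- \<eta>" 0] by (simp add: g_def)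
    \<comment> \<open>With tolerance \<open>g / 4\<close> the lower bound is \<open>g / 2\<close>,
      in conflict with \<open>E n < g / 4\<close>.\<close>
    then obtain L where L: "normal_tail_bound (g / 4) L" using normal_tail_bound_exists[of "g / 4"] by auto
    have "\<forall>\<^sub>F n in sequentially. E n < g / 4" using g by (intro order_tendstoD(2)[OF E0]) simp
    \<comment> \<open>At the exceptional \<open>n\<close> one has \<open>p^2 \<ge> e^2 * n\<close>,
      so this growth condition makes the list long enough for \<open>L\<close>.\<close>
    moreover have "\<forall>\<^sub>F n in sequentially. real L \<le> (c\<^sup>2 * e\<^sup>2) * real n" using c e by (intro eventually_le_linear) simp
    moreover note lower[OF L, of \<eta>] eventually_gt_at_top[of 0]
    ultimately have "\<forall>\<^sub>F n in sequentially. \<not> e \<le> real (p n) / real n powr (1 / 2)"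
    proof eventually_elim
      case (elim n)
      show ?case
      proof
        assume "e \<le> real (p n) / real n powr (1 / 2)"
        then have "e\<^sup>2 \<le> (real (p n) / real n powr (1 / 2))\<^sup>2" using e by (intro power_mono) auto
        then have e2: "e\<^sup>2 \<le> (real (p n))\<^sup>2 / real n" using elim by (simp add: normalized_power)
        then have "\<eta> \<le> c\<^sup>2 / 6 * ((real (p n))\<^sup>2 / real n)" unfolding \<eta>_def by (intro mult_left_mono) auto
        moreover have "real L \<le> (c * real (p n))\<^sup>2"
        proof -
          have "e\<^sup>2 * real n \<le> (real (p n))\<^sup>2" using e2 elim by (simp add: pos_le_divide_eq)
          then have "c\<^sup>2 * (e\<^sup>2 * real n) \<le> c\<^sup>2 * (real (p n))\<^sup>2" by (intro mult_left_mono) auto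
          then show ?thesis using elim by (simp add: power_mult_distrib mult.assoc)
        qed
        ultimately have "g - 2 * (g / 4) \<le> E n" using elim(3) unfolding g_def[symmetric] by (rule_tac mp[OF mp])
        then show False using elim g by linarith
      qed
    qed
    then show False using fr by (simp add: frequently_def)
  qed
qed

text \<open>For sufficiency each \<open>n\<close> falls under one of two regimes: either
  \<open>c * p\<close> is large enough for the normal approximation, or \<open>p\<close> is bounded
  and the crude bound tends to zero with p / n. No subsequences have to be extracted.\<close>

lemma corrected_limit:
  fixes p :: "nat \<Rightarrow> nat" and E :: "nat \<Rightarrow> real"
  assumes c: "0 < c"
    and E: "\<forall>\<^sub>F n in sequentially. 0 < p n \<and> p n + 1 < n \<and> 0 \<le> E n \<and>
      E n \<le> real (p n) * (real (p n) + 1) / real (n - p n - 1)"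
    and upper: "\<And>\<epsilon> L. normal_tail_bound \<epsilon> L \<Longrightarrow> \<forall>\<^sub>F n in sequentially. real L \<le> (c * real (p n))\<^sup>2 \<longrightarrow>
      2 * n \<le> 3 * (n - p n - 1) \<longrightarrow>
      E n \<le> 2 * \<epsilon> + 3 * (real (p n) ^ 3 / (real n)\<^sup>2) + 8 * (real (p n) / real n)"
    and lower: "\<And>\<epsilon> L \<eta>. normal_tail_bound \<epsilon> L \<Longrightarrow> \<forall>\<^sub>F n in sequentially. real L \<le> (c * real (p n))\<^sup>2 \<longrightarrow>
      2 * n \<le> 3 * (n - p n - 1) \<longrightarrow> 0 \<le> \<eta> \<longrightarrow>
      3 * \<eta> \<le> c ^ 3 / 12 * (real (p n) ^ 3 / (real n)\<^sup>2) - real (p n) / real n \<longrightarrow> \<Phi> 0 - \<Phi> (- \<eta>) - 2 * \<epsilon> \<le> E n"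
    and pn0: "(\<lambda>n. real (p n) / real n) \<longlonglongrightarrow> 0"
  shows "E \<longlonglongrightarrow> 0 \<longleftrightarrow> (\<lambda>n. real (p n) / real n powr (2 / 3)) \<longlonglongrightarrow> 0"
proof -
  have small: "\<forall>\<^sub>F n in sequentially. real (p n) / real n \<le> e" if "e > 0" for e
    using order_tendstoD(2)[OF pn0 that] by eventually_elim simp
  \<comment> \<open>\<open>n \<ge> 6 * p\<close> and \<open>p \<ge> 1\<close> give
    \<open>n \<ge> 3 * p + 3\<close>, which is the claim.\<close>
  have n3: "\<forall>\<^sub>F n in sequentially. 2 * n \<le> 3 * (n - p n - 1)"
    using E small[of "1/6"]
  proof (rule eventually_elim2)
    fix n assume n: "0 < p n \<and> p n + 1 < n \<and> 0 \<le> E n \<and> E n \<le> real (p n) * (real (p n) + 1) / real (n - p n - 1)"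
      and s: "real (p n) / real n \<le> 1/6"
    have "6 * real (p n) \<le> real n" using s n by (simp add: pos_divide_le_eq)
    then have "6 * p n \<le> n" by linarith
    then show "2 * n \<le> 3 * (n - p n - 1)" using n by linarith
  qed simp
  show ?thesis
  proof
    assume x: "(\<lambda>n. real (p n) / real n powr (2 / 3)) \<longlonglongrightarrow> 0"
    have x3: "(\<lambda>n. real (p n) ^ 3 / (real n)\<^sup>2) \<longlonglongrightarrow> 0"
  proof (rule tendsto_zero_power[OF x])
    show "\<forall>\<^sub>F n in sequentially. (real (p n) / real n powr (2 / 3)) ^ 3 = real (p n) ^ 3 / (real n)\<^sup>2"
      using eventually_gt_at_top[of 0] by eventually_elim (rule normalized_power(2))
  qed simp
    have main: "\<forall>\<^sub>F n in sequentially. E n < e" if e: "e > 0" for e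
    proof -
      obtain L where L: "normal_tail_bound (e / 8) L" using normal_tail_bound_exists[of "e / 8"] e by auto
      define B where "B = sqrt (real L) / c + 1"
      have B: "B > 0" unfolding B_def using c by (intro add_nonneg_pos divide_nonneg_pos) auto
      have x3': "\<forall>\<^sub>F n in sequentially. real (p n) ^ 3 / (real n)\<^sup>2 < e / 12"
        using e by (intro order_tendstoD(2)[OF x3]) auto
      have s1: "\<forall>\<^sub>F n in sequentially. real (p n) / real n \<le> min (1/4) (min (e / 64) (e / (8 * B)))"
        using e B by (intro small) simp
      show ?thesis using E upper[OF L] n3 x3' s1
      proof eventually_elim
        case (elim n)
        show "E n < e"
        proof (cases "real L \<le> (c * real (p n))\<^sup>2")
          case True
          then have "E n \<le> 2 * (e / 8) + 3 * (real (p n) ^ 3 / (real n)\<^sup>2) + 8 * (real (p n) / real n)"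
            using elim by blast
          moreover have "real (p n) / real n \<le> e / 64" using elim by simp
          ultimately show ?thesis using elim(4) e by linarith
        next
          case False
          then have "c * real (p n) \<le> sqrt (real L)" by (intro real_le_rsqrt) auto
          then have pB: "real (p n) \<le> B" using c unfolding B_def by (simp add: field_simps)
          have "E n \<le> 4 * real (p n) * (real (p n) / real n)"
          proof -
            have "E n \<le> real (p n) * (real (p n) + 1) / real (n - p n - 1)" using elim(1) by blast
            also have "\<dots> \<le> 4 * real (p n) * (real (p n) / real n)"
              by (rule crude_ratio_bound) (use elim(1,5) in auto)
            finally show ?thesis .
          qed
          also have "\<dots> \<le> 4 * B * (e / (8 * B))" using pB B elim by (intro mult_mono) auto
          also have "\<dots> = e / 2" using B by simp
          finally show ?thesis using e by simp
        qed
      qed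
    qed
    show "E \<longlonglongrightarrow> 0"
    proof (rule order_tendstoI)
      show "\<forall>\<^sub>F n in sequentially. a < E n" if "a < 0" for a using E by eventually_elim (use that in auto)
      show "\<forall>\<^sub>F n in sequentially. E n < a" if "0 < a" for a using main[OF that] .
    qed
  next
    assume E0: "E \<longlonglongrightarrow> 0"
    show "(\<lambda>n. real (p n) / real n powr (2 / 3)) \<longlonglongrightarrow> 0"
    proof (rule ccontr)
      assume "\<not> ?thesis"
      then obtain e where e: "e > 0" and fr: "\<exists>\<^sub>F n in sequentially. e \<le> real (p n) / real n powr (2 / 3)"
        using not_tendsto_zero_frequently[of "\<lambda>n. real (p n) / real n powr (2 / 3)"] by (auto simp del: frequently_sequentially)
      \<comment> \<open>The constant 72 is 6 times 12: the main term is then at least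
        \<open>6 * \<eta>\<close>, and p / n may consume \<open>3 * \<eta>\<close> of it.\<close>
      define \<eta> where "\<eta> = c ^ 3 / 72 * e ^ 3"
      define g where "g = \<Phi> 0 - \<Phi> (- \<eta>)"
      have \<eta>: "\<eta> > 0" using c e by (simp add: \<eta>_def)
      then have g: "g > 0" using \<Phi>_strict_mono[of "- \<eta>" 0] by (simp add: g_def)
      then obtain L where L: "normal_tail_bound (g / 4) L" using normal_tail_bound_exists[of "g / 4"] by auto
      define B where "B = sqrt (real L) / c"
      have B: "B \<ge> 0" unfolding B_def using c by simp
      have "\<forall>\<^sub>F n in sequentially. E n < g / 4" using g by (intro order_tendstoD(2)[OF E0]) simp
      \<comment> \<open>At the exceptional \<open>n\<close> one has
        \<open>p^3 \<ge> e^3 * n^2 \<ge> e^3 * n\<close>, hence \<open>p \<ge> B\<close>, and the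
        list of indices is long enough for \<open>L\<close>.\<close>
      moreover have "\<forall>\<^sub>F n in sequentially. B ^ 3 \<le> e ^ 3 * real n" using e by (intro eventually_le_linear) simp
      moreover have "\<forall>\<^sub>F n in sequentially. real (p n) / real n \<le> 3 * \<eta>" using \<eta> by (intro small) simp
      moreover note lower[OF L, of \<eta>] n3 eventually_gt_at_top[of 0]
      ultimately have "\<forall>\<^sub>F n in sequentially. \<not> e \<le> real (p n) / real n powr (2 / 3)"
      proof eventually_elim
        case (elim n)
        show ?case
        proof
          assume "e \<le> real (p n) / real n powr (2 / 3)"
          then have "e ^ 3 \<le> (real (p n) / real n powr (2 / 3)) ^ 3" using e by (intro power_mono) auto
          then have e3: "e ^ 3 \<le> real (p n) ^ 3 / (real n)\<^sup>2" using elim by (simp add: normalized_power)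
          then have "c ^ 3 / 12 * e ^ 3 \<le> c ^ 3 / 12 * (real (p n) ^ 3 / (real n)\<^sup>2)" using c by (intro mult_left_mono) auto
          moreover have "c ^ 3 / 12 * e ^ 3 = 6 * \<eta>" by (simp add: \<eta>_def)
          ultimately have "3 * \<eta> \<le> c ^ 3 / 12 * (real (p n) ^ 3 / (real n)\<^sup>2) - real (p n) / real n"
            using elim by linarith
          moreover have "real L \<le> (c * real (p n))\<^sup>2"
          proof -
            have "B ^ 3 \<le> e ^ 3 * real n" by fact
            also have "\<dots> \<le> e ^ 3 * (real n)\<^sup>2" using elim e by (intro mult_left_mono) (auto simp: power2_eq_square)
            also have "\<dots> \<le> real (p n) ^ 3" using e3 elim by (simp add: pos_le_divide_eq)
            finally have "B \<le> real (p n)" by (rule power_le_imp_le_base[of _ 2, simplified]) simp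
            then have "sqrt (real L) \<le> c * real (p n)" using c by (simp add: B_def pos_divide_le_eq mult.commute)
            then have "(sqrt (real L))\<^sup>2 \<le> (c * real (p n))\<^sup>2" by (intro power_mono) auto
            then show ?thesis by simp
          qed
          ultimately have "g - 2 * (g / 4) \<le> E n" using elim(4,5) less_imp_le[OF \<eta>] unfolding g_def[symmetric] by (rule_tac mp[OF mp[OF mp[OF mp]]])
          then show False using elim g by linarith
        qed
      qed
      then show False using fr by (simp add: frequently_def)
    qed
  qed
qed

theorem theorem7:
  fixes k :: nat
    and p :: "nat \<Rightarrow> nat"
    and d :: "nat \<Rightarrow> nat \<Rightarrow> nat"
    and M :: "nat \<Rightarrow> 'a measure"
    and \<mu> :: "nat \<Rightarrow> real Matrix.vec"
    and \<Sigma> :: "nat \<Rightarrow> real mat"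
    and X :: "nat \<Rightarrow> nat \<Rightarrow> 'a \<Rightarrow> nat \<Rightarrow> real"
  defines "\<Lambda> \<equiv> \<lambda>n \<omega>. lrt_stat n (p n) k (d n) (\<lambda>i. X n i \<omega>)"
    and "f \<equiv> \<lambda>n. lrt_df (p n) k (d n)"
    and "\<rho> \<equiv> \<lambda>n. bartlett_rho n (p n) k (d n)"
  assumes "k \<ge> 2"
    and "\<forall>\<^sub>F n in sequentially. (\<Sum>j<k. d n j) = p n"
    and "\<forall>\<^sub>F n in sequentially. n > p n + 1"
    and "\<exists>\<delta>::real. 0 < \<delta> \<and> \<delta> < 1 \<and>
           (\<forall>\<^sub>F n in sequentially. \<forall>i<k. \<forall>j<k.
              \<delta> < real (d n i) / real (d n j) \<and> real (d n i) / real (d n j) < inverse \<delta>)"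
    and "\<forall>\<^sub>F n in sequentially. iid_mvn_sample (M n) n (p n) (\<mu> n) (\<Sigma> n) (X n)"
    and "\<forall>\<^sub>F n in sequentially. block_independence_hyp k (d n) (\<Sigma> n)"
  shows "((\<lambda>n. chi_squared_level_error (M n) (\<lambda>\<omega>. - 2 * ln (\<Lambda> n \<omega>)) (f n)) \<longlonglongrightarrow> 0
           \<longleftrightarrow> (\<lambda>n. real (p n) / real n powr (1 / 2)) \<longlonglongrightarrow> 0)
       \<and> ((\<lambda>n. real (p n)) \<in> o(\<lambda>n. real n) \<longrightarrow>
           ((\<lambda>n. chi_squared_level_error (M n) (\<lambda>\<omega>. - 2 * \<rho> n * ln (\<Lambda> n \<omega>)) (f n)) \<longlonglongrightarrow> 0
             \<longleftrightarrow> (\<lambda>n. real (p n) / real n powr (2 / 3)) \<longlonglongrightarrow> 0))"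
proof -
  obtain \<delta> :: real where \<delta>: "0 < \<delta>" "\<forall>\<^sub>F n in sequentially. \<forall>i<k. \<forall>j<k. \<delta> < real (d n i) / real (d n j) \<and> real (d n i) / real (d n j) < inverse \<delta>"
    using assms(7) by blast
  \<comment> \<open>Collects the assumptions that hold eventually; each such \<open>n\<close> is an
    instance of the estimates for one sample size, with \<open>\<delta>\<close> and hence
    \<open>?c\<close> independent of \<open>n\<close>.\<close>
  define good where "good n \<longleftrightarrow> (\<Sum>j<k. d n j) = p n \<and> p n + 1 < n \<and>
    (\<forall>i<k. \<forall>j<k. \<delta> < real (d n i) / real (d n j)) \<and>
    iid_mvn_sample (M n) n (p n) (\<mu> n) (\<Sigma> n) (X n) \<and> block_independence_hyp k (d n) (\<Sigma> n)" for n
  have ev: "\<forall>\<^sub>F n in sequentially. good n"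
    using assms(5,6,8,9) \<delta>(2) by eventually_elim (auto simp: good_def)
  have g: "(\<Sum>j<k. d n j) = p n" "p n + 1 < n" "0 < \<delta>" "\<And>i j. i < k \<Longrightarrow> j < k \<Longrightarrow> \<delta> < real (d n i) / real (d n j)"
    "iid_mvn_sample (M n) n (p n) (\<mu> n) (\<Sigma> n) (X n)" "block_independence_hyp k (d n) (\<Sigma> n)" if "good n" for n
    using that \<delta>(1) by (auto simp: good_def)
  let ?c = "\<delta> / real k"
  let ?E1 = "\<lambda>n. chi_squared_level_error (M n) (\<lambda>\<omega>. - 2 * ln (\<Lambda> n \<omega>)) (f n)"
  let ?E2 = "\<lambda>n. chi_squared_level_error (M n) (\<lambda>\<omega>. - 2 * \<rho> n * ln (\<Lambda> n \<omega>)) (f n)"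
  have c: "0 < ?c" using \<delta> \<open>k \<ge> 2\<close> by simp
  have E1: "\<forall>\<^sub>F n in sequentially. 0 < p n \<and> p n + 1 < n \<and> 0 \<le> ?E1 n \<and>
      ?E1 n \<le> real (p n) * (real (p n) + 1) / real (n - p n - 1)"
    using ev
  proof eventually_elim
    case (elim n)
    note H = \<open>k \<ge> 2\<close> g[OF elim]
    from level_error_crude[OF H, of 1] p_pos[OF H] g(2)[OF elim] level_error_nonneg[OF H] show ?case
      by (simp add: \<Lambda>_def f_def)
  qed
  have E2: "\<forall>\<^sub>F n in sequentially. 0 < p n \<and> p n + 1 < n \<and> 0 \<le> ?E2 n \<and>
      ?E2 n \<le> real (p n) * (real (p n) + 1) / real (n - p n - 1)"
    using ev
  proof eventually_elim
    case (elim n)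
    note H = \<open>k \<ge> 2\<close> g[OF elim]
    from level_error_crude[OF H disjI2[OF refl]] p_pos[OF H] g(2)[OF elim] level_error_nonneg[OF H] show ?case
      by (simp add: \<Lambda>_def f_def \<rho>_def)
  qed
  have "?E1 \<longlonglongrightarrow> 0 \<longleftrightarrow> (\<lambda>n. real (p n) / real n powr (1 / 2)) \<longlonglongrightarrow> 0"
  proof (rule uncorrected_limit[OF c E1])
    fix \<epsilon> \<eta> :: real and L assume L: "normal_tail_bound \<epsilon> L"
    show "\<forall>\<^sub>F n in sequentially. real L \<le> (?c * real (p n))\<^sup>2 \<longrightarrow>
      \<eta> \<le> ?c\<^sup>2 / 6 * ((real (p n))\<^sup>2 / real n) \<longrightarrow> \<Phi> 0 - \<Phi> (- \<eta>) - 2 * \<epsilon> \<le> ?E1 n"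
      using ev
    proof (eventually_elim, intro impI)
      fix n assume n: "good n" "real L \<le> (?c * real (p n))\<^sup>2" "\<eta> \<le> ?c\<^sup>2 / 6 * ((real (p n))\<^sup>2 / real n)"
      note H = \<open>k \<ge> 2\<close> g[OF n(1)]
      show "\<Phi> 0 - \<Phi> (- \<eta>) - 2 * \<epsilon> \<le> ?E1 n"
        using uncorrected_level_error_ge[OF H L n(2,3)] unfolding \<Lambda>_def f_def .
    qed
  qed
  moreover have "?E2 \<longlonglongrightarrow> 0 \<longleftrightarrow> (\<lambda>n. real (p n) / real n powr (2 / 3)) \<longlonglongrightarrow> 0" if o: "(\<lambda>n. real (p n)) \<in> o(\<lambda>n. real n)"
  proof (rule corrected_limit[OF c E2])
    show "(\<lambda>n. real (p n) / real n) \<longlonglongrightarrow> 0" using smalloD_tendsto[OF o] .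
    fix \<epsilon> \<eta> :: real and L assume L: "normal_tail_bound \<epsilon> L"
    show "\<forall>\<^sub>F n in sequentially. real L \<le> (?c * real (p n))\<^sup>2 \<longrightarrow> 2 * n \<le> 3 * (n - p n - 1) \<longrightarrow>
      ?E2 n \<le> 2 * \<epsilon> + 3 * (real (p n) ^ 3 / (real n)\<^sup>2) + 8 * (real (p n) / real n)"
      using ev
    proof (eventually_elim, intro impI)
      fix n assume n: "good n" "real L \<le> (?c * real (p n))\<^sup>2" "2 * n \<le> 3 * (n - p n - 1)"
      note H = \<open>k \<ge> 2\<close> g[OF n(1)]
      show "?E2 n \<le> 2 * \<epsilon> + 3 * (real (p n) ^ 3 / (real n)\<^sup>2) + 8 * (real (p n) / real n)"
        using corrected_level_error_le[OF H L n(2,3)] unfolding \<Lambda>_def f_def \<rho>_def .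
    qed
    show "\<forall>\<^sub>F n in sequentially. real L \<le> (?c * real (p n))\<^sup>2 \<longrightarrow> 2 * n \<le> 3 * (n - p n - 1) \<longrightarrow> 0 \<le> \<eta> \<longrightarrow>
      3 * \<eta> \<le> ?c ^ 3 / 12 * (real (p n) ^ 3 / (real n)\<^sup>2) - real (p n) / real n \<longrightarrow> \<Phi> 0 - \<Phi> (- \<eta>) - 2 * \<epsilon> \<le> ?E2 n"
      using ev
    proof (eventually_elim, intro impI)
      fix n assume n: "good n" "real L \<le> (?c * real (p n))\<^sup>2" "2 * n \<le> 3 * (n - p n - 1)" "0 \<le> \<eta>"
        "3 * \<eta> \<le> ?c ^ 3 / 12 * (real (p n) ^ 3 / (real n)\<^sup>2) - real (p n) / real n"
      note H = \<open>k \<ge> 2\<close> g[OF n(1)]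
      show "\<Phi> 0 - \<Phi> (- \<eta>) - 2 * \<epsilon> \<le> ?E2 n"
        using corrected_level_error_ge[OF H L n(2-5)] unfolding \<Lambda>_def f_def \<rho>_def .
    qed
  qed
  ultimately show ?thesis by blast
qed

end
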